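(* Let $E,E'\subset\mathbb R^d$ be closed sets, each admitting an extension operator in the sense below, and such that $$\lim_{R\to+\infty}\frac1{R^d}|(E\triangle E')\cap B_R|=0.$$ Suppose that $\liminf_{R\to+\infty}|B_R\setminus E|/R^d>0$ and that $\Gamma\text{-}\lim_{k\to+\infty}F^E_{\varepsilon_k}$ exists for some sequence $\varepsilon_k\to0^+$. Then $\Gamma\text{-}\lim_{k\to+\infty}F^{E'}_{\varepsilon_k}$ exists and the two $\Gamma$-limits are equal.
   Context: A closed set $E\subset\mathbb R^d$ admits an extension operator if there is $T:H^1(\mathbb R^d\setminus E)\to H^1(\mathbb R^d)$ and $C>0$ with $Tu=u$ a.e. in $\mathbb R^d\setminus E$ and $\|\nabla Tu\|_{L^2(\mathbb R^d)}\le C\|\nabla u\|_{L^2(\mathbb R^d\setminus E)}$ for all $u$. $E\triangle E'=(E\setminus E')\cup(E'\setminus E)$; $B_R$ is the ball of radius $R$ centred at $0$. For a closed set $E$ and $\varepsilon>0$, $F^E_\varepsilon(u)=\int_{\mathbb R^d\setminus\varepsilon E}|\nabla u|^2\,dx$ for $u\in H^1(\mathbb R^d)$; $\Gamma$-limits are computed on $H^1(\mathbb R^d)$ with respect to the $L^2_{\rm loc}(\mathbb R^d)$ topology. *)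

theory Defs
  imports "HOL-Analysis.Analysis"
begin

fun dd :: "'a::euclidean_space list \<Rightarrow> ('a \<Rightarrow> real) \<Rightarrow> 'a \<Rightarrow> real" where
  "dd [] f = f"
| "dd (v # vs) f = (\<lambda>x. frechet_derivative (dd vs f) (at x) v)"

definition smooth_fun :: "('a::euclidean_space \<Rightarrow> real) \<Rightarrow> bool" where
  "smooth_fun f \<longleftrightarrow> (\<forall>vs x. dd vs f differentiable (at x))"

definition test_fun :: "'a::euclidean_space set \<Rightarrow> ('a \<Rightarrow> real) \<Rightarrow> bool" where
  "test_fun U \<phi> \<longleftrightarrow> smooth_fun \<phi> \<and> compact (closure {x. \<phi> x \<noteq> 0})
      \<and> closure {x. \<phi> x \<noteq> 0} \<subseteq> U"

definition has_weak_gradient :: "'a::euclidean_space set \<Rightarrow> ('a \<Rightarrow> real) \<Rightarrow> ('a \<Rightarrow> 'a) \<Rightarrow> bool" where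
  "has_weak_gradient U u g \<longleftrightarrow>
     set_borel_measurable lebesgue U u \<and> (\<integral>\<^sup>+x\<in>U. ennreal ((u x)\<^sup>2) \<partial>lebesgue) < \<infinity> \<and>
     set_borel_measurable lebesgue U g \<and> (\<integral>\<^sup>+x\<in>U. ennreal ((norm (g x))\<^sup>2) \<partial>lebesgue) < \<infinity> \<and>
     (\<forall>\<phi>. test_fun U \<phi> \<longrightarrow> (\<forall>i\<in>Basis.
        (LINT x:U|lebesgue. u x * frechet_derivative \<phi> (at x) i)
          = - (LINT x:U|lebesgue. (g x \<bullet> i) * \<phi> x)))"

definition H1 :: "'a::euclidean_space set \<Rightarrow> ('a \<Rightarrow> real) \<Rightarrow> bool" where
  "H1 U u \<longleftrightarrow> (\<exists>g. has_weak_gradient U u g)"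

definition wgrad :: "'a::euclidean_space set \<Rightarrow> ('a \<Rightarrow> real) \<Rightarrow> 'a \<Rightarrow> 'a" where
  "wgrad U u = (SOME g. has_weak_gradient U u g)"

definition grad_sq :: "'a::euclidean_space set \<Rightarrow> ('a \<Rightarrow> real) \<Rightarrow> ennreal" where
  "grad_sq U u = (\<integral>\<^sup>+x\<in>U. ennreal ((norm (wgrad U u x))\<^sup>2) \<partial>lebesgue)"

definition admits_extension :: "'a::euclidean_space set \<Rightarrow> bool" where
  "admits_extension E \<longleftrightarrow> (\<exists>T C. C > (0::real) \<and> (\<forall>u. H1 (- E) u \<longrightarrow>
      H1 UNIV (T u) \<and> (AE x in lebesgue. x \<in> - E \<longrightarrow> T u x = u x) \<and>
      grad_sq UNIV (T u) \<le> ennreal (C\<^sup>2) * grad_sq (- E) u))"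

definition FE :: "'a::euclidean_space set \<Rightarrow> real \<Rightarrow> ('a \<Rightarrow> real) \<Rightarrow> ennreal" where
  "FE E \<epsilon> u = (\<integral>\<^sup>+x\<in>- ((\<lambda>y. \<epsilon> *\<^sub>R y) ` E). ennreal ((norm (wgrad UNIV u x))\<^sup>2) \<partial>lebesgue)"

definition L2loc_tendsto :: "(nat \<Rightarrow> 'a::euclidean_space \<Rightarrow> real) \<Rightarrow> ('a \<Rightarrow> real) \<Rightarrow> bool" where
  "L2loc_tendsto us u \<longleftrightarrow> (\<forall>R>0. ((\<lambda>k. \<integral>\<^sup>+x\<in>ball 0 R. ennreal ((us k x - u x)\<^sup>2) \<partial>lebesgue)
      \<longlongrightarrow> 0) sequentially)"

text \<open>Gamma-convergence of Fs to G on X = H^1(R^d) with the (first countable) L^2_loc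
  topology, via the sequential characterization.\<close>
definition gamma_converges :: "(nat \<Rightarrow> ('a::euclidean_space \<Rightarrow> real) \<Rightarrow> ennreal)
    \<Rightarrow> (('a \<Rightarrow> real) \<Rightarrow> ennreal) \<Rightarrow> bool" where
  "gamma_converges Fs G \<longleftrightarrow>
     (\<forall>u us. H1 UNIV u \<and> (\<forall>k. H1 UNIV (us k)) \<and> L2loc_tendsto us u \<longrightarrow>
        G u \<le> liminf (\<lambda>k. Fs k (us k))) \<and>
     (\<forall>u. H1 UNIV u \<longrightarrow> (\<exists>us. (\<forall>k. H1 UNIV (us k)) \<and> L2loc_tendsto us u \<and>
        limsup (\<lambda>k. Fs k (us k)) \<le> G u))"

end

theory Submission
  imports Defs
begin

text \<open>
  Write \<open>\<Omega> = - \<epsilon> E\<close> and \<open>\<Omega>' = - \<epsilon> E'\<close>; the difference \<open>\<Omega>' - \<Omega>\<close> has vanishing measure on bounded sets. It suffices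
  to turn a sequence \<open>w \<rightarrow> u\<close> with bounded energy on \<open>\<Omega>\<close> into a sequence \<open>v \<rightarrow> u\<close> whose energy on \<open>\<Omega>'\<close> exceeds that
  of \<open>w\<close> on \<open>\<Omega>\<close> by an arbitrarily small amount; both Gamma inequalities follow by a diagonal argument, with the
  roles of \<open>E\<close> and \<open>E'\<close> exchanged for the lower bound.

  The extension property is scale invariant, so \<open>w\<close> may be replaced on \<open>- \<Omega>\<close> by an extension \<open>e\<close> with globally
  bounded gradient. After a cut-off at a large radius, \<open>e\<close> is replaced by a Lipschitz truncation \<open>f\<close>; the truncation
  level is chosen among \<open>N\<close> dyadic ones by pigeonhole, so that the bad set costs only \<open>O(1/N)\<close> energy, while the energy
  on \<open>\<Omega>' - \<Omega>\<close> is at most the squared Lipschitz constant times its measure. Finally \<open>v = g + \<phi> (f - g)\<close>, where \<open>g\<close> is a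
  Lipschitz truncation of the cut-off of \<open>u\<close> and \<open>\<phi>\<close> is a Lipschitz cut-off with \<open>\<phi> = 1\<close> on \<open>\<Omega>'\<close> and \<open>\<phi> = 0\<close> at distance
  \<open>\<delta>\<close> from \<open>\<Omega>'\<close>. Since \<open>v = f\<close> on \<open>\<Omega>'\<close>, the energy is controlled, and since the extension property forces
  \<open>|\<Omega>' \<inter> B(x,r)| \<ge> \<kappa> r^n\<close> for \<open>x\<close> in \<open>\<Omega>'\<close>, the values of \<open>f - g\<close> near \<open>\<Omega>'\<close> are controlled by its averages on \<open>\<Omega>\<close>,
  where \<open>f\<close> is close to \<open>u\<close>.
\<close>

section \<open>Smooth functions and test functions\<close>

text \<open>Two obstacles shape the proof. The energy of the extension may concentrate on \<Omega>'
  - \<Omega>, where small measure alone bounds nothing; hence the truncation, which trades the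
  gradient for a Lipschitz constant. And e is known to be close to u only on \<Omega>, while in the
  holes it may be far from u in L2; hence the gluing with g. The steep slope 1/\<delta> of \<phi>
  costs nothing, because \<phi> is constant on \<Omega>', the only place where energy is counted.

  The lower bound on |\<Omega>' \<inter> B(x,r)| is a capacity statement: if \<Omega>' were too thin
  near x, a cut-off with small energy on \<Omega>' would extend to a function that jumps by 1
  between two sets more cheaply than their measure and distance permit. The liminf hypothesis
  excludes thinness at the largest scales, and also feeds a Poincare inequality on large balls.

  The fine properties of Sobolev functions (locality of gradients, Lipschitz approximation,
  capacity) rest on one device: the derivative of a mollification in its scale is an average of the
  gradient, hence bounded by the maximal function.\<close>

lemma frechet_derivative_eqI:
  assumes "(f has_derivative f') (at x)"
  shows "frechet_derivative f (at x) v = f' v"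
  by (rule fun_cong[OF frechet_derivative_at[OF assms, symmetric]])

lemma dd_append: "dd (vs @ ws) f = dd vs (dd ws f)"
  by (induction vs) auto

text \<open>\<open>smooth_fun\<close> quantifies over all lists of directions. Rather than computing
  iterated derivatives, one exhibits a class of differentiable functions stable under directional
  derivatives; induction on the list keeps every \<open>dd vs f\<close> in the class.\<close>

lemma smooth_fun_if_closed_class:
  assumes f: "f \<in> \<C>"
    and diff: "\<And>g x. g \<in> \<C> \<Longrightarrow> g differentiable (at x)"
    and deriv: "\<And>g v. g \<in> \<C> \<Longrightarrow> (\<lambda>x. frechet_derivative g (at x) v) \<in> \<C>"
  shows "smooth_fun f"
proof -
  have "dd vs f \<in> \<C>" for vs
    by (induction vs) (auto simp: f deriv)
  then show ?thesis
    by (simp add: smooth_fun_def diff)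
qed

lemma smooth_fun_differentiable: "smooth_fun f \<Longrightarrow> f differentiable (at x)"
  unfolding smooth_fun_def by (metis dd.simps(1))

lemma smooth_fun_deriv: "smooth_fun f \<Longrightarrow> smooth_fun (\<lambda>x. frechet_derivative f (at x) v)"
  unfolding smooth_fun_def
proof (intro allI)
  fix vs x
  assume "\<forall>vs x. dd vs f differentiable (at x)"
  then have "dd (vs @ [v]) f differentiable (at x)" by blast
  then show "dd vs (\<lambda>x. frechet_derivative f (at x) v) differentiable (at x)"
    by (simp add: dd_append)
qed

lemma smooth_fun_has_derivative:
  "smooth_fun f \<Longrightarrow> (f has_derivative frechet_derivative f (at x)) (at x)"
  using smooth_fun_differentiable frechet_derivative_works by blast

lemma smooth_fun_continuous_on: "smooth_fun f \<Longrightarrow> continuous_on S f"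
  by (meson differentiable_imp_continuous_on differentiable_on_def differentiable_at_withinI smooth_fun_differentiable)

lemma smooth_fun_affine:
  assumes "smooth_fun f"
  shows "smooth_fun (\<lambda>x. f (c *\<^sub>R x + b))"
proof (rule smooth_fun_if_closed_class)
  let ?C = "{g. \<exists>h. smooth_fun h \<and> g = (\<lambda>x. h (c *\<^sub>R x + b))}"
  have der: "((\<lambda>x. h (c *\<^sub>R x + b)) has_derivative (\<lambda>v. frechet_derivative h (at (c *\<^sub>R x + b)) (c *\<^sub>R v))) (at x)"
    if "smooth_fun h" for h :: "'a \<Rightarrow> real" and x
  proof -
    have "((\<lambda>x. c *\<^sub>R x + b) has_derivative (\<lambda>v. c *\<^sub>R v)) (at x)"
      by (auto intro!: derivative_eq_intros)
    from diff_chain_at[OF this smooth_fun_has_derivative[OF that]]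
    show ?thesis by (simp add: o_def)
  qed
  show "(\<lambda>x. f (c *\<^sub>R x + b)) \<in> ?C" using assms by blast
  show "g differentiable (at x)" if "g \<in> ?C" for g x
    using that der by (auto simp: differentiable_def)
  show "(\<lambda>x. frechet_derivative g (at x) v) \<in> ?C" if "g \<in> ?C" for g v
  proof -
    from that obtain h where h: "smooth_fun h" "g = (\<lambda>x. h (c *\<^sub>R x + b))" by blast
    have "(\<lambda>x. frechet_derivative g (at x) v) = (\<lambda>x. frechet_derivative h (at (c *\<^sub>R x + b)) (c *\<^sub>R v))"
      unfolding h(2) using frechet_derivative_eqI[OF der[OF h(1)]] by blast
    then show ?thesis
      using smooth_fun_deriv[OF h(1), of "c *\<^sub>R v"] by (auto intro!: exI[of _ "\<lambda>x. frechet_derivative h (at x) (c *\<^sub>R v)"])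
  qed
qed

text \<open>Derivatives of products and of the bump are polynomial expressions in other functions.
  By the Leibniz rule the ring generated by \<open>B\<close> and the constants is stable under
  differentiation as soon as the derivatives of its generators lie in it.\<close>

inductive_set ring_hull :: "('a::euclidean_space \<Rightarrow> real) set \<Rightarrow> ('a \<Rightarrow> real) set" for B where
  base: "f \<in> B \<Longrightarrow> f \<in> ring_hull B"
| const: "(\<lambda>_. c) \<in> ring_hull B"
| add: "f \<in> ring_hull B \<Longrightarrow> g \<in> ring_hull B \<Longrightarrow> (\<lambda>x. f x + g x) \<in> ring_hull B"
| mult: "f \<in> ring_hull B \<Longrightarrow> g \<in> ring_hull B \<Longrightarrow> (\<lambda>x. f x * g x) \<in> ring_hull B"

lemma smooth_fun_ring_hull:
  assumes f: "f \<in> ring_hull B"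
    and diff: "\<And>g x. g \<in> B \<Longrightarrow> g differentiable (at x)"
    and deriv: "\<And>g v. g \<in> B \<Longrightarrow> (\<lambda>x. frechet_derivative g (at x) v) \<in> ring_hull B"
  shows "smooth_fun f"
proof (rule smooth_fun_if_closed_class[OF f])
  have *: "(\<forall>x. g differentiable (at x)) \<and> (\<forall>v. (\<lambda>x. frechet_derivative g (at x) v) \<in> ring_hull B)"
    if "g \<in> ring_hull B" for g
    using that
  proof induction
    case (base f)
    then show ?case using diff deriv by blast
  next
    case (const c)
    then show ?case by (simp add: ring_hull.const)
  next
    case (add f g)
    have "frechet_derivative (\<lambda>x. f x + g x) (at x) v = frechet_derivative f (at x) v + frechet_derivative g (at x) v" for x v
    proof -
      have "((\<lambda>x. f x + g x) has_derivative (\<lambda>v. frechet_derivative f (at x) v + frechet_derivative g (at x) v)) (at x)"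
        using add.IH by (intro has_derivative_add) (auto simp: frechet_derivative_works[symmetric])
      then show ?thesis by (rule frechet_derivative_eqI)
    qed
    with add.IH show ?case by (auto intro: ring_hull.add)
  next
    case (mult f g)
    have "frechet_derivative (\<lambda>x. f x * g x) (at x) v = f x * frechet_derivative g (at x) v + frechet_derivative f (at x) v * g x" for x v
    proof -
      have "((\<lambda>x. f x * g x) has_derivative (\<lambda>v. f x * frechet_derivative g (at x) v + frechet_derivative f (at x) v * g x)) (at x)"
        using mult.IH by (intro has_derivative_mult) (auto simp: frechet_derivative_works[symmetric])
      then show ?thesis by (rule frechet_derivative_eqI)
    qed
    with mult show ?case by (auto intro!: ring_hull.add ring_hull.mult)
  qed
  show "g differentiable (at x)" if "g \<in> ring_hull B" for g x using *[OF that] by blast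
  show "(\<lambda>x. frechet_derivative g (at x) v) \<in> ring_hull B" if "g \<in> ring_hull B" for g v using *[OF that] by blast
qed

lemma smooth_fun_mult: "smooth_fun f \<Longrightarrow> smooth_fun g \<Longrightarrow> smooth_fun (\<lambda>x. f x * g x)"
  and smooth_fun_add: "smooth_fun f \<Longrightarrow> smooth_fun g \<Longrightarrow> smooth_fun (\<lambda>x. f x + g x)"
proof -
  \<comment> \<open>With all smooth functions as generators, the derivatives of generators are again
    generators, and sums and products lie in the hull by construction.\<close>
  have B: "f \<in> ring_hull {f. smooth_fun f} \<Longrightarrow> smooth_fun f" for f :: "'a \<Rightarrow> real"
    by (erule smooth_fun_ring_hull) (auto intro: ring_hull.base smooth_fun_differentiable smooth_fun_deriv)
  show "smooth_fun (\<lambda>x. f x * g x)" "smooth_fun (\<lambda>x. f x + g x)"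
    if "smooth_fun f" "smooth_fun g" for f g :: "'a \<Rightarrow> real"
    by (rule B, rule ring_hull.mult ring_hull.add; rule ring_hull.base; use that in simp)+
qed

lemma smooth_fun_const: "smooth_fun (\<lambda>x. c)"
  by (rule smooth_fun_if_closed_class[where \<C>="range (\<lambda>c x. c)"]) auto

lemma frechet_derivative_inner: "frechet_derivative (\<lambda>x. x \<bullet> w) (at x) v = v \<bullet> w"
proof -
  have "((\<lambda>x. x \<bullet> w) has_derivative (\<lambda>v. v \<bullet> w)) (at x)"
    by (auto intro!: derivative_eq_intros)
  then show ?thesis by (rule frechet_derivative_eqI)
qed

lemma smooth_fun_inner: "smooth_fun (\<lambda>x. x \<bullet> v)"
proof (rule smooth_fun_ring_hull[where B="range (\<lambda>w x. x \<bullet> w)"])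
  show "(\<lambda>x. x \<bullet> v) \<in> ring_hull (range (\<lambda>w x. x \<bullet> w))"
    by (intro ring_hull.base) auto
qed (auto simp: frechet_derivative_inner intro!: ring_hull.const bounded_linear_imp_differentiable bounded_linear_inner_left)

text \<open>For t > 0 this is exp(-1/t) / t^n. The exponent is a parameter because differentiation
  raises it by one or two, so the family is closed under derivatives up to linear
  combinations.\<close>

definition flat_exp :: "nat \<Rightarrow> real \<Rightarrow> real" where
  "flat_exp n t = (if t > 0 then exp (- inverse t) * inverse t ^ n else 0)"

text \<open>A single term of the exponential series at 1/t, the one of index n + 2, gives the bound.
  The two spare powers of t leave a quadratic estimate, which is what differentiability at 0
  needs.\<close>

lemma flat_exp_bound:
  assumes "t > 0"
  shows "flat_exp n t \<le> fact (n + 2) * t\<^sup>2"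
proof -
  have "inverse t ^ (n + 2) / fact (n + 2) \<le> exp (inverse t)"
  proof -
    have s: "(\<lambda>k. (1 / fact k) *\<^sub>R inverse t ^ k) sums exp (inverse t)"
      using exp_converges[of "inverse t"] by (simp add: scaleR_conv_of_real divide_inverse)
    have "(\<Sum>k\<in>{n+2}. (1 / fact k) *\<^sub>R inverse t ^ k) \<le> exp (inverse t)"
      using assms by (intro sum_le_suminf[OF sums_summable[OF s], of "{n+2}", folded sums_unique[OF s]]) auto
    then show ?thesis by simp
  qed
  then have "inverse t ^ (n + 2) \<le> fact (n + 2) * exp (inverse t)"
    by (simp add: divide_le_eq mult.commute del: fact_Suc)
  then have "exp (- inverse t) * inverse t ^ (n + 2) \<le> exp (- inverse t) * (fact (n + 2) * exp (inverse t))"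
    by (intro mult_left_mono) auto
  also have "\<dots> = fact (n + 2)"
    by (simp add: exp_minus del: fact_Suc add_2_eq_Suc')
  finally have "exp (- inverse t) * inverse t ^ (n + 2) \<le> fact (n + 2)" .
  then have "exp (- inverse t) * inverse t ^ (n + 2) * t\<^sup>2 \<le> fact (n + 2) * t\<^sup>2"
    by (intro mult_right_mono) auto
  moreover
  have "inverse t ^ (n + 2) * t\<^sup>2 = inverse t ^ n"
    using assms by (simp add: power_add field_simps power2_eq_square)
  then have "exp (- inverse t) * inverse t ^ (n + 2) * t\<^sup>2 = flat_exp n t"
    using assms by (simp only: flat_exp_def mult.assoc if_True)
  ultimately show ?thesis by (simp del: fact_Suc)
qed

lemma flat_exp_nonneg: "flat_exp n t \<ge> 0"
  by (auto simp: flat_exp_def)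

lemma flat_exp_DERIV:
  "(flat_exp n has_real_derivative (flat_exp (n + 2) t - of_nat n * flat_exp (n + 1) t)) (at t)"
proof -
  consider "t > 0" | "t < 0" | "t = 0" by linarith
  then show ?thesis
  proof cases
    case 1
    have "((\<lambda>t. exp (- inverse t) * inverse t ^ n) has_real_derivative (flat_exp (n + 2) t - of_nat n * flat_exp (n + 1) t)) (at t)"
    proof (cases n)
      case 0
      then show ?thesis using 1
        by (auto intro!: derivative_eq_intros simp: flat_exp_def power2_eq_square)
    next
      case (Suc m)
      have "m = 0 \<or> inverse t * inverse t ^ (m - Suc 0) = inverse t ^ m"
        by (cases m) auto
      then show ?thesis using 1 Suc
        by (auto intro!: derivative_eq_intros simp: flat_exp_def power2_eq_square algebra_simps)
    qed
    then show ?thesis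
      by (rule has_field_derivative_transform_within_open[where S="{0<..}"]) (use 1 in \<open>auto simp: flat_exp_def\<close>)
  next
    case 2
    have "((\<lambda>t. 0) has_real_derivative 0) (at t)" by simp
    then have "(flat_exp n has_real_derivative 0) (at t)"
      by (rule has_field_derivative_transform_within_open[where S="{..<0}"]) (use 2 in \<open>auto simp: flat_exp_def\<close>)
    then show ?thesis using 2 by (simp add: flat_exp_def)
  next
    case 3
    \<comment> \<open>At 0 the difference quotient is squeezed by the quadratic bound of
      \<open>flat_exp_bound\<close> divided by y.\<close>
    have "((\<lambda>y. (flat_exp n y - flat_exp n 0) / (y - 0)) \<longlongrightarrow> 0) (at 0)"
    proof (rule Lim_null_comparison)
      show "\<forall>\<^sub>F y in at 0. norm ((flat_exp n y - flat_exp n 0) / (y - 0)) \<le> fact (n + 2) * \<bar>y\<bar>"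
      proof (rule always_eventually, intro allI)
        fix y :: real
        show "norm ((flat_exp n y - flat_exp n 0) / (y - 0)) \<le> fact (n + 2) * \<bar>y\<bar>"
        proof (cases "y > 0")
          case True
          then show ?thesis
            using flat_exp_bound[OF True, of n] flat_exp_nonneg[of n y]
            by (simp add: flat_exp_def[of _ 0] divide_le_eq power2_eq_square abs_mult mult.assoc)
        next
          case False
          then have "flat_exp n y = 0" "flat_exp n 0 = 0" by (auto simp: flat_exp_def)
          moreover have "fact (n + 2) * \<bar>y\<bar> \<ge> 0" by (intro mult_nonneg_nonneg) auto
          ultimately show ?thesis by simp
        qed
      qed
      show "((\<lambda>y::real. fact (n + 2) * \<bar>y\<bar>) \<longlongrightarrow> 0) (at 0)"
        by (rule tendsto_mult_right_zero[OF tendsto_rabs_zero[OF tendsto_ident_at]])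
    qed
    then show ?thesis
      using 3 by (simp add: has_field_derivative_iff flat_exp_def[of _ 0])
  qed
qed

text \<open>The usual mollifier exp(-1/(1 - |x|^2)) of the unit ball, written with the inner product
  because the norm is not smooth at 0.\<close>

definition bump :: "'a::euclidean_space \<Rightarrow> real" where
  "bump x = flat_exp 0 (1 - x \<bullet> x)"

lemma smooth_fun_bump: "smooth_fun bump"
proof -
  \<comment> \<open>The chain rule for the radial functions produces factors x \<bullet> v, so the
    linear forms join the generators.\<close>
  let ?B = "range (\<lambda>n x::'a. flat_exp n (1 - x \<bullet> x)) \<union> range (\<lambda>w x. x \<bullet> w)"
  have der1: "((\<lambda>x. x \<bullet> w) has_derivative (\<lambda>v. v \<bullet> w)) (at x)" for w x :: 'a
    by (auto intro!: derivative_eq_intros)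
  have der2: "((\<lambda>x. flat_exp n (1 - x \<bullet> x)) has_derivative
     (\<lambda>v. (flat_exp (n + 2) (1 - x \<bullet> x) + (- of_nat n) * flat_exp (n + 1) (1 - x \<bullet> x)) * (-2 * (x \<bullet> v)))) (at x)" for n and x :: 'a
  proof -
    have "((\<lambda>x. 1 - x \<bullet> x) has_derivative (\<lambda>v. -2 * (x \<bullet> v))) (at x)"
      by (auto intro!: derivative_eq_intros simp: inner_commute)
    from diff_chain_at[OF this flat_exp_DERIV[of n "1 - x \<bullet> x", unfolded has_field_derivative_def]]
    show ?thesis by (simp add: o_def)
  qed
  have eq1: "frechet_derivative (\<lambda>x. x \<bullet> w) (at x) v = v \<bullet> w" for w x v :: 'a
    by (rule frechet_derivative_eqI[OF der1])
  have eq2: "frechet_derivative (\<lambda>x. flat_exp n (1 - x \<bullet> x)) (at x) v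
     = (flat_exp (n + 2) (1 - x \<bullet> x) + (- of_nat n) * flat_exp (n + 1) (1 - x \<bullet> x)) * (-2 * (x \<bullet> v))" for n and x v :: 'a
    by (rule frechet_derivative_eqI[OF der2])
  have flat: "(\<lambda>x::'a. flat_exp n (1 - x \<bullet> x)) \<in> ring_hull ?B" for n
    by (intro ring_hull.base) auto
  have inn: "(\<lambda>x::'a. x \<bullet> v) \<in> ring_hull ?B" for v
    by (intro ring_hull.base) auto
  have "f \<in> ring_hull ?B \<Longrightarrow> smooth_fun f" for f
  proof (erule smooth_fun_ring_hull)
    show "g differentiable (at x)" if "g \<in> ?B" for g x
      using that differentiableI[OF der1] differentiableI[OF der2] by blast
    show "(\<lambda>x. frechet_derivative g (at x) v) \<in> ring_hull ?B" if "g \<in> ?B" for g v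
      using that
    proof
      assume "g \<in> range (\<lambda>n x::'a. flat_exp n (1 - x \<bullet> x))"
      then obtain n where "g = (\<lambda>x. flat_exp n (1 - x \<bullet> x))" by blast
      then have g: "(\<lambda>x. frechet_derivative g (at x) v) = (\<lambda>x. (flat_exp (n + 2) (1 - x \<bullet> x) + (- of_nat n) * flat_exp (n + 1) (1 - x \<bullet> x)) * (-2 * (x \<bullet> v)))"
        by (simp add: eq2)
      show ?thesis unfolding g
        by (rule ring_hull.mult[OF ring_hull.add[OF flat ring_hull.mult[OF ring_hull.const flat]] ring_hull.mult[OF ring_hull.const inn]])
    next
      assume "g \<in> range (\<lambda>w x::'a. x \<bullet> w)"
      then show ?thesis by (auto simp: eq1 intro: ring_hull.const)
    qed
  qed
  from this[OF flat[of 0]] show ?thesis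
    by (simp add: bump_def[abs_def])
qed

lemma bump_nonneg: "bump x \<ge> 0"
  and bump_pos: "norm x < 1 \<Longrightarrow> bump x > 0"
  and bump_eq_0: "norm x \<ge> 1 \<Longrightarrow> bump x = 0"
  and bump_le_1: "bump x \<le> 1"
proof -
  show "bump x \<ge> 0" by (simp add: bump_def flat_exp_nonneg)
  show "bump x > 0" if "norm x < 1"
  proof -
    have "x \<bullet> x < 1" using that by (simp add: norm_eq_sqrt_inner)
    then show ?thesis by (simp add: bump_def flat_exp_def)
  qed
  show "bump x = 0" if "norm x \<ge> 1"
  proof -
    have "x \<bullet> x \<ge> 1" using that by (simp add: norm_eq_sqrt_inner)
    then show ?thesis by (simp add: bump_def flat_exp_def)
  qed
  show "bump x \<le> 1" by (auto simp: bump_def flat_exp_def)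
qed

section \<open>Test functions: supports, products, sums and affine changes of variable\<close>

lemma test_fun_smooth: "test_fun U \<phi> \<Longrightarrow> smooth_fun \<phi>"
  by (simp add: test_fun_def)

lemma test_fun_subset: "test_fun U \<phi> \<Longrightarrow> U \<subseteq> V \<Longrightarrow> test_fun V \<phi>"
  by (auto simp: test_fun_def)

text \<open>Any compact K outside which the function vanishes will do: the closure demanded by the
  definition is then a closed subset of K.\<close>

lemma test_funI:
  assumes "smooth_fun \<phi>" "compact K" "K \<subseteq> U" "\<And>x. x \<notin> K \<Longrightarrow> \<phi> x = 0"
  shows "test_fun U \<phi>"
proof -
  let ?S = "{x. \<phi> x \<noteq> 0}"
  have sub: "closure ?S \<subseteq> K"
    by (rule closure_minimal) (use assms(4) compact_imp_closed[OF assms(2)] in blast)+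
  have "compact (K \<inter> closure ?S)"
    by (rule compact_Int_closed[OF assms(2) closed_closure])
  also have "K \<inter> closure ?S = closure ?S" using sub by blast
  finally have "compact (closure ?S)" .
  with sub assms(1,3) show ?thesis
    unfolding test_fun_def by blast
qed

text \<open>One compact set serves for the function and its first derivatives, because the
  complement of the support is open and the function is locally constant there.\<close>

lemma test_fun_cpt:
  assumes "test_fun U \<phi>"
  shows "\<exists>K. compact K \<and> K \<subseteq> U \<and> (\<forall>x. x \<notin> K \<longrightarrow> \<phi> x = 0)
    \<and> (\<forall>x v. x \<notin> K \<longrightarrow> frechet_derivative \<phi> (at x) v = 0)"
proof -
  let ?S = "{x. \<phi> x \<noteq> 0}"
  let ?K = "closure ?S"
  have z: "\<phi> x = 0" if "x \<notin> ?K" for x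
    using that subsetD[OF closure_subset[of ?S], of x] by blast
  have fd: "frechet_derivative \<phi> (at x) v = 0" if "x \<notin> ?K" for x v
  proof (rule frechet_derivative_eqI)
    have "((\<lambda>x. 0) has_derivative (\<lambda>v. 0)) (at x)" by simp
    then show "(\<phi> has_derivative (\<lambda>v. 0)) (at x)"
    proof (rule has_derivative_transform_within_open[where s="- ?K"])
      show "open (- ?K)" using closed_closure by (rule open_Compl)
      show "x \<in> - ?K" using that by blast
      show "0 = \<phi> y" if "y \<in> - ?K" for y by (rule z[symmetric]) (use that in blast)
    qed
  qed
  have "compact ?K" "?K \<subseteq> U" using assms unfolding test_fun_def by blast+
  then show ?thesis by (intro exI[of _ ?K] conjI allI impI z fd)
qed

lemma test_fun_deriv:
  assumes "test_fun U \<phi>"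
  shows "test_fun U (\<lambda>x. frechet_derivative \<phi> (at x) v)"
proof -
  from test_fun_cpt[OF assms] obtain K where K: "compact K" "K \<subseteq> U" "\<forall>x. x \<notin> K \<longrightarrow> \<phi> x = 0"
    "\<forall>x v. x \<notin> K \<longrightarrow> frechet_derivative \<phi> (at x) v = 0" by (elim exE conjE) (rule that)
  show ?thesis
    by (rule test_funI[OF smooth_fun_deriv[OF test_fun_smooth[OF assms]] K(1,2)]) (simp add: K(4))
qed

lemma test_fun_mult:
  assumes "test_fun U \<phi>" "smooth_fun f"
  shows "test_fun U (\<lambda>x. f x * \<phi> x)"
proof -
  from test_fun_cpt[OF assms(1)] obtain K where K: "compact K" "K \<subseteq> U" "\<forall>x. x \<notin> K \<longrightarrow> \<phi> x = 0"
    "\<forall>x v. x \<notin> K \<longrightarrow> frechet_derivative \<phi> (at x) v = 0" by (elim exE conjE) (rule that)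
  show ?thesis
    by (rule test_funI[OF smooth_fun_mult[OF assms(2) test_fun_smooth[OF assms(1)]] K(1,2)]) (simp add: K(3))
qed

lemma test_fun_cmult: "test_fun U \<phi> \<Longrightarrow> test_fun U (\<lambda>x. c * \<phi> x)"
  by (intro test_fun_mult smooth_fun_const)

lemma test_fun_add:
  assumes "test_fun U \<phi>" "test_fun U \<psi>"
  shows "test_fun U (\<lambda>x. \<phi> x + \<psi> x)"
proof -
  from test_fun_cpt[OF assms(1)] obtain K where K: "compact K" "K \<subseteq> U" "\<forall>x. x \<notin> K \<longrightarrow> \<phi> x = 0"
    "\<forall>x v. x \<notin> K \<longrightarrow> frechet_derivative \<phi> (at x) v = 0" by (elim exE conjE) (rule that)
  from test_fun_cpt[OF assms(2)] obtain L where L: "compact L" "L \<subseteq> U" "\<forall>x. x \<notin> L \<longrightarrow> \<psi> x = 0"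
    "\<forall>x v. x \<notin> L \<longrightarrow> frechet_derivative \<psi> (at x) v = 0" by (elim exE conjE) (rule that)
  show ?thesis
    using K(2) L(2) by (intro test_funI[of _ "K \<union> L"] compact_Un K(1) L(1) smooth_fun_add test_fun_smooth[OF assms(1)] test_fun_smooth[OF assms(2)])
      (simp_all add: K(3) L(3))
qed

lemma test_fun_bounded:
  assumes "test_fun U \<phi>"
  obtains B where "B > 0" "\<And>x. \<bar>\<phi> x\<bar> \<le> B"
proof -
  from test_fun_cpt[OF assms] obtain K where K: "compact K" "K \<subseteq> U" "\<forall>x. x \<notin> K \<longrightarrow> \<phi> x = 0"
    "\<forall>x v. x \<notin> K \<longrightarrow> frechet_derivative \<phi> (at x) v = 0" by (elim exE conjE) (rule that)
  have "bounded (\<phi> ` K)"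
    using K(1) assms by (intro compact_imp_bounded compact_continuous_image smooth_fun_continuous_on test_fun_smooth)
  then obtain B where B: "\<And>x. x \<in> K \<Longrightarrow> \<bar>\<phi> x\<bar> \<le> B"
    by (auto simp: bounded_iff)
  show thesis
  proof (rule that[of "max B 1"])
    fix x show "\<bar>\<phi> x\<bar> \<le> max B 1"
      using B[of x] K(3)[rule_format, of x] by (cases "x \<in> K") auto
  qed auto
qed

lemma frechet_derivative_add_smooth:
  "smooth_fun f \<Longrightarrow> smooth_fun g \<Longrightarrow> frechet_derivative (\<lambda>x. f x + g x) (at x) v
    = frechet_derivative f (at x) v + frechet_derivative g (at x) v"
  by (rule frechet_derivative_eqI[OF has_derivative_add[OF smooth_fun_has_derivative smooth_fun_has_derivative]])

lemma frechet_derivative_mult_smooth: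
  "smooth_fun f \<Longrightarrow> smooth_fun g \<Longrightarrow> frechet_derivative (\<lambda>x. f x * g x) (at x) v
    = f x * frechet_derivative g (at x) v + frechet_derivative f (at x) v * g x"
  by (rule frechet_derivative_eqI[OF has_derivative_mult[OF smooth_fun_has_derivative smooth_fun_has_derivative]])

lemma frechet_derivative_cmult_smooth:
  assumes "smooth_fun f"
  shows "frechet_derivative (\<lambda>x. c * f x) (at x) v = c * frechet_derivative f (at x) v"
proof -
  have "((\<lambda>x. c * f x) has_derivative (\<lambda>v. c * frechet_derivative f (at x) v)) (at x)"
    by (intro has_derivative_mult_right smooth_fun_has_derivative assms)
  then show ?thesis by (rule frechet_derivative_eqI)
qed

lemma frechet_derivative_affine:
  assumes "smooth_fun f"
  shows "frechet_derivative (\<lambda>x. f (c *\<^sub>R x + b)) (at x) v = c * frechet_derivative f (at (c *\<^sub>R x + b)) v"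
proof -
  have "((\<lambda>x. c *\<^sub>R x + b) has_derivative (\<lambda>v. c *\<^sub>R v)) (at x)"
    by (auto intro!: derivative_eq_intros)
  from diff_chain_at[OF this smooth_fun_has_derivative[OF assms]]
  have "((\<lambda>x. f (c *\<^sub>R x + b)) has_derivative (\<lambda>v. frechet_derivative f (at (c *\<^sub>R x + b)) (c *\<^sub>R v))) (at x)"
    by (simp add: o_def)
  then have "frechet_derivative (\<lambda>x. f (c *\<^sub>R x + b)) (at x) v = frechet_derivative f (at (c *\<^sub>R x + b)) (c *\<^sub>R v)"
    by (rule frechet_derivative_eqI)
  then show ?thesis
    using linear_cmul[OF has_derivative_linear[OF smooth_fun_has_derivative[OF assms]]] by simp
qed

lemma test_fun_affine:
  assumes "test_fun UNIV \<phi>" "c \<noteq> 0"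
  shows "test_fun UNIV (\<lambda>x. \<phi> (c *\<^sub>R x + b))"
proof -
  from test_fun_cpt[OF assms(1)] obtain K where K: "compact K" "K \<subseteq> UNIV" "\<forall>x. x \<notin> K \<longrightarrow> \<phi> x = 0"
    "\<forall>x v. x \<notin> K \<longrightarrow> frechet_derivative \<phi> (at x) v = 0" by (elim exE conjE) (rule that)
  show ?thesis
  proof (rule test_funI)
    show "compact ((\<lambda>y. (1/c) *\<^sub>R (y - b)) ` K)"
      by (intro compact_continuous_image K(1) continuous_intros)
    fix x assume x: "x \<notin> (\<lambda>y. (1/c) *\<^sub>R (y - b)) ` K"
    have "c *\<^sub>R x + b \<notin> K"
    proof
      assume "c *\<^sub>R x + b \<in> K"
      then have "(1/c) *\<^sub>R ((c *\<^sub>R x + b) - b) \<in> (\<lambda>y. (1/c) *\<^sub>R (y - b)) ` K" by blast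
      then show False using x \<open>c \<noteq> 0\<close> by simp
    qed
    then show "\<phi> (c *\<^sub>R x + b) = 0" by (simp add: K(3))
  qed (use assms in \<open>auto intro!: smooth_fun_affine intro: test_fun_smooth[OF assms(1)]\<close>)
qed

lemma test_fun_bump: "test_fun UNIV bump"
  by (rule test_funI[of _ "cball 0 1"]) (auto simp: smooth_fun_bump bump_eq_0)

section \<open>Square integrable functions and weak gradients\<close>

lemma lebesgue_affine:
  fixes t :: "'a::euclidean_space"
  assumes "c \<noteq> 0"
  shows "lebesgue = density (distr lebesgue lebesgue (\<lambda>x. t + c *\<^sub>R x)) (\<lambda>_. \<bar>c\<bar>^DIM('a))"
    and measurable_lebesgue_affine: "(\<lambda>x. t + c *\<^sub>R x) \<in> lebesgue \<rightarrow>\<^sub>M lebesgue"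
  using lebesgue_affine_euclidean[where c="\<lambda>_::'a. c" and t=t, OF assms]
    lebesgue_affine_measurable[where c="\<lambda>_::'a. c" and t=t, OF assms]
  unfolding scaleR_scaleR[symmetric] scaleR_sum_right[symmetric] euclidean_representation prod_constant by simp_all

lemma nn_integral_lebesgue_affine:
  fixes t :: "'a::euclidean_space"
  assumes c: "c \<noteq> 0" and f[measurable]: "f \<in> borel_measurable lebesgue"
  shows "(\<integral>\<^sup>+x. f (t + c *\<^sub>R x) \<partial>lebesgue) = ennreal (1 / \<bar>c\<bar>^DIM('a)) * (\<integral>\<^sup>+x. f x \<partial>lebesgue)"
proof -
  note [measurable] = measurable_lebesgue_affine[OF c, of t]
  have "(\<integral>\<^sup>+x. f x \<partial>lebesgue) = \<bar>c\<bar>^DIM('a) * (\<integral>\<^sup>+x. f (t + c *\<^sub>R x) \<partial>lebesgue)"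
    by (subst lebesgue_affine[OF c, of t])
      (simp add: nn_integral_density nn_integral_distr nn_integral_cmult)
  then have "ennreal (1 / \<bar>c\<bar>^DIM('a)) * (\<integral>\<^sup>+x. f x \<partial>lebesgue) = ennreal (1 / \<bar>c\<bar>^DIM('a)) * \<bar>c\<bar>^DIM('a) * (\<integral>\<^sup>+x. f (t + c *\<^sub>R x) \<partial>lebesgue)"
    by (simp add: mult.assoc)
  also have "ennreal (1 / \<bar>c\<bar>^DIM('a)) * \<bar>c\<bar>^DIM('a) = 1"
    using c by (subst ennreal_mult[symmetric]) auto
  finally show ?thesis by simp
qed

lemma borel_measurable_lebesgue_affine:
  fixes t :: "'a::euclidean_space"
  assumes c: "c \<noteq> 0" and f[measurable]: "f \<in> borel_measurable lebesgue"
  shows "(\<lambda>x. f (t + c *\<^sub>R x)) \<in> borel_measurable lebesgue"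
  using measurable_compose[OF measurable_lebesgue_affine[OF c] f] .

lemma integrable_lebesgue_affine:
  fixes t :: "'a::euclidean_space" and f :: "'a \<Rightarrow> 'b::euclidean_space"
  assumes c: "c \<noteq> 0" and f: "integrable lebesgue f"
  shows "integrable lebesgue (\<lambda>x. f (t + c *\<^sub>R x))"
proof -
  have [measurable]: "f \<in> borel_measurable lebesgue" using f by simp
  show ?thesis
    using f borel_measurable_lebesgue_affine[OF c, of f t]
    by (subst (asm) integrable_iff_bounded, subst integrable_iff_bounded)
      (auto simp: nn_integral_lebesgue_affine[OF c, of "\<lambda>x. ennreal (norm (f x))" t] ennreal_mult_less_top)
qed

lemma integral_lebesgue_affine:
  fixes t :: "'a::euclidean_space" and f :: "'a \<Rightarrow> 'b::euclidean_space"
  assumes c: "c \<noteq> 0" and f[measurable]: "f \<in> borel_measurable lebesgue"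
  shows "(\<integral>x. f (t + c *\<^sub>R x) \<partial>lebesgue) = (1 / \<bar>c\<bar>^DIM('a)) *\<^sub>R (\<integral>x. f x \<partial>lebesgue)"
proof -
  note [measurable] = measurable_lebesgue_affine[OF c, of t]
  have "(\<integral>x. f x \<partial>lebesgue) = \<bar>c\<bar>^DIM('a) *\<^sub>R (\<integral>x. f (t + c *\<^sub>R x) \<partial>lebesgue)"
    by (subst lebesgue_affine[OF c, of t]) (simp add: integral_density integral_distr)
  then show ?thesis using c by simp
qed

lemma AE_lebesgue_affine:
  fixes t :: "'a::euclidean_space"
  assumes c: "c \<noteq> 0" and P: "AE x in lebesgue. P x"
  shows "AE x in lebesgue. P (t + c *\<^sub>R x)"
proof -
  obtain N where N: "N \<in> null_sets lebesgue" "{x. \<not> P x} \<subseteq> N"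
    using P unfolding eventually_ae_filter by auto
  have [measurable]: "N \<in> sets lebesgue" using N(1) by auto
  have [measurable]: "(\<lambda>x. indicator N (t + c *\<^sub>R x) :: ennreal) \<in> borel_measurable lebesgue"
    by (rule borel_measurable_lebesgue_affine[OF c]) measurable
  have "(\<integral>\<^sup>+x. indicator N (t + c *\<^sub>R x) \<partial>lebesgue) = 0"
    using N(1) by (subst nn_integral_lebesgue_affine[OF c]) (auto simp: null_sets_def)
  then have "AE x in lebesgue. indicator N (t + c *\<^sub>R x) = (0::ennreal)"
    by (subst (asm) nn_integral_0_iff_AE) auto
  then show ?thesis
    by eventually_elim (use N(2) in \<open>auto simp: indicator_def split: if_splits\<close>)
qed

section \<open>Square integrable functions, Cauchy-Schwarz and integration over sets of finite
  measure\<close>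

definition sqi :: "('a::euclidean_space \<Rightarrow> 'b::euclidean_space) \<Rightarrow> bool" where
  "sqi f \<longleftrightarrow> f \<in> borel_measurable lebesgue \<and> integrable lebesgue (\<lambda>x. (norm (f x))\<^sup>2)"

definition sqn :: "('a::euclidean_space \<Rightarrow> 'b::euclidean_space) \<Rightarrow> real" where
  "sqn f = (\<integral>x. (norm (f x))\<^sup>2 \<partial>lebesgue)"

lemma sqi_measurable: "sqi f \<Longrightarrow> f \<in> borel_measurable lebesgue"
  by (simp add: sqi_def)

lemma sqn_nonneg: "sqn f \<ge> 0"
  by (simp add: sqn_def)

lemma sqi_iff: "sqi f \<longleftrightarrow> f \<in> borel_measurable lebesgue \<and> (\<integral>\<^sup>+x. ennreal ((norm (f x))\<^sup>2) \<partial>lebesgue) < \<infinity>"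
  unfolding sqi_def by (auto simp: integrable_iff_bounded)

lemma nn_integral_sqn: "sqi f \<Longrightarrow> (\<integral>\<^sup>+x. ennreal ((norm (f x))\<^sup>2) \<partial>lebesgue) = ennreal (sqn f)"
  unfolding sqi_def sqn_def by (intro nn_integral_eq_integral) auto

lemma sqi_bound:
  fixes f :: "'a::euclidean_space \<Rightarrow> 'b::euclidean_space"
  assumes "f \<in> borel_measurable lebesgue" "sqi g" "AE x in lebesgue. norm (f x) \<le> norm (g x)"
  shows "sqi f" "sqn f \<le> sqn g"
proof -
  have [measurable]: "f \<in> borel_measurable lebesgue" by fact
  have le: "AE x in lebesgue. (norm (f x))\<^sup>2 \<le> (norm (g x))\<^sup>2"
    using assms(3) by eventually_elim (simp add: power_mono)
  have g: "integrable lebesgue (\<lambda>x. (norm (g x))\<^sup>2)" using assms(2) by (simp add: sqi_def)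
  have f: "integrable lebesgue (\<lambda>x. (norm (f x))\<^sup>2)"
    by (rule Bochner_Integration.integrable_bound[OF g]) (use le in auto)
  then show "sqi f" by (simp add: sqi_def)
  show "sqn f \<le> sqn g" unfolding sqn_def by (rule integral_mono_AE[OF f g le])
qed

lemma sqi_cmult: "sqi f \<Longrightarrow> sqi (\<lambda>x. c *\<^sub>R f x)"
  unfolding sqi_def by (auto simp: power_mult_distrib)

lemma sqi_norm: "sqi f \<Longrightarrow> sqi (\<lambda>x. norm (f x))"
  unfolding sqi_def by auto

lemma sqi_add:
  assumes "sqi f" "sqi g"
  shows "sqi (\<lambda>x. f x + g x)" "sqn (\<lambda>x. f x + g x) \<le> 2 * sqn f + 2 * sqn g"
proof -
  have [measurable]: "f \<in> borel_measurable lebesgue" "g \<in> borel_measurable lebesgue"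
    using assms by (simp_all add: sqi_def)
  have le: "(norm (f x + g x))\<^sup>2 \<le> 2 * (norm (f x))\<^sup>2 + 2 * (norm (g x))\<^sup>2" for x
  proof -
    have "(norm (f x + g x))\<^sup>2 \<le> (norm (f x) + norm (g x))\<^sup>2"
      by (intro power_mono norm_triangle_ineq) auto
    also have "\<dots> \<le> 2 * (norm (f x))\<^sup>2 + 2 * (norm (g x))\<^sup>2"
      using sum_squares_bound[of "norm (f x)" "norm (g x)"] by (simp add: power2_sum)
    finally show ?thesis .
  qed
  have i: "integrable lebesgue (\<lambda>x. 2 * (norm (f x))\<^sup>2 + 2 * (norm (g x))\<^sup>2)"
    using assms by (auto simp: sqi_def)
  have j: "integrable lebesgue (\<lambda>x. (norm (f x + g x))\<^sup>2)"
    by (rule Bochner_Integration.integrable_bound[OF i]) (use le in \<open>auto intro!: always_eventually order_trans[OF le]\<close>)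
  then show "sqi (\<lambda>x. f x + g x)" by (simp add: sqi_def)
  show "sqn (\<lambda>x. f x + g x) \<le> 2 * sqn f + 2 * sqn g"
    using integral_mono[OF j i le] assms by (simp add: sqn_def sqi_def)
qed

lemma sqi_diff:
  assumes "sqi f" "sqi g"
  shows "sqi (\<lambda>x. f x - g x)" "sqn (\<lambda>x. f x - g x) \<le> 2 * sqn f + 2 * sqn g"
  using sqi_add[OF assms(1) sqi_cmult[OF assms(2), of "-1"]] by (auto simp: sqn_def)

lemma sqi_inner: "sqi g \<Longrightarrow> sqi (\<lambda>x. g x \<bullet> i)"
proof -
  assume g: "sqi g"
  have [measurable]: "g \<in> borel_measurable lebesgue" using g by (simp add: sqi_def)
  show "sqi (\<lambda>x. g x \<bullet> i)"
    by (rule sqi_bound(1)[OF _ sqi_cmult[OF g, of "norm i"]])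
      (auto simp: mult.commute[of "norm i"] Cauchy_Schwarz_ineq2)
qed

lemma sqi_mult_integrable:
  fixes f g :: "'a::euclidean_space \<Rightarrow> real"
  assumes "sqi f" "sqi g"
  shows "integrable lebesgue (\<lambda>x. f x * g x)"
proof -
  have [measurable]: "f \<in> borel_measurable lebesgue" "g \<in> borel_measurable lebesgue"
    using assms by (simp_all add: sqi_def)
  have i: "integrable lebesgue (\<lambda>x. (norm (f x))\<^sup>2 + (norm (g x))\<^sup>2)"
    using assms by (auto simp: sqi_def)
  have le: "\<bar>f x * g x\<bar> \<le> (f x)\<^sup>2 + (g x)\<^sup>2" for x
  proof -
    have "2 * \<bar>f x\<bar> * \<bar>g x\<bar> \<le> \<bar>f x\<bar>\<^sup>2 + \<bar>g x\<bar>\<^sup>2" by (rule sum_squares_bound)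
    moreover have "0 \<le> \<bar>f x\<bar> * \<bar>g x\<bar>" by simp
    ultimately show ?thesis unfolding abs_mult power2_abs by linarith
  qed
  show ?thesis
    by (rule Bochner_Integration.integrable_bound[OF i]) (use le in \<open>auto\<close>)
qed

lemma sqi_Cauchy_Schwarz:
  fixes f g :: "'a::euclidean_space \<Rightarrow> real"
  assumes f: "sqi f" and g: "sqi g"
  shows "(\<integral>x. \<bar>f x * g x\<bar> \<partial>lebesgue)\<^sup>2 \<le> sqn f * sqn g"
proof -
  have [measurable]: "f \<in> borel_measurable lebesgue" "g \<in> borel_measurable lebesgue"
    using assms by (simp_all add: sqi_def)
  have "(\<integral>\<^sup>+x. ennreal \<bar>f x\<bar> * ennreal \<bar>g x\<bar> \<partial>lebesgue)\<^sup>2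
      \<le> (\<integral>\<^sup>+x. ennreal \<bar>f x\<bar> ^ 2 \<partial>lebesgue) * (\<integral>\<^sup>+x. ennreal \<bar>g x\<bar> ^ 2 \<partial>lebesgue)"
    by (rule Cauchy_Schwarz_nn_integral) auto
  also have "(\<integral>\<^sup>+x. ennreal \<bar>f x\<bar> * ennreal \<bar>g x\<bar> \<partial>lebesgue) = (\<integral>\<^sup>+x. ennreal \<bar>f x * g x\<bar> \<partial>lebesgue)"
    by (simp add: ennreal_mult' abs_mult)
  also have "\<dots> = ennreal (\<integral>x. \<bar>f x * g x\<bar> \<partial>lebesgue)"
    using sqi_mult_integrable[OF assms] by (intro nn_integral_eq_integral) auto
  finally have "ennreal ((\<integral>x. \<bar>f x * g x\<bar> \<partial>lebesgue)\<^sup>2) \<le> ennreal (sqn f) * ennreal (sqn g)"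
    using nn_integral_sqn[OF f] nn_integral_sqn[OF g] by (simp add: ennreal_power)
  then show ?thesis
    by (simp add: ennreal_mult'[symmetric] sqn_nonneg)
qed

lemma sqi_indicator:
  "S \<in> lmeasurable \<Longrightarrow> sqi (indicator S :: 'a::euclidean_space \<Rightarrow> real)"
  "S \<in> lmeasurable \<Longrightarrow> sqn (indicator S :: 'a::euclidean_space \<Rightarrow> real) = measure lebesgue S"
proof -
  assume S: "S \<in> lmeasurable"
  have eq: "(\<lambda>x::'a. (norm (indicator S x :: real))\<^sup>2) = indicator S"
    by (auto simp: fun_eq_iff indicator_def)
  show "sqi (indicator S :: 'a \<Rightarrow> real)"
    using S unfolding sqi_def eq by (auto simp: fmeasurable_def)
  show "sqn (indicator S :: 'a \<Rightarrow> real) = measure lebesgue S"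
    using S unfolding sqn_def eq by (auto simp: fmeasurable_def)
qed

lemma sqi_indicator_mult:
  fixes f :: "'a::euclidean_space \<Rightarrow> 'b::euclidean_space"
  assumes "sqi f" "S \<in> sets lebesgue"
  shows "sqi (\<lambda>x. indicator S x *\<^sub>R f x)" "sqn (\<lambda>x. indicator S x *\<^sub>R f x) \<le> sqn f"
proof -
  have [measurable]: "f \<in> borel_measurable lebesgue" "S \<in> sets lebesgue"
    using assms by (simp_all add: sqi_def)
  show "sqi (\<lambda>x. indicator S x *\<^sub>R f x)" "sqn (\<lambda>x. indicator S x *\<^sub>R f x) \<le> sqn f"
    by (rule sqi_bound[OF _ assms(1)]; auto simp: indicator_def)+
qed

lemma sqi_set_integrable:
  fixes f :: "'a::euclidean_space \<Rightarrow> 'b::euclidean_space"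
  assumes f: "sqi f" and S: "S \<in> lmeasurable"
  shows "integrable lebesgue (\<lambda>x. indicator S x * norm (f x))"
    and "integrable lebesgue (\<lambda>x. indicator S x *\<^sub>R f x)"
    and "(\<integral>x. indicator S x * norm (f x) \<partial>lebesgue)\<^sup>2 \<le> measure lebesgue S * sqn f"
proof -
  have [measurable]: "f \<in> borel_measurable lebesgue" "S \<in> sets lebesgue"
    using assms by (simp_all add: sqi_def)
  show i: "integrable lebesgue (\<lambda>x. indicator S x * norm (f x))"
    by (rule sqi_mult_integrable[OF sqi_indicator(1)[OF S] sqi_norm[OF f]])
  show "integrable lebesgue (\<lambda>x. indicator S x *\<^sub>R f x)"
    by (rule Bochner_Integration.integrable_bound[OF i]) (auto simp: indicator_def)
  show "(\<integral>x. indicator S x * norm (f x) \<partial>lebesgue)\<^sup>2 \<le> measure lebesgue S * sqn f"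
    using sqi_Cauchy_Schwarz[OF sqi_indicator(1)[OF S] sqi_norm[OF f]] sqi_indicator(2)[OF S]
    by (simp add: sqn_def[of f] sqn_def[of "\<lambda>x. norm (f x)"])
qed

lemma sqi_if_bounded_support:
  fixes f :: "'a::euclidean_space \<Rightarrow> 'b::euclidean_space"
  assumes [measurable]: "f \<in> borel_measurable lebesgue" and K: "K \<in> lmeasurable"
    and z: "\<And>x. x \<notin> K \<Longrightarrow> f x = 0" and B: "\<And>x. norm (f x) \<le> B"
  shows "sqi f" "sqn f \<le> B\<^sup>2 * measure lebesgue K"
proof -
  have B0: "B \<ge> 0" using B[of undefined] norm_ge_zero order_trans by blast
  have s: "sqi (\<lambda>x. B *\<^sub>R (indicator K x :: real))"
    by (intro sqi_cmult sqi_indicator K)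
  have le: "norm (f x) \<le> norm (B *\<^sub>R (indicator K x :: real))" for x
    using z[of x] B[of x] B0 by (auto simp: indicator_def)
  show "sqi f" by (rule sqi_bound[OF _ s]) (use le in auto)
  have "sqn f \<le> sqn (\<lambda>x. B *\<^sub>R (indicator K x :: real))" by (rule sqi_bound[OF _ s]) (use le in auto)
  also have "\<dots> = B\<^sup>2 * sqn (indicator K :: 'a \<Rightarrow> real)"
    by (simp add: sqn_def power_mult_distrib)
  finally show "sqn f \<le> B\<^sup>2 * measure lebesgue K" by (simp add: sqi_indicator(2)[OF K])
qed

lemma borel_measurable_continuous_lebesgue:
  "continuous_on UNIV f \<Longrightarrow> f \<in> borel_measurable lebesgue"
  by (intro measurable_completion) (simp add: borel_measurable_continuous_onI)

lemma sqi_test_fun: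
  assumes "test_fun U \<phi>"
  shows "sqi \<phi>" and "sqi (\<lambda>x. frechet_derivative \<phi> (at x) v)"
proof -
  have *: "sqi \<psi>" if t: "test_fun U \<psi>" for \<psi>
  proof -
    from test_fun_cpt[OF t] obtain K where K: "compact K" "\<And>x. x \<notin> K \<Longrightarrow> \<psi> x = 0" by metis
    obtain B where B: "\<And>x. \<bar>\<psi> x\<bar> \<le> B" using test_fun_bounded[OF t] by metis
    show ?thesis
      by (rule sqi_if_bounded_support[of _ K B])
        (use K B in \<open>auto intro!: borel_measurable_continuous_lebesgue smooth_fun_continuous_on test_fun_smooth[OF t] lmeasurable_compact\<close>)
  qed
  show "sqi \<phi>" by (rule *[OF assms])
  show "sqi (\<lambda>x. frechet_derivative \<phi> (at x) v)" by (rule *[OF test_fun_deriv[OF assms]])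
qed

section \<open>Weak gradients on the whole space and their restriction to open sets\<close>

lemma has_weak_gradient_UNIV_iff:
  "has_weak_gradient UNIV u g \<longleftrightarrow> sqi u \<and> sqi g \<and>
     (\<forall>\<phi>. test_fun UNIV \<phi> \<longrightarrow> (\<forall>i\<in>Basis.
        (\<integral>x. u x * frechet_derivative \<phi> (at x) i \<partial>lebesgue) = - (\<integral>x. (g x \<bullet> i) * \<phi> x \<partial>lebesgue)))"
  unfolding has_weak_gradient_def sqi_iff
  by (auto simp: set_borel_measurable_def set_lebesgue_integral_def)

lemma has_weak_gradient_restrict:
  assumes "has_weak_gradient UNIV u g" "open U"
  shows "has_weak_gradient U u g"
proof -
  have [measurable]: "U \<in> sets lebesgue" using assms(2) by simp
  have u: "sqi u" "sqi g" and eq: "\<And>\<phi> i. test_fun UNIV \<phi> \<Longrightarrow> i \<in> Basis \<Longrightarrow>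
        (\<integral>x. u x * frechet_derivative \<phi> (at x) i \<partial>lebesgue) = - (\<integral>x. (g x \<bullet> i) * \<phi> x \<partial>lebesgue)"
    using assms(1) by (auto simp: has_weak_gradient_UNIV_iff)
  have [measurable]: "u \<in> borel_measurable lebesgue" "g \<in> borel_measurable lebesgue"
    using u by (auto simp: sqi_def)
  have 1: "(\<integral>\<^sup>+x\<in>U. ennreal ((u x)\<^sup>2) \<partial>lebesgue) < \<infinity>"
  proof -
    have "(\<integral>\<^sup>+x\<in>U. ennreal ((u x)\<^sup>2) \<partial>lebesgue) \<le> (\<integral>\<^sup>+x. ennreal ((norm (u x))\<^sup>2) \<partial>lebesgue)"
      by (intro nn_integral_mono) (auto simp: indicator_def)
    then show ?thesis using u(1) by (auto simp: sqi_iff intro: le_less_trans)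
  qed
  have 2: "(\<integral>\<^sup>+x\<in>U. ennreal ((norm (g x))\<^sup>2) \<partial>lebesgue) < \<infinity>"
  proof -
    have "(\<integral>\<^sup>+x\<in>U. ennreal ((norm (g x))\<^sup>2) \<partial>lebesgue) \<le> (\<integral>\<^sup>+x. ennreal ((norm (g x))\<^sup>2) \<partial>lebesgue)"
      by (intro nn_integral_mono) (auto simp: indicator_def)
    then show ?thesis using u(2) by (auto simp: sqi_iff intro: le_less_trans)
  qed
  have 3: "(LINT x:U|lebesgue. u x * frechet_derivative \<phi> (at x) i) = - (LINT x:U|lebesgue. (g x \<bullet> i) * \<phi> x)"
    if t: "test_fun U \<phi>" and i: "i \<in> Basis" for \<phi> i
  proof -
    from test_fun_cpt[OF t] obtain K where K: "K \<subseteq> U" "\<forall>x. x \<notin> K \<longrightarrow> \<phi> x = 0"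
      "\<forall>x v. x \<notin> K \<longrightarrow> frechet_derivative \<phi> (at x) v = 0" by metis
    have "indicator U x *\<^sub>R (u x * frechet_derivative \<phi> (at x) i) = u x * frechet_derivative \<phi> (at x) i" for x
      using K by (cases "x \<in> U") auto
    moreover have "indicator U x *\<^sub>R ((g x \<bullet> i) * \<phi> x) = (g x \<bullet> i) * \<phi> x" for x
      using K by (cases "x \<in> U") auto
    ultimately show ?thesis
      unfolding set_lebesgue_integral_def
      using eq[OF test_fun_subset[OF t] i] by (simp only: subset_UNIV)
  qed
  show ?thesis
    unfolding has_weak_gradient_def set_borel_measurable_def using 1 2 3 by auto
qed

lemma has_weak_gradient_wgrad: "H1 U u \<Longrightarrow> has_weak_gradient U u (wgrad U u)"
  unfolding H1_def wgrad_def by (erule someI_ex)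

section \<open>Mollification and uniqueness of weak gradients\<close>

text \<open>A Lebesgue point, with averages over cubes having x as lower corner instead of balls
  centred at x. This is the form in which \<open>integrable_ccontinuous_explicit\<close> yields
  differentiation of integrals, and it is why all mollifying kernels below live in the positive
  orthant.\<close>

definition leb_pt :: "('a::euclidean_space \<Rightarrow> real) \<Rightarrow> 'a \<Rightarrow> bool" where
  "leb_pt f x \<longleftrightarrow> (\<forall>e>0. \<exists>d>0. \<forall>h. 0 < h \<and> h < d \<longrightarrow>
     (\<integral>z. indicator (cbox x (x + h *\<^sub>R One)) z * \<bar>f z - f x\<bar> \<partial>lebesgue) \<le> e * h ^ DIM('a))"

lemma measure_cube:
  fixes x :: "'a::euclidean_space"
  assumes "h \<ge> 0"
  shows "measure lebesgue (cbox x (x + h *\<^sub>R One)) = h ^ DIM('a)"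
proof -
  have "cbox x (x + h *\<^sub>R One) \<noteq> {}" using assms by (auto simp: box_ne_empty inner_add_left inner_Basis)
  then show ?thesis
    by (simp add: content_cbox_if inner_add_left)
qed

lemma integrable_cbox_diff:
  fixes f :: "'a::euclidean_space \<Rightarrow> real"
  assumes int: "integrable lebesgue (\<lambda>z. indicator (cbox a b) z * f z)"
  shows "integrable lebesgue (\<lambda>z. indicator (cbox a b) z * \<bar>f z - q\<bar>)"
proof -
  have "integrable lebesgue (indicator (cbox a b) :: 'a \<Rightarrow> real)"
    using sqi_indicator(1)[of "cbox a b"] lmeasurable_cbox by (intro integrable_real_indicator) (auto simp: fmeasurable_def)
  from integrable_mult_left[OF this, of q]
  have q: "integrable lebesgue (\<lambda>z. indicator (cbox a b) z * q)" .
  have eq: "(\<lambda>z. indicator (cbox a b) z * \<bar>f z - q\<bar>) = (\<lambda>z. \<bar>indicator (cbox a b) z * f z - indicator (cbox a b) z * q\<bar>)"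
    by (auto simp: fun_eq_iff indicator_def)
  show ?thesis
    unfolding eq by (rule integrable_abs[OF Bochner_Integration.integrable_diff[OF int q]])
qed

text \<open>The differentiation theorem is applied to |f - q| for every rational q; outside a
  countable union of null sets all these averages converge. At such a point a rational q close to f
  x controls the oscillation of f.\<close>

lemma AE_leb_pt:
  fixes f :: "'a::euclidean_space \<Rightarrow> real"
  assumes int: "\<And>a b. integrable lebesgue (\<lambda>z. indicator (cbox a b) z * f z)"
  shows "AE x in lebesgue. leb_pt f x"
proof -
  define F where "F q z = \<bar>f z - q\<bar>" for q z
  have si: "set_integrable lebesgue (cbox a b) (F q)" for a b q
    using integrable_cbox_diff[OF int, of a b q] unfolding F_def set_integrable_def by simp
  define P where "P q N \<longleftrightarrow> negligible N \<and> (\<forall>x e. x \<notin> N \<longrightarrow> 0 < e \<longrightarrow> (\<exists>d>0. \<forall>h. 0 < h \<and> h < d \<longrightarrow>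
       norm (integral (cbox x (x + h *\<^sub>R One)) (F q) /\<^sub>R h ^ DIM('a) - F q x) < e))" for q N
  have "\<exists>N. P q N" for q
  proof (rule integrable_ccontinuous_explicit[OF set_lebesgue_integral_eq_integral(1)[OF si[of _ _ q]]])
    fix N assume "negligible N" and
      "\<And>x e. x \<notin> N \<Longrightarrow> 0 < e \<Longrightarrow> \<exists>d>0. \<forall>h. 0 < h \<and> h < d \<longrightarrow>
        norm (integral (cbox x (x + h *\<^sub>R One)) (F q) /\<^sub>R h ^ DIM('a) - F q x) < e"
    then have "P q N" unfolding P_def by (intro conjI allI impI)
    then show ?thesis by (rule exI)
  qed
  then have "\<forall>q. \<exists>N. P q N" by blast
  from choice[OF this] obtain N where "\<forall>q. P q (N q)" ..
  then have PN: "P q (N q)" for q by blast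
  have N: "negligible (N q)" for q using PN[of q] by (simp add: P_def)
  have D: "\<exists>d>0. \<forall>h. 0 < h \<and> h < d \<longrightarrow>
       norm (integral (cbox x (x + h *\<^sub>R One)) (F q) /\<^sub>R h ^ DIM('a) - F q x) < e"
    if "x \<notin> N q" "0 < e" for q x e
    using PN[of q, unfolded P_def, THEN conjunct2, rule_format, OF that] .
  have "negligible (\<Union>q\<in>\<rat>. N q)"
    using N by (intro negligible_countable_Union) (auto simp: countable_rat)
  moreover have "leb_pt f x" if x: "x \<notin> (\<Union>q\<in>\<rat>. N q)" for x
    unfolding leb_pt_def
  proof (intro allI impI)
    fix e :: real assume e: "e > 0"
    \<comment> \<open>Two thirds of e pay for the average of |f - q| on a small cube, namely |f x -
      q| and the error of convergence. The last third pays for replacing q by f x.\<close>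
    obtain q where q: "q \<in> \<rat>" "f x - e/3 < q" "q < f x + e/3"
      using Rats_dense_in_real[of "f x - e/3" "f x + e/3"] e by auto
    then have qx: "\<bar>f x - q\<bar> < e / 3" by linarith
    obtain d where d: "d > 0" and dd: "\<And>h. 0 < h \<Longrightarrow> h < d \<Longrightarrow>
       norm (integral (cbox x (x + h *\<^sub>R One)) (F q) /\<^sub>R h ^ DIM('a) - F q x) < e/3"
    proof -
      have "x \<notin> N q" "0 < e / 3" using x q(1) e by auto
      from D[OF this] show ?thesis using that by blast
    qed
    have "(\<integral>z. indicator (cbox x (x + h *\<^sub>R One)) z * \<bar>f z - f x\<bar> \<partial>lebesgue) \<le> e * h ^ DIM('a)"
      if h: "0 < h \<and> h < d" for h
    proof -
      let ?Q = "cbox x (x + h *\<^sub>R One)"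
      have hp: "h ^ DIM('a) > 0" using h by simp
      have mQ: "measure lebesgue ?Q = h ^ DIM('a)" using h by (intro measure_cube) auto
      have "integral ?Q (F q) / h ^ DIM('a) - F q x < e/3"
      proof -
        have "norm (integral ?Q (F q) /\<^sub>R h ^ DIM('a) - F q x) < e/3" using dd[of h] h by blast
        then have "\<bar>integral ?Q (F q) / h ^ DIM('a) - F q x\<bar> < e/3"
          unfolding real_norm_def real_scaleR_def divide_inverse_commute[of _ "h ^ DIM('a)"] .
        then show ?thesis by linarith
      qed
      then have "integral ?Q (F q) / h ^ DIM('a) < 2 * e/3"
        using qx by (simp add: F_def)
      then have I: "integral ?Q (F q) < 2 * e/3 * h ^ DIM('a)"
        using hp by (simp add: divide_less_eq)
      have eqI: "(\<integral>z. indicator ?Q z * F q z \<partial>lebesgue) = integral ?Q (F q)"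
        using set_lebesgue_integral_eq_integral(2)[OF si] by (simp add: set_lebesgue_integral_def)
      have ii: "integrable lebesgue (\<lambda>z. indicator ?Q z * F q z)"
        using integrable_cbox_diff[OF int] by (simp add: F_def)
      have "integrable lebesgue (indicator ?Q :: 'a \<Rightarrow> real)"
        using lmeasurable_cbox by (intro integrable_real_indicator) (auto simp: fmeasurable_def)
      from integrable_mult_left[OF this, of "e/3"]
      have i3: "integrable lebesgue (\<lambda>z. indicator ?Q z * (e/3))" .
      have i4: "(\<integral>z. indicator ?Q z * (e/3) \<partial>lebesgue) = h ^ DIM('a) * (e/3)"
        by (simp add: mQ)
      have "(\<integral>z. indicator ?Q z * \<bar>f z - f x\<bar> \<partial>lebesgue) \<le> (\<integral>z. indicator ?Q z * F q z + indicator ?Q z * (e/3) \<partial>lebesgue)"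
      proof (rule integral_mono)
        show "integrable lebesgue (\<lambda>z. indicator ?Q z * \<bar>f z - f x\<bar>)" by (rule integrable_cbox_diff[OF int])
        show "integrable lebesgue (\<lambda>z. indicator ?Q z * F q z + indicator ?Q z * (e/3))" by (rule Bochner_Integration.integrable_add[OF ii i3])
        show "indicator ?Q z * \<bar>f z - f x\<bar> \<le> indicator ?Q z * F q z + indicator ?Q z * (e/3)" for z
        proof -
          have "\<bar>f z - f x\<bar> \<le> F q z + e/3" using qx unfolding F_def by linarith
          then show ?thesis by (cases "z \<in> ?Q") auto
        qed
      qed
      also have "\<dots> = integral ?Q (F q) + h ^ DIM('a) * (e/3)"
        by (simp only: Bochner_Integration.integral_add[OF ii i3] eqI i4)
      also have "\<dots> \<le> e * h ^ DIM('a)" using I by (simp add: field_simps)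
      finally show ?thesis .
    qed
    then show "\<exists>d>0. \<forall>h. 0 < h \<and> h < d \<longrightarrow>
      (\<integral>z. indicator (cbox x (x + h *\<^sub>R One)) z * \<bar>f z - f x\<bar> \<partial>lebesgue) \<le> e * h ^ DIM('a)"
      using d by blast
  qed
  ultimately show ?thesis
    unfolding negligible_iff_null_sets by (intro AE_I'[of "\<Union>q\<in>\<rat>. N q"]) blast+
qed

lemma AE_leb_pt_sqi:
  fixes f :: "'a::euclidean_space \<Rightarrow> real"
  assumes "sqi f"
  shows "AE x in lebesgue. leb_pt f x"
  using sqi_set_integrable(2)[OF assms] by (intro AE_leb_pt) auto

text \<open>The cube has side 3 to leave room for translating \<open>std_kernel\<close> by vectors
  with coordinates at most 1 in modulus. Neither sign nor mass is prescribed, so that the moment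
  kernels \<open>mker\<close> fit as well.\<close>

definition kernel :: "real \<Rightarrow> ('a::euclidean_space \<Rightarrow> real) \<Rightarrow> bool" where
  "kernel B \<zeta> \<longleftrightarrow> smooth_fun \<zeta> \<and> (\<forall>z. \<bar>\<zeta> z\<bar> \<le> B) \<and> (\<forall>z. z \<notin> cbox 0 (3 *\<^sub>R One) \<longrightarrow> \<zeta> z = 0)"

text \<open>With z = x + t w this is the average of f (x + t w) against \<zeta> w: the mollification
  of f at scale t by the reflected kernel.\<close>

definition mol :: "('a::euclidean_space \<Rightarrow> real) \<Rightarrow> ('a \<Rightarrow> real) \<Rightarrow> 'a \<Rightarrow> real \<Rightarrow> real" where
  "mol \<zeta> f x t = (\<integral>z. f z * (\<zeta> ((1/t) *\<^sub>R (z - x)) / t ^ DIM('a)) \<partial>lebesgue)"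

lemma kernel_test_fun: "kernel B \<zeta> \<Longrightarrow> test_fun UNIV \<zeta>"
  unfolding kernel_def by (rule test_funI[of _ "cbox 0 (3 *\<^sub>R One)"]) auto

lemma kernel_measurable: "kernel B \<zeta> \<Longrightarrow> \<zeta> \<in> borel_measurable lebesgue"
  using sqi_test_fun(1)[OF kernel_test_fun] sqi_measurable by blast

lemma kernel_scaled_eq_0:
  fixes z x :: "'a::euclidean_space"
  assumes k: "kernel B \<zeta>" and t: "t > 0" and z: "z \<notin> cbox x (x + (3 * t) *\<^sub>R One)"
  shows "\<zeta> ((1/t) *\<^sub>R (z - x)) = 0"
proof -
  have "(1/t) *\<^sub>R (z - x) \<notin> cbox 0 (3 *\<^sub>R One)"
  proof
    assume a: "(1/t) *\<^sub>R (z - x) \<in> cbox 0 (3 *\<^sub>R One)"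
    have "x \<bullet> i \<le> z \<bullet> i \<and> z \<bullet> i \<le> x \<bullet> i + 3 * t" if i: "i \<in> Basis" for i
    proof -
      have "0 \<le> (1/t) * (z \<bullet> i - x \<bullet> i) \<and> (1/t) * (z \<bullet> i - x \<bullet> i) \<le> 3"
        using a i by (auto simp: mem_box inner_diff_left)
      then show ?thesis using t by (auto simp: field_simps)
    qed
    then show False using z by (auto simp: mem_box inner_add_left)
  qed
  then show ?thesis using k by (simp add: kernel_def)
qed

lemma kernel_scaled_test_fun:
  fixes x :: "'a::euclidean_space"
  assumes k: "kernel B \<zeta>" and t: "t > 0" and U: "cbox x (x + (3 * t) *\<^sub>R One) \<subseteq> U"
  shows "test_fun U (\<lambda>z. \<zeta> ((1/t) *\<^sub>R (z - x)) / t ^ DIM('a))"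
proof (rule test_funI[OF _ _ U])
  have "smooth_fun (\<lambda>z. (1 / t ^ DIM('a)) * \<zeta> ((1/t) *\<^sub>R z + (- (1/t) *\<^sub>R x)))"
    using k by (intro smooth_fun_mult smooth_fun_const smooth_fun_affine) (simp add: kernel_def)
  then show "smooth_fun (\<lambda>z. \<zeta> ((1/t) *\<^sub>R (z - x)) / t ^ DIM('a))"
    by (simp add: scaleR_diff_right)
qed (use kernel_scaled_eq_0[OF k t] in auto)

lemma kernel_scaled_integral:
  fixes x :: "'a::euclidean_space"
  assumes k: "kernel B \<zeta>" and t: "t > 0"
  shows "(\<integral>z. \<zeta> ((1/t) *\<^sub>R (z - x)) / t ^ DIM('a) \<partial>lebesgue) = (\<integral>z. \<zeta> z \<partial>lebesgue)"
proof -
  have "(\<integral>z. \<zeta> ((1/t) *\<^sub>R (z - x)) \<partial>lebesgue) = (\<integral>z. \<zeta> ((- (1/t) *\<^sub>R x) + (1/t) *\<^sub>R z) \<partial>lebesgue)"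
    by (simp add: algebra_simps)
  also have "\<dots> = t ^ DIM('a) * (\<integral>z. \<zeta> z \<partial>lebesgue)"
    using t by (subst integral_lebesgue_affine[OF _ kernel_measurable[OF k]]) (auto simp: power_one_over)
  finally show ?thesis using t by simp
qed

text \<open>The scaled kernel is at most B / t^n and lives in a cube of side 3 t at x. Replacing f z
  by f x therefore costs at most B 3^n times the mean oscillation of f over that cube.\<close>

lemma mol_tendsto:
  fixes x :: "'a::euclidean_space"
  assumes k: "kernel B \<zeta>" and f: "sqi f" and x: "leb_pt f x"
  shows "(mol \<zeta> f x \<longlongrightarrow> f x * (\<integral>z. \<zeta> z \<partial>lebesgue)) (at_right 0)"
proof (rule tendstoI)
  fix e :: real assume e: "e > 0"
  have B: "B \<ge> 0" using k unfolding kernel_def by (meson abs_ge_zero order_trans)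
  \<comment> \<open>The power of 3 is the volume of the cube relative to t^n; B + 1 in place of B
    guards against B = 0.\<close>
  define e' where "e' = e / (2 * (B + 1) * 3 ^ DIM('a))"
  have e': "e' > 0" using e B by (simp add: e'_def)
  obtain d where d: "d > 0" and dd: "\<And>h. 0 < h \<Longrightarrow> h < d \<Longrightarrow>
     (\<integral>z. indicator (cbox x (x + h *\<^sub>R One)) z * \<bar>f z - f x\<bar> \<partial>lebesgue) \<le> e' * h ^ DIM('a)"
    using x e' unfolding leb_pt_def by meson
  have "dist (mol \<zeta> f x t) (f x * (\<integral>z. \<zeta> z \<partial>lebesgue)) < e" if t: "0 < t" "t < d / 3" for t
  proof -
    let ?Q = "cbox x (x + (3 * t) *\<^sub>R One)"
    let ?k = "\<lambda>z. \<zeta> ((1/t) *\<^sub>R (z - x)) / t ^ DIM('a)"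
    have tp: "t ^ DIM('a) > 0" using t by simp
    have k2: "sqi ?k" using kernel_scaled_test_fun[OF k t(1), of x UNIV] by (intro sqi_test_fun) auto
    have i1: "integrable lebesgue (\<lambda>z. f z * ?k z)" by (rule sqi_mult_integrable[OF f k2])
    have i2: "integrable lebesgue ?k"
    proof -
      have "integrable lebesgue (\<lambda>z. indicator ?Q z * ?k z)"
        by (rule sqi_mult_integrable[OF sqi_indicator(1) k2]) simp
      moreover have "(\<lambda>z. indicator ?Q z * ?k z) = ?k"
        by (auto simp: fun_eq_iff indicator_def kernel_scaled_eq_0[OF k t(1)])
      ultimately show ?thesis by metis
    qed
    have int: "integrable lebesgue (\<lambda>z. indicator ?Q z * \<bar>f z - f x\<bar>)"
      using sqi_set_integrable(2)[OF f, of ?Q] by (intro integrable_cbox_diff) auto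
    have i3: "integrable lebesgue (\<lambda>z. f x * ?k z)" by (rule integrable_mult_right[OF i2])
    have "(\<integral>z. f x * ?k z \<partial>lebesgue) = f x * (\<integral>z. \<zeta> z \<partial>lebesgue)"
      by (simp only: integral_mult_right_zero kernel_scaled_integral[OF k t(1)])
    then have "mol \<zeta> f x t - f x * (\<integral>z. \<zeta> z \<partial>lebesgue) = (\<integral>z. f z * ?k z - f x * ?k z \<partial>lebesgue)"
      unfolding Bochner_Integration.integral_diff[OF i1 i3] mol_def by simp
    also have "\<bar>\<dots>\<bar> \<le> (\<integral>z. (B / t ^ DIM('a)) * (indicator ?Q z * \<bar>f z - f x\<bar>) \<partial>lebesgue)"
    proof (rule integral_abs_bound[THEN order_trans], rule integral_mono)
      show "\<bar>f z * ?k z - f x * ?k z\<bar> \<le> (B / t ^ DIM('a)) * (indicator ?Q z * \<bar>f z - f x\<bar>)" for z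
      proof (cases "z \<in> ?Q")
        case True
        have "\<bar>?k z\<bar> \<le> B / t ^ DIM('a)"
          using k tp by (auto simp: kernel_def intro!: divide_right_mono)
        then have "\<bar>f z - f x\<bar> * \<bar>?k z\<bar> \<le> \<bar>f z - f x\<bar> * (B / t ^ DIM('a))"
          by (intro mult_left_mono) auto
        moreover have "\<bar>f z * ?k z - f x * ?k z\<bar> = \<bar>f z - f x\<bar> * \<bar>?k z\<bar>"
          by (simp only: left_diff_distrib[symmetric] abs_mult)
        ultimately show ?thesis using True by (simp add: mult.commute)
      next
        case False
        then show ?thesis by (simp add: kernel_scaled_eq_0[OF k t(1)])
      qed
    qed (intro integrable_abs Bochner_Integration.integrable_diff i1 i3 integrable_mult_right int)+
    also have "\<dots> = B / t ^ DIM('a) * (\<integral>z. indicator ?Q z * \<bar>f z - f x\<bar> \<partial>lebesgue)" by simp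
    also have "\<dots> \<le> B / t ^ DIM('a) * (e' * (3 * t) ^ DIM('a))"
      using dd[of "3 * t"] t B by (intro mult_left_mono) auto
    also have "\<dots> = B * e' * 3 ^ DIM('a)" using t by (simp add: power_mult_distrib)
    also have "\<dots> = e / 2 * (B / (B + 1))" unfolding e'_def by simp
    also have "\<dots> \<le> e / 2 * 1" using B e by (intro mult_left_mono) auto
    also have "\<dots> < e" using e by simp
    finally show ?thesis by (simp add: dist_real_def)
  qed
  then show "\<forall>\<^sub>F t in at_right 0. dist (mol \<zeta> f x t) (f x * (\<integral>z. \<zeta> z \<partial>lebesgue)) < e"
    using d by (auto simp: eventually_at_right_field intro!: exI[of _ "d/3"])
qed

text \<open>A bump of radius 1/2 around (3/2, ..., 3/2), hence inside [1,2]^n, the middle of the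
  cube allowed by \<open>kernel\<close>.\<close>

definition std_kernel :: "'a::euclidean_space \<Rightarrow> real" where
  "std_kernel z = bump (2 *\<^sub>R z + (-3) *\<^sub>R One)"

lemma kernel_shift:
  fixes v :: "'a::euclidean_space"
  assumes v: "\<And>i. i \<in> Basis \<Longrightarrow> \<bar>v \<bullet> i\<bar> \<le> 1"
  shows "kernel 1 (\<lambda>z. std_kernel (z - v))"
  unfolding kernel_def
proof (intro conjI allI impI)
  have "smooth_fun (\<lambda>z. bump (2 *\<^sub>R z + (- 2 *\<^sub>R v + (-3) *\<^sub>R One)))"
    by (rule smooth_fun_affine[OF smooth_fun_bump])
  then show "smooth_fun (\<lambda>z. std_kernel (z - v))"
    by (simp add: std_kernel_def algebra_simps)
  show "\<bar>std_kernel (z - v)\<bar> \<le> 1" for z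
    using bump_nonneg[of "2 *\<^sub>R (z - v) + (-3) *\<^sub>R One"] bump_le_1[of "2 *\<^sub>R (z - v) + (-3) *\<^sub>R One"] by (simp add: std_kernel_def)
  show "std_kernel (z - v) = 0" if z: "z \<notin> cbox 0 (3 *\<^sub>R One)" for z
    unfolding std_kernel_def
  proof (rule bump_eq_0, rule ccontr)
    assume a: "\<not> 1 \<le> norm (2 *\<^sub>R (z - v) + - 3 *\<^sub>R One)"
    have "0 \<le> z \<bullet> i \<and> z \<bullet> i \<le> 3" if i: "i \<in> Basis" for i
    proof -
      have "\<bar>(2 *\<^sub>R (z - v) + - 3 *\<^sub>R One) \<bullet> i\<bar> < 1"
        using a Basis_le_norm[OF i, of "2 *\<^sub>R (z - v) + - 3 *\<^sub>R One"] by simp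
      then have "\<bar>2 * (z \<bullet> i - v \<bullet> i) - 3\<bar> < 1" using i by (simp add: inner_simps)
      then show ?thesis using v[OF i] by auto
    qed
    then show False using z by (auto simp: mem_box)
  qed
qed

lemma kernel_std: "kernel 1 std_kernel"
  using kernel_shift[of 0] by simp

lemma std_kernel_nonneg: "std_kernel z \<ge> 0"
  by (simp add: std_kernel_def bump_nonneg)

lemma kernel_integrable: "kernel B \<zeta> \<Longrightarrow> integrable lebesgue \<zeta>"
proof -
  assume k: "kernel B \<zeta>"
  have "integrable lebesgue (\<lambda>z. indicator (cbox 0 (3 *\<^sub>R One)) z * \<zeta> z)"
    by (rule sqi_mult_integrable[OF sqi_indicator(1) sqi_test_fun(1)[OF kernel_test_fun[OF k]]]) simp
  moreover have "(\<lambda>z. indicator (cbox 0 (3 *\<^sub>R One)) z * \<zeta> z) = \<zeta>"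
    using k by (auto simp: fun_eq_iff indicator_def kernel_def)
  ultimately show ?thesis by metis
qed

text \<open>The bump is left unnormalised, so its mass appears as a factor in the pointwise
  estimates. As for all later dimensional constants, the \<open>itself\<close> argument expresses
  dependence on the space alone.\<close>

definition ker_mass :: "'a::euclidean_space itself \<Rightarrow> real" where
  "ker_mass _ = (\<integral>z. std_kernel (z::'a) \<partial>lebesgue)"

lemma ker_mass_pos: "ker_mass TYPE('a::euclidean_space) > 0"
proof -
  have "(\<integral>z. std_kernel (z::'a) \<partial>lebesgue) \<ge> 0" by (intro Bochner_Integration.integral_nonneg) (simp add: std_kernel_nonneg)
  moreover have "(\<integral>z. std_kernel (z::'a) \<partial>lebesgue) \<noteq> 0"
  proof
    assume "(\<integral>z. std_kernel (z::'a) \<partial>lebesgue) = 0"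
    then have "AE z in lebesgue. std_kernel (z::'a) = 0"
      by (subst (asm) integral_nonneg_eq_0_iff_AE) (auto simp: std_kernel_nonneg kernel_integrable[OF kernel_std])
    then have "AE z in lebesgue. z \<notin> ball ((3/2) *\<^sub>R One :: 'a) (1/2)"
    proof eventually_elim
      fix z :: 'a assume z: "std_kernel z = 0"
      show "z \<notin> ball ((3/2) *\<^sub>R One) (1/2)"
      proof
        assume "z \<in> ball ((3/2) *\<^sub>R One) (1/2)"
        then have "norm (z - (3/2) *\<^sub>R One) < 1/2" by (simp add: dist_norm norm_minus_commute)
        moreover have "2 *\<^sub>R z + (-3) *\<^sub>R One = 2 *\<^sub>R (z - (3/2) *\<^sub>R One)" by (simp add: algebra_simps)
        ultimately have "norm (2 *\<^sub>R z + (-3) *\<^sub>R One) < 1" by simp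
        from bump_pos[OF this] z show False by (simp add: std_kernel_def)
      qed
    qed
    then have "emeasure lebesgue (ball ((3/2) *\<^sub>R One :: 'a) (1/2)) = 0"
      by (subst (asm) AE_iff_measurable[of "ball ((3/2) *\<^sub>R One :: 'a) (1/2)"]) auto
    then show False
      using unit_ball_vol_pos[of "real DIM('a)"] by (simp add: emeasure_ball)
  qed
  ultimately show ?thesis by (simp add: ker_mass_def)
qed

lemma kernel_shift_mass: "(\<integral>z. std_kernel (z - v) \<partial>lebesgue) = ker_mass TYPE('a)" for v :: "'a::euclidean_space"
  using integral_lebesgue_affine[of 1 std_kernel "- v"] kernel_measurable[OF kernel_std] by (simp add: ker_mass_def)

text \<open>The scaled kernels are admissible nonnegative test functions once their cube lies in U.
  At a Lebesgue point, letting the scale tend to 0 turns the integral inequality into the pointwise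
  one, multiplied by \<open>ker_mass\<close>.\<close>

lemma AE_le_if_test_le:
  fixes q :: "'a::euclidean_space \<Rightarrow> real"
  assumes q: "sqi q" and U: "open U"
    and le: "\<And>\<phi>. test_fun U \<phi> \<Longrightarrow> (\<And>x. \<phi> x \<ge> 0) \<Longrightarrow> (\<integral>x. q x * \<phi> x \<partial>lebesgue) \<le> L * (\<integral>x. \<phi> x \<partial>lebesgue)"
  shows "AE x in lebesgue. x \<in> U \<longrightarrow> q x \<le> L"
  using AE_leb_pt_sqi[OF q]
proof eventually_elim
  fix x assume x: "leb_pt q x"
  show "x \<in> U \<longrightarrow> q x \<le> L"
  proof
    assume "x \<in> U"
    then obtain e where e: "e > 0" "ball x e \<subseteq> U" using U openE by blast
    have sub: "cbox x (x + (3 * t) *\<^sub>R One) \<subseteq> U" if t: "0 < t" "t < e / (3 * DIM('a))" for t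
    proof (rule order_trans[OF _ e(2)], rule subsetI)
      fix z assume z: "z \<in> cbox x (x + (3 * t) *\<^sub>R One)"
      have "norm (z - x) \<le> (\<Sum>i\<in>Basis. \<bar>(z - x) \<bullet> i\<bar>)" by (rule norm_le_l1)
      also have "\<dots> \<le> (\<Sum>i\<in>(Basis::'a set). 3 * t)"
        using z t by (intro sum_mono) (auto simp: mem_box inner_simps)
      also have "\<dots> = DIM('a) * (3 * t)" by simp
      also have "\<dots> < e" using t by (simp add: field_simps)
      finally show "z \<in> ball x e" by (simp add: dist_norm norm_minus_commute)
    qed
    have "q x * ker_mass TYPE('a) \<le> L * ker_mass TYPE('a)"
    proof (rule tendsto_upperbound)
      show "(mol std_kernel q x \<longlongrightarrow> q x * ker_mass TYPE('a)) (at_right 0)"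
        using mol_tendsto[OF kernel_std q x] by (simp add: ker_mass_def)
      have "mol std_kernel q x t \<le> L * ker_mass TYPE('a)" if t: "0 < t" "t < e / (3 * DIM('a))" for t
      proof -
        have "mol std_kernel q x t \<le> L * (\<integral>z. std_kernel ((1/t) *\<^sub>R (z - x)) / t ^ DIM('a) \<partial>lebesgue)"
          unfolding mol_def
          by (rule le[OF kernel_scaled_test_fun[OF kernel_std t(1) sub[OF t]]]) (use t in \<open>simp add: std_kernel_nonneg\<close>)
        then show ?thesis by (simp only: kernel_scaled_integral[OF kernel_std t(1)] ker_mass_def)
      qed
      then show "\<forall>\<^sub>F t in at_right 0. mol std_kernel q x t \<le> L * ker_mass TYPE('a)"
        using e by (auto simp: eventually_at_right_field intro!: exI[of _ "e / (3 * DIM('a))"])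
    qed simp
    then show "q x \<le> L" using ker_mass_pos[where 'a='a] by simp
  qed
qed

lemma AE_0_if_test_0:
  fixes q :: "'a::euclidean_space \<Rightarrow> real"
  assumes q: "sqi q" and U: "open U"
    and z: "\<And>\<phi>. test_fun U \<phi> \<Longrightarrow> (\<integral>x. q x * \<phi> x \<partial>lebesgue) = 0"
  shows "AE x in lebesgue. x \<in> U \<longrightarrow> q x = 0"
proof -
  have "AE x in lebesgue. x \<in> U \<longrightarrow> q x \<le> 0"
    by (rule AE_le_if_test_le[OF q U]) (simp add: z)
  moreover have "AE x in lebesgue. x \<in> U \<longrightarrow> - q x \<le> 0"
    using sqi_cmult[OF q, of "-1"] by (intro AE_le_if_test_le[OF _ U]) (simp_all add: z)
  ultimately show ?thesis by eventually_elim auto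
qed

text \<open>Multiplication by the indicator of U makes both fields square integrable on the whole
  space; the fundamental lemma \<open>AE_0_if_test_0\<close> then applies to each coordinate of
  their difference.\<close>

lemma weak_gradient_unique:
  fixes g1 g2 :: "'a::euclidean_space \<Rightarrow> 'a"
  assumes U: "open U" and g1: "has_weak_gradient U u g1" and g2: "has_weak_gradient U u g2"
  shows "AE x in lebesgue. x \<in> U \<longrightarrow> g1 x = g2 x"
proof -
  have sq: "sqi (\<lambda>x. indicator U x *\<^sub>R g x)" if "has_weak_gradient U u g" for g :: "'a \<Rightarrow> 'a"
  proof -
    have "(\<integral>\<^sup>+x. ennreal ((norm (indicator U x *\<^sub>R g x))\<^sup>2) \<partial>lebesgue) = (\<integral>\<^sup>+x\<in>U. ennreal ((norm (g x))\<^sup>2) \<partial>lebesgue)"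
      by (intro nn_integral_cong) (auto simp: indicator_def)
    moreover have "(\<integral>\<^sup>+x\<in>U. ennreal ((norm (g x))\<^sup>2) \<partial>lebesgue) < \<infinity>"
      "(\<lambda>x. indicator U x *\<^sub>R g x) \<in> borel_measurable lebesgue"
      using that unfolding has_weak_gradient_def set_borel_measurable_def by blast+
    ultimately show ?thesis unfolding sqi_iff by (simp only: simp_thms)
  qed
  have "AE x in lebesgue. x \<in> U \<longrightarrow> (indicator U x *\<^sub>R g1 x) \<bullet> i - (indicator U x *\<^sub>R g2 x) \<bullet> i = 0" if i: "i \<in> Basis" for i
  proof (rule AE_0_if_test_0[OF sqi_diff(1)[OF sqi_inner[OF sq[OF g1]] sqi_inner[OF sq[OF g2]]] U])
    fix \<phi> assume t: "test_fun U \<phi>"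
    have eq: "(LINT x:U|lebesgue. (g x \<bullet> i) * \<phi> x) = (\<integral>x. ((indicator U x *\<^sub>R g x) \<bullet> i) * \<phi> x \<partial>lebesgue)" for g :: "'a \<Rightarrow> 'a"
      unfolding set_lebesgue_integral_def by (simp add: mult.assoc)
    have "(LINT x:U|lebesgue. (g1 x \<bullet> i) * \<phi> x) = (LINT x:U|lebesgue. (g2 x \<bullet> i) * \<phi> x)"
    proof -
      have "- (LINT x:U|lebesgue. (g x \<bullet> i) * \<phi> x) = (LINT x:U|lebesgue. u x * frechet_derivative \<phi> (at x) i)"
        if "has_weak_gradient U u g" for g
        using that[unfolded has_weak_gradient_def] t i by (metis (no_types, lifting) minus_minus)
      from this[OF g1] this[OF g2] show ?thesis by simp
    qed
    then show "(\<integral>x. ((indicator U x *\<^sub>R g1 x) \<bullet> i - (indicator U x *\<^sub>R g2 x) \<bullet> i) * \<phi> x \<partial>lebesgue) = 0"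
      unfolding eq left_diff_distrib
        Bochner_Integration.integral_diff[OF sqi_mult_integrable[OF sqi_inner[OF sq[OF g1]] sqi_test_fun(1)[OF t]]
          sqi_mult_integrable[OF sqi_inner[OF sq[OF g2]] sqi_test_fun(1)[OF t]]]
      by simp
  qed
  then have "AE x in lebesgue. \<forall>i\<in>Basis. x \<in> U \<longrightarrow> (indicator U x *\<^sub>R g1 x) \<bullet> i - (indicator U x *\<^sub>R g2 x) \<bullet> i = 0"
    by (intro AE_finite_allI) auto
  then show ?thesis
  proof eventually_elim
    fix x assume a: "\<forall>i\<in>Basis. x \<in> U \<longrightarrow> (indicator U x *\<^sub>R g1 x) \<bullet> i - (indicator U x *\<^sub>R g2 x) \<bullet> i = 0"
    show "x \<in> U \<longrightarrow> g1 x = g2 x"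
    proof
      assume x: "x \<in> U"
      show "g1 x = g2 x"
        by (rule euclidean_eqI) (use a x in simp)
    qed
  qed
qed

section \<open>The maximal function\<close>

text \<open>The centred maximal function, normalised by r^n instead of the volume of the ball; this
  is why \<open>ubv\<close> enters its constants. Values in \<open>ennreal\<close> make it defined
  for every h.\<close>

definition Mx :: "('a::euclidean_space \<Rightarrow> ennreal) \<Rightarrow> 'a \<Rightarrow> ennreal" where
  "Mx h x = (SUP r\<in>{0<..}. (\<integral>\<^sup>+z\<in>ball x r. h z \<partial>lebesgue) * ennreal (1 / r ^ DIM('a)))"

lemma ennreal_less_mult_inverse_iff:
  assumes "c > 0" "t \<ge> 0"
  shows "ennreal t < a * ennreal (1 / c) \<longleftrightarrow> ennreal (t * c) < a"
proof (cases a)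
  case (real r)
  then have "a * ennreal (1 / c) = ennreal (r / c)"
    using assms by (simp add: ennreal_mult[symmetric])
  then show ?thesis
    using assms real by (simp add: ennreal_less_iff less_divide_eq)
next
  case top
  then show ?thesis using assms by (simp add: ennreal_top_mult)
qed

lemma less_Mx_iff:
  assumes "t \<ge> 0"
  shows "ennreal t < Mx h (x::'a::euclidean_space) \<longleftrightarrow> (\<exists>r>0. ennreal (t * r ^ DIM('a)) < (\<integral>\<^sup>+z\<in>ball x r. h z \<partial>lebesgue))"
  unfolding Mx_def less_SUP_iff using assms by (auto simp: ennreal_less_mult_inverse_iff)

lemma Mx_ge:
  fixes x :: "'a::euclidean_space"
  assumes "r > 0"
  shows "(\<integral>\<^sup>+z\<in>ball x r. h z \<partial>lebesgue) \<le> Mx h x * ennreal (r ^ DIM('a))"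
proof -
  have "(\<integral>\<^sup>+z\<in>ball x r. h z \<partial>lebesgue) * ennreal (1 / r ^ DIM('a)) \<le> Mx h x"
    unfolding Mx_def using assms by (intro SUP_upper) auto
  then have "(\<integral>\<^sup>+z\<in>ball x r. h z \<partial>lebesgue) * ennreal (1 / r ^ DIM('a)) * ennreal (r ^ DIM('a)) \<le> Mx h x * ennreal (r ^ DIM('a))"
    by (rule mult_right_mono) simp
  moreover have "ennreal (1 / r ^ DIM('a)) * ennreal (r ^ DIM('a)) = 1"
    using assms by (simp add: ennreal_mult[symmetric])
  ultimately show ?thesis by (simp add: mult.assoc)
qed

lemma Mx_le:
  fixes x :: "'a::euclidean_space"
  assumes "\<And>r. r > 0 \<Longrightarrow> (\<integral>\<^sup>+z\<in>ball x r. h z \<partial>lebesgue) \<le> m * ennreal (r ^ DIM('a))"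
  shows "Mx h x \<le> m"
  unfolding Mx_def
proof (rule SUP_least)
  fix r :: real assume "r \<in> {0<..}"
  then have r: "r > 0" by simp
  have "(\<integral>\<^sup>+z\<in>ball x r. h z \<partial>lebesgue) * ennreal (1 / r ^ DIM('a)) \<le> m * ennreal (r ^ DIM('a)) * ennreal (1 / r ^ DIM('a))"
    by (rule mult_right_mono[OF assms[OF r]]) simp
  also have "\<dots> = m"
    using r by (simp add: mult.assoc ennreal_mult[symmetric])
  finally show "(\<integral>\<^sup>+z\<in>ball x r. h z \<partial>lebesgue) * ennreal (1 / r ^ DIM('a)) \<le> m" .
qed

text \<open>Lower semicontinuity: a strict inequality at radius r survives with a slightly larger r'
  in the denominator, and \<open>ball y r'\<close> contains \<open>ball x r\<close> for all y within
  r' - r of x.\<close>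

lemma open_Mx_less:
  fixes h :: "'a::euclidean_space \<Rightarrow> ennreal"
  assumes "t \<ge> 0"
  shows "open {x. ennreal t < Mx h x}"
proof (rule openI)
  fix x assume "x \<in> {x. ennreal t < Mx h x}"
  then obtain r where r: "r > 0" "ennreal (t * r ^ DIM('a)) < (\<integral>\<^sup>+z\<in>ball x r. h z \<partial>lebesgue)"
    using assms by (auto simp: less_Mx_iff)
  let ?a = "\<integral>\<^sup>+z\<in>ball x r. h z \<partial>lebesgue"
  have "\<exists>r'>r. ennreal (t * r' ^ DIM('a)) < ?a"
  proof (cases ?a)
    case (real a)
    have ta: "t * r ^ DIM('a) < a" using r real assms by (simp add: ennreal_less_iff)
    have "((\<lambda>s. t * s ^ DIM('a)) \<longlongrightarrow> t * r ^ DIM('a)) (at_right r)"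
      by (intro tendsto_intros)
    from order_tendstoD(2)[OF this ta] obtain b where b: "b > r" "\<And>s. r < s \<Longrightarrow> s < b \<Longrightarrow> t * s ^ DIM('a) < a"
      by (auto simp: eventually_at_right_field)
    have "t * ((r + b) / 2) ^ DIM('a) < a" using b(1) by (intro b(2)) auto
    then show ?thesis
      using b(1) real assms r(1) by (intro exI[of _ "(r + b) / 2"]) (auto simp: ennreal_less_iff)
  next
    case top
    then show ?thesis using r by (intro exI[of _ "r + 1"]) (auto simp: top.not_eq_extremum)
  qed
  then obtain r' where r': "r' > r" "ennreal (t * r' ^ DIM('a)) < ?a" by blast
  have "ball x (r' - r) \<subseteq> {x. ennreal t < Mx h x}"
  proof
    fix y assume y: "y \<in> ball x (r' - r)"
    have "ball x r \<subseteq> ball y r'"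
    proof
      fix z assume "z \<in> ball x r"
      then show "z \<in> ball y r'" using y dist_triangle[of y z x] by (auto simp: dist_commute)
    qed
    then have "?a \<le> (\<integral>\<^sup>+z\<in>ball y r'. h z \<partial>lebesgue)"
      by (intro nn_integral_mono) (auto simp: indicator_def)
    with r' have "ennreal (t * r' ^ DIM('a)) < (\<integral>\<^sup>+z\<in>ball y r'. h z \<partial>lebesgue)" by (rule_tac less_le_trans)
    then show "y \<in> {x. ennreal t < Mx h x}"
      using r r' assms by (auto simp: less_Mx_iff intro!: exI[of _ r'])
  qed
  then show "\<exists>T>0. ball x T \<subseteq> {x. ennreal t < Mx h x}" using r' by (intro exI[of _ "r' - r"]) auto
qed

lemma borel_measurable_Mx: "Mx h \<in> borel_measurable borel"
proof (rule borel_measurableI_greater)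
  fix y :: ennreal
  show "{x \<in> space borel. y < Mx h x} \<in> sets borel"
  proof (cases y)
    case (real r)
    then show ?thesis using open_Mx_less[of r h] by (simp add: borel_open)
  qed simp
qed

lemma borel_measurable_Mx_lebesgue: "Mx h \<in> borel_measurable lebesgue"
  by (rule measurable_completion) (simp add: borel_measurable_Mx)

definition ubv :: "'a::euclidean_space itself \<Rightarrow> real" where
  "ubv _ = unit_ball_vol (real DIM('a))"

lemma ubv_pos: "ubv TYPE('a::euclidean_space) > 0"
  by (simp add: ubv_def unit_ball_vol_pos)

lemma emeasure_ball_ubv: "r \<ge> 0 \<Longrightarrow> emeasure lebesgue (ball (x::'a::euclidean_space) r) = ennreal (ubv TYPE('a) * r ^ DIM('a))"
  by (simp add: ubv_def emeasure_ball)

lemma measure_ball_ubv: "r \<ge> 0 \<Longrightarrow> measure lebesgue (ball (x::'a::euclidean_space) r) = ubv TYPE('a) * r ^ DIM('a)"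
  by (simp add: ubv_def content_ball)

text \<open>The power of 5 is the volume lost in the Vitali covering lemma, where the selected balls
  are enlarged five times.\<close>

definition C1 :: "'a::euclidean_space itself \<Rightarrow> real" where
  "C1 _ = ubv TYPE('a) * 5 ^ DIM('a)"

lemma C1_pos: "C1 TYPE('a::euclidean_space) > 0"
  by (simp add: C1_def ubv_pos)

text \<open>Vitali: among balls on which the mean of h exceeds t, a disjoint subfamily is selected
  whose fivefold enlargements still cover. Each enlargement is paid for by the integral of h over
  its own ball.\<close>

lemma Mx_weak_type:
  fixes h :: "'a::euclidean_space \<Rightarrow> ennreal"
  assumes t: "t > 0" and h[measurable]: "h \<in> borel_measurable lebesgue"
  shows "emeasure lebesgue {x. ennreal t < Mx h x} \<le> ennreal (C1 TYPE('a) / t) * (\<integral>\<^sup>+z. h z \<partial>lebesgue)"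
proof (cases "\<integral>\<^sup>+z. h z \<partial>lebesgue")
  case top
  then show ?thesis using t C1_pos[where 'a='a] by (simp add: ennreal_mult_top)
next
  case (real I)
  let ?S = "{x. ennreal t < Mx h x}"
  have "\<forall>x\<in>?S. \<exists>r. r > 0 \<and> ennreal (t * r ^ DIM('a)) < (\<integral>\<^sup>+z\<in>ball x r. h z \<partial>lebesgue)"
    using t by (auto simp: less_Mx_iff)
  then obtain r where r: "\<And>x. x \<in> ?S \<Longrightarrow> r x > 0"
    "\<And>x. x \<in> ?S \<Longrightarrow> ennreal (t * r x ^ DIM('a)) < (\<integral>\<^sup>+z\<in>ball x (r x). h z \<partial>lebesgue)"
    by (auto simp: bchoice_iff)
  \<comment> \<open>The covering lemma wants bounded radii. Here t r^n < I, the total integral, and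
    r \<le> r^n whenever r \<ge> 1.\<close>
  have bd: "0 < r x \<and> r x \<le> max 1 (I / t)" if x: "x \<in> ?S" for x
  proof -
    have "(\<integral>\<^sup>+z\<in>ball x (r x). h z \<partial>lebesgue) \<le> (\<integral>\<^sup>+z. h z \<partial>lebesgue)"
      by (intro nn_integral_mono) (auto simp: indicator_def)
    then have "ennreal (t * r x ^ DIM('a)) < ennreal I" using r(2)[OF x] real by (metis order_less_le_trans)
    then have "t * r x ^ DIM('a) < I" using r(1)[OF x] t real by (subst (asm) ennreal_less_iff) auto
    then have 1: "r x ^ DIM('a) < I / t" using t by (simp add: field_simps)
    have "r x \<le> r x ^ DIM('a)" if "r x \<ge> 1" using that by (intro self_le_power) auto
    then show ?thesis using r(1)[OF x] 1 by (cases "r x \<ge> 1") auto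
  qed
  obtain D where D: "countable D" "D \<subseteq> ?S"
    and dis: "pairwise (\<lambda>i j. disjnt (ball i (r i)) (ball j (r j))) D"
    and cov: "?S \<subseteq> (\<Union>i\<in>D. ball i (5 * r i))"
  proof (rule Vitali_covering_lemma_balls[where S="?S" and K="?S" and a="\<lambda>x. x" and r=r and B="max 1 (I / t)"])
    show "?S \<subseteq> (\<Union>i\<in>?S. ball i (r i))" using r(1) by force
  qed (use bd in auto)
  \<comment> \<open>The countable family is enumerated by natural numbers, with empty sets at
    indices outside \<open>T\<close>, so that countable additivity along \<open>nat\<close>
    applies.\<close>
  define T where "T = to_nat_on D ` D"
  define e where "e = from_nat_into D"
  have eD: "e n \<in> D" if "n \<in> T" for n using that D(1) by (auto simp: T_def e_def)
  have e_ex: "\<exists>n\<in>T. e n = i" if "i \<in> D" for i using that D(1) by (auto simp: T_def e_def)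
  have e_inj: "m = n" if "m \<in> T" "n \<in> T" "e m = e n" for m n using that D(1) by (auto simp: T_def e_def)
  define A where "A n = (if n \<in> T then ball (e n) (5 * r (e n)) else {})" for n
  define B where "B n = (if n \<in> T then ball (e n) (r (e n)) else {})" for n
  have [measurable]: "A n \<in> sets lebesgue" "B n \<in> sets lebesgue" for n by (auto simp: A_def B_def)
  have disB: "disjoint_family B"
    unfolding disjoint_family_on_def
  proof (intro ballI impI)
    fix m n :: nat assume mn: "m \<noteq> n"
    show "B m \<inter> B n = {}"
    proof (cases "m \<in> T \<and> n \<in> T")
      case True
      then have "e m \<noteq> e n" using e_inj mn by blast
      with True have "disjnt (ball (e m) (r (e m))) (ball (e n) (r (e n)))"
        using pairwiseD[OF dis, of "e m" "e n"] eD by blast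
      then show ?thesis using True by (simp add: B_def disjnt_def)
    qed (auto simp: B_def)
  qed
  have "?S \<subseteq> (\<Union>n. A n)"
  proof
    fix x assume "x \<in> ?S"
    then obtain i where "i \<in> D" "x \<in> ball i (5 * r i)" using cov by blast
    with e_ex[of i] show "x \<in> (\<Union>n. A n)" by (auto simp: A_def)
  qed
  then have "emeasure lebesgue ?S \<le> emeasure lebesgue (\<Union>n. A n)"
    by (intro emeasure_mono) auto
  also have "\<dots> \<le> (\<Sum>n. emeasure lebesgue (A n))"
    by (rule emeasure_subadditive_countably) auto
  also have "\<dots> \<le> (\<Sum>n. ennreal (C1 TYPE('a) / t) * emeasure (density lebesgue h) (B n))"
  proof (rule suminf_le)
    fix n
    show "emeasure lebesgue (A n) \<le> ennreal (C1 TYPE('a) / t) * emeasure (density lebesgue h) (B n)"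
    proof (cases "n \<in> T")
      case True
      let ?i = "e n"
      have i: "?i \<in> ?S" using D(2) eD[OF True] by auto
      have "emeasure lebesgue (ball ?i (5 * r ?i)) = ennreal (ubv TYPE('a) * (5 * r ?i) ^ DIM('a))"
        using r(1)[OF i] by (intro emeasure_ball_ubv) auto
      also have "\<dots> = ennreal (C1 TYPE('a) / t) * ennreal (t * r ?i ^ DIM('a))"
        using t r(1)[OF i] C1_pos[where 'a='a] by (subst ennreal_mult[symmetric]) (auto simp: C1_def power_mult_distrib)
      also have "\<dots> \<le> ennreal (C1 TYPE('a) / t) * (\<integral>\<^sup>+z\<in>ball ?i (r ?i). h z \<partial>lebesgue)"
        using r(2)[OF i] by (intro mult_left_mono) auto
      also have "(\<integral>\<^sup>+z\<in>ball ?i (r ?i). h z \<partial>lebesgue) = emeasure (density lebesgue h) (B n)"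
        using True by (subst emeasure_density) (auto simp: B_def)
      finally show ?thesis using True by (simp add: A_def)
    qed (simp add: A_def)
  qed auto
  also have "\<dots> = ennreal (C1 TYPE('a) / t) * (\<Sum>n. emeasure (density lebesgue h) (B n))"
    by (rule ennreal_suminf_cmult)
  also have "(\<Sum>n. emeasure (density lebesgue h) (B n)) = emeasure (density lebesgue h) (\<Union>n. B n)"
    using disB by (intro suminf_emeasure) auto
  also have "ennreal (C1 TYPE('a) / t) * \<dots> \<le> ennreal (C1 TYPE('a) / t) * emeasure (density lebesgue h) (space lebesgue)"
    by (intro mult_left_mono emeasure_mono) auto
  also have "emeasure (density lebesgue h) (space lebesgue) = (\<integral>\<^sup>+z. h z \<partial>lebesgue)" by (simp add: emeasure_density)
  finally show ?thesis .
qed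

text \<open>The part of h below s contributes at most \<open>ubv\<close> times s to each mean, so a
  value above (1 + \<open>ubv\<close>) s forces the part of h above s to have maximal function
  larger than s. This is the truncation step of Marcinkiewicz interpolation.\<close>

lemma Mx_trunc:
  fixes h :: "'a::euclidean_space \<Rightarrow> ennreal"
  assumes s: "s > 0" and h[measurable]: "h \<in> borel_measurable lebesgue"
  shows "emeasure lebesgue {x. ennreal ((1 + ubv TYPE('a)) * s) < Mx h x}
    \<le> ennreal (C1 TYPE('a) / s) * (\<integral>\<^sup>+z. h z * indicator {z. ennreal s < h z} z \<partial>lebesgue)"
proof -
  let ?w = "ubv TYPE('a)"
  let ?h = "\<lambda>z. h z * indicator {z. ennreal s < h z} z"
  have [measurable]: "{z. ennreal s < h z} \<in> sets lebesgue"
    using measurable_sets[OF h, of "{ennreal s<..}"] by (simp add: vimage_def greaterThan_def)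
  have hm: "?h \<in> borel_measurable lebesgue" by measurable
  have le: "Mx h x \<le> Mx ?h x + ennreal (?w * s)" for x :: 'a
  proof (rule Mx_le)
    fix r :: real assume r: "r > 0"
    have [measurable]: "ball x r \<in> sets lebesgue" by simp
    have eb: "emeasure lebesgue (ball x r) = ennreal (?w * r ^ DIM('a))" using r by (intro emeasure_ball_ubv) auto
    have m1: "(\<lambda>z. ?h z * indicator (ball x r) z) \<in> borel_measurable lebesgue" by measurable
    have m2: "(\<lambda>z. ennreal s * indicator (ball x r) z) \<in> borel_measurable lebesgue" by measurable
    have "(\<integral>\<^sup>+z\<in>ball x r. h z \<partial>lebesgue) \<le> (\<integral>\<^sup>+z. ?h z * indicator (ball x r) z + ennreal s * indicator (ball x r) z \<partial>lebesgue)"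
      by (intro nn_integral_mono) (auto simp: indicator_def not_less)
    also have "\<dots> = (\<integral>\<^sup>+z\<in>ball x r. ?h z \<partial>lebesgue) + ennreal s * emeasure lebesgue (ball x r)"
      unfolding nn_integral_add[OF m1 m2] by (simp only: nn_integral_cmult_indicator \<open>ball x r \<in> sets lebesgue\<close>)
    also have "\<dots> \<le> Mx ?h x * ennreal (r ^ DIM('a)) + ennreal s * ennreal (?w * r ^ DIM('a))"
      unfolding eb by (intro add_mono Mx_ge[OF r, where h="?h"] order_refl)
    also have "\<dots> = (Mx ?h x + ennreal (?w * s)) * ennreal (r ^ DIM('a))"
    proof -
      have "ennreal s * ennreal (?w * r ^ DIM('a)) = ennreal (?w * s) * ennreal (r ^ DIM('a))"
        using s r ubv_pos[where 'a='a] by (simp add: ennreal_mult[symmetric] mult.commute mult.left_commute)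
      then show ?thesis by (simp add: distrib_right)
    qed
    finally show "(\<integral>\<^sup>+z\<in>ball x r. h z \<partial>lebesgue) \<le> (Mx ?h x + ennreal (?w * s)) * ennreal (r ^ DIM('a))" .
  qed
  have sub: "{x. ennreal ((1 + ?w) * s) < Mx h x} \<subseteq> {x. ennreal s < Mx ?h x}"
  proof (safe, rule ccontr)
    fix x assume 1: "ennreal ((1 + ?w) * s) < Mx h x" and "\<not> ennreal s < Mx ?h x"
    then have "Mx ?h x + ennreal (?w * s) \<le> ennreal s + ennreal (?w * s)" by (intro add_mono) auto
    also have "\<dots> = ennreal ((1 + ?w) * s)"
      using s ubv_pos[where 'a='a] by (simp add: ennreal_plus[symmetric] algebra_simps del: ennreal_plus)
    finally show False using 1 le[of x] by simp
  qed
  have "emeasure lebesgue {x. ennreal ((1 + ?w) * s) < Mx h x} \<le> emeasure lebesgue {x. ennreal s < Mx ?h x}"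
    using open_Mx_less[of s ?h] s by (intro emeasure_mono sub) auto
  also have "\<dots> \<le> ennreal (C1 TYPE('a) / s) * (\<integral>\<^sup>+z. ?h z \<partial>lebesgue)"
    by (rule Mx_weak_type[OF s hm])
  finally show ?thesis .
qed

lemma dyadic_sum_le:
  fixes a s :: real
  assumes "s > 0" "a \<ge> 0"
  shows "(\<Sum>j<m. if 2 ^ j * s < a then 2 ^ j * s else 0) \<le> 2 * a"
proof (induction m)
  case 0
  then show ?case using assms by simp
next
  case (Suc m)
  show ?case
  proof (cases "2 ^ m * s < a")
    case True
    have "(\<Sum>j<Suc m. if 2 ^ j * s < a then 2 ^ j * s else 0) \<le> (\<Sum>j<Suc m. 2 ^ j * s)"
      using assms by (intro sum_mono) auto
    also have "\<dots> = (\<Sum>j<Suc m. 2 ^ j) * s" by (simp only: sum_distrib_right)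
    also have "(\<Sum>j<Suc m. (2::real) ^ j) = 2 ^ Suc m - 1" by (subst geometric_sum) auto
    also have "(2 ^ Suc m - 1) * s \<le> 2 * (2 ^ m * s)" using assms by (simp add: algebra_simps)
    finally show ?thesis using True by linarith
  next
    case False
    then show ?thesis using Suc by simp
  qed
qed

lemma dyadic_suminf_le:
  fixes m :: ennreal
  assumes s: "s > 0"
  shows "(\<Sum>j. ennreal (2 ^ j * s) * (m * indicator {z. ennreal (2 ^ j * s) < z} m)) \<le> 2 * m\<^sup>2"
proof (cases m)
  case (real a)
  show ?thesis
  proof (rule suminf_le_const)
    show "summable (\<lambda>j. ennreal (2 ^ j * s) * (m * indicator {z. ennreal (2 ^ j * s) < z} m))" by simp
    fix k
    have "(\<Sum>j<k. ennreal (2 ^ j * s) * (m * indicator {z. ennreal (2 ^ j * s) < z} m))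
      = (\<Sum>j<k. ennreal ((if 2 ^ j * s < a then 2 ^ j * s else 0) * a))"
    proof (rule sum.cong[OF refl])
      fix j
      have "ennreal (2 ^ j * s) < m \<longleftrightarrow> 2 ^ j * s < a" using s real by (simp add: ennreal_less_iff)
      then show "ennreal (2 ^ j * s) * (m * indicator {z. ennreal (2 ^ j * s) < z} m) = ennreal ((if 2 ^ j * s < a then 2 ^ j * s else 0) * a)"
        using s real by (cases "2 ^ j * s < a") (auto simp: ennreal_mult)
    qed
    also have "\<dots> = ennreal ((\<Sum>j<k. if 2 ^ j * s < a then 2 ^ j * s else 0) * a)"
      using s real by (subst sum_ennreal) (auto simp: sum_distrib_right)
    also have "\<dots> \<le> ennreal (2 * a * a)"
      using dyadic_sum_le[OF s, of a k] real by (intro ennreal_leI mult_right_mono) auto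
    also have "\<dots> = 2 * m\<^sup>2" using real by (simp add: power2_eq_square ennreal_mult mult.assoc)
    finally show "(\<Sum>j<k. ennreal (2 ^ j * s) * (m * indicator {z. ennreal (2 ^ j * s) < z} m)) \<le> 2 * m\<^sup>2" .
  qed
qed (simp add: ennreal_mult_top)

text \<open>A discrete layer-cake formula for the square of the maximal function. The truncated weak
  bound is summed over the levels 2^j s; after exchanging sum and integral, the levels below h z
  form a geometric series of sum at most 2 h z.\<close>

lemma Mx_dyadic:
  fixes h :: "'a::euclidean_space \<Rightarrow> ennreal"
  assumes s: "s > 0" and h[measurable]: "h \<in> borel_measurable lebesgue"
  shows "(\<Sum>j. ennreal ((2 ^ j * s)\<^sup>2) * emeasure lebesgue {x. ennreal ((1 + ubv TYPE('a)) * (2 ^ j * s)) < Mx h x})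
    \<le> ennreal (2 * C1 TYPE('a)) * (\<integral>\<^sup>+z. (h z)\<^sup>2 \<partial>lebesgue)"
proof -
  have [measurable]: "{z. ennreal t < h z} \<in> sets lebesgue" for t
    using measurable_sets[OF h, of "{ennreal t<..}"] by (simp add: vimage_def greaterThan_def)
  have "(\<Sum>j. ennreal ((2 ^ j * s)\<^sup>2) * emeasure lebesgue {x. ennreal ((1 + ubv TYPE('a)) * (2 ^ j * s)) < Mx h x})
    \<le> (\<Sum>j. \<integral>\<^sup>+z. ennreal (C1 TYPE('a)) * (ennreal (2 ^ j * s) * (h z * indicator {z. ennreal (2 ^ j * s) < h z} z)) \<partial>lebesgue)"
  proof (rule suminf_le)
    fix j
    let ?t = "2 ^ j * s"
    have t: "?t > 0" using s by simp
    have "ennreal (?t\<^sup>2) * emeasure lebesgue {x. ennreal ((1 + ubv TYPE('a)) * ?t) < Mx h x}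
       \<le> ennreal (?t\<^sup>2) * (ennreal (C1 TYPE('a) / ?t) * (\<integral>\<^sup>+z. h z * indicator {z. ennreal ?t < h z} z \<partial>lebesgue))"
      by (intro mult_left_mono Mx_trunc[OF t h]) simp
    also have "\<dots> = ennreal (C1 TYPE('a)) * (ennreal ?t * (\<integral>\<^sup>+z. h z * indicator {z. ennreal ?t < h z} z \<partial>lebesgue))"
    proof -
      have "?t\<^sup>2 * (C1 TYPE('a) / ?t) = C1 TYPE('a) * ?t" using s by (simp add: power2_eq_square)
      then have "ennreal (?t\<^sup>2) * ennreal (C1 TYPE('a) / ?t) = ennreal (C1 TYPE('a)) * ennreal ?t"
        using t C1_pos[where 'a='a] by (subst (1 2) ennreal_mult[symmetric]) auto
      then show ?thesis by (simp only: mult.assoc[symmetric])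
    qed
    also have "\<dots> = (\<integral>\<^sup>+z. ennreal (C1 TYPE('a)) * (ennreal ?t * (h z * indicator {z. ennreal ?t < h z} z)) \<partial>lebesgue)"
    proof -
      have m1: "(\<lambda>z. h z * indicator {z. ennreal ?t < h z} z) \<in> borel_measurable lebesgue" by measurable
      then have m2: "(\<lambda>z. ennreal ?t * (h z * indicator {z. ennreal ?t < h z} z)) \<in> borel_measurable lebesgue" by measurable
      show ?thesis unfolding nn_integral_cmult[OF m2] nn_integral_cmult[OF m1] ..
    qed
    finally show "ennreal (?t\<^sup>2) * emeasure lebesgue {x. ennreal ((1 + ubv TYPE('a)) * ?t) < Mx h x}
      \<le> (\<integral>\<^sup>+z. ennreal (C1 TYPE('a)) * (ennreal ?t * (h z * indicator {z. ennreal ?t < h z} z)) \<partial>lebesgue)" .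
  qed auto
  also have "\<dots> = (\<integral>\<^sup>+z. (\<Sum>j. ennreal (C1 TYPE('a)) * (ennreal (2 ^ j * s) * (h z * indicator {z. ennreal (2 ^ j * s) < h z} z))) \<partial>lebesgue)"
    by (rule nn_integral_suminf[symmetric]) measurable
  also have "\<dots> \<le> (\<integral>\<^sup>+z. ennreal (C1 TYPE('a)) * (2 * (h z)\<^sup>2) \<partial>lebesgue)"
  proof (rule nn_integral_mono)
    fix z
    have "(\<Sum>j. ennreal (C1 TYPE('a)) * (ennreal (2 ^ j * s) * (h z * indicator {z. ennreal (2 ^ j * s) < h z} z)))
      = ennreal (C1 TYPE('a)) * (\<Sum>j. ennreal (2 ^ j * s) * (h z * indicator {y. ennreal (2 ^ j * s) < y} (h z)))"
      by (simp add: ennreal_suminf_cmult indicator_def)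
    also have "\<dots> \<le> ennreal (C1 TYPE('a)) * (2 * (h z)\<^sup>2)"
      by (intro mult_left_mono dyadic_suminf_le[OF s]) simp
    finally show "(\<Sum>j. ennreal (C1 TYPE('a)) * (ennreal (2 ^ j * s) * (h z * indicator {z. ennreal (2 ^ j * s) < h z} z)))
      \<le> ennreal (C1 TYPE('a)) * (2 * (h z)\<^sup>2)" .
  qed
  also have "\<dots> = ennreal (2 * C1 TYPE('a)) * (\<integral>\<^sup>+z. (h z)\<^sup>2 \<partial>lebesgue)"
  proof -
    have "ennreal (C1 TYPE('a)) * (2 * (h z)\<^sup>2) = ennreal (2 * C1 TYPE('a)) * (h z)\<^sup>2" for z
      using C1_pos[where 'a='a] by (simp add: ennreal_mult mult.commute mult.left_commute)
    then show ?thesis by (simp add: nn_integral_cmult)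
  qed
  finally show ?thesis .
qed

text \<open>The product of 2 \<open>C1\<close> from \<open>Mx_dyadic\<close>, the square of the
  factor 1 + \<open>ubv\<close> by which the levels are rescaled, and the 4 lost by rounding up to
  the next dyadic level.\<close>

definition Cmax :: "'a::euclidean_space itself \<Rightarrow> real" where
  "Cmax _ = 8 * (1 + ubv TYPE('a))\<^sup>2 * C1 TYPE('a)"

lemma Cmax_pos: "Cmax TYPE('a::euclidean_space) > 0"
  using C1_pos[where 'a='a] ubv_pos[where 'a='a] by (simp add: Cmax_def)

lemma Mx_dyadic':
  fixes h :: "'a::euclidean_space \<Rightarrow> ennreal"
  assumes s: "s > 0" and h: "h \<in> borel_measurable lebesgue"
  shows "(\<Sum>j. ennreal (4 * (2 ^ j * s)\<^sup>2) * emeasure lebesgue {x. ennreal (2 ^ j * s) < Mx h x})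
    \<le> ennreal (Cmax TYPE('a)) * (\<integral>\<^sup>+z. (h z)\<^sup>2 \<partial>lebesgue)"
proof -
  let ?w = "1 + ubv TYPE('a)"
  have w: "?w > 0" using ubv_pos[where 'a='a] by simp
  have "(\<Sum>j. ennreal (4 * (2 ^ j * s)\<^sup>2) * emeasure lebesgue {x. ennreal (2 ^ j * s) < Mx h x})
    = (\<Sum>j. ennreal (4 * ?w\<^sup>2) * (ennreal ((2 ^ j * (s / ?w))\<^sup>2) * emeasure lebesgue {x. ennreal (?w * (2 ^ j * (s / ?w))) < Mx h x}))"
  proof (rule suminf_cong)
    fix j
    have 1: "?w * (2 ^ j * (s / ?w)) = 2 ^ j * s" using w by simp
    have "4 * ?w\<^sup>2 * (2 ^ j * (s / ?w))\<^sup>2 = 4 * (?w * (2 ^ j * (s / ?w)))\<^sup>2" by (simp only: power_mult_distrib mult.assoc)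
    then have 2: "4 * ?w\<^sup>2 * (2 ^ j * (s / ?w))\<^sup>2 = 4 * (2 ^ j * s)\<^sup>2" by (simp only: 1)
    have "ennreal (4 * (2 ^ j * s)\<^sup>2) = ennreal (4 * ?w\<^sup>2) * ennreal ((2 ^ j * (s / ?w))\<^sup>2)"
      unfolding 2[symmetric] by (rule ennreal_mult) auto
    then show "ennreal (4 * (2 ^ j * s)\<^sup>2) * emeasure lebesgue {x. ennreal (2 ^ j * s) < Mx h x}
      = ennreal (4 * ?w\<^sup>2) * (ennreal ((2 ^ j * (s / ?w))\<^sup>2) * emeasure lebesgue {x. ennreal (?w * (2 ^ j * (s / ?w))) < Mx h x})"
      by (simp only: 1 mult.assoc)
  qed
  also have "\<dots> = ennreal (4 * ?w\<^sup>2) * (\<Sum>j. ennreal ((2 ^ j * (s / ?w))\<^sup>2) * emeasure lebesgue {x. ennreal (?w * (2 ^ j * (s / ?w))) < Mx h x})"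
    by (rule ennreal_suminf_cmult)
  also have "\<dots> \<le> ennreal (4 * ?w\<^sup>2) * (ennreal (2 * C1 TYPE('a)) * (\<integral>\<^sup>+z. (h z)\<^sup>2 \<partial>lebesgue))"
    using s w by (intro mult_left_mono Mx_dyadic h) auto
  also have "\<dots> = ennreal (Cmax TYPE('a)) * (\<integral>\<^sup>+z. (h z)\<^sup>2 \<partial>lebesgue)"
  proof -
    have "ennreal (4 * ?w\<^sup>2) * ennreal (2 * C1 TYPE('a)) = ennreal (Cmax TYPE('a))"
      using C1_pos[where 'a='a] by (subst ennreal_mult[symmetric]) (auto simp: Cmax_def)
    then show ?thesis by (simp only: mult.assoc[symmetric])
  qed
  finally show ?thesis .
qed

lemma ennreal_le_suminf: "f j \<le> (\<Sum>j. f j)" for f :: "nat \<Rightarrow> ennreal"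
  using sum_le_suminf[of f "{j}"] by simp

text \<open>If m lies between 2^j s and 2^(j+1) s, then m^2 \<le> 4 (2^j s)^2, and this single term
  suffices. For infinite m all terms are present and the sum diverges.\<close>

lemma sq_le_dyadic_suminf:
  fixes m :: ennreal
  assumes s: "s > 0"
  shows "m\<^sup>2 * indicator {z. ennreal s < z} m \<le> (\<Sum>j. ennreal (4 * (2 ^ j * s)\<^sup>2) * indicator {z. ennreal (2 ^ j * s) < z} m)"
    (is "_ \<le> (\<Sum>j. ?f j)")
proof (cases "ennreal s < m")
  case True
  have term_le: "?f j \<le> (\<Sum>j. ?f j)" for j
    by (rule ennreal_le_suminf)
  show ?thesis
  proof (cases m)
    case (real a)
    have sa: "s < a" using True real s by (simp add: ennreal_less_iff)
    obtain k where "a / s < 2 ^ k" using real_arch_pow[of 2 "a / s"] by auto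
    then have ex: "\<exists>k. a \<le> 2 ^ k * s" using s by (intro exI[of _ k]) (auto simp: field_simps)
    define k where "k = (LEAST k. a \<le> 2 ^ k * s)"
    have k: "a \<le> 2 ^ k * s" unfolding k_def by (rule LeastI_ex[OF ex])
    have "k \<noteq> 0" using k sa by (cases k) auto
    then obtain j where j: "k = Suc j" by (cases k) auto
    have j2: "2 ^ j * s < a"
      using not_less_Least[of j "\<lambda>k. a \<le> 2 ^ k * s"] j unfolding k_def by auto
    have "a\<^sup>2 \<le> (2 ^ k * s)\<^sup>2" using k real by (intro power_mono) auto
    also have "\<dots> = 4 * (2 ^ j * s)\<^sup>2" by (simp add: j power_mult_distrib)
    finally have "m\<^sup>2 \<le> ?f j"
      using real j2 s by (simp add: indicator_def ennreal_power ennreal_less_iff)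
    with term_le[of j] True show ?thesis by (auto intro: order_trans)
  next
    case top
    have "(\<Sum>j. ?f j) = top"
    proof (rule ccontr)
      assume "(\<Sum>j. ?f j) \<noteq> top"
      then obtain b where b: "(\<Sum>j. ?f j) = ennreal b" "b \<ge> 0" by (cases "\<Sum>j. ?f j") auto
      obtain k where k: "(b + 1) / s\<^sup>2 < 2 ^ k" using real_arch_pow[of 2 "(b + 1) / s\<^sup>2"] by auto
      then have "b + 1 < 2 ^ k * s\<^sup>2" using s by (simp add: field_simps)
      also have "\<dots> \<le> 4 * (2 ^ k * s)\<^sup>2"
      proof -
        have "(2::real) ^ k * 1 \<le> 2 ^ k * 2 ^ k" by (intro mult_left_mono) auto
        then have "(2::real) ^ k * s\<^sup>2 \<le> (2 ^ k)\<^sup>2 * s\<^sup>2" by (intro mult_right_mono) (auto simp: power2_eq_square)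
        moreover have "0 \<le> ((2::real) ^ k)\<^sup>2 * s\<^sup>2" by simp
        ultimately show ?thesis unfolding power_mult_distrib by linarith
      qed
      finally have "b < 4 * (2 ^ k * s)\<^sup>2" by simp
      moreover have "ennreal (4 * (2 ^ k * s)\<^sup>2) \<le> ennreal b"
        using term_le[of k] top unfolding b(1) by (simp add: indicator_def)
      ultimately show False using b(2) by simp
    qed
    then show ?thesis by simp
  qed
qed simp

text \<open>The dyadic sum sees only values above its lowest level s, but its bound is independent
  of s. Fatou's lemma along s = 1/(k + 1) removes the restriction.\<close>

lemma Mx_strong_type:
  fixes h :: "'a::euclidean_space \<Rightarrow> ennreal"
  assumes h: "h \<in> borel_measurable lebesgue"
  shows "(\<integral>\<^sup>+x. (Mx h x)\<^sup>2 \<partial>lebesgue) \<le> ennreal (Cmax TYPE('a)) * (\<integral>\<^sup>+z. (h z)\<^sup>2 \<partial>lebesgue)"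
proof -
  note [measurable] = borel_measurable_Mx_lebesgue[of h]
  have m[measurable]: "{x. ennreal t < Mx h x} \<in> sets lebesgue" if "t \<ge> 0" for t
    using open_Mx_less[OF that, of h] by auto
  have m': "{x. ennreal (2 ^ j * s) < Mx h x} \<in> sets lebesgue" if "s > 0" for j s
    using that by (intro m) auto
  let ?I = "ennreal (Cmax TYPE('a)) * (\<integral>\<^sup>+z. (h z)\<^sup>2 \<partial>lebesgue)"
  have part: "(\<integral>\<^sup>+x. (Mx h x)\<^sup>2 * indicator {x. ennreal s < Mx h x} x \<partial>lebesgue) \<le> ?I" if s: "s > 0" for s
  proof -
    have "(\<integral>\<^sup>+x. (Mx h x)\<^sup>2 * indicator {x. ennreal s < Mx h x} x \<partial>lebesgue)
       \<le> (\<integral>\<^sup>+x. (\<Sum>j. ennreal (4 * (2 ^ j * s)\<^sup>2) * indicator {x. ennreal (2 ^ j * s) < Mx h x} x) \<partial>lebesgue)"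
    proof (rule nn_integral_mono)
      fix x
      show "(Mx h x)\<^sup>2 * indicator {x. ennreal s < Mx h x} x \<le> (\<Sum>j. ennreal (4 * (2 ^ j * s)\<^sup>2) * indicator {x. ennreal (2 ^ j * s) < Mx h x} x)"
        using sq_le_dyadic_suminf[OF s, of "Mx h x"] by (simp add: indicator_def)
    qed
    also have "\<dots> = (\<Sum>j. \<integral>\<^sup>+x. ennreal (4 * (2 ^ j * s)\<^sup>2) * indicator {x. ennreal (2 ^ j * s) < Mx h x} x \<partial>lebesgue)"
      using m'[OF s] by (intro nn_integral_suminf) auto
    also have "\<dots> = (\<Sum>j. ennreal (4 * (2 ^ j * s)\<^sup>2) * emeasure lebesgue {x. ennreal (2 ^ j * s) < Mx h x})"
      using m'[OF s] by (intro suminf_cong nn_integral_cmult_indicator)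
    also have "\<dots> \<le> ?I" by (rule Mx_dyadic'[OF s h])
    finally show ?thesis .
  qed
  let ?F = "\<lambda>k x. (Mx h x)\<^sup>2 * indicator {x. ennreal (1 / (real k + 1)) < Mx h x} x"
  have "(Mx h x)\<^sup>2 \<le> liminf (\<lambda>k. ?F k x)" for x
  proof (cases "Mx h x = 0")
    case False
    then obtain y where y: "0 < y" "y < Mx h x"
      using dense[of 0 "Mx h x"] by (auto simp: zero_less_iff_neq_zero)
    then obtain e where ye: "y = ennreal e" "e \<ge> 0" by (cases y) auto
    then have e: "e > 0" "ennreal e < Mx h x" using y by auto
    obtain K where K: "1 / (real K + 1) < e"
      using e(1) reals_Archimedean[of e] by (auto simp: inverse_eq_divide add.commute)
    have "?F k x = (Mx h x)\<^sup>2" if "k \<ge> K" for k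
    proof -
      have "1 / (real k + 1) \<le> 1 / (real K + 1)" using that by (intro divide_left_mono) auto
      then have "ennreal (1 / (real k + 1)) \<le> ennreal e" using K by (intro ennreal_leI) linarith
      then show ?thesis using e(2) by (simp add: indicator_def)
    qed
    then have "\<forall>\<^sub>F k in sequentially. (Mx h x)\<^sup>2 \<le> ?F k x"
      unfolding eventually_sequentially by (intro exI[of _ K]) auto
    then show ?thesis by (rule Liminf_bounded)
  qed simp
  then have "(\<integral>\<^sup>+x. (Mx h x)\<^sup>2 \<partial>lebesgue) \<le> (\<integral>\<^sup>+x. liminf (\<lambda>k. ?F k x) \<partial>lebesgue)"
    by (rule nn_integral_mono)
  also have "\<dots> \<le> liminf (\<lambda>k. \<integral>\<^sup>+x. ?F k x \<partial>lebesgue)"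
    by (intro nn_integral_liminf) (auto intro!: borel_measurable_times borel_measurable_indicator m)
  also have "\<dots> \<le> liminf (\<lambda>k. ?I)"
    by (intro Liminf_mono always_eventually allI part) simp
  also have "\<dots> = ?I" by (simp add: Liminf_const)
  finally show ?thesis .
qed

section \<open>The maximal function of a square integrable field\<close>

definition MG :: "('a::euclidean_space \<Rightarrow> 'b::euclidean_space) \<Rightarrow> 'a \<Rightarrow> ennreal" where
  "MG g = Mx (\<lambda>z. ennreal (norm (g z)))"

lemma MG_measurable: "MG g \<in> borel_measurable lebesgue"
  unfolding MG_def by (rule borel_measurable_Mx_lebesgue)

lemma open_MG: "t \<ge> 0 \<Longrightarrow> open {x. ennreal t < MG g x}"
  unfolding MG_def by (rule open_Mx_less)

lemma MG_strong:
  fixes g :: "'a::euclidean_space \<Rightarrow> 'b::euclidean_space"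
  assumes "sqi g"
  shows "(\<integral>\<^sup>+x. (MG g x)\<^sup>2 \<partial>lebesgue) \<le> ennreal (Cmax TYPE('a) * sqn g)"
proof -
  have [measurable]: "g \<in> borel_measurable lebesgue" using assms by (rule sqi_measurable)
  have "(\<integral>\<^sup>+x. (MG g x)\<^sup>2 \<partial>lebesgue) \<le> ennreal (Cmax TYPE('a)) * (\<integral>\<^sup>+x. (ennreal (norm (g x)))\<^sup>2 \<partial>lebesgue)"
    unfolding MG_def by (rule Mx_strong_type) measurable
  also have "(\<integral>\<^sup>+x. (ennreal (norm (g x)))\<^sup>2 \<partial>lebesgue) = ennreal (sqn g)"
    using nn_integral_sqn[OF assms] by (simp add: ennreal_power)
  finally show ?thesis using Cmax_pos[where 'a='a] sqn_nonneg[of g] by (simp add: ennreal_mult)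
qed

text \<open>The weighted measures of the N indices from N to 2 N - 1 add up to at most the strong
  bound, so the smallest is at most 1/N of it. Starting at N keeps all admissible levels at least
  2^N, which the truncation needs far from the support.\<close>

lemma MG_pigeonhole:
  fixes g :: "'a::euclidean_space \<Rightarrow> 'b::euclidean_space"
  assumes g: "sqi g" and N: "N \<ge> 1"
  obtains j where "N \<le> j" "j < 2 * N" "ennreal (4 ^ j) * emeasure lebesgue {x. ennreal (2 ^ j) < MG g x} \<le> ennreal (Cmax TYPE('a) * sqn g / N)"
proof -
  have [measurable]: "g \<in> borel_measurable lebesgue" using g by (rule sqi_measurable)
  define a where "a j = ennreal (4 ^ j) * emeasure lebesgue {x. ennreal (2 ^ j) < MG g x}" for j
  have a4: "ennreal (4 * (2 ^ j * 1)\<^sup>2) * emeasure lebesgue {x. ennreal (2 ^ j * 1) < MG g x} = 4 * a j" for j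
  proof -
    have "(4::real) * (2 ^ j * 1)\<^sup>2 = 4 * 4 ^ j" by (simp add: power_mult_distrib power2_eq_square power_mult[symmetric] flip: power_mult_distrib)
    then show ?thesis unfolding a_def by (simp add: ennreal_mult mult.assoc)
  qed
  have "(\<Sum>j. 4 * a j) \<le> ennreal (Cmax TYPE('a)) * (\<integral>\<^sup>+z. (ennreal (norm (g z)))\<^sup>2 \<partial>lebesgue)"
    unfolding a4[symmetric] unfolding MG_def by (rule Mx_dyadic') auto
  also have "(\<integral>\<^sup>+x. (ennreal (norm (g x)))\<^sup>2 \<partial>lebesgue) = ennreal (sqn g)"
    using nn_integral_sqn[OF g] by (simp add: ennreal_power)
  finally have tot: "(\<Sum>j. 4 * a j) \<le> ennreal (Cmax TYPE('a) * sqn g)"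
    using Cmax_pos[where 'a='a] sqn_nonneg[of g] by (simp add: ennreal_mult)
  have "(\<Sum>j\<in>{N..<2*N}. a j) \<le> (\<Sum>j\<in>{N..<2*N}. 4 * a j)"
  proof (rule sum_mono)
    fix j
    have "1 * a j \<le> 4 * a j" by (intro mult_right_mono) auto
    then show "a j \<le> 4 * a j" by simp
  qed
  also have "\<dots> \<le> (\<Sum>j. 4 * a j)" by (rule sum_le_suminf) auto
  also note tot
  finally have sum: "(\<Sum>j\<in>{N..<2*N}. a j) \<le> ennreal (Cmax TYPE('a) * sqn g)" .
  have "\<exists>j\<in>{N..<2*N}. a j \<le> ennreal (Cmax TYPE('a) * sqn g / N)"
  proof -
    let ?S = "{N..<2*N}" and ?c = "Cmax TYPE('a) * sqn g"
    have "Min (a ` ?S) \<in> a ` ?S" using N by (intro Min_in) auto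
    then obtain j where j: "j \<in> ?S" "a j = Min (a ` ?S)" by (auto simp: image_iff)
    have "(\<Sum>i\<in>?S. a j) \<le> (\<Sum>i\<in>?S. a i)" unfolding j(2) by (intro sum_mono Min_le) auto
    then have le: "of_nat N * a j \<le> ennreal ?c" using sum by simp
    have "a j \<le> ennreal (?c / N)"
    proof (cases "a j")
      case (real b)
      have "ennreal (real N * b) \<le> ennreal ?c" using le real by (simp add: ennreal_mult ennreal_of_nat_eq_real_of_nat)
      moreover have "?c \<ge> 0" using Cmax_pos[where 'a='a] sqn_nonneg[of g] by simp
      ultimately have "real N * b \<le> ?c" by simp
      then have "b \<le> ?c / N" using N by (simp add: field_simps)
      then show ?thesis using real by (simp add: ennreal_leI)
    next
      case top
      then show ?thesis using le N by (simp add: ennreal_mult_top top_unique)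
    qed
    with j(1) show ?thesis by blast
  qed
  then show thesis using that by (auto simp: a_def)
qed

section \<open>Pointwise inequalities for Sobolev functions\<close>

text \<open>Both k - F and k + F are nondecreasing; this yields the integrated estimate without
  integrating \<open>F'\<close>.\<close>

lemma DERIV_compare:
  fixes F k :: "real \<Rightarrow> real"
  assumes "a \<le> b"
    and F: "\<And>t. a \<le> t \<Longrightarrow> t \<le> b \<Longrightarrow> (F has_real_derivative F' t) (at t)"
    and k: "\<And>t. a \<le> t \<Longrightarrow> t \<le> b \<Longrightarrow> (k has_real_derivative k' t) (at t)"
    and le: "\<And>t. a \<le> t \<Longrightarrow> t \<le> b \<Longrightarrow> \<bar>F' t\<bar> \<le> k' t"
  shows "\<bar>F b - F a\<bar> \<le> k b - k a"
proof -
  have "k a - F a \<le> k b - F b"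
  proof (rule DERIV_nonneg_imp_nondecreasing[OF \<open>a \<le> b\<close>, of "\<lambda>t. k t - F t"])
    fix t assume "a \<le> t" "t \<le> b"
    then show "\<exists>y. ((\<lambda>t. k t - F t) has_real_derivative y) (at t) \<and> 0 \<le> y"
      using le[of t] by (intro exI[of _ "k' t - F' t"] conjI DERIV_diff k F) auto
  qed
  moreover have "k a + F a \<le> k b + F b"
  proof (rule DERIV_nonneg_imp_nondecreasing[OF \<open>a \<le> b\<close>, of "\<lambda>t. k t + F t"])
    fix t assume "a \<le> t" "t \<le> b"
    then show "\<exists>y. ((\<lambda>t. k t + F t) has_real_derivative y) (at t) \<and> 0 \<le> y"
      using le[of t] by (intro exI[of _ "k' t + F' t"] conjI DERIV_add k F) auto
  qed
  ultimately show ?thesis by linarith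
qed

text \<open>By the mean value inequality all difference quotients are bounded by L, and they vanish
  off K. Since f is integrable over K, dominated convergence applies along every sequence.\<close>

lemma DERIV_under_integral:
  fixes f :: "'a::euclidean_space \<Rightarrow> real"
  assumes f: "sqi f" and K: "K \<in> lmeasurable" and t: "t \<in> {a<..<b}"
    and \<Phi>m: "\<And>s. s \<in> {a<..<b} \<Longrightarrow> sqi (\<Phi> s)"
    and \<Phi>'m: "\<Phi>' t \<in> borel_measurable lebesgue"
    and der: "\<And>s z. s \<in> {a<..<b} \<Longrightarrow> ((\<lambda>s. \<Phi> s z) has_real_derivative \<Phi>' s z) (at s)"
    and bd: "\<And>s z. s \<in> {a<..<b} \<Longrightarrow> \<bar>\<Phi>' s z\<bar> \<le> L"
    and z0: "\<And>s z. s \<in> {a<..<b} \<Longrightarrow> z \<notin> K \<Longrightarrow> \<Phi> s z = 0"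
  shows "((\<lambda>s. \<integral>z. f z * \<Phi> s z \<partial>lebesgue) has_real_derivative (\<integral>z. f z * \<Phi>' t z \<partial>lebesgue)) (at t)"
proof -
  have [measurable]: "f \<in> borel_measurable lebesgue" using f by (rule sqi_measurable)
  note [measurable] = \<Phi>'m
  let ?F = "\<lambda>s. \<integral>z. f z * \<Phi> s z \<partial>lebesgue"
  have int: "integrable lebesgue (\<lambda>z. f z * \<Phi> s z)" if "s \<in> {a<..<b}" for s
    by (rule sqi_mult_integrable[OF f \<Phi>m[OF that]])
  have "((\<lambda>s. (?F s - ?F t) / (s - t)) \<longlongrightarrow> (\<integral>z. f z * \<Phi>' t z \<partial>lebesgue)) (at t)"
    unfolding tendsto_at_iff_sequentially
  proof (intro allI impI)
    fix X :: "nat \<Rightarrow> real" assume X: "\<forall>i. X i \<in> UNIV - {t}" "X \<longlonglongrightarrow> t"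
    have "eventually (\<lambda>i. X i \<in> {a<..<b}) sequentially"
      using X(2) t by (intro topological_tendstoD) auto
    then obtain i0 where i0: "\<And>i. i \<ge> i0 \<Longrightarrow> X i \<in> {a<..<b}" unfolding eventually_sequentially by blast
    define Y where "Y i = X (i + i0)" for i
    have Y: "Y i \<in> {a<..<b}" "Y i \<noteq> t" for i using i0 X(1) by (auto simp: Y_def)
    have Yt: "Y \<longlonglongrightarrow> t" unfolding Y_def by (rule LIMSEQ_ignore_initial_segment[OF X(2)])
    have sm[measurable]: "\<Phi> s \<in> borel_measurable lebesgue" if "s \<in> {a<..<b}" for s using \<Phi>m[OF that] by (rule sqi_measurable)
    have "(\<lambda>i. \<integral>z. f z * ((\<Phi> (Y i) z - \<Phi> t z) / (Y i - t)) \<partial>lebesgue) \<longlonglongrightarrow> (\<integral>z. f z * \<Phi>' t z \<partial>lebesgue)"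
    proof (rule integral_dominated_convergence[where w="\<lambda>z. L * (indicator K z * norm (f z))"])
      show "(\<lambda>z. f z * \<Phi>' t z) \<in> borel_measurable lebesgue" by measurable
      show "(\<lambda>z. f z * ((\<Phi> (Y i) z - \<Phi> t z) / (Y i - t))) \<in> borel_measurable lebesgue" for i
        using sm[OF Y(1)[of i]] sm[OF t] by measurable
      show "integrable lebesgue (\<lambda>z. L * (indicator K z * norm (f z)))"
        by (intro integrable_mult_right sqi_set_integrable(1)[OF f K])
      show "AE z in lebesgue. (\<lambda>i. f z * ((\<Phi> (Y i) z - \<Phi> t z) / (Y i - t))) \<longlonglongrightarrow> f z * \<Phi>' t z"
      proof (rule AE_I2)
        fix z
        have "((\<lambda>s. (\<Phi> s z - \<Phi> t z) / (s - t)) \<longlongrightarrow> \<Phi>' t z) (at t)"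
          using der[OF t, of z] by (simp add: has_field_derivative_iff)
        then have "(\<lambda>i. (\<Phi> (Y i) z - \<Phi> t z) / (Y i - t)) \<longlonglongrightarrow> \<Phi>' t z"
          using Y(2) Yt by (auto simp: tendsto_at_iff_sequentially o_def)
        then show "(\<lambda>i. f z * ((\<Phi> (Y i) z - \<Phi> t z) / (Y i - t))) \<longlonglongrightarrow> f z * \<Phi>' t z"
          by (rule tendsto_mult_left)
      qed
      show "AE z in lebesgue. norm (f z * ((\<Phi> (Y i) z - \<Phi> t z) / (Y i - t))) \<le> L * (indicator K z * norm (f z))" for i
      proof (rule AE_I2)
        fix z
        show "norm (f z * ((\<Phi> (Y i) z - \<Phi> t z) / (Y i - t))) \<le> L * (indicator K z * norm (f z))"
        proof (cases "z \<in> K")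
          case True
          have "norm (\<Phi> (Y i) z - \<Phi> t z) \<le> L * norm (Y i - t)"
          proof (rule field_differentiable_bound[of "{a<..<b}" "\<lambda>s. \<Phi> s z" "\<lambda>s. \<Phi>' s z"])
            show "((\<lambda>s. \<Phi> s z) has_field_derivative \<Phi>' s z) (at s within {a<..<b})" if "s \<in> {a<..<b}" for s
              using der[OF that] by (rule has_field_derivative_at_within)
          qed (use Y t bd in auto)
          then have "\<bar>(\<Phi> (Y i) z - \<Phi> t z) / (Y i - t)\<bar> \<le> L"
            using Y(2)[of i] by (simp add: divide_le_eq abs_divide)
          then have "\<bar>f z\<bar> * \<bar>(\<Phi> (Y i) z - \<Phi> t z) / (Y i - t)\<bar> \<le> \<bar>f z\<bar> * L" by (intro mult_left_mono) auto
          then show ?thesis using True by (simp add: abs_mult mult.commute)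
        next
          case False
          then show ?thesis using z0[OF Y(1)] z0[OF t] by simp
        qed
      qed
    qed
    moreover have "(\<integral>z. f z * ((\<Phi> (Y i) z - \<Phi> t z) / (Y i - t)) \<partial>lebesgue) = (?F (Y i) - ?F t) / (Y i - t)" for i
    proof -
      have "(?F (Y i) - ?F t) / (Y i - t) = (\<integral>z. f z * \<Phi> (Y i) z - f z * \<Phi> t z \<partial>lebesgue) / (Y i - t)"
        by (simp only: Bochner_Integration.integral_diff[OF int[OF Y(1)] int[OF t]])
      also have "\<dots> = (\<integral>z. (f z * \<Phi> (Y i) z - f z * \<Phi> t z) / (Y i - t) \<partial>lebesgue)" by simp
      also have "\<dots> = (\<integral>z. f z * ((\<Phi> (Y i) z - \<Phi> t z) / (Y i - t)) \<partial>lebesgue)"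
        by (simp only: right_diff_distrib[symmetric] times_divide_eq_right)
      finally show ?thesis ..
    qed
    ultimately have "(\<lambda>i. (?F (Y i) - ?F t) / (Y i - t)) \<longlonglongrightarrow> (\<integral>z. f z * \<Phi>' t z \<partial>lebesgue)" by (simp only:)
    then show "((\<lambda>s. (?F s - ?F t) / (s - t)) \<circ> X) \<longlonglongrightarrow> (\<integral>z. f z * \<Phi>' t z \<partial>lebesgue)"
      unfolding Y_def by (intro LIMSEQ_offset[of "(\<lambda>s. (?F s - ?F t) / (s - t)) \<circ> X" i0]) (simp add: o_def)
  qed
  then show ?thesis by (simp add: has_field_derivative_iff)
qed

text \<open>A component of the vector kernel w \<zeta>(w), which appears when a mollification is
  differentiated in its scale.\<close>

definition mker :: "('a::euclidean_space \<Rightarrow> real) \<Rightarrow> 'a \<Rightarrow> 'a \<Rightarrow> real" where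
  "mker \<zeta> i w = (w \<bullet> i) * \<zeta> w"

lemma kernel_mker:
  assumes k: "kernel B \<zeta>" and i: "i \<in> Basis"
  shows "kernel (3 * B) (mker \<zeta> i)"
proof -
  have B: "B \<ge> 0" using k unfolding kernel_def by (meson abs_ge_zero order_trans)
  have "smooth_fun (\<lambda>w. (w \<bullet> i) * \<zeta> w)"
    using k by (intro smooth_fun_mult smooth_fun_inner) (simp add: kernel_def)
  moreover have "\<bar>(w \<bullet> i) * \<zeta> w\<bar> \<le> 3 * B" for w
  proof (cases "w \<in> cbox 0 (3 *\<^sub>R One)")
    case True
    then have "0 \<le> w \<bullet> i \<and> w \<bullet> i \<le> 3" using i by (auto simp: mem_box)
    then have "\<bar>w \<bullet> i\<bar> * \<bar>\<zeta> w\<bar> \<le> 3 * B" using k by (intro mult_mono) (auto simp: kernel_def)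
    then show ?thesis by (simp add: abs_mult)
  next
    case False
    then show ?thesis using k B by (simp add: kernel_def)
  qed
  ultimately show ?thesis using k unfolding kernel_def mker_def[abs_def] by simp
qed

text \<open>Formally, the t-derivative of the average of f (x + t w) against \<zeta> w is the
  average of the inner product of w with the gradient at x + t w. The derivative is put on the
  scaled kernel, where it is minus a divergence in z; the weak gradient identity then moves it to
  f.\<close>

lemma mol_DERIV:
  fixes f :: "'a::euclidean_space \<Rightarrow> real"
  assumes wg: "has_weak_gradient UNIV f g" and k: "kernel B \<zeta>" and t: "t > 0"
  shows "(mol \<zeta> f x has_real_derivative (\<Sum>i\<in>Basis. mol (mker \<zeta> i) (\<lambda>z. g z \<bullet> i) x t)) (at t)"
proof -
  have f: "sqi f" and g: "sqi g" and eq: "\<And>\<phi> i. test_fun UNIV \<phi> \<Longrightarrow> i \<in> Basis \<Longrightarrow>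
        (\<integral>x. f x * frechet_derivative \<phi> (at x) i \<partial>lebesgue) = - (\<integral>x. (g x \<bullet> i) * \<phi> x \<partial>lebesgue)"
    using wg by (auto simp: has_weak_gradient_UNIV_iff)
  have sm: "smooth_fun \<zeta>" using k by (simp add: kernel_def)
  let ?n = "DIM('a)"
  \<comment> \<open>The divergence of the vector field w \<zeta>(w). By the product rule it is n
    \<zeta>(w) plus the derivative of \<zeta> at w in the direction w.\<close>
  define \<xi> where "\<xi> w = (\<Sum>i\<in>Basis. frechet_derivative (mker \<zeta> i) (at w) i)" for w
  have tf: "test_fun UNIV (mker \<zeta> i)" if "i \<in> Basis" for i by (rule kernel_test_fun[OF kernel_mker[OF k that]])
  have \<xi>_eq: "\<xi> w = ?n * \<zeta> w + frechet_derivative \<zeta> (at w) w" for w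
  proof -
    interpret D: linear "frechet_derivative \<zeta> (at w)"
      using has_derivative_linear[OF smooth_fun_has_derivative[OF sm]] .
    have 1: "frechet_derivative (mker \<zeta> i) (at w) i = (w \<bullet> i) * frechet_derivative \<zeta> (at w) i + \<zeta> w" if "i \<in> Basis" for i
      unfolding mker_def[abs_def] using that
      by (simp add: frechet_derivative_mult_smooth[OF smooth_fun_inner sm] frechet_derivative_inner inner_Basis)
    have "frechet_derivative \<zeta> (at w) w = frechet_derivative \<zeta> (at w) (\<Sum>i\<in>Basis. (w \<bullet> i) *\<^sub>R i)"
      by (simp add: euclidean_representation)
    also have "\<dots> = (\<Sum>i\<in>Basis. (w \<bullet> i) * frechet_derivative \<zeta> (at w) i)"
      by (simp add: D.sum D.scale)
    finally have 2: "frechet_derivative \<zeta> (at w) w = (\<Sum>i\<in>Basis. (w \<bullet> i) * frechet_derivative \<zeta> (at w) i)" .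
    have "\<xi> w = (\<Sum>i\<in>Basis. (w \<bullet> i) * frechet_derivative \<zeta> (at w) i + \<zeta> w)"
      unfolding \<xi>_def by (rule sum.cong[OF refl 1])
    also have "\<dots> = frechet_derivative \<zeta> (at w) w + ?n * \<zeta> w"
      unfolding sum.distrib 2[symmetric] by simp
    finally show ?thesis by simp
  qed
  have "\<exists>b. \<forall>w. \<bar>frechet_derivative (mker \<zeta> i) (at w) i\<bar> \<le> b" if "i \<in> Basis" for i
    using test_fun_bounded[OF test_fun_deriv[OF tf[OF that], of i]] by blast
  then obtain b where b: "\<And>i w. i \<in> Basis \<Longrightarrow> \<bar>frechet_derivative (mker \<zeta> i) (at w) i\<bar> \<le> b i" by metis
  define M where "M = (\<Sum>i\<in>Basis. b i)"
  have \<xi>_le: "\<bar>\<xi> w\<bar> \<le> M" for w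
    unfolding \<xi>_def M_def by (rule sum_abs[THEN order_trans]) (intro sum_mono b)
  have M0: "M \<ge> 0" using \<xi>_le[of 0] by linarith
  have \<xi>m: "(\<lambda>z. \<xi> ((1/s) *\<^sub>R (z - x))) \<in> borel_measurable lebesgue" for s
  proof (rule borel_measurable_continuous_lebesgue)
    have "continuous_on UNIV \<xi>"
      unfolding \<xi>_def[abs_def] by (intro continuous_on_sum smooth_fun_continuous_on smooth_fun_deriv test_fun_smooth[OF tf])
    then show "continuous_on UNIV (\<lambda>z. \<xi> ((1/s) *\<^sub>R (z - x)))"
      by (rule continuous_on_compose2) (auto intro!: continuous_intros)
  qed
  define \<Phi> where "\<Phi> s z = \<zeta> ((1/s) *\<^sub>R (z - x)) / s ^ ?n" for s z
  \<comment> \<open>The prefactor s^-n and the argument (z - x)/s each contribute one of the two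
    terms of \<xi>.\<close>
  define \<Phi>' where "\<Phi>' s z = - \<xi> ((1/s) *\<^sub>R (z - x)) / s ^ (?n + 1)" for s z
  have der: "((\<lambda>s. \<Phi> s z) has_real_derivative \<Phi>' s z) (at s)" if s: "s > 0" for s z
  proof -
    let ?y = "z - x" let ?w = "(1/s) *\<^sub>R ?y"
    have "((\<lambda>s. (1/s) *\<^sub>R ?y) has_derivative (\<lambda>h. (- h / s\<^sup>2) *\<^sub>R ?y)) (at s)"
      using s by (auto intro!: derivative_eq_intros simp: power2_eq_square)
    from diff_chain_at[OF this smooth_fun_has_derivative[OF sm]]
    have "((\<lambda>s. \<zeta> ((1/s) *\<^sub>R ?y)) has_derivative (\<lambda>h. frechet_derivative \<zeta> (at ?w) ((- h / s\<^sup>2) *\<^sub>R ?y))) (at s)"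
      by (simp add: o_def)
    moreover have "(\<lambda>h. frechet_derivative \<zeta> (at ?w) ((- h / s\<^sup>2) *\<^sub>R ?y)) = (*) (- frechet_derivative \<zeta> (at ?w) ?w / s)"
    proof
      fix h
      interpret D: linear "frechet_derivative \<zeta> (at ?w)"
        using has_derivative_linear[OF smooth_fun_has_derivative[OF sm]] .
      show "frechet_derivative \<zeta> (at ?w) ((- h / s\<^sup>2) *\<^sub>R ?y) = - frechet_derivative \<zeta> (at ?w) ?w / s * h"
        using s unfolding D.scale by (simp add: power2_eq_square)
    qed
    ultimately have d1: "((\<lambda>s. \<zeta> ((1/s) *\<^sub>R ?y)) has_real_derivative (- frechet_derivative \<zeta> (at ?w) ?w / s)) (at s)"
      by (simp only: has_field_derivative_def)
    have d2: "((\<lambda>s. s ^ ?n) has_real_derivative (?n * s ^ (?n - 1))) (at s)"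
      using DERIV_pow[of ?n s UNIV] by simp
    have sn: "s ^ ?n = s * s ^ (?n - 1)" by (metis DIM_positive power_eq_if not_less0 neq0_conv)
    have "((\<lambda>s. \<Phi> s z) has_real_derivative (((- frechet_derivative \<zeta> (at ?w) ?w / s) * s ^ ?n - \<zeta> ?w * (?n * s ^ (?n - 1))) / (s ^ ?n * s ^ ?n))) (at s)"
      unfolding \<Phi>_def by (rule DERIV_divide[OF d1 d2]) (use s in simp)
    moreover have "((- frechet_derivative \<zeta> (at ?w) ?w / s) * s ^ ?n - \<zeta> ?w * (?n * s ^ (?n - 1))) / (s ^ ?n * s ^ ?n) = \<Phi>' s z"
    proof -
      have "((- frechet_derivative \<zeta> (at ?w) ?w / s) * s ^ ?n - \<zeta> ?w * (?n * s ^ (?n - 1))) = - \<xi> ?w * s ^ (?n - 1)"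
        unfolding \<xi>_eq sn using s by (simp add: algebra_simps)
      moreover have "- \<xi> ?w * s ^ (?n - 1) / (s ^ ?n * s ^ ?n) = - \<xi> ?w / s ^ (?n + 1)"
        using s by (simp add: sn field_simps)
      ultimately show ?thesis by (simp add: \<Phi>'_def)
    qed
    ultimately show ?thesis by simp
  qed
  have D: "(mol \<zeta> f x has_real_derivative (\<integral>z. f z * \<Phi>' t z \<partial>lebesgue)) (at t)"
  proof -
    have "((\<lambda>s. \<integral>z. f z * \<Phi> s z \<partial>lebesgue) has_real_derivative (\<integral>z. f z * \<Phi>' t z \<partial>lebesgue)) (at t)"
    proof (rule DERIV_under_integral[OF f, where a="t/2" and b="2*t" and K="cbox x (x + (6 * t) *\<^sub>R One)" and L="M / (t/2) ^ (?n + 1)"])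
      show "sqi (\<Phi> s)" if "s \<in> {t/2<..<2*t}" for s
        using that t unfolding \<Phi>_def by (intro sqi_test_fun(1)[OF kernel_scaled_test_fun[OF k _ subset_UNIV]]) auto
      show "\<Phi>' t \<in> borel_measurable lebesgue" using \<xi>m[of t] unfolding \<Phi>'_def by measurable
      show "((\<lambda>s. \<Phi> s z) has_real_derivative \<Phi>' s z) (at s)" if "s \<in> {t/2<..<2*t}" for s z
        using that t by (intro der) auto
      show "\<bar>\<Phi>' s z\<bar> \<le> M / (t/2) ^ (?n + 1)" if s: "s \<in> {t/2<..<2*t}" for s z
      proof -
        have s': "s > 0" "t/2 \<le> s" using s t by auto
        have "\<bar>\<Phi>' s z\<bar> = \<bar>\<xi> ((1/s) *\<^sub>R (z - x))\<bar> / s ^ (?n + 1)" using s' by (simp add: \<Phi>'_def)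
        also have "\<dots> \<le> M / (t/2) ^ (?n + 1)"
          using s' t M0 by (intro frac_le \<xi>_le power_mono) auto
        finally show ?thesis .
      qed
      show "\<Phi> s z = 0" if s: "s \<in> {t/2<..<2*t}" and z: "z \<notin> cbox x (x + (6 * t) *\<^sub>R One)" for s z
      proof -
        have "s > 0" "3 * s \<le> 6 * t" using s t by auto
        then have "cbox x (x + (3 * s) *\<^sub>R One) \<subseteq> cbox x (x + (6 * t) *\<^sub>R One)"
          by (intro subset_box_imp) (auto simp: inner_add_left)
        with z kernel_scaled_eq_0[OF k \<open>s > 0\<close>, of z x] show ?thesis by (auto simp: \<Phi>_def)
      qed
    qed (use t in auto)
    then show ?thesis by (simp add: mol_def[abs_def] \<Phi>_def)
  qed
  have "(\<integral>z. f z * \<Phi>' t z \<partial>lebesgue) = (\<Sum>i\<in>Basis. mol (mker \<zeta> i) (\<lambda>z. g z \<bullet> i) x t)"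
  proof -
    define \<phi> where "\<phi> i z = mker \<zeta> i ((1/t) *\<^sub>R (z - x)) / t ^ ?n" for i z
    have \<phi>: "test_fun UNIV (\<phi> i)" if "i \<in> Basis" for i
      unfolding \<phi>_def using kernel_scaled_test_fun[OF kernel_mker[OF k that] t subset_UNIV] .
    have d\<phi>: "frechet_derivative (\<phi> i) (at z) i = frechet_derivative (mker \<zeta> i) (at ((1/t) *\<^sub>R (z - x))) i / t ^ (?n + 1)" if "i \<in> Basis" for i z
    proof -
      have s1: "smooth_fun (mker \<zeta> i)" using tf[OF that] by (rule test_fun_smooth)
      have "\<phi> i = (\<lambda>z. (1 / t ^ ?n) * mker \<zeta> i ((1/t) *\<^sub>R z + (- (1/t) *\<^sub>R x)))"
        by (auto simp: fun_eq_iff \<phi>_def scaleR_diff_right)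
      then have "frechet_derivative (\<phi> i) (at z) i = (1 / t ^ ?n) * ((1/t) * frechet_derivative (mker \<zeta> i) (at ((1/t) *\<^sub>R z + (- (1/t) *\<^sub>R x))) i)"
        by (simp only: frechet_derivative_cmult_smooth[OF smooth_fun_affine[OF s1]] frechet_derivative_affine[OF s1])
      then show ?thesis by (simp add: scaleR_diff_right)
    qed
    have "(\<integral>z. f z * \<Phi>' t z \<partial>lebesgue) = (\<integral>z. (\<Sum>i\<in>Basis. - (f z * frechet_derivative (\<phi> i) (at z) i)) \<partial>lebesgue)"
    proof (rule Bochner_Integration.integral_cong[OF refl])
      fix z
      have "(\<Sum>i\<in>Basis. - (f z * frechet_derivative (\<phi> i) (at z) i)) = (\<Sum>i\<in>Basis. - (f z * (frechet_derivative (mker \<zeta> i) (at ((1/t) *\<^sub>R (z - x))) i / t ^ (?n + 1))))"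
        by (rule sum.cong) (auto simp only: d\<phi>)
      also have "\<dots> = f z * \<Phi>' t z"
        unfolding \<Phi>'_def \<xi>_def by (simp add: sum_negf sum_distrib_left sum_divide_distrib)
      finally show "f z * \<Phi>' t z = (\<Sum>i\<in>Basis. - (f z * frechet_derivative (\<phi> i) (at z) i))" ..
    qed
    also have "\<dots> = (\<Sum>i\<in>Basis. \<integral>z. - (f z * frechet_derivative (\<phi> i) (at z) i) \<partial>lebesgue)"
      by (rule Bochner_Integration.integral_sum) (intro Bochner_Integration.integrable_minus sqi_mult_integrable[OF f] sqi_test_fun(2)[OF \<phi>])
    also have "\<dots> = (\<Sum>i\<in>Basis. \<integral>z. (g z \<bullet> i) * \<phi> i z \<partial>lebesgue)"
      by (rule sum.cong) (auto simp: eq[OF \<phi>])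
    finally show ?thesis by (simp add: mol_def \<phi>_def)
  qed
  with D show ?thesis by simp
qed

text \<open>The l1 norm bounds the distance to the corner by 3 n t; the additional t leaves room for
  an open ball.\<close>

lemma cube_subset_ball:
  fixes x :: "'a::euclidean_space" and t :: real
  assumes "t > 0"
  shows "cbox x (x + (3 * t) *\<^sub>R One) \<subseteq> ball x ((3 * real DIM('a) + 1) * t)"
proof
  fix z assume z: "z \<in> cbox x (x + (3 * t) *\<^sub>R One)"
  have "norm (z - x) \<le> (\<Sum>i\<in>Basis. \<bar>(z - x) \<bullet> i\<bar>)" by (rule norm_le_l1)
  also have "\<dots> \<le> (\<Sum>i\<in>(Basis::'a set). 3 * t)"
    using z by (intro sum_mono) (auto simp: mem_box inner_simps)
  also have "\<dots> = 3 * real DIM('a) * t" by simp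
  also have "\<dots> < (3 * real DIM('a) + 1) * t" using assms by (simp add: algebra_simps)
  finally show "z \<in> ball x ((3 * real DIM('a) + 1) * t)" by (simp add: dist_norm norm_minus_commute)
qed

lemma mol_le:
  fixes h :: "'a::euclidean_space \<Rightarrow> real"
  assumes k: "kernel B \<zeta>" and h: "sqi h" and t: "t > 0"
  shows "\<bar>mol \<zeta> h x t\<bar> \<le> B / t ^ DIM('a) * (\<integral>z. indicator (cbox x (x + (3 * t) *\<^sub>R One)) z * \<bar>h z\<bar> \<partial>lebesgue)"
proof -
  let ?Q = "cbox x (x + (3 * t) *\<^sub>R One)"
  let ?k = "\<lambda>z. \<zeta> ((1/t) *\<^sub>R (z - x)) / t ^ DIM('a)"
  have k2: "sqi ?k" using kernel_scaled_test_fun[OF k t, of x UNIV] by (intro sqi_test_fun) auto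
  have "\<bar>mol \<zeta> h x t\<bar> \<le> (\<integral>z. \<bar>h z * ?k z\<bar> \<partial>lebesgue)" unfolding mol_def by (rule integral_abs_bound)
  also have "\<dots> \<le> (\<integral>z. B / t ^ DIM('a) * (indicator ?Q z * \<bar>h z\<bar>) \<partial>lebesgue)"
  proof (rule integral_mono)
    show "integrable lebesgue (\<lambda>z. \<bar>h z * ?k z\<bar>)" by (intro integrable_abs sqi_mult_integrable[OF h k2])
    show "integrable lebesgue (\<lambda>z. B / t ^ DIM('a) * (indicator ?Q z * \<bar>h z\<bar>))"
      using sqi_set_integrable(1)[OF h, of ?Q] by (intro integrable_mult_right) auto
    show "\<bar>h z * ?k z\<bar> \<le> B / t ^ DIM('a) * (indicator ?Q z * \<bar>h z\<bar>)" for z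
    proof (cases "z \<in> ?Q")
      case True
      have "\<bar>?k z\<bar> \<le> B / t ^ DIM('a)"
        using k t by (auto simp: kernel_def intro!: divide_right_mono)
      then have "\<bar>h z\<bar> * \<bar>?k z\<bar> \<le> \<bar>h z\<bar> * (B / t ^ DIM('a))" by (intro mult_left_mono) auto
      then show ?thesis using True by (simp only: abs_mult) (simp add: mult.commute)
    next
      case False
      then show ?thesis by (simp add: kernel_scaled_eq_0[OF k t])
    qed
  qed
  also have "\<dots> = B / t ^ DIM('a) * (\<integral>z. indicator ?Q z * \<bar>h z\<bar> \<partial>lebesgue)" by simp
  finally show ?thesis .
qed

lemma mol_grad_le:
  fixes g :: "'a::euclidean_space \<Rightarrow> 'a"
  assumes k: "kernel B \<zeta>" and g: "sqi g" and t: "t > 0"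
  shows "\<bar>\<Sum>i\<in>Basis. mol (mker \<zeta> i) (\<lambda>z. g z \<bullet> i) x t\<bar>
     \<le> 3 * real DIM('a) * B / t ^ DIM('a) * (\<integral>z. indicator (ball x ((3 * real DIM('a) + 1) * t)) z * norm (g z) \<partial>lebesgue)"
proof -
  have B: "B \<ge> 0" using k unfolding kernel_def by (meson abs_ge_zero order_trans)
  let ?I = "\<integral>z. indicator (ball x ((3 * real DIM('a) + 1) * t)) z * norm (g z) \<partial>lebesgue"
  have "\<bar>mol (mker \<zeta> i) (\<lambda>z. g z \<bullet> i) x t\<bar> \<le> 3 * B / t ^ DIM('a) * ?I" if i: "i \<in> Basis" for i
  proof -
    let ?Q = "cbox x (x + (3 * t) *\<^sub>R One)"
    have "\<bar>mol (mker \<zeta> i) (\<lambda>z. g z \<bullet> i) x t\<bar> \<le> 3 * B / t ^ DIM('a) * (\<integral>z. indicator ?Q z * \<bar>g z \<bullet> i\<bar> \<partial>lebesgue)"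
      by (rule mol_le[OF kernel_mker[OF k i] sqi_inner[OF g] t])
    also have "\<dots> \<le> 3 * B / t ^ DIM('a) * ?I"
    proof (rule mult_left_mono)
      show "(\<integral>z. indicator ?Q z * \<bar>g z \<bullet> i\<bar> \<partial>lebesgue) \<le> ?I"
      proof (rule integral_mono)
        show "integrable lebesgue (\<lambda>z. indicator ?Q z * \<bar>g z \<bullet> i\<bar>)"
          using sqi_set_integrable(1)[OF sqi_inner[OF g], of ?Q i] by simp
        show "integrable lebesgue (\<lambda>z. indicator (ball x ((3 * real DIM('a) + 1) * t)) z * norm (g z))"
          by (intro sqi_set_integrable(1)[OF g] lmeasurable_ball)
        show "indicator ?Q z * \<bar>g z \<bullet> i\<bar> \<le> indicator (ball x ((3 * real DIM('a) + 1) * t)) z * norm (g z)" for z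
          using cube_subset_ball[OF t, of x] Basis_le_norm[OF i, of "g z"]
          by (cases "z \<in> ?Q") (auto simp: subset_iff)
      qed
    qed (use B t in auto)
    finally show ?thesis .
  qed
  then have "(\<Sum>i\<in>Basis. \<bar>mol (mker \<zeta> i) (\<lambda>z. g z \<bullet> i) x t\<bar>) \<le> (\<Sum>i\<in>(Basis::'a set). 3 * B / t ^ DIM('a) * ?I)"
    by (rule sum_mono)
  also have "\<dots> = 3 * real DIM('a) * B / t ^ DIM('a) * ?I" by simp
  finally show ?thesis by (rule order_trans[OF sum_abs])
qed

lemma MG_integral_le:
  fixes g :: "'a::euclidean_space \<Rightarrow> 'b::euclidean_space"
  assumes g: "sqi g" and r: "r > 0" and m: "MG g x \<le> ennreal m" "m \<ge> 0"
  shows "(\<integral>z. indicator (ball x r) z * norm (g z) \<partial>lebesgue) \<le> m * r ^ DIM('a)"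
proof -
  have "ennreal (\<integral>z. indicator (ball x r) z * norm (g z) \<partial>lebesgue) = (\<integral>\<^sup>+z. ennreal (indicator (ball x r) z * norm (g z)) \<partial>lebesgue)"
    by (rule nn_integral_eq_integral[symmetric]) (auto intro!: sqi_set_integrable(1)[OF g])
  also have "\<dots> = (\<integral>\<^sup>+z\<in>ball x r. ennreal (norm (g z)) \<partial>lebesgue)"
    by (intro nn_integral_cong) (auto simp: indicator_def)
  also have "\<dots> \<le> MG g x * ennreal (r ^ DIM('a))" unfolding MG_def by (rule Mx_ge[OF r])
  also have "\<dots> \<le> ennreal m * ennreal (r ^ DIM('a))" by (intro mult_right_mono m) simp
  also have "\<dots> = ennreal (m * r ^ DIM('a))" using m r by (simp add: ennreal_mult)
  finally show ?thesis using m r by (subst (asm) ennreal_le_iff) auto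
qed

text \<open>The factor 3 n collects the n moment kernels, each bounded by 3 on the cube of side 3;
  the power is the r^n of the ball from \<open>cube_subset_ball\<close>, relative to t^n.\<close>

definition Cpw :: "'a::euclidean_space itself \<Rightarrow> real" where
  "Cpw _ = 3 * real DIM('a) * (3 * real DIM('a) + 1) ^ DIM('a)"

lemma mol_grad_le_MG:
  fixes g :: "'a::euclidean_space \<Rightarrow> 'a"
  assumes k: "kernel 1 \<zeta>" and g: "sqi g" and t: "t > 0" and m: "MG g x \<le> ennreal m" "m \<ge> 0"
  shows "\<bar>\<Sum>i\<in>Basis. mol (mker \<zeta> i) (\<lambda>z. g z \<bullet> i) x t\<bar> \<le> Cpw TYPE('a) * m"
proof -
  let ?r = "(3 * real DIM('a) + 1) * t"
  have r: "?r > 0" using t by (simp add: add_pos_pos)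
  have "\<bar>\<Sum>i\<in>Basis. mol (mker \<zeta> i) (\<lambda>z. g z \<bullet> i) x t\<bar>
     \<le> 3 * real DIM('a) * 1 / t ^ DIM('a) * (\<integral>z. indicator (ball x ?r) z * norm (g z) \<partial>lebesgue)"
    by (rule mol_grad_le[OF k g t])
  also have "\<dots> \<le> 3 * real DIM('a) * 1 / t ^ DIM('a) * (m * ?r ^ DIM('a))"
    using t by (intro mult_left_mono MG_integral_le[OF g r m]) auto
  also have "\<dots> = Cpw TYPE('a) * m" using t by (simp add: Cpw_def power_mult_distrib)
  finally show ?thesis .
qed

text \<open>The derivative in the scale is bounded by \<open>Cpw\<close> times m at every scale.
  Integration from scale 0, where the mollification tends to its pointwise limit, up to \<rho> gives
  a bound linear in \<rho>.\<close>

lemma mol_minus_le: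
  fixes f :: "'a::euclidean_space \<Rightarrow> real"
  assumes wg: "has_weak_gradient UNIV f g" and k: "kernel 1 \<zeta>" and x: "leb_pt f x"
    and \<rho>: "\<rho> > 0" and m: "MG g x \<le> ennreal m" "m \<ge> 0"
  shows "\<bar>mol \<zeta> f x \<rho> - f x * (\<integral>z. \<zeta> z \<partial>lebesgue)\<bar> \<le> Cpw TYPE('a) * m * \<rho>"
proof -
  have f: "sqi f" and g: "sqi g" using wg by (auto simp: has_weak_gradient_UNIV_iff)
  have "\<bar>mol \<zeta> f x \<rho> - mol \<zeta> f x \<tau>\<bar> \<le> Cpw TYPE('a) * m * \<rho>" if \<tau>: "0 < \<tau>" "\<tau> < \<rho>" for \<tau>
  proof -
    have "\<bar>mol \<zeta> f x \<rho> - mol \<zeta> f x \<tau>\<bar> \<le> Cpw TYPE('a) * m * \<rho> - Cpw TYPE('a) * m * \<tau>"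
    proof (rule DERIV_compare)
      show "(mol \<zeta> f x has_real_derivative (\<Sum>i\<in>Basis. mol (mker \<zeta> i) (\<lambda>z. g z \<bullet> i) x t)) (at t)" if "\<tau> \<le> t" for t
        using that \<tau> by (intro mol_DERIV[OF wg k]) auto
      show "((\<lambda>t. Cpw TYPE('a) * m * t) has_real_derivative (Cpw TYPE('a) * m)) (at t)" for t
        by (auto intro!: derivative_eq_intros)
      show "\<bar>\<Sum>i\<in>Basis. mol (mker \<zeta> i) (\<lambda>z. g z \<bullet> i) x t\<bar> \<le> Cpw TYPE('a) * m" if "\<tau> \<le> t" for t
        using that \<tau> by (intro mol_grad_le_MG[OF k g _ m]) auto
    qed (use \<tau> in auto)
    moreover have "Cpw TYPE('a) * m * \<tau> \<ge> 0" using m \<tau> by (simp add: Cpw_def)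
    ultimately show ?thesis by linarith
  qed
  then have ev: "\<forall>\<^sub>F \<tau> in at_right 0. \<bar>mol \<zeta> f x \<rho> - mol \<zeta> f x \<tau>\<bar> \<le> Cpw TYPE('a) * m * \<rho>"
    using \<rho> by (auto simp: eventually_at_right_field)
  have "((\<lambda>\<tau>. \<bar>mol \<zeta> f x \<rho> - mol \<zeta> f x \<tau>\<bar>) \<longlongrightarrow> \<bar>mol \<zeta> f x \<rho> - f x * (\<integral>z. \<zeta> z \<partial>lebesgue)\<bar>) (at_right 0)"
    by (intro tendsto_rabs tendsto_diff tendsto_const mol_tendsto[OF k f x])
  from tendsto_upperbound[OF this ev] show ?thesis by simp
qed

text \<open>The scale derivative has two bounds: P = \<open>Cpw\<close> m from the maximal function,
  and Q t^(-n/2) from Cauchy-Schwarz. Their geometric mean with exponents 1 - 1/n and 1/n is a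
  multiple of t^(-1/2), integrable at 0 in every dimension; hence the final \<rho>^(1/2).\<close>

lemma mol_minus_le_Hedberg:
  fixes f :: "'a::euclidean_space \<Rightarrow> real"
  assumes wg: "has_weak_gradient UNIV f g" and k: "kernel 1 \<zeta>" and x: "leb_pt f x"
    and \<rho>: "\<rho> > 0" and m: "MG g x \<le> ennreal m" "m \<ge> 0"
  defines "Q \<equiv> 3 * real DIM('a) * sqrt (ubv TYPE('a) * (3 * real DIM('a) + 1) ^ DIM('a) * sqn g)"
  shows "\<bar>mol \<zeta> f x \<rho> - f x * (\<integral>z. \<zeta> z \<partial>lebesgue)\<bar>
    \<le> 2 * (Cpw TYPE('a) * m) powr (1 - 1 / real DIM('a)) * Q powr (1 / real DIM('a)) * \<rho> powr (1/2)"
proof -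
  let ?n = "real DIM('a)"
  have n: "?n > 0" by simp
  have f: "sqi f" and g: "sqi g" using wg by (auto simp: has_weak_gradient_UNIV_iff)
  have Q0: "Q \<ge> 0" using ubv_pos[where 'a='a] sqn_nonneg[of g] by (simp add: Q_def)
  let ?P = "Cpw TYPE('a) * m"
  have P0: "?P \<ge> 0" using m by (simp add: Cpw_def)
  define A where "A = ?P powr (1 - 1 / ?n) * Q powr (1 / ?n)"
  have A0: "A \<ge> 0" by (simp add: A_def)
  have Dle: "\<bar>\<Sum>i\<in>Basis. mol (mker \<zeta> i) (\<lambda>z. g z \<bullet> i) x t\<bar> \<le> A * t powr (-1/2)" (is "\<bar>?D\<bar> \<le> _") if t: "t > 0" for t
  proof -
    have 1: "\<bar>?D\<bar> \<le> ?P" by (rule mol_grad_le_MG[OF k g t m])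
    let ?r = "(3 * ?n + 1) * t"
    have r: "?r > 0" using t by (simp add: add_pos_pos)
    let ?I = "\<integral>z. indicator (ball x ?r) z * norm (g z) \<partial>lebesgue"
    have "?I\<^sup>2 \<le> measure lebesgue (ball x ?r) * sqn g" by (intro sqi_set_integrable(3)[OF g] lmeasurable_ball)
    also have "\<dots> = ubv TYPE('a) * ?r ^ DIM('a) * sqn g" using r by (subst measure_ball_ubv) auto
    also have "\<dots> = (ubv TYPE('a) * (3 * ?n + 1) ^ DIM('a) * sqn g) * t ^ DIM('a)" by (simp add: power_mult_distrib)
    finally have "?I \<le> sqrt ((ubv TYPE('a) * (3 * ?n + 1) ^ DIM('a) * sqn g) * t ^ DIM('a))"
      by (rule real_le_rsqrt)
    then have I: "?I \<le> sqrt (ubv TYPE('a) * (3 * ?n + 1) ^ DIM('a) * sqn g) * sqrt (t ^ DIM('a))" by (simp add: real_sqrt_mult)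
    have "\<bar>?D\<bar> \<le> 3 * ?n * 1 / t ^ DIM('a) * ?I" using mol_grad_le[OF k g t, of x] by simp
    also have "\<dots> \<le> 3 * ?n * 1 / t ^ DIM('a) * (sqrt (ubv TYPE('a) * (3 * ?n + 1) ^ DIM('a) * sqn g) * sqrt (t ^ DIM('a)))"
      using t by (intro mult_left_mono I) auto
    also have "\<dots> = Q * (sqrt (t ^ DIM('a)) / t ^ DIM('a))" by (simp add: Q_def)
    also have "sqrt (t ^ DIM('a)) / t ^ DIM('a) = t powr (- ?n / 2)"
    proof -
      have "sqrt (t ^ DIM('a)) = (t powr ?n) powr (1/2)" using t by (simp add: powr_half_sqrt powr_realpow)
      also have "\<dots> = t powr (?n / 2)" by (simp add: powr_powr)
      finally have "sqrt (t ^ DIM('a)) / t ^ DIM('a) = t powr (?n / 2) / t powr ?n" using t by (simp add: powr_realpow)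
      also have "\<dots> = t powr (?n / 2 - ?n)" by (simp only: powr_diff)
      also have "?n / 2 - ?n = - ?n / 2" by simp
      finally show ?thesis .
    qed
    finally have 2: "\<bar>?D\<bar> \<le> Q * t powr (- ?n / 2)" .
    show ?thesis
    proof (cases "?D = 0")
      case True
      then show ?thesis using A0 by simp
    next
      case False
      have "\<bar>?D\<bar> = \<bar>?D\<bar> powr (1 - 1 / ?n) * \<bar>?D\<bar> powr (1 / ?n)"
        using False by (simp add: powr_add[symmetric])
      also have "\<dots> \<le> ?P powr (1 - 1 / ?n) * (Q * t powr (- ?n / 2)) powr (1 / ?n)"
        using 1 2 by (intro mult_mono powr_mono2) (auto simp: field_simps Suc_leI)
      also have "(Q * t powr (- ?n / 2)) powr (1 / ?n) = Q powr (1 / ?n) * t powr (-1/2)"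
        using Q0 by (simp add: powr_mult powr_powr)
      finally show ?thesis by (simp add: A_def mult.assoc)
    qed
  qed
  have "\<bar>mol \<zeta> f x \<rho> - mol \<zeta> f x \<tau>\<bar> \<le> 2 * A * \<rho> powr (1/2)" if \<tau>: "0 < \<tau>" "\<tau> < \<rho>" for \<tau>
  proof -
    have "\<bar>mol \<zeta> f x \<rho> - mol \<zeta> f x \<tau>\<bar> \<le> 2 * A * \<rho> powr (1/2) - 2 * A * \<tau> powr (1/2)"
    proof (rule DERIV_compare)
      show "(mol \<zeta> f x has_real_derivative (\<Sum>i\<in>Basis. mol (mker \<zeta> i) (\<lambda>z. g z \<bullet> i) x t)) (at t)" if "\<tau> \<le> t" for t
        using that \<tau> by (intro mol_DERIV[OF wg k]) auto
      show "((\<lambda>t. 2 * A * t powr (1/2)) has_real_derivative (A * t powr (-1/2))) (at t)" if "\<tau> \<le> t" for t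
      proof -
        have "((\<lambda>t. t powr (1/2)) has_real_derivative ((1/2) * t powr (1/2 - 1))) (at t)"
          using that \<tau> by (intro has_real_derivative_powr) auto
        from DERIV_cmult[OF this, of "2 * A"] show ?thesis by simp
      qed
      show "\<bar>\<Sum>i\<in>Basis. mol (mker \<zeta> i) (\<lambda>z. g z \<bullet> i) x t\<bar> \<le> A * t powr (-1/2)" if "\<tau> \<le> t" for t
        using that \<tau> by (intro Dle) auto
    qed (use \<tau> in auto)
    moreover have "2 * A * \<tau> powr (1/2) \<ge> 0" using A0 by simp
    ultimately show ?thesis by linarith
  qed
  then have ev: "\<forall>\<^sub>F \<tau> in at_right 0. \<bar>mol \<zeta> f x \<rho> - mol \<zeta> f x \<tau>\<bar> \<le> 2 * A * \<rho> powr (1/2)"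
    using \<rho> by (auto simp: eventually_at_right_field)
  have "((\<lambda>\<tau>. \<bar>mol \<zeta> f x \<rho> - mol \<zeta> f x \<tau>\<bar>) \<longlongrightarrow> \<bar>mol \<zeta> f x \<rho> - f x * (\<integral>z. \<zeta> z \<partial>lebesgue)\<bar>) (at_right 0)"
    by (intro tendsto_rabs tendsto_diff tendsto_const mol_tendsto[OF k f x])
  from tendsto_upperbound[OF this ev] show ?thesis by (simp add: A_def mult.assoc)
qed

text \<open>The average at y is also an average at x, taken with the kernel translated by (y -
  x)/\<rho>. Thus f x and f y can be compared with one and the same number.\<close>

lemma pair_kernel:
  fixes x y :: "'a::euclidean_space"
  assumes \<rho>: "\<rho> > 0" "norm (x - y) \<le> \<rho>"
  defines "v \<equiv> (1/\<rho>) *\<^sub>R (y - x)"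
  shows "kernel 1 (\<lambda>z. std_kernel (z - v))" "mol (\<lambda>z. std_kernel (z - v)) f x \<rho> = mol std_kernel f y \<rho>"
proof -
  show "kernel 1 (\<lambda>z. std_kernel (z - v))"
  proof (rule kernel_shift)
    fix i :: 'a assume i: "i \<in> Basis"
    have "\<bar>(y - x) \<bullet> i\<bar> \<le> \<rho>" using Basis_le_norm[OF i, of "y - x"] \<rho> by (simp add: norm_minus_commute)
    then show "\<bar>v \<bullet> i\<bar> \<le> 1" using \<rho> by (simp add: v_def abs_mult)
  qed
  show "mol (\<lambda>z. std_kernel (z - v)) f x \<rho> = mol std_kernel f y \<rho>"
    unfolding mol_def v_def by (simp add: scaleR_diff_right[symmetric])
qed

text \<open>The Hajlasz inequality: increments are controlled by distance times the sum of the
  maximal functions of the gradient at the two points. The radius \<rho> may exceed the distance, so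
  that a single bound serves all pairs in a ball.\<close>

lemma pw_ineq:
  fixes f :: "'a::euclidean_space \<Rightarrow> real"
  assumes wg: "has_weak_gradient UNIV f g" and x: "leb_pt f x" and y: "leb_pt f y"
    and \<rho>: "\<rho> > 0" "norm (x - y) \<le> \<rho>"
    and m: "MG g x \<le> ennreal m" "m \<ge> 0" and m': "MG g y \<le> ennreal m'" "m' \<ge> 0"
  shows "ker_mass TYPE('a) * \<bar>f x - f y\<bar> \<le> Cpw TYPE('a) * (m + m') * \<rho>"
proof -
  let ?v = "(1/\<rho>) *\<^sub>R (y - x)" and ?k = "ker_mass TYPE('a)"
  note pk = pair_kernel(1)[OF \<rho>] pair_kernel(2)[OF \<rho>, of f]
  have "\<bar>mol std_kernel f y \<rho> - f x * ?k\<bar> \<le> Cpw TYPE('a) * m * \<rho>"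
    using mol_minus_le[OF wg pk(1) x \<rho>(1) m] by (simp add: pk(2) kernel_shift_mass)
  moreover have "\<bar>mol std_kernel f y \<rho> - f y * ?k\<bar> \<le> Cpw TYPE('a) * m' * \<rho>"
    using mol_minus_le[OF wg kernel_std y \<rho>(1) m'] by (simp add: ker_mass_def)
  ultimately have "\<bar>f x * ?k - f y * ?k\<bar> \<le> Cpw TYPE('a) * (m + m') * \<rho>" by (simp add: algebra_simps)
  moreover have "\<bar>f x * ?k - f y * ?k\<bar> = ?k * \<bar>f x - f y\<bar>"
    using ker_mass_pos[where 'a='a] by (simp only: left_diff_distrib[symmetric] abs_mult) simp
  ultimately show ?thesis by simp
qed

text \<open>Only the power 1 - 1/n of m enters, at the price of the L2 norm of the gradient. This
  gain is what \<open>capacity_estimate\<close> exploits.\<close>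

lemma pw_ineq_Hedberg:
  fixes f :: "'a::euclidean_space \<Rightarrow> real"
  assumes wg: "has_weak_gradient UNIV f g" and x: "leb_pt f x" and y: "leb_pt f y"
    and \<rho>: "\<rho> > 0" "norm (x - y) \<le> \<rho>"
    and m: "MG g x \<le> ennreal m" and m': "MG g y \<le> ennreal m" and m0: "m \<ge> 0"
  defines "Q \<equiv> 3 * real DIM('a) * sqrt (ubv TYPE('a) * (3 * real DIM('a) + 1) ^ DIM('a) * sqn g)"
  shows "ker_mass TYPE('a) * \<bar>f x - f y\<bar> \<le> 4 * (Cpw TYPE('a) * m) powr (1 - 1 / real DIM('a)) * Q powr (1 / real DIM('a)) * \<rho> powr (1/2)"
proof -
  let ?v = "(1/\<rho>) *\<^sub>R (y - x)" and ?k = "ker_mass TYPE('a)"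
  let ?b = "2 * (Cpw TYPE('a) * m) powr (1 - 1 / real DIM('a)) * Q powr (1 / real DIM('a)) * \<rho> powr (1/2)"
  note pk = pair_kernel(1)[OF \<rho>] pair_kernel(2)[OF \<rho>, of f]
  have "\<bar>mol std_kernel f y \<rho> - f x * ?k\<bar> \<le> ?b"
    using mol_minus_le_Hedberg[OF wg pk(1) x \<rho>(1) m m0] by (simp add: pk(2) kernel_shift_mass Q_def)
  moreover have "\<bar>mol std_kernel f y \<rho> - f y * ?k\<bar> \<le> ?b"
    using mol_minus_le_Hedberg[OF wg kernel_std y \<rho>(1) m' m0] by (simp add: ker_mass_def Q_def)
  ultimately have "\<bar>f x * ?k - f y * ?k\<bar> \<le> 2 * ?b" by linarith
  moreover have "\<bar>f x * ?k - f y * ?k\<bar> = ?k * \<bar>f x - f y\<bar>"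
    using ker_mass_pos[where 'a='a] by (simp only: left_diff_distrib[symmetric] abs_mult) simp
  ultimately show ?thesis by simp
qed

section \<open>Locality of weak gradients and Lipschitz functions\<close>

lemma MG_finite_AE:
  fixes g :: "'a::euclidean_space \<Rightarrow> 'b::euclidean_space"
  assumes "sqi g"
  shows "AE x in lebesgue. MG g x < top"
proof -
  note [measurable] = MG_measurable[of g]
  have "(\<integral>\<^sup>+x. (MG g x)\<^sup>2 \<partial>lebesgue) < \<infinity>"
    using MG_strong[OF assms] by (rule le_less_trans) simp
  then have "AE x in lebesgue. (MG g x)\<^sup>2 \<noteq> \<infinity>"
    by (intro nn_integral_PInf_AE) auto
  then show ?thesis
  proof eventually_elim
    fix x assume a: "(MG g x)\<^sup>2 \<noteq> \<infinity>"
    show "MG g x < top"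
    proof (rule ccontr)
      assume "\<not> MG g x < top"
      then have "MG g x = top" by (simp add: less_top[symmetric])
      then show False using a by (simp add: power2_eq_square)
    qed
  qed
qed

lemma sqi_MG:
  fixes g :: "'a::euclidean_space \<Rightarrow> 'b::euclidean_space"
  assumes "sqi g"
  shows "sqi (\<lambda>x. enn2real (MG g x))" "sqn (\<lambda>x. enn2real (MG g x)) \<le> Cmax TYPE('a) * sqn g"
proof -
  note [measurable] = MG_measurable[of g]
  have "(\<integral>\<^sup>+x. ennreal ((norm (enn2real (MG g x)))\<^sup>2) \<partial>lebesgue) = (\<integral>\<^sup>+x. (MG g x)\<^sup>2 \<partial>lebesgue)"
  proof (rule nn_integral_cong_AE)
    show "AE x in lebesgue. ennreal ((norm (enn2real (MG g x)))\<^sup>2) = (MG g x)\<^sup>2"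
      using MG_finite_AE[OF assms] by eventually_elim (simp add: ennreal_power[symmetric])
  qed
  also have "\<dots> \<le> ennreal (Cmax TYPE('a) * sqn g)" by (rule MG_strong[OF assms])
  finally have le: "(\<integral>\<^sup>+x. ennreal ((norm (enn2real (MG g x)))\<^sup>2) \<partial>lebesgue) \<le> ennreal (Cmax TYPE('a) * sqn g)" .
  then show s: "sqi (\<lambda>x. enn2real (MG g x))"
    unfolding sqi_iff by (auto intro: le_less_trans)
  show "sqn (\<lambda>x. enn2real (MG g x)) \<le> Cmax TYPE('a) * sqn g"
    using le nn_integral_sqn[OF s] Cmax_pos[where 'a='a] sqn_nonneg[of g] by (simp add: ennreal_le_iff)
qed

text \<open>At almost every x in S the mollifications of w at scale t are o(t), since
  \<open>pw_ineq\<close> bounds w by t times functions that vanish at x and have x as Lebesgue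
  point. By l'Hospital the same quotient tends to the pairing of h x with the first moments of the
  kernel. Comparing two kernels whose first moments differ by a multiple of a basis vector gives
  each coordinate h x = 0.\<close>

lemma weak_gradient_zero_on:
  fixes w :: "'a::euclidean_space \<Rightarrow> real"
  assumes wg: "has_weak_gradient UNIV w h" and S[measurable]: "S \<in> sets lebesgue"
    and w0: "AE x in lebesgue. x \<in> S \<longrightarrow> w x = 0"
  shows "AE x in lebesgue. x \<in> S \<longrightarrow> h x = 0"
proof -
  have w: "sqi w" and h: "sqi h" using wg by (auto simp: has_weak_gradient_UNIV_iff)
  have [measurable]: "w \<in> borel_measurable lebesgue" using w by (rule sqi_measurable)
  define m where "m x = enn2real (MG h x)" for x
  have m: "sqi m" unfolding m_def by (rule sqi_MG[OF h])
  \<comment> \<open>The maximal function is kept only off S, so q vanishes at points x of S and its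
    averages over small cubes at such Lebesgue points tend to 0.\<close>
  define q where "q x = indicator (- S) x *\<^sub>R m x" for x
  have [measurable]: "- S \<in> sets lebesgue" using sets.compl_sets[OF S] by (simp add: Compl_eq_Diff_UNIV)
  have q: "sqi q" unfolding q_def by (rule sqi_indicator_mult[OF m]) measurable
  let ?o = "indicator (- S) :: 'a \<Rightarrow> real"
  have lo: "AE x in lebesgue. leb_pt ?o x"
  proof (rule AE_leb_pt)
    fix a b :: 'a
    have eq: "(\<lambda>z. indicator (cbox a b) z * ?o z) = indicator (cbox a b - S)"
      by (auto simp: fun_eq_iff indicator_def)
    have "cbox a b - S \<in> lmeasurable" by (intro fmeasurable_Diff) auto
    then show "integrable lebesgue (\<lambda>z. indicator (cbox a b) z * ?o z)"
      unfolding eq by (intro integrable_real_indicator) (auto simp: fmeasurable_def)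
  qed
  have lh: "AE x in lebesgue. \<forall>i\<in>Basis. leb_pt (\<lambda>z. h z \<bullet> i) x"
    by (intro AE_finite_allI AE_leb_pt_sqi sqi_inner h) auto
  define good where "good z \<longleftrightarrow> leb_pt w z \<and> MG h z < top \<and> (z \<in> S \<longrightarrow> w z = 0)" for z
  have AEgood: "AE z in lebesgue. good z"
    using AE_leb_pt_sqi[OF w] MG_finite_AE[OF h] w0 by eventually_elim (simp add: good_def)
  have "AE x in lebesgue. good x \<and> leb_pt q x \<and> leb_pt ?o x \<and> (\<forall>i\<in>Basis. leb_pt (\<lambda>z. h z \<bullet> i) x)"
    using AEgood AE_leb_pt_sqi[OF q] lo lh by eventually_elim auto
  then show ?thesis
  proof eventually_elim
    fix x assume A: "good x \<and> leb_pt q x \<and> leb_pt ?o x \<and> (\<forall>i\<in>Basis. leb_pt (\<lambda>z. h z \<bullet> i) x)"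
    show "x \<in> S \<longrightarrow> h x = 0"
    proof
      assume xS: "x \<in> S"
      have gx: "leb_pt w x" "w x = 0" "MG h x \<le> ennreal (m x)" "m x \<ge> 0"
        using A xS by (auto simp: good_def m_def ennreal_enn2real_if less_top)
      have qx: "q x = 0" "?o x = 0" using xS by (auto simp: q_def)
      let ?n = "real DIM('a)"
      define C where "C = Cpw TYPE('a) * (3 * ?n + 1) / ker_mass TYPE('a)"
      have C0: "C \<ge> 0" using ker_mass_pos[where 'a='a] by (simp add: C_def Cpw_def)
      let ?Q = "\<lambda>t. cbox x (x + t *\<^sub>R One)"
      \<comment> \<open>For z in S the left side is 0. For z outside S the point x, where w x = 0,
        serves as comparison point, and the two maximal functions become the two summands.\<close>
      have wle: "\<bar>w z\<bar> \<le> C * t * (m x * ?o z + q z)" if gz: "good z" and t: "t > 0" and z: "z \<in> ?Q (3 * t)" for z t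
      proof (cases "z \<in> S")
        case True
        then show ?thesis using gz C0 t gx by (simp add: good_def q_def)
      next
        case False
        have "norm (z - x) < (3 * ?n + 1) * t"
          using cube_subset_ball[OF t, of x] z by (auto simp: dist_norm norm_minus_commute subset_iff)
        then have "ker_mass TYPE('a) * \<bar>w z - w x\<bar> \<le> Cpw TYPE('a) * (m z + m x) * ((3 * ?n + 1) * t)"
          using gz gx t by (intro pw_ineq[OF wg]) (auto simp: good_def m_def ennreal_enn2real_if less_top)
        then have "\<bar>w z\<bar> \<le> (Cpw TYPE('a) * (m z + m x) * ((3 * ?n + 1) * t)) / ker_mass TYPE('a)"
          using ker_mass_pos[where 'a='a] gx by (simp add: field_simps)
        also have "\<dots> = C * t * (m x * ?o z + q z)" using False by (simp add: C_def q_def algebra_simps)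
        finally show ?thesis .
      qed
      have lim0: "((\<lambda>t. mol \<zeta> w x t / t) \<longlongrightarrow> 0) (at_right 0)" if k: "kernel 1 \<zeta>" for \<zeta>
      proof (rule tendstoI)
        fix e :: real assume e: "e > 0"
        define e' where "e' = e / (2 * (C + 1) * 3 ^ DIM('a) * (m x + 1))"
        have e': "e' > 0" using e C0 gx(4) by (simp add: e'_def)
        obtain d1 where d1: "d1 > 0" and I1: "\<And>h. 0 < h \<Longrightarrow> h < d1 \<Longrightarrow> (\<integral>z. indicator (?Q h) z * \<bar>q z - q x\<bar> \<partial>lebesgue) \<le> e' * h ^ DIM('a)"
          using A e' unfolding leb_pt_def by meson
        obtain d2 where d2: "d2 > 0" and I2: "\<And>h. 0 < h \<Longrightarrow> h < d2 \<Longrightarrow> (\<integral>z. indicator (?Q h) z * \<bar>?o z - ?o x\<bar> \<partial>lebesgue) \<le> e' * h ^ DIM('a)"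
          using A e' unfolding leb_pt_def by meson
        have "dist (mol \<zeta> w x t / t) 0 < e" if t: "0 < t" "t < min d1 d2 / 3" for t
        proof -
          let ?q = "?Q (3 * t)"
          have iq: "integrable lebesgue (\<lambda>z. indicator ?q z * q z)"
            using sqi_set_integrable(2)[OF q, of ?q] by simp
          have io: "integrable lebesgue (\<lambda>z. indicator ?q z * ?o z)"
          proof -
            have eq: "(\<lambda>z. indicator ?q z * ?o z) = indicator (?q - S)" by (auto simp: fun_eq_iff indicator_def)
            have "?q - S \<in> lmeasurable" by (intro fmeasurable_Diff) auto
            then show ?thesis unfolding eq by (intro integrable_real_indicator) (auto simp: fmeasurable_def)
          qed
          have qabs: "\<bar>q z - q x\<bar> = q z" for z
          proof -
            have "q z \<ge> 0" by (simp add: q_def m_def)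
            then show ?thesis using qx(1) by simp
          qed
          have oabs: "\<bar>?o z - ?o x\<bar> = ?o z" for z using qx(2) by simp
          have J1: "(\<integral>z. indicator ?q z * q z \<partial>lebesgue) \<le> e' * (3 * t) ^ DIM('a)"
            using I1[of "3 * t"] t unfolding qabs by simp
          have J2: "(\<integral>z. indicator ?q z * ?o z \<partial>lebesgue) \<le> e' * (3 * t) ^ DIM('a)"
            using I2[of "3 * t"] t unfolding oabs by simp
          have tp: "t ^ DIM('a) > 0" using t by simp
          have "\<bar>mol \<zeta> w x t\<bar> \<le> 1 / t ^ DIM('a) * (\<integral>z. indicator ?q z * \<bar>w z\<bar> \<partial>lebesgue)"
            by (rule mol_le[OF k w t(1)])
          also have "\<dots> \<le> 1 / t ^ DIM('a) * (\<integral>z. C * t * (m x * (indicator ?q z * ?o z) + indicator ?q z * q z) \<partial>lebesgue)"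
          proof (intro mult_left_mono integral_mono_AE)
            show "integrable lebesgue (\<lambda>z. indicator ?q z * \<bar>w z\<bar>)" using sqi_set_integrable(1)[OF w, of ?q] by simp
            show "integrable lebesgue (\<lambda>z. C * t * (m x * (indicator ?q z * ?o z) + indicator ?q z * q z))"
              by (intro integrable_mult_right Bochner_Integration.integrable_add iq io)
            show "AE z in lebesgue. indicator ?q z * \<bar>w z\<bar> \<le> C * t * (m x * (indicator ?q z * ?o z) + indicator ?q z * q z)"
              using AEgood
            proof eventually_elim
              fix z assume "good z"
              then show "indicator ?q z * \<bar>w z\<bar> \<le> C * t * (m x * (indicator ?q z * ?o z) + indicator ?q z * q z)"
                using wle[OF _ t(1), of z] by (cases "z \<in> ?q") auto
            qed
          qed (use tp in auto)
          also have "(\<integral>z. C * t * (m x * (indicator ?q z * ?o z) + indicator ?q z * q z) \<partial>lebesgue)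
              = C * t * (m x * (\<integral>z. indicator ?q z * ?o z \<partial>lebesgue) + (\<integral>z. indicator ?q z * q z \<partial>lebesgue))"
            unfolding integral_mult_right_zero
            by (subst Bochner_Integration.integral_add[OF integrable_mult_right[OF io] iq]) (simp only: integral_mult_right_zero)
          also have "1 / t ^ DIM('a) * (C * t * (m x * (\<integral>z. indicator ?q z * ?o z \<partial>lebesgue) + (\<integral>z. indicator ?q z * q z \<partial>lebesgue)))
             \<le> 1 / t ^ DIM('a) * (C * t * (m x * (e' * (3 * t) ^ DIM('a)) + e' * (3 * t) ^ DIM('a)))"
            using tp C0 t gx(4) J1 J2 by (intro mult_left_mono add_mono) auto
          also have "\<dots> = t * (C * (m x + 1) * (e' * 3 ^ DIM('a)))"
            using t by (simp add: power_mult_distrib field_simps)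
          also have "C * (m x + 1) * (e' * 3 ^ DIM('a)) = e / 2 * (C / (C + 1))"
            unfolding e'_def using gx(4) by simp
          also have "t * (e / 2 * (C / (C + 1))) \<le> t * (e / 2 * 1)"
            using C0 e t by (intro mult_left_mono) auto
          finally have "\<bar>mol \<zeta> w x t\<bar> \<le> t * (e / 2)" by simp
          then have "\<bar>mol \<zeta> w x t\<bar> / t \<le> e / 2" using t by (simp add: divide_le_eq mult.commute)
          moreover have "\<bar>mol \<zeta> w x t / t\<bar> = \<bar>mol \<zeta> w x t\<bar> / t" using t by simp
          ultimately have "\<bar>mol \<zeta> w x t / t\<bar> < e" using e by linarith
          then show ?thesis by (simp add: dist_real_def)
        qed
        then show "\<forall>\<^sub>F t in at_right 0. dist (mol \<zeta> w x t / t) 0 < e"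
          using d1 d2 by (auto simp: eventually_at_right_field intro!: exI[of _ "min d1 d2 / 3"])
      qed
      \<comment> \<open>The mollification itself tends to w x = 0, and its derivative is a
        mollification of h, which converges at the Lebesgue point x.\<close>
      have lim1: "((\<lambda>t. mol \<zeta> w x t / t) \<longlongrightarrow> (\<Sum>i\<in>Basis. (h x \<bullet> i) * (\<integral>z. mker \<zeta> i z \<partial>lebesgue))) (at_right 0)" if k: "kernel 1 \<zeta>" for \<zeta>
      proof (rule lhopital_right_0[where f'="\<lambda>t. \<Sum>i\<in>Basis. mol (mker \<zeta> i) (\<lambda>z. h z \<bullet> i) x t" and g'="\<lambda>_. 1"])
        show "(mol \<zeta> w x \<longlongrightarrow> 0) (at_right 0)" using mol_tendsto[OF k w gx(1)] gx(2) by simp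
        show "((\<lambda>t::real. t) \<longlongrightarrow> 0) (at_right 0)" by (rule tendsto_ident_at)
        show "\<forall>\<^sub>F t in at_right 0. t \<noteq> (0::real)" by (auto simp: eventually_at_right_field intro!: exI[of _ 1])
        show "\<forall>\<^sub>F t in at_right 0. (mol \<zeta> w x has_real_derivative (\<Sum>i\<in>Basis. mol (mker \<zeta> i) (\<lambda>z. h z \<bullet> i) x t)) (at t)"
          using mol_DERIV[OF wg k] by (auto simp: eventually_at_right_field intro!: exI[of _ 1])
        show "((\<lambda>t. (\<Sum>i\<in>Basis. mol (mker \<zeta> i) (\<lambda>z. h z \<bullet> i) x t) / 1) \<longlongrightarrow> (\<Sum>i\<in>Basis. (h x \<bullet> i) * (\<integral>z. mker \<zeta> i z \<partial>lebesgue))) (at_right 0)"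
          unfolding div_by_1
        proof (rule tendsto_sum)
          fix i :: 'a assume i: "i \<in> Basis"
          show "((\<lambda>t. mol (mker \<zeta> i) (\<lambda>z. h z \<bullet> i) x t) \<longlongrightarrow> (h x \<bullet> i) * (\<integral>z. mker \<zeta> i z \<partial>lebesgue)) (at_right 0)"
            using mol_tendsto[OF kernel_mker[OF k i] sqi_inner[OF h, of i], of x] A i by blast
        qed
      qed auto
      have zero: "(\<Sum>i\<in>Basis. (h x \<bullet> i) * (\<integral>z. mker \<zeta> i z \<partial>lebesgue)) = 0" if "kernel 1 \<zeta>" for \<zeta>
        using tendsto_unique[OF _ lim1[OF that] lim0[OF that]] by simp
      show "h x = 0"
      proof (rule euclidean_eqI)
        fix j :: 'a assume j: "j \<in> Basis"
        have kj: "kernel 1 (\<lambda>z. std_kernel (z - j))" using j by (intro kernel_shift) (auto simp: inner_Basis)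
        \<comment> \<open>Translating the kernel by the basis vector j adds \<open>ker_mass\<close>
          to its first moment in direction j and leaves the other moments unchanged.\<close>
        have shift: "(\<integral>z. mker (\<lambda>z. std_kernel (z - j)) i z \<partial>lebesgue) = (\<integral>z. mker std_kernel i z \<partial>lebesgue) + (j \<bullet> i) * ker_mass TYPE('a)" if i: "i \<in> Basis" for i
        proof -
          have km: "mker (\<lambda>z. std_kernel (z - j)) i \<in> borel_measurable lebesgue" by (rule kernel_measurable[OF kernel_mker[OF kj i]])
          have i1: "integrable lebesgue (mker std_kernel i)" by (rule kernel_integrable[OF kernel_mker[OF kernel_std i]])
          have i2: "integrable lebesgue (\<lambda>z::'a. (j \<bullet> i) * std_kernel z)" by (intro integrable_mult_right kernel_integrable[OF kernel_std])
          have "(\<integral>z. mker (\<lambda>z. std_kernel (z - j)) i z \<partial>lebesgue) = (\<integral>z. mker (\<lambda>z. std_kernel (z - j)) i (j + 1 *\<^sub>R z) \<partial>lebesgue)"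
            by (subst integral_lebesgue_affine[OF _ km]) auto
          also have "\<dots> = (\<integral>z. mker std_kernel i z + (j \<bullet> i) * std_kernel z \<partial>lebesgue)"
            by (simp add: mker_def inner_add_left algebra_simps)
          also have "\<dots> = (\<integral>z. mker std_kernel i z \<partial>lebesgue) + (j \<bullet> i) * ker_mass TYPE('a)"
            unfolding Bochner_Integration.integral_add[OF i1 i2] by (simp add: ker_mass_def)
          finally show ?thesis .
        qed
        have "0 = (\<Sum>i\<in>Basis. (h x \<bullet> i) * (\<integral>z. mker (\<lambda>z. std_kernel (z - j)) i z \<partial>lebesgue))" using zero[OF kj] by simp
        also have "\<dots> = (\<Sum>i\<in>Basis. (h x \<bullet> i) * (\<integral>z. mker std_kernel i z \<partial>lebesgue) + (h x \<bullet> i) * ((j \<bullet> i) * ker_mass TYPE('a)))"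
          by (rule sum.cong) (auto simp: shift distrib_left)
        also have "\<dots> = (\<Sum>i\<in>Basis. (h x \<bullet> i) * ((j \<bullet> i) * ker_mass TYPE('a)))"
          unfolding sum.distrib zero[OF kernel_std] by simp
        also have "\<dots> = (\<Sum>i\<in>Basis. (h x \<bullet> i) * (j \<bullet> i)) * ker_mass TYPE('a)" by (simp add: sum_distrib_right mult.assoc)
        also have "(\<Sum>i\<in>Basis. (h x \<bullet> i) * (j \<bullet> i)) = h x \<bullet> j" by (rule euclidean_inner[symmetric])
        finally show "h x \<bullet> j = 0 \<bullet> j" using ker_mass_pos[where 'a='a] by simp
      qed
    qed
  qed
qed

lemma weak_gradient_diff:
  fixes u v :: "'a::euclidean_space \<Rightarrow> real"
  assumes "has_weak_gradient UNIV u g" "has_weak_gradient UNIV v h"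
  shows "has_weak_gradient UNIV (\<lambda>x. u x - v x) (\<lambda>x. g x - h x)"
proof -
  have s: "sqi u" "sqi g" "sqi v" "sqi h" using assms by (auto simp: has_weak_gradient_UNIV_iff)
  show ?thesis
    unfolding has_weak_gradient_UNIV_iff
  proof (intro conjI allI impI ballI sqi_diff s)
    fix \<phi> :: "'a \<Rightarrow> real" and i :: 'a assume t: "test_fun UNIV \<phi>" and i: "i \<in> Basis"
    note I = sqi_mult_integrable[OF _ sqi_test_fun(2)[OF t, of i]] sqi_mult_integrable[OF _ sqi_test_fun(1)[OF t]]
    have 1: "(\<integral>x. (u x - v x) * frechet_derivative \<phi> (at x) i \<partial>lebesgue) = (\<integral>x. u x * frechet_derivative \<phi> (at x) i \<partial>lebesgue) - (\<integral>x. v x * frechet_derivative \<phi> (at x) i \<partial>lebesgue)"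
      unfolding left_diff_distrib by (rule Bochner_Integration.integral_diff[OF I(1)[OF s(1)] I(1)[OF s(3)]])
    have 2: "(\<integral>x. (g x - h x) \<bullet> i * \<phi> x \<partial>lebesgue) = (\<integral>x. g x \<bullet> i * \<phi> x \<partial>lebesgue) - (\<integral>x. h x \<bullet> i * \<phi> x \<partial>lebesgue)"
      unfolding left_diff_distrib inner_diff_left by (rule Bochner_Integration.integral_diff[OF I(2)[OF sqi_inner[OF s(2)]] I(2)[OF sqi_inner[OF s(4)]]])
    show "(\<integral>x. (u x - v x) * frechet_derivative \<phi> (at x) i \<partial>lebesgue) = - (\<integral>x. (g x - h x) \<bullet> i * \<phi> x \<partial>lebesgue)"
      unfolding 1 2 using assms t i by (simp add: has_weak_gradient_UNIV_iff)
  qed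
qed

lemma weak_gradient_eq_on:
  fixes u v :: "'a::euclidean_space \<Rightarrow> real"
  assumes "has_weak_gradient UNIV u g" "has_weak_gradient UNIV v h" "S \<in> sets lebesgue"
    and "AE x in lebesgue. x \<in> S \<longrightarrow> u x = v x"
  shows "AE x in lebesgue. x \<in> S \<longrightarrow> g x = h x"
proof -
  have "AE x in lebesgue. x \<in> S \<longrightarrow> g x - h x = 0"
    using assms(4) by (intro weak_gradient_zero_on[OF weak_gradient_diff[OF assms(1,2)] assms(3)]) auto
  then show ?thesis by eventually_elim auto
qed

section \<open>Riesz representation on test functions, and weak gradients of Lipschitz
  functions\<close>

lemma sqn_add_scaled:
  fixes a b :: "'a::euclidean_space \<Rightarrow> real"
  assumes "sqi a" "sqi b"
  shows "sqn (\<lambda>x. a x + s * b x) = sqn a + 2 * s * (\<integral>x. a x * b x \<partial>lebesgue) + s\<^sup>2 * sqn b"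
proof -
  have i: "integrable lebesgue (\<lambda>x. (a x)\<^sup>2)" "integrable lebesgue (\<lambda>x. (b x)\<^sup>2)" "integrable lebesgue (\<lambda>x. a x * b x)"
    using assms sqi_mult_integrable[OF assms] by (auto simp: sqi_def)
  have "sqn (\<lambda>x. a x + s * b x) = (\<integral>x. ((a x)\<^sup>2 + 2 * s * (a x * b x)) + s\<^sup>2 * (b x)\<^sup>2 \<partial>lebesgue)"
    unfolding sqn_def by (rule Bochner_Integration.integral_cong) (auto simp: power2_eq_square algebra_simps)
  also have "\<dots> = (\<integral>x. (a x)\<^sup>2 + 2 * s * (a x * b x) \<partial>lebesgue) + (\<integral>x. s\<^sup>2 * (b x)\<^sup>2 \<partial>lebesgue)"
    by (rule Bochner_Integration.integral_add) (intro Bochner_Integration.integrable_add integrable_mult_right i)+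
  also have "(\<integral>x. (a x)\<^sup>2 + 2 * s * (a x * b x) \<partial>lebesgue) = (\<integral>x. (a x)\<^sup>2 \<partial>lebesgue) + (\<integral>x. 2 * s * (a x * b x) \<partial>lebesgue)"
    by (rule Bochner_Integration.integral_add) (intro integrable_mult_right i)+
  finally show ?thesis by (simp add: sqn_def)
qed

lemma ennreal_finite_ex: "(a::ennreal) \<noteq> \<infinity> \<Longrightarrow> \<exists>c. a = ennreal c \<and> c \<ge> 0"
  by (cases a) auto

text \<open>The arithmetic of a minimising sequence: the value c at the midpoint is not below the
  infimum d, so two nearly minimal values a and b force the squared distance s to be small.\<close>

lemma parallelogram_arith:
  fixes a b c d s p q :: real
  assumes "d \<le> c" "(a + b) / 2 - c = s / 8" "q \<le> p" "a < d + p" "b < d + q"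
  shows "s \<le> 8 * p"
proof -
  have "s = 4 * a + 4 * b - 8 * c" using assms(2) by (simp add: field_simps)
  then show ?thesis using assms(1,3,4,5) by linarith
qed

text \<open>The direct method: minimise \<open>sqn \<phi> / 2 - \<Lambda> \<phi>\<close> over test
  functions. The parallelogram law makes a minimising sequence Cauchy in L2, and the vanishing of
  the first variation in the limit is the representation of \<Lambda>.\<close>

lemma riesz_test_fun:
  fixes \<Lambda> :: "('a::euclidean_space \<Rightarrow> real) \<Rightarrow> real"
  assumes add: "\<And>\<phi> \<psi>. test_fun UNIV \<phi> \<Longrightarrow> test_fun UNIV \<psi> \<Longrightarrow> \<Lambda> (\<lambda>x. \<phi> x + \<psi> x) = \<Lambda> \<phi> + \<Lambda> \<psi>"
    and scale: "\<And>\<phi> c. test_fun UNIV \<phi> \<Longrightarrow> \<Lambda> (\<lambda>x. c * \<phi> x) = c * \<Lambda> \<phi>"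
    and bd: "\<And>\<phi>. test_fun UNIV \<phi> \<Longrightarrow> (\<Lambda> \<phi>)\<^sup>2 \<le> C * sqn \<phi>" and C: "C \<ge> 0"
  shows "\<exists>g. sqi g \<and> (\<forall>\<phi>. test_fun UNIV \<phi> \<longrightarrow> \<Lambda> \<phi> = (\<integral>x. g x * \<phi> x \<partial>lebesgue))"
proof -
  define T where "T = {\<phi> :: 'a \<Rightarrow> real. test_fun UNIV \<phi>}"
  define J where "J \<phi> = sqn \<phi> / 2 - \<Lambda> \<phi>" for \<phi>
  have sq: "sqi \<phi>" if "\<phi> \<in> T" for \<phi> using that sqi_test_fun(1) by (auto simp: T_def)
  have Tadd: "(\<lambda>x. \<phi> x + s * \<psi> x) \<in> T" if "\<phi> \<in> T" "\<psi> \<in> T" for \<phi> \<psi> s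
    using that by (auto simp: T_def intro!: test_fun_add test_fun_cmult)
  have \<Lambda>add: "\<Lambda> (\<lambda>x. \<phi> x + s * \<psi> x) = \<Lambda> \<phi> + s * \<Lambda> \<psi>" if "\<phi> \<in> T" "\<psi> \<in> T" for \<phi> \<psi> s
    using that add[of \<phi> "\<lambda>x. s * \<psi> x"] scale[of \<psi> s] by (auto simp: T_def test_fun_cmult)
  have Jlow: "J \<phi> \<ge> - C / 2" if "\<phi> \<in> T" for \<phi>
  proof -
    have "(\<Lambda> \<phi>)\<^sup>2 \<le> C * sqn \<phi>" using bd that by (simp add: T_def)
    then have "\<Lambda> \<phi> \<le> sqrt (C * sqn \<phi>)" by (rule real_le_rsqrt)
    then have "\<Lambda> \<phi> \<le> sqrt C * sqrt (sqn \<phi>)" by (simp only: real_sqrt_mult)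
    also have "\<dots> \<le> (C + sqn \<phi>) / 2"
      using sum_squares_bound[of "sqrt C" "sqrt (sqn \<phi>)"] C sqn_nonneg[of \<phi>] by simp
    finally show ?thesis by (simp add: J_def field_simps)
  qed
  define d where "d = Inf (J ` T)"
  have Tne: "T \<noteq> {}" using test_fun_bump by (auto simp: T_def)
  have bdd: "bdd_below (J ` T)" using Jlow by (auto intro!: bdd_belowI2[of _ "- C / 2"])
  have dle: "d \<le> J \<phi>" if "\<phi> \<in> T" for \<phi> unfolding d_def by (intro cInf_lower bdd imageI that)
  \<comment> \<open>The rate 16^-k keeps the squared consecutive differences summable even with
    weights 4^k. The sequence therefore converges almost everywhere, without passing to a
    subsequence.\<close>
  have "\<exists>\<phi>\<in>T. J \<phi> < d + (1/16) ^ k" for k :: nat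
    using cInf_lessD[of "J ` T" "d + (1/16) ^ k"] Tne by (auto simp: d_def)
  then have "\<forall>k. \<exists>\<phi>. \<phi> \<in> T \<and> J \<phi> < d + (1/16) ^ k" by blast
  from choice[OF this] obtain \<phi> where \<phi>: "\<And>k. \<phi> k \<in> T" and J\<phi>: "\<And>k. J (\<phi> k) < d + (1/16) ^ k" by blast
  have par: "sqn (\<lambda>x. \<phi> k x - \<phi> m x) \<le> 8 * (1/16) ^ k" if "k \<le> m" for k m
  proof -
    let ?a = "\<phi> k" and ?b = "\<phi> m"
    let ?c = "\<lambda>x. (1/2) * ?b x + (1/2) * ?a x"
    have hb: "(\<lambda>x. (1/2) * ?b x) \<in> T" using test_fun_cmult[of UNIV "\<phi> m" "1/2"] \<phi>[of m] unfolding T_def by blast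
    have cT: "?c \<in> T" by (rule Tadd[OF hb \<phi>])
    have sb: "sqn (\<lambda>x. (1/2) * ?b x) = sqn ?b / 4" by (simp add: sqn_def power_mult_distrib power_divide)
    have cc: "\<Lambda> ?c = (\<Lambda> ?b + \<Lambda> ?a) / 2"
      using \<Lambda>add[OF hb \<phi>, of "1/2" k] scale[of ?b "1/2"] \<phi>[of m] by (simp add: T_def)
    have I: "(\<integral>x. (1/2) * ?b x * ?a x \<partial>lebesgue) = (\<integral>x. ?a x * ?b x \<partial>lebesgue) / 2"
      by (simp add: mult.commute mult.assoc)
    have sc: "sqn ?c = sqn ?b / 4 + (\<integral>x. ?a x * ?b x \<partial>lebesgue) / 2 + sqn ?a / 4"
      unfolding sqn_add_scaled[OF sq[OF hb] sq[OF \<phi>]] sb I by (simp add: power2_eq_square)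
    have sd: "sqn (\<lambda>x. ?a x - ?b x) = sqn ?a - 2 * (\<integral>x. ?a x * ?b x \<partial>lebesgue) + sqn ?b"
      using sqn_add_scaled[OF sq[OF \<phi>[of k]] sq[OF \<phi>[of m]], of "-1"] by simp
    have "d \<le> J ?c" by (rule dle[OF cT])
    moreover have "(J ?a + J ?b) / 2 - J ?c = sqn (\<lambda>x. ?a x - ?b x) / 8"
      unfolding J_def cc sc sd by (simp add: field_simps)
    moreover have "(1/16::real) ^ m \<le> (1/16) ^ k" using that by (intro power_decreasing) auto
    ultimately show ?thesis using J\<phi>[of k] J\<phi>[of m] by (rule parallelogram_arith)
  qed
  have [measurable]: "\<phi> k \<in> borel_measurable lebesgue" for k using sq[OF \<phi>] by (rule sqi_measurable)
  define g where "g x = lim (\<lambda>k. \<phi> k x)" for x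
  have [measurable]: "g \<in> borel_measurable lebesgue" unfolding g_def by measurable
  have "AE x in lebesgue. (\<lambda>k. \<phi> k x) \<longlonglongrightarrow> g x"
  proof -
    let ?D = "\<lambda>k x. (\<phi> k x - \<phi> (Suc k) x)"
    have "(\<integral>\<^sup>+x. (\<Sum>k. ennreal (4 ^ k * (?D k x)\<^sup>2)) \<partial>lebesgue) = (\<Sum>k. \<integral>\<^sup>+x. ennreal (4 ^ k * (?D k x)\<^sup>2) \<partial>lebesgue)"
      by (rule nn_integral_suminf) measurable
    also have "\<dots> \<le> (\<Sum>k. ennreal (8 * (1/4) ^ k))"
    proof (rule suminf_le)
      fix k
      have "(\<integral>\<^sup>+x. ennreal (4 ^ k * (?D k x)\<^sup>2) \<partial>lebesgue) = ennreal (4 ^ k) * (\<integral>\<^sup>+x. ennreal ((norm (?D k x))\<^sup>2) \<partial>lebesgue)"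
      proof -
        have "(\<integral>\<^sup>+x. ennreal (4 ^ k * (?D k x)\<^sup>2) \<partial>lebesgue) = (\<integral>\<^sup>+x. ennreal (4 ^ k) * ennreal ((norm (?D k x))\<^sup>2) \<partial>lebesgue)"
          by (intro nn_integral_cong) (subst ennreal_mult[symmetric], auto)
        also have "\<dots> = ennreal (4 ^ k) * (\<integral>\<^sup>+x. ennreal ((norm (?D k x))\<^sup>2) \<partial>lebesgue)"
          by (rule nn_integral_cmult) measurable
        finally show ?thesis .
      qed
      also have "\<dots> = ennreal (4 ^ k) * ennreal (sqn (?D k))"
        by (subst nn_integral_sqn[OF sqi_diff(1)[OF sq[OF \<phi>] sq[OF \<phi>]]]) simp
      also have "\<dots> \<le> ennreal (4 ^ k) * ennreal (8 * (1/16) ^ k)"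
        using par[of k "Suc k"] by (intro mult_left_mono ennreal_leI) auto
      also have "\<dots> = ennreal (8 * (1/4) ^ k)"
      proof -
        have "(4::real) ^ k * (8 * (1/16) ^ k) = 8 * (4 * (1/16)) ^ k" by (simp only: power_mult_distrib mult.left_commute)
        then show ?thesis by (subst ennreal_mult[symmetric]) auto
      qed
      finally show "(\<integral>\<^sup>+x. ennreal (4 ^ k * (?D k x)\<^sup>2) \<partial>lebesgue) \<le> ennreal (8 * (1/4) ^ k)" .
    qed auto
    also have "\<dots> < \<infinity>"
    proof -
      have "summable (\<lambda>k. 8 * (1/4::real) ^ k)" by (intro summable_mult summable_geometric) auto
      then have "(\<Sum>k. ennreal (8 * (1/4) ^ k)) = ennreal (\<Sum>k. 8 * (1/4) ^ k)"
        by (intro suminf_ennreal_eq summable_sums) auto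
      then show ?thesis by simp
    qed
    finally have "AE x in lebesgue. (\<Sum>k. ennreal (4 ^ k * (?D k x)\<^sup>2)) \<noteq> \<infinity>"
      by (intro nn_integral_PInf_AE) auto
    then show ?thesis
    proof eventually_elim
      fix x assume fin: "(\<Sum>k. ennreal (4 ^ k * (?D k x)\<^sup>2)) \<noteq> \<infinity>"
      then obtain c where c: "(\<Sum>k. ennreal (4 ^ k * (?D k x)\<^sup>2)) = ennreal c" "c \<ge> 0"
        using ennreal_finite_ex[of "\<Sum>k. ennreal (4 ^ k * (?D k x)\<^sup>2)"] by blast
      have Dk: "\<bar>?D k x\<bar> \<le> sqrt c * (1/2) ^ k" for k
      proof -
        have "ennreal (4 ^ k * (?D k x)\<^sup>2) \<le> ennreal c" using ennreal_le_suminf[of "\<lambda>k. ennreal (4 ^ k * (?D k x)\<^sup>2)" k] c by simp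
        then have "4 ^ k * (?D k x)\<^sup>2 \<le> c" using c(2) by simp
        moreover have "(2 ^ k * \<bar>?D k x\<bar>)\<^sup>2 = 4 ^ k * (?D k x)\<^sup>2"
        proof -
          have "((2::real) ^ k)\<^sup>2 = 4 ^ k" by (simp add: power2_eq_square power_mult_distrib[symmetric])
          then show ?thesis by (simp add: power_mult_distrib)
        qed
        ultimately have "2 ^ k * \<bar>?D k x\<bar> \<le> sqrt c" by (intro real_le_rsqrt) simp
        then show ?thesis by (simp add: power_one_over field_simps)
      qed
      have "summable (\<lambda>k. ?D k x)"
      proof (rule summable_comparison_test')
        show "summable (\<lambda>k. sqrt c * (1/2::real) ^ k)" by (intro summable_mult summable_geometric) auto
        show "norm (?D k x) \<le> sqrt c * (1/2) ^ k" for k using Dk[of k] by simp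
      qed
      then have "convergent (\<lambda>K. \<Sum>k<K. ?D k x)" by (simp add: summable_iff_convergent)
      then have "convergent (\<lambda>K. \<phi> 0 x - (\<Sum>k<K. ?D k x))" by (intro convergent_diff convergent_const)
      moreover have "\<phi> 0 x - (\<Sum>k<K. ?D k x) = \<phi> K x" for K by (induction K) auto
      ultimately have "convergent (\<lambda>K. \<phi> K x)" by simp
      then show "(\<lambda>k. \<phi> k x) \<longlonglongrightarrow> g x" unfolding g_def by (simp add: convergent_LIMSEQ_iff)
    qed
  qed
  then have lim: "AE x in lebesgue. (\<lambda>k. \<phi> k x) \<longlonglongrightarrow> g x" .
  have gk: "(\<integral>\<^sup>+x. ennreal ((norm (\<phi> k x - g x))\<^sup>2) \<partial>lebesgue) \<le> ennreal (8 * (1/16) ^ k)" for k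
  proof -
    have "(\<integral>\<^sup>+x. ennreal ((norm (\<phi> k x - g x))\<^sup>2) \<partial>lebesgue) = (\<integral>\<^sup>+x. liminf (\<lambda>m. ennreal ((norm (\<phi> k x - \<phi> m x))\<^sup>2)) \<partial>lebesgue)"
    proof (rule nn_integral_cong_AE)
      show "AE x in lebesgue. ennreal ((norm (\<phi> k x - g x))\<^sup>2) = liminf (\<lambda>m. ennreal ((norm (\<phi> k x - \<phi> m x))\<^sup>2))"
        using lim
      proof eventually_elim
        fix x assume "(\<lambda>k. \<phi> k x) \<longlonglongrightarrow> g x"
        then have "(\<lambda>m. ennreal ((norm (\<phi> k x - \<phi> m x))\<^sup>2)) \<longlonglongrightarrow> ennreal ((norm (\<phi> k x - g x))\<^sup>2)"
          by (intro tendsto_ennrealI tendsto_power tendsto_norm tendsto_diff tendsto_const)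
        then show "ennreal ((norm (\<phi> k x - g x))\<^sup>2) = liminf (\<lambda>m. ennreal ((norm (\<phi> k x - \<phi> m x))\<^sup>2))"
          by (rule lim_imp_Liminf[symmetric, rotated]) simp
      qed
    qed
    also have "\<dots> \<le> liminf (\<lambda>m. \<integral>\<^sup>+x. ennreal ((norm (\<phi> k x - \<phi> m x))\<^sup>2) \<partial>lebesgue)"
      by (rule nn_integral_liminf) measurable
    also have "\<dots> \<le> ennreal (8 * (1/16) ^ k)"
    proof (rule Liminf_le)
      show "\<forall>\<^sub>F m in sequentially. (\<integral>\<^sup>+x. ennreal ((norm (\<phi> k x - \<phi> m x))\<^sup>2) \<partial>lebesgue) \<le> ennreal (8 * (1/16) ^ k)"
        unfolding eventually_sequentially
      proof (intro exI[of _ k] allI impI)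
        fix m assume "k \<le> m"
        then show "(\<integral>\<^sup>+x. ennreal ((norm (\<phi> k x - \<phi> m x))\<^sup>2) \<partial>lebesgue) \<le> ennreal (8 * (1/16) ^ k)"
          using par[of k m] by (subst nn_integral_sqn[OF sqi_diff(1)[OF sq[OF \<phi>] sq[OF \<phi>]]]) (rule ennreal_leI)
      qed
    qed simp
    finally show ?thesis .
  qed
  have sgk: "sqi (\<lambda>x. \<phi> k x - g x)" for k
    unfolding sqi_iff using gk[of k] by (auto intro: le_less_trans)
  have sgk2: "sqn (\<lambda>x. \<phi> k x - g x) \<le> 8 * (1/16) ^ k" for k
    using gk[of k] unfolding nn_integral_sqn[OF sgk] by (subst (asm) ennreal_le_iff) auto
  have g: "sqi g" using sqi_diff(1)[OF sq[OF \<phi>[of 0]] sgk[of 0]] by simp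
  have "\<Lambda> \<psi> = (\<integral>x. g x * \<psi> x \<partial>lebesgue)" if \<psi>: "test_fun UNIV \<psi>" for \<psi>
  proof -
    have \<psi>T: "\<psi> \<in> T" using \<psi> by (simp add: T_def)
    define I where "I k = (\<integral>x. \<phi> k x * \<psi> x \<partial>lebesgue)" for k
    have EL: "\<bar>I k - \<Lambda> \<psi>\<bar> \<le> (1/4) ^ k * (1 + sqn \<psi> / 2)" for k
    proof -
      have "- ((1/16) ^ k) \<le> s * (I k - \<Lambda> \<psi>) + s\<^sup>2 * sqn \<psi> / 2" for s
      proof -
        have "d \<le> J (\<lambda>x. \<phi> k x + s * \<psi> x)" by (rule dle[OF Tadd[OF \<phi> \<psi>T]])
        also have "\<dots> = J (\<phi> k) + s * (I k - \<Lambda> \<psi>) + s\<^sup>2 * sqn \<psi> / 2"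
          unfolding J_def \<Lambda>add[OF \<phi> \<psi>T] sqn_add_scaled[OF sq[OF \<phi>] sq[OF \<psi>T]] I_def by (simp add: algebra_simps)
        finally show ?thesis using J\<phi>[of k] by linarith
      qed
      \<comment> \<open>The step sizes 4^-k and -4^-k balance the defect 16^-k of minimality against
        the quadratic term.\<close>
      from this[of "(1/4)^k"] this[of "-((1/4)^k)"]
      have a: "\<bar>(1/4)^k * (I k - \<Lambda> \<psi>)\<bar> \<le> (1/16) ^ k + ((1/4)^k)\<^sup>2 * sqn \<psi> / 2" by (simp add: algebra_simps)
      define p where "p = (1/4::real)^k"
      have p: "p > 0" by (simp add: p_def)
      have pp: "(1/16) ^ k = p * p" by (simp add: p_def power_mult_distrib[symmetric])
      have "\<bar>p * (I k - \<Lambda> \<psi>)\<bar> = p * \<bar>I k - \<Lambda> \<psi>\<bar>" using p by (simp only: abs_mult abs_of_pos)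
      moreover have "\<bar>p * (I k - \<Lambda> \<psi>)\<bar> \<le> p * (p * (1 + sqn \<psi> / 2))"
        using a unfolding p_def[symmetric] pp by (simp add: power2_eq_square distrib_left)
      ultimately have "(1/4)^k * \<bar>I k - \<Lambda> \<psi>\<bar> \<le> (1/4)^k * ((1/4)^k * (1 + sqn \<psi> / 2))"
        by (simp only: p_def)
      then show ?thesis by (subst (asm) mult_le_cancel_left_pos) auto
    qed
    have GI: "(I k - (\<integral>x. g x * \<psi> x \<partial>lebesgue))\<^sup>2 \<le> 8 * (1/16) ^ k * sqn \<psi>" for k
    proof -
      have "I k - (\<integral>x. g x * \<psi> x \<partial>lebesgue) = (\<integral>x. (\<phi> k x - g x) * \<psi> x \<partial>lebesgue)"
        unfolding I_def left_diff_distrib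
        by (rule Bochner_Integration.integral_diff[symmetric]) (intro sqi_mult_integrable sq \<phi> \<psi>T g)+
      then have "\<bar>I k - (\<integral>x. g x * \<psi> x \<partial>lebesgue)\<bar> \<le> (\<integral>x. \<bar>(\<phi> k x - g x) * \<psi> x\<bar> \<partial>lebesgue)"
        by (simp only: integral_abs_bound)
      then have "\<bar>I k - (\<integral>x. g x * \<psi> x \<partial>lebesgue)\<bar>\<^sup>2 \<le> (\<integral>x. \<bar>(\<phi> k x - g x) * \<psi> x\<bar> \<partial>lebesgue)\<^sup>2"
        by (rule power_mono) simp
      also have "\<dots> \<le> sqn (\<lambda>x. \<phi> k x - g x) * sqn \<psi>" by (rule sqi_Cauchy_Schwarz[OF sgk sq[OF \<psi>T]])
      also have "\<dots> \<le> 8 * (1/16) ^ k * sqn \<psi>" by (intro mult_right_mono sgk2 sqn_nonneg)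
      finally show ?thesis by simp
    qed
    have "I \<longlonglongrightarrow> \<Lambda> \<psi>"
    proof (rule LIM_zero_cancel, rule Lim_null_comparison)
      show "\<forall>\<^sub>F k in sequentially. norm (I k - \<Lambda> \<psi>) \<le> (1/4) ^ k * (1 + sqn \<psi> / 2)" using EL by simp
      show "(\<lambda>k. (1/4) ^ k * (1 + sqn \<psi> / 2)) \<longlonglongrightarrow> 0" by (intro tendsto_mult_left_zero LIMSEQ_power_zero) simp
    qed
    moreover have "I \<longlonglongrightarrow> (\<integral>x. g x * \<psi> x \<partial>lebesgue)"
    proof (rule LIM_zero_cancel)
      have "(\<lambda>k. (I k - (\<integral>x. g x * \<psi> x \<partial>lebesgue))\<^sup>2) \<longlonglongrightarrow> 0"
      proof (rule Lim_null_comparison)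
        show "\<forall>\<^sub>F k in sequentially. norm ((I k - (\<integral>x. g x * \<psi> x \<partial>lebesgue))\<^sup>2) \<le> 8 * (1/16) ^ k * sqn \<psi>" using GI by simp
        show "(\<lambda>k. 8 * (1/16) ^ k * sqn \<psi>) \<longlonglongrightarrow> 0" by (intro tendsto_mult_left_zero tendsto_mult_right_zero LIMSEQ_power_zero) simp
      qed
      from tendsto_real_sqrt[OF this] show "(\<lambda>k. I k - (\<integral>x. g x * \<psi> x \<partial>lebesgue)) \<longlonglongrightarrow> 0"
        by (simp only: real_sqrt_abs real_sqrt_zero tendsto_rabs_zero_iff)
    qed
    ultimately show ?thesis by (rule LIMSEQ_unique)
  qed
  with g show ?thesis by blast
qed

text \<open>The difference quotient is moved from \<phi> to u by translation, where the Lipschitz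
  bound applies. Since u and its translates by less than 1 vanish off \<open>ball 0 (R + 1)\<close>,
  only that part of \<phi> enters.\<close>

lemma lipschitz_deriv_bound:
  fixes u :: "'a::euclidean_space \<Rightarrow> real"
  assumes lip: "\<And>x y. \<bar>u x - u y\<bar> \<le> L * norm (x - y)" and u: "sqi u"
    and u0: "\<And>x. norm x \<ge> R \<Longrightarrow> u x = 0" and \<phi>: "test_fun UNIV \<phi>" and i: "i \<in> Basis"
  shows "\<bar>\<integral>x. u x * frechet_derivative \<phi> (at x) i \<partial>lebesgue\<bar> \<le> L * (\<integral>x. indicator (ball 0 (R + 1)) x * \<bar>\<phi> x\<bar> \<partial>lebesgue)"
proof -
  have sm: "smooth_fun \<phi>" using \<phi> by (rule test_fun_smooth)
  have [measurable]: "u \<in> borel_measurable lebesgue" using u by (rule sqi_measurable)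
  from test_fun_cpt[OF \<phi>] obtain K where K: "compact K" "\<forall>x. x \<notin> K \<longrightarrow> \<phi> x = 0" by metis
  obtain r where r: "K \<subseteq> ball 0 r" using compact_imp_bounded[OF K(1)] bounded_subset_ballD[of K 0] by auto
  obtain b where b: "\<And>x. \<bar>frechet_derivative \<phi> (at x) i\<bar> \<le> b" using test_fun_bounded[OF test_fun_deriv[OF \<phi>, of i]] by metis
  have tr: "test_fun UNIV (\<lambda>z. \<phi> (z + s *\<^sub>R i))" for s using test_fun_affine[OF \<phi>, of 1 "s *\<^sub>R i"] by simp
  let ?F = "\<lambda>s. \<integral>z. u z * \<phi> (z + s *\<^sub>R i) \<partial>lebesgue"
  have D: "(?F has_real_derivative (\<integral>z. u z * frechet_derivative \<phi> (at (z + 0 *\<^sub>R i)) i \<partial>lebesgue)) (at 0)"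
  proof (rule DERIV_under_integral[OF u, where a="-1" and b=1 and K="ball 0 (r + 1)" and L=b
        and \<Phi>="\<lambda>s z. \<phi> (z + s *\<^sub>R i)" and \<Phi>'="\<lambda>s z. frechet_derivative \<phi> (at (z + s *\<^sub>R i)) i"])
    show "sqi (\<lambda>z. \<phi> (z + s *\<^sub>R i))" for s by (rule sqi_test_fun(1)[OF tr])
    show "(\<lambda>z. frechet_derivative \<phi> (at (z + 0 *\<^sub>R i)) i) \<in> borel_measurable lebesgue"
      using sqi_measurable[OF sqi_test_fun(2)[OF \<phi>, of i]] by simp
    show "((\<lambda>s. \<phi> (z + s *\<^sub>R i)) has_real_derivative frechet_derivative \<phi> (at (z + s *\<^sub>R i)) i) (at s)" for s z
    proof -
      have "((\<lambda>s. z + s *\<^sub>R i) has_derivative (\<lambda>h. h *\<^sub>R i)) (at s)" by (auto intro!: derivative_eq_intros)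
      from diff_chain_at[OF this smooth_fun_has_derivative[OF sm]]
      have "((\<lambda>s. \<phi> (z + s *\<^sub>R i)) has_derivative (\<lambda>h. frechet_derivative \<phi> (at (z + s *\<^sub>R i)) (h *\<^sub>R i))) (at s)" by (simp add: o_def)
      moreover have "(\<lambda>h. frechet_derivative \<phi> (at (z + s *\<^sub>R i)) (h *\<^sub>R i)) = (*) (frechet_derivative \<phi> (at (z + s *\<^sub>R i)) i)"
        using linear_cmul[OF has_derivative_linear[OF smooth_fun_has_derivative[OF sm]]] by (auto simp: fun_eq_iff)
      ultimately show ?thesis by (simp only: has_field_derivative_def)
    qed
    show "\<bar>frechet_derivative \<phi> (at (z + s *\<^sub>R i)) i\<bar> \<le> b" for s z by (rule b)
    show "\<phi> (z + s *\<^sub>R i) = 0" if s: "s \<in> {-1<..<1}" and z: "z \<notin> ball 0 (r + 1)" for s z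
    proof -
      have "norm z \<le> norm (z + s *\<^sub>R i) + norm (s *\<^sub>R i)" by (metis add_diff_cancel_right' norm_triangle_ineq4)
      then have "norm (z + s *\<^sub>R i) \<ge> r" using z s i by auto
      then have "z + s *\<^sub>R i \<notin> K" using r by force
      then show ?thesis using K(2) by blast
    qed
  qed auto
  let ?I = "\<integral>x. indicator (ball 0 (R + 1)) x * \<bar>\<phi> x\<bar> \<partial>lebesgue"
  have L0: "L \<ge> 0" using lip[of 0 i] i by auto
  have intI: "integrable lebesgue (\<lambda>x. indicator (ball 0 (R + 1)) x * \<bar>\<phi> x\<bar>)"
    using sqi_set_integrable(1)[OF sqi_test_fun(1)[OF \<phi>], of "ball 0 (R + 1)"] by simp
  have Q: "\<bar>?F s - ?F 0\<bar> \<le> L * ?I * \<bar>s\<bar>" if s: "\<bar>s\<bar> < 1" for s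
  proof -
    have su: "sqi (\<lambda>z. u (z - s *\<^sub>R i))"
    proof -
      have m: "(\<lambda>z. u (- (s *\<^sub>R i) + 1 *\<^sub>R z)) \<in> borel_measurable lebesgue" by (rule borel_measurable_lebesgue_affine) auto
      have "integrable lebesgue (\<lambda>z. (\<lambda>z. (norm (u z))\<^sup>2) (- (s *\<^sub>R i) + 1 *\<^sub>R z))"
        by (rule integrable_lebesgue_affine) (use u in \<open>auto simp: sqi_def\<close>)
      with m show ?thesis by (simp add: sqi_def algebra_simps)
    qed
    have [measurable]: "\<phi> \<in> borel_measurable lebesgue" by (rule sqi_measurable[OF sqi_test_fun(1)[OF \<phi>]])
    have [measurable]: "(\<lambda>z. u (z - s *\<^sub>R i)) \<in> borel_measurable lebesgue" by (rule sqi_measurable[OF su])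
    have "?F s = (\<integral>z. u ((s *\<^sub>R i + 1 *\<^sub>R z) - s *\<^sub>R i) * \<phi> (s *\<^sub>R i + 1 *\<^sub>R z) \<partial>lebesgue)" by (simp add: add.commute)
    also have "\<dots> = (\<integral>z. u (z - s *\<^sub>R i) * \<phi> z \<partial>lebesgue)"
      by (subst integral_lebesgue_affine[where f="\<lambda>z. u (z - s *\<^sub>R i) * \<phi> z"]) auto
    finally have "?F s - ?F 0 = (\<integral>z. u (z - s *\<^sub>R i) * \<phi> z - u z * \<phi> z \<partial>lebesgue)"
      by (subst Bochner_Integration.integral_diff) (auto intro!: sqi_mult_integrable su u sqi_test_fun(1)[OF \<phi>])
    also have "\<bar>\<dots>\<bar> \<le> (\<integral>z. (L * \<bar>s\<bar>) * (indicator (ball 0 (R + 1)) z * \<bar>\<phi> z\<bar>) \<partial>lebesgue)"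
    proof (rule integral_abs_bound[THEN order_trans], rule integral_mono)
      show "integrable lebesgue (\<lambda>z. \<bar>u (z - s *\<^sub>R i) * \<phi> z - u z * \<phi> z\<bar>)"
        by (intro integrable_abs Bochner_Integration.integrable_diff sqi_mult_integrable su u sqi_test_fun(1)[OF \<phi>])
      show "integrable lebesgue (\<lambda>z. (L * \<bar>s\<bar>) * (indicator (ball 0 (R + 1)) z * \<bar>\<phi> z\<bar>))" by (intro integrable_mult_right intI)
      show "\<bar>u (z - s *\<^sub>R i) * \<phi> z - u z * \<phi> z\<bar> \<le> (L * \<bar>s\<bar>) * (indicator (ball 0 (R + 1)) z * \<bar>\<phi> z\<bar>)" for z
      proof (cases "z \<in> ball 0 (R + 1)")
        case True
        have "\<bar>u (z - s *\<^sub>R i) - u z\<bar> \<le> L * \<bar>s\<bar>" using lip[of "z - s *\<^sub>R i" z] i by simp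
        then have "\<bar>u (z - s *\<^sub>R i) - u z\<bar> * \<bar>\<phi> z\<bar> \<le> L * \<bar>s\<bar> * \<bar>\<phi> z\<bar>" by (intro mult_right_mono) auto
        then show ?thesis using True by (simp add: left_diff_distrib[symmetric] abs_mult)
      next
        case False
        have "norm z \<le> norm (z - s *\<^sub>R i) + norm (s *\<^sub>R i)" by (metis diff_add_cancel norm_triangle_ineq)
        then have "norm (z - s *\<^sub>R i) \<ge> R" "norm z \<ge> R" using False s i by auto
        then show ?thesis using u0 L0 by simp
      qed
    qed
    also have "\<dots> = L * ?I * \<bar>s\<bar>" by simp
    finally show ?thesis .
  qed
  have "((\<lambda>s. (?F s - ?F 0) / s) \<longlongrightarrow> (\<integral>z. u z * frechet_derivative \<phi> (at z) i \<partial>lebesgue)) (at 0)"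
    using D by (simp add: has_field_derivative_iff)
  then have "((\<lambda>s. \<bar>(?F s - ?F 0) / s\<bar>) \<longlongrightarrow> \<bar>\<integral>z. u z * frechet_derivative \<phi> (at z) i \<partial>lebesgue\<bar>) (at 0)"
    by (rule tendsto_rabs)
  moreover have "\<forall>\<^sub>F s in at 0. \<bar>(?F s - ?F 0) / s\<bar> \<le> L * ?I"
  proof -
    have "\<bar>(?F s - ?F 0) / s\<bar> \<le> L * ?I" if "s \<noteq> 0" "\<bar>s\<bar> < 1" for s
      using Q[OF that(2)] that(1) by (simp add: abs_divide divide_le_eq)
    then show ?thesis unfolding eventually_at by (intro exI[of _ 1]) (auto simp: dist_real_def)
  qed
  ultimately show ?thesis by (rule tendsto_upperbound) simp
qed

text \<open>By \<open>lipschitz_deriv_bound\<close> and Cauchy-Schwarz the distributional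
  derivatives are bounded functionals in L2, so Riesz represents them. Testing with nonnegative
  functions bounds each coordinate by L almost everywhere; summing the coordinates costs the
  dimension.\<close>

lemma lipschitz_has_weak_gradient:
  fixes u :: "'a::euclidean_space \<Rightarrow> real" and L R :: real
  assumes lip: "\<And>x y. \<bar>u x - u y\<bar> \<le> L * norm (x - y)" and R: "R > 0"
    and u0: "\<And>x. norm x \<ge> R \<Longrightarrow> u x = 0"
  shows "\<exists>g. has_weak_gradient UNIV u g \<and> (AE x in lebesgue. norm (g x) \<le> real DIM('a) * L)"
proof -
  obtain b :: 'a where b: "b \<in> Basis" using nonempty_Basis by blast
  have L0: "L \<ge> 0" using lip[of 0 b] b by auto
  have "continuous_on UNIV u"
  proof (rule continuous_on_iff[THEN iffD2], intro ballI allI impI)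
    fix x :: 'a and e :: real assume e: "e > 0"
    have "dist (u y) (u x) < e" if "dist y x < e / (L + 1)" for y
    proof -
      have "dist (u y) (u x) \<le> L * norm (y - x)" using lip[of y x] by (simp add: dist_real_def)
      also have "\<dots> \<le> (L + 1) * norm (y - x)" by (intro mult_right_mono) auto
      also have "\<dots> < e" using that L0 by (simp add: dist_norm field_simps)
      finally show ?thesis .
    qed
    then show "\<exists>d>0. \<forall>y\<in>UNIV. dist y x < d \<longrightarrow> dist (u y) (u x) < e"
      using e L0 by (intro exI[of _ "e / (L + 1)"]) auto
  qed
  then have um: "u \<in> borel_measurable lebesgue" by (rule borel_measurable_continuous_lebesgue)
  have u: "sqi u"
  proof (rule sqi_if_bounded_support[OF um, of "ball 0 R"])
    show "u x = 0" if "x \<notin> ball 0 R" for x using that u0 by simp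
    show "norm (u x) \<le> L * (2 * R)" for x
    proof (cases "norm x < R")
      case True
      have "\<bar>u x - u (R *\<^sub>R b)\<bar> \<le> L * norm (x - R *\<^sub>R b)" by (rule lip)
      also have "\<dots> \<le> L * (2 * R)"
        using True R b norm_triangle_ineq4[of x "R *\<^sub>R b"] L0 by (intro mult_left_mono) auto
      finally show ?thesis using u0[of "R *\<^sub>R b"] R b by simp
    next
      case False
      then show ?thesis using u0 L0 R by simp
    qed
  qed auto
  have "\<exists>g. sqi g \<and> (\<forall>\<phi>. test_fun UNIV \<phi> \<longrightarrow> - (\<integral>x. u x * frechet_derivative \<phi> (at x) i \<partial>lebesgue) = (\<integral>x. g x * \<phi> x \<partial>lebesgue))" if i: "i \<in> Basis" for i
  proof (rule riesz_test_fun)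
    fix \<phi> :: "'a \<Rightarrow> real" assume \<phi>: "test_fun UNIV \<phi>"
    note I = sqi_mult_integrable[OF u sqi_test_fun(2)]
    show "- (\<integral>x. u x * frechet_derivative (\<lambda>x. \<phi> x + \<psi> x) (at x) i \<partial>lebesgue) = - (\<integral>x. u x * frechet_derivative \<phi> (at x) i \<partial>lebesgue) + - (\<integral>x. u x * frechet_derivative \<psi> (at x) i \<partial>lebesgue)"
      if \<psi>: "test_fun UNIV \<psi>" for \<psi>
      unfolding frechet_derivative_add_smooth[OF test_fun_smooth[OF \<phi>] test_fun_smooth[OF \<psi>]] distrib_left
      by (subst Bochner_Integration.integral_add[OF I[OF \<phi>] I[OF \<psi>]]) simp
    show "- (\<integral>x. u x * frechet_derivative (\<lambda>x. c * \<phi> x) (at x) i \<partial>lebesgue) = c * - (\<integral>x. u x * frechet_derivative \<phi> (at x) i \<partial>lebesgue)" for c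
      unfolding frechet_derivative_cmult_smooth[OF test_fun_smooth[OF \<phi>]] by (simp add: mult.left_commute[of _ c])
    have "\<bar>\<integral>x. u x * frechet_derivative \<phi> (at x) i \<partial>lebesgue\<bar> \<le> L * (\<integral>x. indicator (ball 0 (R + 1)) x * \<bar>\<phi> x\<bar> \<partial>lebesgue)"
      by (rule lipschitz_deriv_bound[OF lip u u0 \<phi> i])
    then have "\<bar>\<integral>x. u x * frechet_derivative \<phi> (at x) i \<partial>lebesgue\<bar>\<^sup>2 \<le> (L * (\<integral>x. indicator (ball 0 (R + 1)) x * \<bar>\<phi> x\<bar> \<partial>lebesgue))\<^sup>2"
      by (rule power_mono) simp
    also have "\<dots> \<le> L\<^sup>2 * (measure lebesgue (ball (0::'a) (R + 1)) * sqn \<phi>)"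
      unfolding power_mult_distrib
      using sqi_set_integrable(3)[OF sqi_test_fun(1)[OF \<phi>], of "ball 0 (R + 1)"] by (intro mult_left_mono) auto
    finally show "(- (\<integral>x. u x * frechet_derivative \<phi> (at x) i \<partial>lebesgue))\<^sup>2 \<le> (L\<^sup>2 * measure lebesgue (ball (0::'a) (R + 1))) * sqn \<phi>"
      by (simp add: mult.assoc)
  qed simp
  then have "\<forall>i. \<exists>g. i \<in> Basis \<longrightarrow> sqi g \<and> (\<forall>\<phi>. test_fun UNIV \<phi> \<longrightarrow> - (\<integral>x. u x * frechet_derivative \<phi> (at x) i \<partial>lebesgue) = (\<integral>x. g x * \<phi> x \<partial>lebesgue))" by blast
  from choice[OF this] obtain G where G: "\<And>i. i \<in> Basis \<Longrightarrow> sqi (G i)"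
    and Geq: "\<And>i \<phi>. i \<in> Basis \<Longrightarrow> test_fun UNIV \<phi> \<Longrightarrow> - (\<integral>x. u x * frechet_derivative \<phi> (at x) i \<partial>lebesgue) = (\<integral>x. G i x * \<phi> x \<partial>lebesgue)" by blast
  have bnd: "(\<integral>x. c * G i x * \<phi> x \<partial>lebesgue) \<le> L * (\<integral>x. \<phi> x \<partial>lebesgue)" if i: "i \<in> Basis" and \<phi>: "test_fun UNIV \<phi>" and p: "\<And>x. \<phi> x \<ge> 0" and c: "c = 1 \<or> c = -1" for i \<phi> c
  proof -
    have s\<phi>: "sqi \<phi>" by (rule sqi_test_fun(1)[OF \<phi>])
    from test_fun_cpt[OF \<phi>] obtain K where K: "compact K" "\<forall>x. x \<notin> K \<longrightarrow> \<phi> x = 0" by metis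
    have int\<phi>: "integrable lebesgue \<phi>"
    proof -
      have "(\<lambda>x. indicator K x *\<^sub>R \<phi> x) = \<phi>" using K(2) by (auto simp: fun_eq_iff indicator_def)
      then show ?thesis using sqi_set_integrable(2)[OF s\<phi> lmeasurable_compact[OF K(1)]] by simp
    qed
    have "(\<integral>x. c * G i x * \<phi> x \<partial>lebesgue) = c * (\<integral>x. G i x * \<phi> x \<partial>lebesgue)" by (simp add: mult.assoc)
    also have "\<dots> \<le> \<bar>\<integral>x. u x * frechet_derivative \<phi> (at x) i \<partial>lebesgue\<bar>" using Geq[OF i \<phi>] c by auto
    also have "\<dots> \<le> L * (\<integral>x. indicator (ball 0 (R + 1)) x * \<bar>\<phi> x\<bar> \<partial>lebesgue)"
      by (rule lipschitz_deriv_bound[OF lip u u0 \<phi> i])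
    also have "\<dots> \<le> L * (\<integral>x. \<phi> x \<partial>lebesgue)"
    proof (intro mult_left_mono L0 integral_mono)
      show "integrable lebesgue (\<lambda>x. indicator (ball 0 (R + 1)) x * \<bar>\<phi> x\<bar>)" using sqi_set_integrable(1)[OF s\<phi>, of "ball 0 (R + 1)"] by simp
      show "indicator (ball 0 (R + 1)) x * \<bar>\<phi> x\<bar> \<le> \<phi> x" for x using p[of x] by (auto simp: indicator_def)
    qed (rule int\<phi>)
    finally show ?thesis .
  qed
  have Gle: "AE x in lebesgue. \<bar>G i x\<bar> \<le> L" if i: "i \<in> Basis" for i
  proof -
    have "AE x in lebesgue. x \<in> UNIV \<longrightarrow> 1 * G i x \<le> L"
      using bnd[OF i, of _ 1] sqi_cmult[OF G[OF i], of 1] by (intro AE_le_if_test_le) auto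
    moreover have "AE x in lebesgue. x \<in> UNIV \<longrightarrow> (-1) * G i x \<le> L"
      using bnd[OF i, of _ "-1"] sqi_cmult[OF G[OF i], of "-1"] by (intro AE_le_if_test_le) auto
    ultimately show ?thesis by eventually_elim auto
  qed
  define g where "g x = (\<Sum>i\<in>Basis. G i x *\<^sub>R i)" for x
  have gi: "g x \<bullet> i = G i x" if "i \<in> Basis" for x i using that by (simp add: g_def inner_sum_left_Basis)
  have gle: "norm (g x) \<le> (\<Sum>i\<in>Basis. \<bar>G i x\<bar>)" for x
    using norm_le_l1[of "g x"] gi by simp
  have gm: "g \<in> borel_measurable lebesgue"
    unfolding g_def using sqi_measurable[OF G] by measurable
  have sG: "sqi (\<lambda>x. \<Sum>i\<in>I. \<bar>G i x\<bar>)" if "I \<subseteq> Basis" for I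
    using finite_subset[OF that finite_Basis] that
  proof (induction I rule: finite_induct)
    case empty
    then show ?case by (simp add: sqi_def)
  next
    case (insert i I)
    have "sqi (\<lambda>x. \<bar>G i x\<bar>)" using sqi_norm[OF G[of i]] insert.prems by simp
    from sqi_add(1)[OF this insert.IH] insert show ?case by auto
  qed
  have sg: "sqi g"
    by (rule sqi_bound(1)[OF gm sG[OF order_refl]]) (use gle in \<open>auto intro!: always_eventually order_trans[OF gle]\<close>)
  have "has_weak_gradient UNIV u g"
    unfolding has_weak_gradient_UNIV_iff
  proof (intro conjI allI impI ballI u sg)
    fix \<phi> :: "'a \<Rightarrow> real" and i :: 'a assume t: "test_fun UNIV \<phi>" and i: "i \<in> Basis"
    show "(\<integral>x. u x * frechet_derivative \<phi> (at x) i \<partial>lebesgue) = - (\<integral>x. (g x \<bullet> i) * \<phi> x \<partial>lebesgue)"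
      using Geq[OF i t] by (simp add: gi[OF i])
  qed
  moreover have "AE x in lebesgue. norm (g x) \<le> real DIM('a) * L"
  proof -
    have "AE x in lebesgue. \<forall>i\<in>Basis. \<bar>G i x\<bar> \<le> L" by (intro AE_finite_allI Gle) auto
    then show ?thesis
    proof eventually_elim
      fix x assume "\<forall>i\<in>Basis. \<bar>G i x\<bar> \<le> L"
      then have "(\<Sum>i\<in>Basis. \<bar>G i x\<bar>) \<le> (\<Sum>i\<in>(Basis::'a set). L)" by (intro sum_mono) auto
      with gle[of x] show "norm (g x) \<le> real DIM('a) * L" by simp
    qed
  qed
  ultimately show ?thesis by blast
qed

section \<open>Lipschitz truncation and the extension property\<close>

text \<open>The extension is the lower envelope of the cones of slope L that stand on the graph of f
  over S.\<close>

lemma McShane_extension: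
  fixes f :: "'a::real_normed_vector \<Rightarrow> real"
  assumes S: "S \<noteq> {}" and L: "L \<ge> 0"
    and lip: "\<And>x y. x \<in> S \<Longrightarrow> y \<in> S \<Longrightarrow> \<bar>f x - f y\<bar> \<le> L * norm (x - y)"
  obtains F where "\<And>x. x \<in> S \<Longrightarrow> F x = f x" "\<And>x y. \<bar>F x - F y\<bar> \<le> L * norm (x - y)"
proof -
  define F where "F x = (INF y\<in>S. f y + L * norm (x - y))" for x
  obtain y0 where y0: "y0 \<in> S" using S by blast
  have low: "f y0 - L * norm (x - y0) \<le> f y + L * norm (x - y)" if y: "y \<in> S" for x y
  proof -
    have "f y0 - f y \<le> L * norm (y0 - y)" using lip[OF y0 y] by linarith
    also have "\<dots> \<le> L * (norm (x - y0) + norm (x - y))"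
      using L norm_triangle_ineq4[of "x - y" "x - y0"] by (intro mult_left_mono) (auto simp: algebra_simps)
    finally show ?thesis by (simp add: algebra_simps)
  qed
  have bdd: "bdd_below ((\<lambda>y. f y + L * norm (x - y)) ` S)" for x
    using low by (auto intro!: bdd_belowI2[of _ "f y0 - L * norm (x - y0)"])
  have one: "F x \<le> F x' + L * norm (x - x')" for x x'
  proof -
    have "F x - L * norm (x - x') \<le> F x'"
      unfolding F_def[of x']
    proof (rule cINF_greatest[OF S])
      fix y assume y: "y \<in> S"
      have "F x \<le> f y + L * norm (x - y)" unfolding F_def by (rule cINF_lower[OF bdd y])
      also have "\<dots> \<le> f y + L * (norm (x - x') + norm (x' - y))"
        using L norm_triangle_ineq[of "x - x'" "x' - y"] by (intro add_left_mono mult_left_mono) auto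
      finally show "F x - L * norm (x - x') \<le> f y + L * norm (x' - y)" by (simp add: algebra_simps)
    qed
    then show ?thesis by simp
  qed
  show thesis
  proof (rule that[of F])
    fix x assume x: "x \<in> S"
    have "F x \<le> f x" using cINF_lower[OF bdd x, of x] by (simp add: F_def)
    moreover have "f x \<le> F x"
      unfolding F_def
    proof (rule cINF_greatest[OF S])
      fix y assume "y \<in> S"
      then show "f x \<le> f y + L * norm (x - y)" using lip[OF x, of y] by linarith
    qed
    ultimately show "F x = f x" by simp
  next
    fix x y
    show "\<bar>F x - F y\<bar> \<le> L * norm (x - y)"
      using one[of x y] one[of y x] by (simp add: norm_minus_commute abs_le_iff)
  qed
qed

text \<open>A ball cannot be covered by a null set and a set of smaller measure. It is used to find
  good points at a controlled distance from bad ones.\<close>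

lemma AE_ball_ex:
  fixes y :: "'a::euclidean_space"
  assumes P: "AE x in lebesgue. P x" and B: "B \<in> sets lebesgue" "emeasure lebesgue B \<le> ennreal b"
    and \<rho>: "\<rho> > 0" "b < ubv TYPE('a) * \<rho> ^ DIM('a)" and b: "b \<ge> 0"
  shows "\<exists>z\<in>ball y \<rho>. P z \<and> z \<notin> B"
proof (rule ccontr)
  assume neg: "\<not> ?thesis"
  obtain N where N: "N \<in> null_sets lebesgue" "{x. \<not> P x} \<subseteq> N"
    using P unfolding eventually_ae_filter by auto
  have "ball y \<rho> \<subseteq> B \<union> N" using neg N(2) by blast
  then have "emeasure lebesgue (ball y \<rho>) \<le> emeasure lebesgue (B \<union> N)"
    using B N(1) by (intro emeasure_mono) auto
  also have "\<dots> = emeasure lebesgue B" by (rule emeasure_Un_null_set[OF B(1) N(1)])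
  also have "\<dots> \<le> ennreal b" by (rule B(2))
  finally have "ennreal (ubv TYPE('a) * \<rho> ^ DIM('a)) \<le> ennreal b" using \<rho> by (subst (asm) emeasure_ball_ubv) auto
  then show False using \<rho> b by (subst (asm) ennreal_le_iff) auto
qed

text \<open>The Lipschitz constant given by \<open>pw_ineq\<close> where the maximal function is at
  most 1; both points contribute, hence the 2.\<close>

definition Clip :: "'a::euclidean_space itself \<Rightarrow> real" where
  "Clip _ = 2 * Cpw TYPE('a) / ker_mass TYPE('a)"

lemma Clip_pos: "Clip TYPE('a::euclidean_space) > 0"
  using ker_mass_pos[where 'a='a] by (simp add: Clip_def Cpw_def add_pos_nonneg)

text \<open>Balls of radius at most 1 around x miss the support of g. For larger radii
  Cauchy-Schwarz produces sqrt(r^n), which is at most r^n.\<close>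

lemma MG_le_outside:
  fixes g :: "'a::euclidean_space \<Rightarrow> 'a"
  assumes g: "sqi g" and g0: "AE x in lebesgue. x \<in> - ball 0 R \<longrightarrow> g x = 0" and x: "norm x > R + 1"
  shows "MG g x \<le> ennreal (sqrt (ubv TYPE('a) * sqn g))"
  unfolding MG_def
proof (rule Mx_le)
  fix r :: real assume r: "r > 0"
  let ?c = "sqrt (ubv TYPE('a) * sqn g)"
  have c0: "?c \<ge> 0" using ubv_pos[where 'a='a] sqn_nonneg[of g] by simp
  show "(\<integral>\<^sup>+z\<in>ball x r. ennreal (norm (g z)) \<partial>lebesgue) \<le> ennreal ?c * ennreal (r ^ DIM('a))"
  proof (cases "r \<le> 1")
    case True
    have sub: "z \<in> - ball 0 R" if "z \<in> ball x r" for z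
    proof -
      have "norm x \<le> norm z + dist x z" by (simp add: dist_norm norm_triangle_sub)
      then show ?thesis using that x True by auto
    qed
    have "(\<integral>\<^sup>+z\<in>ball x r. ennreal (norm (g z)) \<partial>lebesgue) = (\<integral>\<^sup>+z. 0 \<partial>(lebesgue :: 'a measure))"
    proof (rule nn_integral_cong_AE)
      show "AE z in lebesgue. ennreal (norm (g z)) * indicator (ball x r) z = 0"
        using g0
      proof eventually_elim
        fix z assume "z \<in> - ball 0 R \<longrightarrow> g z = 0"
        then show "ennreal (norm (g z)) * indicator (ball x r) z = 0"
          using sub[of z] by (cases "z \<in> ball x r") auto
      qed
    qed
    then show ?thesis by simp
  next
    case False
    let ?I = "\<integral>z. indicator (ball x r) z * norm (g z) \<partial>lebesgue"
    have "?I\<^sup>2 \<le> measure lebesgue (ball x r) * sqn g" by (intro sqi_set_integrable(3)[OF g] lmeasurable_ball)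
    also have "\<dots> = ubv TYPE('a) * sqn g * r ^ DIM('a)" using r by (subst measure_ball_ubv) auto
    finally have "?I \<le> sqrt (ubv TYPE('a) * sqn g * r ^ DIM('a))" by (rule real_le_rsqrt)
    also have "\<dots> = ?c * sqrt (r ^ DIM('a))" by (simp only: real_sqrt_mult)
    also have "\<dots> \<le> ?c * r ^ DIM('a)"
    proof (rule mult_left_mono[OF _ c0])
      have r1: "r ^ DIM('a) \<ge> 1" using False by simp
      have "sqrt (r ^ DIM('a)) \<le> sqrt ((r ^ DIM('a))\<^sup>2)"
        using mult_left_mono[OF r1, of "r ^ DIM('a)"] r by (intro real_sqrt_le_mono) (simp add: power2_eq_square)
      then show "sqrt (r ^ DIM('a)) \<le> r ^ DIM('a)" using r by simp
    qed
    finally have I: "?I \<le> ?c * r ^ DIM('a)" .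
    have "(\<integral>\<^sup>+z\<in>ball x r. ennreal (norm (g z)) \<partial>lebesgue) = (\<integral>\<^sup>+z. ennreal (indicator (ball x r) z * norm (g z)) \<partial>lebesgue)"
      by (intro nn_integral_cong) (auto simp: indicator_def)
    also have "\<dots> = ennreal ?I"
      by (rule nn_integral_eq_integral) (auto intro!: sqi_set_integrable(1)[OF g])
    also have "\<dots> \<le> ennreal (?c * r ^ DIM('a))" by (rule ennreal_leI[OF I])
    also have "\<dots> = ennreal ?c * ennreal (r ^ DIM('a))" using c0 r by (intro ennreal_mult) auto
    finally show ?thesis .
  qed
qed

text \<open>A discrete version of the Fonseca--Mueller--Pedregal decomposition: among \<open>N\<close> dyadic
  truncation levels one has a bad set whose contribution to the energy is of order \<open>1/N\<close>.\<close>
lemma lipschitz_truncation: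
  fixes f :: "'a::euclidean_space \<Rightarrow> real"
  assumes wg: "has_weak_gradient UNIV f g" and N: "N \<ge> 1" and f0: "\<And>x. norm x \<ge> R \<Longrightarrow> f x = 0"
    and big: "ubv TYPE('a) * sqn g \<le> 4 ^ N"
  shows "\<exists>j F B. N \<le> j \<and> j < 2 * N \<and> B \<in> sets lebesgue
     \<and> ennreal (4 ^ j) * emeasure lebesgue B \<le> ennreal (Cmax TYPE('a) * sqn g / N)
     \<and> (\<forall>x y. \<bar>F x - F y\<bar> \<le> (Clip TYPE('a) * 2 ^ j) * norm (x - y))
     \<and> (\<forall>x. norm x \<ge> R + 2 \<longrightarrow> F x = 0)
     \<and> (AE x in lebesgue. x \<notin> B \<longrightarrow> F x = f x)
     \<and> (\<forall>\<rho>>0. Cmax TYPE('a) * sqn g / N < ubv TYPE('a) * \<rho> ^ DIM('a) \<longrightarrow>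
          sqi (\<lambda>x. F x - f x) \<and> sqn (\<lambda>x. F x - f x) \<le> (2 * Clip TYPE('a) * \<rho>)\<^sup>2 * (Cmax TYPE('a) * sqn g))"
proof -
  have f: "sqi f" and g: "sqi g" using wg by (auto simp: has_weak_gradient_UNIV_iff)
  obtain j where j: "N \<le> j" "j < 2 * N"
    and small: "ennreal (4 ^ j) * emeasure lebesgue {x. ennreal (2 ^ j) < MG g x} \<le> ennreal (Cmax TYPE('a) * sqn g / N)"
    using MG_pigeonhole[OF g N] by blast
  define B where "B = {x. ennreal (2 ^ j) < MG g x}"
  let ?b = "Cmax TYPE('a) * sqn g / N"
  have b0: "?b \<ge> 0" using Cmax_pos[where 'a='a] sqn_nonneg[of g] by simp
  have Bm: "B \<in> sets lebesgue" unfolding B_def using open_MG[of "2 ^ j" g] by auto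
  have Bb: "emeasure lebesgue B \<le> ennreal ?b"
  proof -
    have "1 * emeasure lebesgue B \<le> ennreal (4 ^ j) * emeasure lebesgue B"
      by (intro mult_right_mono) (auto simp: ennreal_ge_1)
    also have "\<dots> \<le> ennreal ?b" using small by (simp add: B_def)
    finally show ?thesis by simp
  qed
  define Gd where "Gd = {x. leb_pt f x \<and> x \<notin> B}"
  have Gd: "leb_pt f x" "MG g x \<le> ennreal (2 ^ j)" if "x \<in> Gd" for x using that by (auto simp: Gd_def B_def)
  let ?L = "Clip TYPE('a) * 2 ^ j"
  have L0: "?L \<ge> 0" using Clip_pos[where 'a='a] by simp
  have k0: "ker_mass TYPE('a) > 0" by (rule ker_mass_pos)
  have near: "\<exists>z\<in>ball y \<rho>. z \<in> Gd" if "\<rho> > 0" "?b < ubv TYPE('a) * \<rho> ^ DIM('a)" for y \<rho>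
    using AE_ball_ex[OF AE_leb_pt_sqi[OF f] Bm Bb that b0, of y] by (auto simp: Gd_def)
  have "Gd \<noteq> {}"
  proof -
    \<comment> \<open>The summand 1 makes \<rho> \<ge> 1, so that \<rho>^n \<ge> \<rho> and the ball
      outweighs the bad set.\<close>
    define \<rho> where "\<rho> = ?b / ubv TYPE('a) + 1"
    have r: "\<rho> \<ge> 1" using divide_nonneg_pos[OF b0 ubv_pos[where 'a='a]] by (simp add: \<rho>_def)
    have "\<rho> \<le> \<rho> ^ DIM('a)" using r by (intro self_le_power) auto
    then have "ubv TYPE('a) * \<rho> \<le> ubv TYPE('a) * \<rho> ^ DIM('a)" using ubv_pos[where 'a='a] by (intro mult_left_mono) auto
    moreover have "?b < ubv TYPE('a) * \<rho>" using ubv_pos[where 'a='a] by (simp add: \<rho>_def field_simps)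
    ultimately have "?b < ubv TYPE('a) * \<rho> ^ DIM('a)" by linarith
    then show ?thesis using near[of \<rho> 0] r by auto
  qed
  moreover have "\<bar>f x - f y\<bar> \<le> ?L * norm (x - y)" if xy: "x \<in> Gd" "y \<in> Gd" for x y
  proof (cases "x = y")
    case False
    have "ker_mass TYPE('a) * \<bar>f x - f y\<bar> \<le> Cpw TYPE('a) * (2 ^ j + 2 ^ j) * norm (x - y)"
      using False by (intro pw_ineq[OF wg Gd(1)[OF xy(1)] Gd(1)[OF xy(2)] _ _ Gd(2)[OF xy(1)] _ Gd(2)[OF xy(2)]]) auto
    then show ?thesis using k0 by (simp add: Clip_def field_simps)
  qed simp
  ultimately obtain F where F: "\<And>x. x \<in> Gd \<Longrightarrow> F x = f x" and Flip: "\<And>x y. \<bar>F x - F y\<bar> \<le> ?L * norm (x - y)"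
    using McShane_extension[OF _ L0, of Gd f] by blast
  have Feq: "AE x in lebesgue. x \<notin> B \<longrightarrow> F x = f x"
    using AE_leb_pt_sqi[OF f] by eventually_elim (auto simp: Gd_def intro!: F)
  \<comment> \<open>A McShane extension need not have compact support. Beyond R + 1, however, the
    maximal function is at most 2^N \<le> 2^j, so almost every point there is good and carries F = f
    = 0. Such points are dense, and the Lipschitz bound extends F = 0 to all points beyond R +
    2.\<close>
  have F0: "F x = 0" if x: "norm x \<ge> R + 2" for x
  proof -
    have g0: "AE x in lebesgue. x \<in> - ball 0 R \<longrightarrow> g x = 0"
      by (rule weak_gradient_zero_on[OF wg]) (auto intro!: always_eventually f0 simp: not_less)
    have "\<bar>F x\<bar> \<le> ?L * e" if e: "0 < e" "e < 1" for e
    proof -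
      obtain z where z: "z \<in> ball x e" "leb_pt f z"
        using AE_ball_ex[OF AE_leb_pt_sqi[OF f], of "{}" 0 e x] e ubv_pos[where 'a='a] by auto
      have "norm x \<le> norm z + dist x z" by (simp add: dist_norm norm_triangle_sub)
      then have nz: "norm z > R + 1" using z x e by auto
      have "MG g z \<le> ennreal (sqrt (ubv TYPE('a) * sqn g))" by (rule MG_le_outside[OF g g0 nz])
      also have "\<dots> \<le> ennreal (2 ^ j)"
      proof (rule ennreal_leI)
        have "sqrt (ubv TYPE('a) * sqn g) \<le> sqrt (4 ^ N)" by (rule real_sqrt_le_mono[OF big])
        also have "(4::real) ^ N = (2 ^ N)\<^sup>2" by (simp add: power2_eq_square power_mult_distrib[symmetric])
        also have "sqrt ((2 ^ N)\<^sup>2) = (2::real) ^ N" by simp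
        also have "\<dots> \<le> 2 ^ j" using j by (intro power_increasing) auto
        finally show "sqrt (ubv TYPE('a) * sqn g) \<le> 2 ^ j" .
      qed
      finally have "z \<in> Gd" using z by (auto simp: Gd_def B_def)
      then have "F z = 0" using F f0[of z] nz by auto
      then have "\<bar>F x\<bar> \<le> ?L * norm (x - z)" using Flip[of x z] by simp
      also have "\<dots> \<le> ?L * e" using z L0 by (intro mult_left_mono) (auto simp: dist_norm)
      finally show ?thesis .
    qed
    then have "\<forall>\<^sub>F e in at_right 0. \<bar>F x\<bar> \<le> ?L * e" by (auto simp: eventually_at_right_field intro!: exI[of _ 1])
    moreover have "((\<lambda>e. ?L * e) \<longlongrightarrow> ?L * 0) (at_right 0)" by (intro tendsto_mult tendsto_const tendsto_ident_at)
    ultimately have "\<bar>F x\<bar> \<le> ?L * 0" by (intro tendsto_lowerbound[where F="at_right 0"]) auto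
    then show ?thesis by simp
  qed
  \<comment> \<open>On the bad set, F and f are both compared with the value at a good point within
    \<rho>, which exists once B is smaller than a ball of radius \<rho>. At a bad point the maximal
    function exceeds 2^j and dominates both errors, so the maximal theorem gives the L2
    bound.\<close>
  have close: "sqi (\<lambda>x. F x - f x) \<and> sqn (\<lambda>x. F x - f x) \<le> (2 * Clip TYPE('a) * \<rho>)\<^sup>2 * (Cmax TYPE('a) * sqn g)"
    if \<rho>: "\<rho> > 0" "?b < ubv TYPE('a) * \<rho> ^ DIM('a)" for \<rho>
  proof -
    let ?m = "\<lambda>x. (2 * Clip TYPE('a) * \<rho>) *\<^sub>R enn2real (MG g x)"
    have sm: "sqi ?m" by (intro sqi_cmult sqi_MG[OF g])
    have le: "AE x in lebesgue. norm (F x - f x) \<le> norm (?m x)"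
      using AE_leb_pt_sqi[OF f] MG_finite_AE[OF g]
    proof eventually_elim
      fix x assume lx: "leb_pt f x" and fin: "MG g x < top"
      show "norm (F x - f x) \<le> norm (?m x)"
      proof (cases "x \<in> B")
        case False
        then show ?thesis using F[of x] lx by (simp add: Gd_def)
      next
        case True
        define m where "m = enn2real (MG g x)"
        have mx: "MG g x = ennreal m" "m \<ge> 0" using fin by (auto simp: m_def ennreal_enn2real_if)
        have m2: "2 ^ j < m" using True mx by (simp add: B_def ennreal_less_iff)
        obtain z where z: "z \<in> ball x \<rho>" "z \<in> Gd" using near[OF \<rho>] by blast
        have zx: "norm (x - z) \<le> \<rho>" using z by (simp add: dist_norm)
        have "\<bar>F x - f z\<bar> \<le> ?L * \<rho>"
          using Flip[of x z] F[OF z(2)] mult_left_mono[OF zx L0] by simp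
        also have "\<dots> \<le> Clip TYPE('a) * m * \<rho>"
          using m2 \<rho> Clip_pos[where 'a='a] by (intro mult_right_mono mult_left_mono) auto
        finally have 1: "\<bar>F x - f z\<bar> \<le> Clip TYPE('a) * m * \<rho>" .
        have "ker_mass TYPE('a) * \<bar>f x - f z\<bar> \<le> Cpw TYPE('a) * (m + 2 ^ j) * \<rho>"
          using mx by (intro pw_ineq[OF wg lx Gd(1)[OF z(2)] \<rho>(1) zx _ _ Gd(2)[OF z(2)]]) auto
        also have "\<dots> \<le> Cpw TYPE('a) * (m + m) * \<rho>"
          using m2 \<rho> by (intro mult_right_mono mult_left_mono) (auto simp: Cpw_def)
        finally have 2: "\<bar>f x - f z\<bar> \<le> Clip TYPE('a) * m * \<rho>" using k0 by (simp add: Clip_def field_simps)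
        have "\<bar>F x - f x\<bar> \<le> 2 * (Clip TYPE('a) * m * \<rho>)" using 1 2 by linarith
        then show ?thesis using Clip_pos[where 'a='a] \<rho> mx by (simp add: m_def[symmetric] abs_mult mult_ac)
      qed
    qed
    have Fm: "(\<lambda>x. F x - f x) \<in> borel_measurable lebesgue"
    proof -
      have "continuous_on UNIV F"
      proof (rule lipschitz_on_continuous_on)
        show "?L-lipschitz_on UNIV F" using Flip L0 by (intro lipschitz_onI) (auto simp: dist_real_def dist_norm)
      qed
      then have "F \<in> borel_measurable lebesgue" by (rule borel_measurable_continuous_lebesgue)
      then show ?thesis using sqi_measurable[OF f] by measurable
    qed
    have "sqn (\<lambda>x. F x - f x) \<le> sqn ?m" by (rule sqi_bound(2)[OF Fm sm le])
    also have "\<dots> = (2 * Clip TYPE('a) * \<rho>)\<^sup>2 * sqn (\<lambda>x. enn2real (MG g x))"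
      by (simp add: sqn_def power_mult_distrib)
    also have "\<dots> \<le> (2 * Clip TYPE('a) * \<rho>)\<^sup>2 * (Cmax TYPE('a) * sqn g)"
      by (intro mult_left_mono sqi_MG(2)[OF g]) auto
    finally show ?thesis using sqi_bound(1)[OF Fm sm le] by simp
  qed
  show ?thesis
    using j Bm small Flip F0 Feq close unfolding B_def[symmetric]
    by (intro exI[of _ j] exI[of _ F] exI[of _ B] conjI allI impI) blast+
qed

section \<open>Products with test functions, dilations, and the extension property\<close>

definition tgrad :: "('a::euclidean_space \<Rightarrow> real) \<Rightarrow> 'a \<Rightarrow> 'a" where
  "tgrad \<psi> x = (\<Sum>i\<in>Basis. frechet_derivative \<psi> (at x) i *\<^sub>R i)"

lemma weak_gradient_mult_test:
  fixes f :: "'a::euclidean_space \<Rightarrow> real"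
  assumes wg: "has_weak_gradient UNIV f g" and \<psi>: "test_fun UNIV \<psi>"
  shows "has_weak_gradient UNIV (\<lambda>x. \<psi> x * f x) (\<lambda>x. \<psi> x *\<^sub>R g x + f x *\<^sub>R tgrad \<psi> x)"
proof -
  have f: "sqi f" and g: "sqi g" and eq: "\<And>\<phi> i. test_fun UNIV \<phi> \<Longrightarrow> i \<in> Basis \<Longrightarrow>
        (\<integral>x. f x * frechet_derivative \<phi> (at x) i \<partial>lebesgue) = - (\<integral>x. (g x \<bullet> i) * \<phi> x \<partial>lebesgue)"
    using wg by (auto simp: has_weak_gradient_UNIV_iff)
  have sm: "smooth_fun \<psi>" using \<psi> by (rule test_fun_smooth)
  have [measurable]: "f \<in> borel_measurable lebesgue" "g \<in> borel_measurable lebesgue" "\<psi> \<in> borel_measurable lebesgue"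
    using f g sqi_test_fun(1)[OF \<psi>] by (auto intro: sqi_measurable)
  obtain b where b: "\<And>x. \<bar>\<psi> x\<bar> \<le> b" using test_fun_bounded[OF \<psi>] by metis
  have b0: "b \<ge> 0" using b[of 0] by linarith
  have "\<exists>c. \<forall>x. \<bar>frechet_derivative \<psi> (at x) i\<bar> \<le> c" for i
    using test_fun_bounded[OF test_fun_deriv[OF \<psi>, of i]] by blast
  then obtain c where c: "\<And>i x. \<bar>frechet_derivative \<psi> (at x) i\<bar> \<le> c i" by metis
  define cc where "cc = (\<Sum>i\<in>(Basis::'a set). c i)"
  have ti: "tgrad \<psi> x \<bullet> i = frechet_derivative \<psi> (at x) i" if "i \<in> Basis" for x i
    using that by (simp add: tgrad_def inner_sum_left_Basis)
  have tle: "norm (tgrad \<psi> x) \<le> cc" for x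
  proof -
    have "norm (tgrad \<psi> x) \<le> (\<Sum>i\<in>Basis. \<bar>tgrad \<psi> x \<bullet> i\<bar>)" by (rule norm_le_l1)
    also have "\<dots> \<le> cc" unfolding cc_def using c ti by (intro sum_mono) auto
    finally show ?thesis .
  qed
  have [measurable]: "tgrad \<psi> \<in> borel_measurable lebesgue"
    unfolding tgrad_def[abs_def] using sqi_measurable[OF sqi_test_fun(2)[OF \<psi>]] by measurable
  have s1: "sqi (\<lambda>x. \<psi> x * f x)"
    by (rule sqi_bound(1)[OF _ sqi_cmult[OF f, of b]]) (use b b0 in \<open>auto simp: abs_mult intro!: mult_right_mono\<close>)
  have s2: "sqi (\<lambda>x. \<psi> x *\<^sub>R g x)"
    by (rule sqi_bound(1)[OF _ sqi_cmult[OF g, of b]]) (use b b0 in \<open>auto intro!: mult_right_mono\<close>)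
  have cc0: "cc \<ge> 0" using tle[of 0] norm_ge_zero order_trans by blast
  have s3: "sqi (\<lambda>x. f x *\<^sub>R tgrad \<psi> x)"
  proof (rule sqi_bound(1)[OF _ sqi_cmult[OF f, of cc]])
    have "norm (f x *\<^sub>R tgrad \<psi> x) \<le> norm (cc *\<^sub>R f x)" for x
      using mult_left_mono[OF tle, of "\<bar>f x\<bar>" x] cc0 by (simp add: mult.commute abs_mult)
    then show "AE x in lebesgue. norm (f x *\<^sub>R tgrad \<psi> x) \<le> norm (cc *\<^sub>R f x)" by (intro always_eventually allI)
  qed measurable
  show ?thesis
    unfolding has_weak_gradient_UNIV_iff
  proof (intro conjI allI impI ballI s1 sqi_add(1)[OF s2 s3])
    fix \<phi> :: "'a \<Rightarrow> real" and i :: 'a assume t: "test_fun UNIV \<phi>" and i: "i \<in> Basis"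
    have sm': "smooth_fun \<phi>" using t by (rule test_fun_smooth)
    have pt: "test_fun UNIV (\<lambda>x. \<psi> x * \<phi> x)" by (rule test_fun_mult[OF t sm])
    let ?d = "\<lambda>x. frechet_derivative \<psi> (at x) i"
    have dp: "test_fun UNIV (\<lambda>x. ?d x * \<phi> x)" by (rule test_fun_mult[OF t smooth_fun_deriv[OF sm]])
    have i1: "integrable lebesgue (\<lambda>x. f x * frechet_derivative (\<lambda>x. \<psi> x * \<phi> x) (at x) i)"
      by (rule sqi_mult_integrable[OF f sqi_test_fun(2)[OF pt]])
    have i2: "integrable lebesgue (\<lambda>x. f x * (?d x * \<phi> x))" by (rule sqi_mult_integrable[OF f sqi_test_fun(1)[OF dp]])
    have i3: "integrable lebesgue (\<lambda>x. (g x \<bullet> i) * (\<psi> x * \<phi> x))" by (rule sqi_mult_integrable[OF sqi_inner[OF g] sqi_test_fun(1)[OF pt]])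
    have "(\<integral>x. \<psi> x * f x * frechet_derivative \<phi> (at x) i \<partial>lebesgue)
      = (\<integral>x. f x * frechet_derivative (\<lambda>x. \<psi> x * \<phi> x) (at x) i - f x * (?d x * \<phi> x) \<partial>lebesgue)"
      unfolding frechet_derivative_mult_smooth[OF sm sm'] by (simp add: algebra_simps)
    also have "\<dots> = (\<integral>x. f x * frechet_derivative (\<lambda>x. \<psi> x * \<phi> x) (at x) i \<partial>lebesgue) - (\<integral>x. f x * (?d x * \<phi> x) \<partial>lebesgue)"
      by (rule Bochner_Integration.integral_diff[OF i1 i2])
    also have "\<dots> = - ((\<integral>x. (g x \<bullet> i) * (\<psi> x * \<phi> x) \<partial>lebesgue) + (\<integral>x. f x * (?d x * \<phi> x) \<partial>lebesgue))"
      unfolding eq[OF pt i] by simp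
    also have "\<dots> = - (\<integral>x. (g x \<bullet> i) * (\<psi> x * \<phi> x) + f x * (?d x * \<phi> x) \<partial>lebesgue)"
      unfolding Bochner_Integration.integral_add[OF i3 i2] ..
    also have "\<dots> = - (\<integral>x. ((\<psi> x *\<^sub>R g x + f x *\<^sub>R tgrad \<psi> x) \<bullet> i) * \<phi> x \<partial>lebesgue)"
      using ti[OF i] by (simp add: inner_add_left algebra_simps)
    finally show "(\<integral>x. \<psi> x * f x * frechet_derivative \<phi> (at x) i \<partial>lebesgue) = - (\<integral>x. ((\<psi> x *\<^sub>R g x + f x *\<^sub>R tgrad \<psi> x) \<bullet> i) * \<phi> x \<partial>lebesgue)" .
  qed
qed

lemma sqi_scale:
  fixes f :: "'a::euclidean_space \<Rightarrow> 'b::euclidean_space"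
  assumes "sqi f" "a > 0"
  shows "sqi (\<lambda>x. f (a *\<^sub>R x))" "sqn (\<lambda>x. f (a *\<^sub>R x)) = sqn f / a ^ DIM('a)"
proof -
  have f: "f \<in> borel_measurable lebesgue" "integrable lebesgue (\<lambda>x. (norm (f x))\<^sup>2)" using assms by (auto simp: sqi_def)
  have a: "a \<noteq> 0" using assms by simp
  have m: "(\<lambda>x. f (0 + a *\<^sub>R x)) \<in> borel_measurable lebesgue" by (rule borel_measurable_lebesgue_affine[OF a f(1)])
  have i: "integrable lebesgue (\<lambda>x. (norm (f (0 + a *\<^sub>R x)))\<^sup>2)"
    by (rule integrable_lebesgue_affine[OF a f(2)])
  show "sqi (\<lambda>x. f (a *\<^sub>R x))" using m i by (simp add: sqi_def)
  have "(\<integral>x. (norm (f (0 + a *\<^sub>R x)))\<^sup>2 \<partial>lebesgue) = (1 / \<bar>a\<bar> ^ DIM('a)) *\<^sub>R (\<integral>x. (norm (f x))\<^sup>2 \<partial>lebesgue)"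
    by (rule integral_lebesgue_affine[OF a]) (use f in measurable)
  then show "sqn (\<lambda>x. f (a *\<^sub>R x)) = sqn f / a ^ DIM('a)" using assms(2) by (simp add: sqn_def)
qed

lemma weak_gradient_scale:
  fixes f :: "'a::euclidean_space \<Rightarrow> real"
  assumes wg: "has_weak_gradient UNIV f g" and a: "a > 0"
  shows "has_weak_gradient UNIV (\<lambda>x. f (a *\<^sub>R x)) (\<lambda>x. a *\<^sub>R g (a *\<^sub>R x))"
proof -
  have f: "sqi f" and g: "sqi g" and eq: "\<And>\<phi> i. test_fun UNIV \<phi> \<Longrightarrow> i \<in> Basis \<Longrightarrow>
        (\<integral>x. f x * frechet_derivative \<phi> (at x) i \<partial>lebesgue) = - (\<integral>x. (g x \<bullet> i) * \<phi> x \<partial>lebesgue)"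
    using wg by (auto simp: has_weak_gradient_UNIV_iff)
  have fm: "f \<in> borel_measurable lebesgue" and gm: "g \<in> borel_measurable lebesgue" using f g by (auto intro: sqi_measurable)
  have a0: "a \<noteq> 0" using a by simp
  show ?thesis
    unfolding has_weak_gradient_UNIV_iff
  proof (intro conjI allI impI ballI sqi_cmult sqi_scale(1)[OF f a] sqi_scale(1)[OF g a])
    fix \<phi> :: "'a \<Rightarrow> real" and i :: 'a assume t: "test_fun UNIV \<phi>" and i: "i \<in> Basis"
    define \<psi> where "\<psi> y = \<phi> ((1/a) *\<^sub>R y + 0)" for y
    have \<psi>: "test_fun UNIV \<psi>" unfolding \<psi>_def using a by (intro test_fun_affine[OF t]) auto
    have d\<psi>: "frechet_derivative \<psi> (at y) i = (1/a) * frechet_derivative \<phi> (at ((1/a) *\<^sub>R y)) i" for y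
      unfolding \<psi>_def using frechet_derivative_affine[OF test_fun_smooth[OF t], of "1/a" 0 y i] by simp
    have m1: "(\<lambda>y. f y * frechet_derivative \<psi> (at y) i) \<in> borel_measurable lebesgue"
      using fm sqi_measurable[OF sqi_test_fun(2)[OF \<psi>, of i]] by measurable
    have m2: "(\<lambda>y. (g y \<bullet> i) * \<psi> y) \<in> borel_measurable lebesgue"
      using gm sqi_measurable[OF sqi_test_fun(1)[OF \<psi>]] by measurable
    have "(\<integral>x. f (a *\<^sub>R x) * frechet_derivative \<phi> (at x) i \<partial>lebesgue) = (\<integral>x. a * (f (0 + a *\<^sub>R x) * frechet_derivative \<psi> (at (0 + a *\<^sub>R x)) i) \<partial>lebesgue)"
      using a by (simp add: d\<psi>)
    also have "\<dots> = a * ((1 / \<bar>a\<bar> ^ DIM('a)) *\<^sub>R (\<integral>x. f x * frechet_derivative \<psi> (at x) i \<partial>lebesgue))"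
      unfolding integral_mult_right_zero by (subst integral_lebesgue_affine[OF a0 m1]) simp
    also have "\<dots> = - (a * ((1 / \<bar>a\<bar> ^ DIM('a)) *\<^sub>R (\<integral>x. (g x \<bullet> i) * \<psi> x \<partial>lebesgue)))"
      unfolding eq[OF \<psi> i] by simp
    also have "\<dots> = - (\<integral>x. a * ((g (0 + a *\<^sub>R x) \<bullet> i) * \<psi> (0 + a *\<^sub>R x)) \<partial>lebesgue)"
      unfolding integral_mult_right_zero by (subst integral_lebesgue_affine[OF a0 m2]) simp
    also have "\<dots> = - (\<integral>x. ((a *\<^sub>R g (a *\<^sub>R x)) \<bullet> i) * \<phi> x \<partial>lebesgue)"
      using a by (simp add: \<psi>_def mult.assoc)
    finally show "(\<integral>x. f (a *\<^sub>R x) * frechet_derivative \<phi> (at x) i \<partial>lebesgue) = - (\<integral>x. ((a *\<^sub>R g (a *\<^sub>R x)) \<bullet> i) * \<phi> x \<partial>lebesgue)" .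
  qed
qed

text \<open>The extension property phrased without an operator, for restrictions of functions in H1
  of the whole space. Any weak gradient of u may be used, and C bounds squared norms, so it
  corresponds to the square of the constant in \<open>admits_extension\<close>. In this form it is
  invariant under dilations.\<close>

definition ext_prop :: "'a::euclidean_space set \<Rightarrow> real \<Rightarrow> bool" where
  "ext_prop \<Omega> C \<longleftrightarrow> (\<forall>u g. has_weak_gradient UNIV u g \<longrightarrow>
     (\<exists>v h. has_weak_gradient UNIV v h \<and> (AE x in lebesgue. x \<in> \<Omega> \<longrightarrow> v x = u x) \<and>
        ennreal (sqn h) \<le> ennreal C * (\<integral>\<^sup>+x\<in>\<Omega>. ennreal ((norm (g x))\<^sup>2) \<partial>lebesgue)))"

text \<open>The function is restricted to the open complement of E and extended back; uniqueness of
  weak gradients identifies the chosen \<open>wgrad\<close> there with g.\<close>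

lemma admits_extension_ext_prop:
  fixes E :: "'a::euclidean_space set"
  assumes E: "closed E" and adm: "admits_extension E"
  shows "\<exists>C>0. ext_prop (- E) C"
proof -
  obtain T C where C: "C > 0" and T: "\<And>u. H1 (- E) u \<Longrightarrow>
      H1 UNIV (T u) \<and> (AE x in lebesgue. x \<in> - E \<longrightarrow> T u x = u x) \<and>
      grad_sq UNIV (T u) \<le> ennreal (C\<^sup>2) * grad_sq (- E) u"
    using adm unfolding admits_extension_def by blast
  have op: "open (- E)" using E by (simp add: open_Compl)
  have "ext_prop (- E) (C\<^sup>2)"
    unfolding ext_prop_def
  proof (intro allI impI)
    fix u :: "'a \<Rightarrow> real" and g assume wg: "has_weak_gradient UNIV u g"
    have wgE: "has_weak_gradient (- E) u g" by (rule has_weak_gradient_restrict[OF wg op])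
    then have HE: "H1 (- E) u" unfolding H1_def by blast
    note TT = T[OF HE]
    let ?h = "wgrad UNIV (T u)"
    have wh: "has_weak_gradient UNIV (T u) ?h" using TT by (intro has_weak_gradient_wgrad) auto
    then have h: "sqi ?h" by (simp add: has_weak_gradient_UNIV_iff)
    have "ennreal (sqn ?h) = grad_sq UNIV (T u)" unfolding grad_sq_def nn_integral_sqn[OF h, symmetric] by simp
    also have "\<dots> \<le> ennreal (C\<^sup>2) * grad_sq (- E) u" using TT by blast
    also have "grad_sq (- E) u = (\<integral>\<^sup>+x\<in>- E. ennreal ((norm (g x))\<^sup>2) \<partial>lebesgue)"
      unfolding grad_sq_def
    proof (rule nn_integral_cong_AE)
      show "AE x in lebesgue. ennreal ((norm (wgrad (- E) u x))\<^sup>2) * indicator (- E) x = ennreal ((norm (g x))\<^sup>2) * indicator (- E) x"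
        using weak_gradient_unique[OF op has_weak_gradient_wgrad[OF HE] wgE]
        by eventually_elim (auto simp: indicator_def)
    qed
    finally show "\<exists>v h. has_weak_gradient UNIV v h \<and> (AE x in lebesgue. x \<in> - E \<longrightarrow> v x = u x) \<and>
        ennreal (sqn h) \<le> ennreal (C\<^sup>2) * (\<integral>\<^sup>+x\<in>- E. ennreal ((norm (g x))\<^sup>2) \<partial>lebesgue)"
      using wh TT by blast
  qed
  then show ?thesis using C by (intro exI[of _ "C\<^sup>2"]) auto
qed

text \<open>Pull back by the dilation, extend, push forward. The energies on both sides acquire the
  same factor a^2 / a^n, so C is unchanged.\<close>

lemma ext_prop_scale:
  fixes \<Omega> :: "'a::euclidean_space set"
  assumes ext: "ext_prop \<Omega> C" and \<Omega>[measurable]: "\<Omega> \<in> sets lebesgue" and a: "a > 0"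
  shows "ext_prop ((\<lambda>y. a *\<^sub>R y) ` \<Omega>) C"
  unfolding ext_prop_def
proof (intro allI impI)
  fix u :: "'a \<Rightarrow> real" and g assume wg: "has_weak_gradient UNIV u g"
  let ?n = "DIM('a)"
  have a0: "a \<noteq> 0" "1/a \<noteq> 0" "1/a > 0" using a by auto
  have gm[measurable]: "g \<in> borel_measurable lebesgue" using wg by (auto simp: has_weak_gradient_UNIV_iff sqi_def)
  have mem: "x \<in> (\<lambda>y. a *\<^sub>R y) ` \<Omega> \<longleftrightarrow> (1/a) *\<^sub>R x \<in> \<Omega>" for x
  proof
    assume "(1/a) *\<^sub>R x \<in> \<Omega>"
    then have "a *\<^sub>R ((1/a) *\<^sub>R x) \<in> (\<lambda>y. a *\<^sub>R y) ` \<Omega>" by blast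
    then show "x \<in> (\<lambda>y. a *\<^sub>R y) ` \<Omega>" using a by simp
  qed (use a in auto)
  have "has_weak_gradient UNIV (\<lambda>x. u (a *\<^sub>R x)) (\<lambda>x. a *\<^sub>R g (a *\<^sub>R x))" by (rule weak_gradient_scale[OF wg a])
  then obtain v h where wh: "has_weak_gradient UNIV v h" and eq: "AE x in lebesgue. x \<in> \<Omega> \<longrightarrow> v x = u (a *\<^sub>R x)"
    and le: "ennreal (sqn h) \<le> ennreal C * (\<integral>\<^sup>+x\<in>\<Omega>. ennreal ((norm (a *\<^sub>R g (a *\<^sub>R x)))\<^sup>2) \<partial>lebesgue)"
    using ext unfolding ext_prop_def by blast
  have h: "sqi h" using wh by (simp add: has_weak_gradient_UNIV_iff)
  let ?v = "\<lambda>x. v ((1/a) *\<^sub>R x)" and ?h = "\<lambda>x. (1/a) *\<^sub>R h ((1/a) *\<^sub>R x)"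
  have 1: "has_weak_gradient UNIV ?v ?h" by (rule weak_gradient_scale[OF wh a0(3)])
  have 2: "AE x in lebesgue. x \<in> (\<lambda>y. a *\<^sub>R y) ` \<Omega> \<longrightarrow> ?v x = u x"
  proof -
    have "AE x in lebesgue. 0 + (1/a) *\<^sub>R x \<in> \<Omega> \<longrightarrow> v (0 + (1/a) *\<^sub>R x) = u (a *\<^sub>R (0 + (1/a) *\<^sub>R x))"
      by (rule AE_lebesgue_affine[OF a0(2) eq])
    then show ?thesis using a unfolding mem by simp
  qed
  have imm: "(\<lambda>y. a *\<^sub>R y) ` \<Omega> \<in> sets lebesgue"
  proof -
    have "(\<lambda>y. a *\<^sub>R y) ` \<Omega> = (\<lambda>x. (1/a) *\<^sub>R x) -` \<Omega> \<inter> space lebesgue" using mem by auto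
    then show ?thesis using measurable_sets[OF lebesgue_measurable_scaling \<Omega>] by simp
  qed
  note [measurable] = imm
  have int: "(\<integral>\<^sup>+x\<in>\<Omega>. ennreal ((norm (a *\<^sub>R g (a *\<^sub>R x)))\<^sup>2) \<partial>lebesgue) = ennreal (a\<^sup>2 / a ^ ?n) * (\<integral>\<^sup>+x\<in>(\<lambda>y. a *\<^sub>R y) ` \<Omega>. ennreal ((norm (g x))\<^sup>2) \<partial>lebesgue)"
  proof -
    let ?F = "\<lambda>y. ennreal (a\<^sup>2) * (ennreal ((norm (g y))\<^sup>2) * indicator ((\<lambda>y. a *\<^sub>R y) ` \<Omega>) y)"
    have Fm: "?F \<in> borel_measurable lebesgue" by measurable
    have "(\<integral>\<^sup>+x\<in>\<Omega>. ennreal ((norm (a *\<^sub>R g (a *\<^sub>R x)))\<^sup>2) \<partial>lebesgue) = (\<integral>\<^sup>+x. ?F (0 + a *\<^sub>R x) \<partial>lebesgue)"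
    proof (rule nn_integral_cong)
      fix x
      have "indicator ((\<lambda>y. a *\<^sub>R y) ` \<Omega>) (a *\<^sub>R x) = (indicator \<Omega> x :: ennreal)" using mem[of "a *\<^sub>R x"] a by (simp add: indicator_def)
      then show "ennreal ((norm (a *\<^sub>R g (a *\<^sub>R x)))\<^sup>2) * indicator \<Omega> x = ?F (0 + a *\<^sub>R x)"
        using a by (simp add: power_mult_distrib ennreal_mult mult.assoc)
    qed
    also have "\<dots> = ennreal (1 / \<bar>a\<bar> ^ ?n) * (\<integral>\<^sup>+x. ?F x \<partial>lebesgue)" by (rule nn_integral_lebesgue_affine[OF a0(1) Fm])
    also have "(\<integral>\<^sup>+x. ?F x \<partial>lebesgue) = ennreal (a\<^sup>2) * (\<integral>\<^sup>+x\<in>(\<lambda>y. a *\<^sub>R y) ` \<Omega>. ennreal ((norm (g x))\<^sup>2) \<partial>lebesgue)"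
      by (rule nn_integral_cmult) measurable
    finally have "(\<integral>\<^sup>+x\<in>\<Omega>. ennreal ((norm (a *\<^sub>R g (a *\<^sub>R x)))\<^sup>2) \<partial>lebesgue) = ennreal (1 / \<bar>a\<bar> ^ ?n) * ennreal (a\<^sup>2) * (\<integral>\<^sup>+x\<in>(\<lambda>y. a *\<^sub>R y) ` \<Omega>. ennreal ((norm (g x))\<^sup>2) \<partial>lebesgue)"
      by (simp only: mult.assoc)
    also have "ennreal (1 / \<bar>a\<bar> ^ ?n) * ennreal (a\<^sup>2) = ennreal (a\<^sup>2 / a ^ ?n)"
      using a by (subst ennreal_mult[symmetric]) auto
    finally show ?thesis .
  qed
  have sq: "sqn ?h = sqn h * (a ^ ?n / a\<^sup>2)"
  proof -
    have "sqn ?h = (1/a)\<^sup>2 * sqn (\<lambda>x. h ((1/a) *\<^sub>R x))" by (simp add: sqn_def power_mult_distrib power_divide)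
    also have "\<dots> = (1/a)\<^sup>2 * (sqn h / (1/a) ^ ?n)" by (simp only: sqi_scale(2)[OF h a0(3)])
    finally show ?thesis using a by (simp add: power_divide)
  qed
  have "ennreal (sqn ?h) = ennreal (a ^ ?n / a\<^sup>2) * ennreal (sqn h)"
    unfolding sq using a sqn_nonneg[of h] by (subst ennreal_mult[symmetric]) (auto simp: mult.commute)
  also have "\<dots> \<le> ennreal (a ^ ?n / a\<^sup>2) * (ennreal C * (ennreal (a\<^sup>2 / a ^ ?n) * (\<integral>\<^sup>+x\<in>(\<lambda>y. a *\<^sub>R y) ` \<Omega>. ennreal ((norm (g x))\<^sup>2) \<partial>lebesgue)))"
    using le unfolding int by (intro mult_left_mono) auto
  also have "\<dots> = (ennreal (a ^ ?n / a\<^sup>2) * ennreal (a\<^sup>2 / a ^ ?n)) * (ennreal C * (\<integral>\<^sup>+x\<in>(\<lambda>y. a *\<^sub>R y) ` \<Omega>. ennreal ((norm (g x))\<^sup>2) \<partial>lebesgue))"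
    by (simp only: mult_ac)
  also have "ennreal (a ^ ?n / a\<^sup>2) * ennreal (a\<^sup>2 / a ^ ?n) = 1"
    using a by (subst ennreal_mult[symmetric]) auto
  finally have 3: "ennreal (sqn ?h) \<le> ennreal C * (\<integral>\<^sup>+x\<in>(\<lambda>y. a *\<^sub>R y) ` \<Omega>. ennreal ((norm (g x))\<^sup>2) \<partial>lebesgue)" by simp
  show "\<exists>v h. has_weak_gradient UNIV v h \<and> (AE x in lebesgue. x \<in> (\<lambda>y. a *\<^sub>R y) ` \<Omega> \<longrightarrow> v x = u x) \<and>
        ennreal (sqn h) \<le> ennreal C * (\<integral>\<^sup>+x\<in>(\<lambda>y. a *\<^sub>R y) ` \<Omega>. ennreal ((norm (g x))\<^sup>2) \<partial>lebesgue)"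
    using 1 2 3 by blast
qed

section \<open>Measure density of extension domains\<close>

lemma MG_Markov:
  fixes g :: "'a::euclidean_space \<Rightarrow> 'b::euclidean_space"
  assumes g: "sqi g" and t: "t > 0"
  shows "emeasure lebesgue {x. ennreal t < MG g x} \<le> ennreal (Cmax TYPE('a) * sqn g / t\<^sup>2)"
proof -
  note [measurable] = MG_measurable[of g]
  have m: "{x. ennreal t < MG g x} \<in> sets lebesgue" using open_MG[of t g] t by auto
  have "ennreal (t\<^sup>2) * emeasure lebesgue {x. ennreal t < MG g x} = (\<integral>\<^sup>+x. ennreal (t\<^sup>2) * indicator {x. ennreal t < MG g x} x \<partial>lebesgue)"
    using m by (rule nn_integral_cmult_indicator[symmetric])
  also have "\<dots> \<le> (\<integral>\<^sup>+x. (MG g x)\<^sup>2 \<partial>lebesgue)"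
  proof (rule nn_integral_mono)
    fix x
    show "ennreal (t\<^sup>2) * indicator {x. ennreal t < MG g x} x \<le> (MG g x)\<^sup>2"
    proof (cases "ennreal t < MG g x")
      case True
      then have "ennreal t * ennreal t \<le> MG g x * MG g x" by (intro mult_mono) auto
      then show ?thesis using True t by (simp add: power2_eq_square ennreal_mult)
    qed simp
  qed
  also have "\<dots> \<le> ennreal (Cmax TYPE('a) * sqn g)" by (rule MG_strong[OF g])
  finally have le: "ennreal (t\<^sup>2) * emeasure lebesgue {x. ennreal t < MG g x} \<le> ennreal (Cmax TYPE('a) * sqn g)" .
  have c0: "Cmax TYPE('a) * sqn g \<ge> 0" using Cmax_pos[where 'a='a] sqn_nonneg[of g] by simp
  have "emeasure lebesgue {x. ennreal t < MG g x} = ennreal (1 / t\<^sup>2) * (ennreal (t\<^sup>2) * emeasure lebesgue {x. ennreal t < MG g x})"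
    using t by (simp add: mult.assoc[symmetric] ennreal_mult[symmetric])
  also have "\<dots> \<le> ennreal (1 / t\<^sup>2) * ennreal (Cmax TYPE('a) * sqn g)" by (intro mult_left_mono le) simp
  also have "\<dots> = ennreal (Cmax TYPE('a) * sqn g / t\<^sup>2)" using t c0 by (subst ennreal_mult[symmetric]) auto
  finally show ?thesis .
qed

lemma AE_set_ex:
  fixes A :: "'a::euclidean_space set"
  assumes P: "AE x in lebesgue. P x" and B: "B \<in> sets lebesgue" "emeasure lebesgue B \<le> ennreal b" "b \<ge> 0"
    and A: "A \<in> lmeasurable" "b < measure lebesgue A"
  shows "\<exists>z\<in>A. P z \<and> z \<notin> B"
proof (rule ccontr)
  assume neg: "\<not> ?thesis"
  obtain N where N: "N \<in> null_sets lebesgue" "{x. \<not> P x} \<subseteq> N"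
    using P unfolding eventually_ae_filter by auto
  have "A \<subseteq> B \<union> N" using neg N(2) by blast
  then have "emeasure lebesgue A \<le> emeasure lebesgue (B \<union> N)"
    using B N(1) by (intro emeasure_mono) auto
  also have "\<dots> = emeasure lebesgue B" by (rule emeasure_Un_null_set[OF B(1) N(1)])
  also have "\<dots> \<le> ennreal b" by (rule B(2))
  also have "emeasure lebesgue A = ennreal (measure lebesgue A)" using A(1) by (simp add: emeasure_eq_measure2)
  finally show False using A(2) B(3) by (subst (asm) ennreal_le_iff) auto
qed

text \<open>The purely dimensional factors of \<open>capacity_estimate\<close>; sqrt 3 stems from
  the distance 3 s.\<close>

definition K1 :: "'a::euclidean_space itself \<Rightarrow> real" where
  "K1 _ = 4 * (Cpw TYPE('a) * sqrt (2 * Cmax TYPE('a))) powr (1 - 1 / real DIM('a))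
     * (3 * real DIM('a) * sqrt (ubv TYPE('a) * (3 * real DIM('a) + 1) ^ DIM('a))) powr (1 / real DIM('a)) * sqrt 3"

lemma Cpw_pos: "Cpw TYPE('a::euclidean_space) > 0"
  by (simp add: Cpw_def add_pos_nonneg)

lemma K1_pos: "K1 TYPE('a::euclidean_space) > 0"
proof -
  have "(3 * real DIM('a) + 1) ^ DIM('a) > 0" by (intro zero_less_power) (simp add: add_pos_nonneg)
  then show ?thesis
    using Cpw_pos[where 'a='a] Cmax_pos[where 'a='a] ubv_pos[where 'a='a] by (simp add: K1_def)
qed

text \<open>Once the level is of order sqrt(S / p), the bad set of the maximal function has measure
  below p, so P and Z each contain a good point. Between these v jumps by 1 over a distance at most
  3 s. The plain \<open>pw_ineq\<close> would give the power p^(-1/2); the Hedberg form gives p^(-(1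
  - 1/n)/2), and the gain p^(1/(2n)) drives \<open>measure_density\<close>.\<close>

lemma capacity_estimate:
  fixes v :: "'a::euclidean_space \<Rightarrow> real"
  assumes wg: "has_weak_gradient UNIV v h" and S: "sqn h \<le> S" "S > 0" and p: "p > 0"
    and P: "P \<in> lmeasurable" "measure lebesgue P \<ge> p" "AE x in lebesgue. x \<in> P \<longrightarrow> v x = 1"
    and Z: "Z \<in> lmeasurable" "measure lebesgue Z \<ge> p" "AE x in lebesgue. x \<in> Z \<longrightarrow> v x = 0"
    and s: "s > 0" and dist: "\<And>y z. y \<in> P \<Longrightarrow> z \<in> Z \<Longrightarrow> norm (y - z) \<le> 3 * s"
  shows "ker_mass TYPE('a) \<le> K1 TYPE('a) * sqrt S * sqrt s * p powr (- (1 - 1 / real DIM('a)) / 2)"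
proof -
  have v: "sqi v" and h: "sqi h" using wg by (auto simp: has_weak_gradient_UNIV_iff)
  let ?n = "real DIM('a)"
  have n1: "?n \<ge> 1" using DIM_positive[where 'a='a] by linarith
  define \<alpha> where "\<alpha> = 1 - 1 / ?n"
  have \<alpha>: "\<alpha> \<ge> 0" using n1 by (simp add: \<alpha>_def)
  \<comment> \<open>Chosen so that t^2 = 2 \<open>Cmax\<close> S / p, which by Chebyshev leaves a
    bad set of measure at most p / 2.\<close>
  define t where "t = sqrt (2 * Cmax TYPE('a)) * sqrt S * p powr (-1/2)"
  have Cm: "Cmax TYPE('a) > 0" by (rule Cmax_pos)
  have t: "t > 0" using Cm S p by (simp add: t_def)
  have t2: "t\<^sup>2 = 2 * Cmax TYPE('a) * S / p"
  proof -
    have "(p powr (-1/2))\<^sup>2 = p powr (-1)" using p by (simp add: power2_eq_square powr_add[symmetric])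
    also have "\<dots> = 1 / p" using p by (simp add: powr_minus_divide)
    finally show ?thesis using Cm S by (simp add: t_def power_mult_distrib)
  qed
  let ?B = "{x. ennreal t < MG h x}"
  have Bm: "?B \<in> sets lebesgue" using open_MG[of t h] t by auto
  have "Cmax TYPE('a) * sqn h / t\<^sup>2 \<le> Cmax TYPE('a) * S / t\<^sup>2" using S Cm t by (intro divide_right_mono mult_left_mono) auto
  also have "\<dots> = p / 2" unfolding t2 using Cm S p by (simp add: field_simps)
  finally have Bb: "emeasure lebesgue ?B \<le> ennreal (p / 2)"
    using MG_Markov[OF h t] by (meson ennreal_leI order_trans)
  have "\<exists>y\<in>P. (leb_pt v y \<and> (y \<in> P \<longrightarrow> v y = 1)) \<and> y \<notin> ?B"
    using p P by (intro AE_set_ex[OF _ Bm Bb] AE_conjI AE_leb_pt_sqi[OF v]) auto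
  then obtain y where y: "y \<in> P" "leb_pt v y" "v y = 1" "MG h y \<le> ennreal t" by (auto simp: not_less)
  have "\<exists>z\<in>Z. (leb_pt v z \<and> (z \<in> Z \<longrightarrow> v z = 0)) \<and> z \<notin> ?B"
    using p Z by (intro AE_set_ex[OF _ Bm Bb] AE_conjI AE_leb_pt_sqi[OF v]) auto
  then obtain z where z: "z \<in> Z" "leb_pt v z" "v z = 0" "MG h z \<le> ennreal t" by (auto simp: not_less)
  let ?q = "3 * ?n * sqrt (ubv TYPE('a) * (3 * ?n + 1) ^ DIM('a))"
  have q0: "?q \<ge> 0" using ubv_pos[where 'a='a] by simp
  have "ker_mass TYPE('a) * \<bar>v y - v z\<bar> \<le> 4 * (Cpw TYPE('a) * t) powr \<alpha> * (3 * ?n * sqrt (ubv TYPE('a) * (3 * ?n + 1) ^ DIM('a) * sqn h)) powr (1 / ?n) * (3 * s) powr (1/2)"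
    unfolding \<alpha>_def using s t dist[OF y(1) z(1)] by (intro pw_ineq_Hedberg[OF wg y(2) z(2) _ _ y(4) z(4)]) auto
  then have "ker_mass TYPE('a) \<le> 4 * (Cpw TYPE('a) * t) powr \<alpha> * (3 * ?n * sqrt (ubv TYPE('a) * (3 * ?n + 1) ^ DIM('a) * sqn h)) powr (1 / ?n) * (3 * s) powr (1/2)"
    using y z by simp
  also have "\<dots> \<le> 4 * (Cpw TYPE('a) * t) powr \<alpha> * (?q * sqrt S) powr (1 / ?n) * (3 * s) powr (1/2)"
  proof (intro mult_right_mono mult_left_mono powr_mono2)
    show "3 * ?n * sqrt (ubv TYPE('a) * (3 * ?n + 1) ^ DIM('a) * sqn h) \<le> ?q * sqrt S"
      unfolding real_sqrt_mult[of _ "sqn h"] mult.assoc[symmetric]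
      using S ubv_pos[where 'a='a] by (intro mult_left_mono) auto
    show "0 \<le> 3 * ?n * sqrt (ubv TYPE('a) * (3 * ?n + 1) ^ DIM('a) * sqn h)"
      using ubv_pos[where 'a='a] sqn_nonneg[of h] by simp
  qed auto
  also have "(?q * sqrt S) powr (1 / ?n) = ?q powr (1 / ?n) * sqrt S powr (1 / ?n)" by (rule powr_mult)
  also have "(3 * s) powr (1/2) = sqrt 3 * sqrt s" using s by (simp add: powr_half_sqrt real_sqrt_mult)
  also have "(Cpw TYPE('a) * t) powr \<alpha> = (Cpw TYPE('a) * sqrt (2 * Cmax TYPE('a))) powr \<alpha> * sqrt S powr \<alpha> * p powr (- \<alpha> / 2)"
  proof -
    have "(Cpw TYPE('a) * t) = (Cpw TYPE('a) * sqrt (2 * Cmax TYPE('a))) * sqrt S * p powr (-1/2)" by (simp add: t_def)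
    then have "(Cpw TYPE('a) * t) powr \<alpha> = (Cpw TYPE('a) * sqrt (2 * Cmax TYPE('a))) powr \<alpha> * sqrt S powr \<alpha> * (p powr (-1/2)) powr \<alpha>"
      using Cm S Cpw_pos[where 'a='a] by (simp add: powr_mult)
    also have "(p powr (-1/2)) powr \<alpha> = p powr (- \<alpha> / 2)" by (simp add: powr_powr)
    finally show ?thesis .
  qed
  also have "4 * ((Cpw TYPE('a) * sqrt (2 * Cmax TYPE('a))) powr \<alpha> * sqrt S powr \<alpha> * p powr (- \<alpha> / 2)) * (?q powr (1 / ?n) * sqrt S powr (1 / ?n)) * (sqrt 3 * sqrt s)
    = (4 * (Cpw TYPE('a) * sqrt (2 * Cmax TYPE('a))) powr \<alpha> * ?q powr (1 / ?n) * sqrt 3) * (sqrt S powr \<alpha> * sqrt S powr (1 / ?n)) * sqrt s * p powr (- \<alpha> / 2)"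
    by (simp only: mult_ac)
  also have "sqrt S powr \<alpha> * sqrt S powr (1 / ?n) = sqrt S"
    using S by (simp add: powr_add[symmetric] \<alpha>_def)
  finally show ?thesis by (simp add: K1_def \<alpha>_def)
qed

lemma cutoff_gradient:
  fixes x :: "'a::euclidean_space"
  assumes ab: "0 < a" "a < b"
  shows "\<exists>u g. has_weak_gradient UNIV u g \<and> (AE y in lebesgue. norm (g y) \<le> real DIM('a) / (b - a))
    \<and> (AE y in lebesgue. y \<notin> ball x b \<longrightarrow> g y = 0) \<and> (\<forall>y\<in>ball x a. u y = 1) \<and> (\<forall>y. y \<notin> ball x b \<longrightarrow> u y = 0)"
proof -
  define u where "u y = max 0 (min 1 ((b - norm (y - x)) / (b - a)))" for y
  have lip: "\<bar>u y - u z\<bar> \<le> (1 / (b - a)) * norm (y - z)" for y z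
  proof -
    have "\<bar>u y - u z\<bar> \<le> \<bar>(b - norm (y - x)) / (b - a) - (b - norm (z - x)) / (b - a)\<bar>"
      unfolding u_def by (auto simp: max_def min_def)
    also have "\<dots> = \<bar>norm (z - x) - norm (y - x)\<bar> / (b - a)"
      using ab by (simp add: diff_divide_distrib[symmetric])
    also have "\<dots> \<le> norm (z - y) / (b - a)"
      using ab norm_triangle_ineq3[of "z - x" "y - x"] by (intro divide_right_mono) auto
    finally show ?thesis by (simp add: norm_minus_commute)
  qed
  have out: "u y = 0" if "y \<notin> ball x b" for y
    using that ab by (simp add: u_def dist_norm norm_minus_commute divide_le_0_iff)
  have inn: "u y = 1" if "y \<in> ball x a" for y
  proof -
    have "1 \<le> (b - norm (y - x)) / (b - a)" using that ab by (simp add: dist_norm norm_minus_commute le_divide_eq)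
    then show ?thesis by (simp add: u_def)
  qed
  have "u y = 0" if "norm y \<ge> norm x + b" for y
    using that norm_triangle_ineq2[of y x] by (intro out) (auto simp: dist_norm norm_minus_commute)
  then obtain g where g: "has_weak_gradient UNIV u g" "AE y in lebesgue. norm (g y) \<le> real DIM('a) * (1 / (b - a))"
    using lipschitz_has_weak_gradient[OF lip, of "norm x + b"] ab by (auto simp: add_nonneg_pos)
  have "AE y in lebesgue. y \<in> - ball x b \<longrightarrow> g y = 0"
    using out by (intro weak_gradient_zero_on[OF g(1)]) (auto intro!: always_eventually)
  then show ?thesis using g inn out by (intro exI[of _ u] exI[of _ g]) auto
qed

text \<open>The oscillation in r is dominated by that of the volume of the ball itself. Continuity
  provides the radii at which the measure halves.\<close>

lemma measure_Int_ball_continuous: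
  fixes \<Omega> :: "'a::euclidean_space set"
  assumes \<Omega>: "\<Omega> \<in> sets lebesgue"
  shows "continuous_on {0..} (\<lambda>r. measure lebesgue (\<Omega> \<inter> ball x r))"
proof -
  let ?m = "\<lambda>r. measure lebesgue (\<Omega> \<inter> ball x r)" and ?F = "\<lambda>r. ubv TYPE('a) * r ^ DIM('a)"
  have lm: "\<Omega> \<inter> ball x r \<in> lmeasurable" for r using fmeasurable_Int_fmeasurable[OF lmeasurable_ball \<Omega>, of x r] by (simp add: Int_commute)
  have le1: "\<bar>?m r' - ?m r\<bar> \<le> \<bar>?F r' - ?F r\<bar>" if r: "0 \<le> r" "r \<le> r'" for r r'
  proof -
    have sub: "ball x r \<subseteq> ball x r'" using r by auto
    have "?m r \<le> ?m r'" using sub by (intro measure_mono_fmeasurable) (auto intro: lm fmeasurableD[OF lm])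
    moreover have "?m r' \<le> measure lebesgue ((\<Omega> \<inter> ball x r) \<union> (ball x r' - ball x r))"
      by (intro measure_mono_fmeasurable fmeasurable.Un lm fmeasurable_Diff) (auto intro: fmeasurableD[OF lm])
    moreover have "measure lebesgue ((\<Omega> \<inter> ball x r) \<union> (ball x r' - ball x r)) \<le> ?m r + measure lebesgue (ball x r' - ball x r)"
      by (intro measure_Un_le) (auto intro: fmeasurableD[OF lm])
    moreover have "measure lebesgue (ball x r' - ball x r) = ?F r' - ?F r"
    proof -
      have "measure lebesgue (ball x r' - ball x r) = measure lebesgue (ball x r') - measure lebesgue (ball x r)"
        using sub by (intro measurable_measure_Diff) auto
      then show ?thesis by (simp only: measure_ball_ubv[OF r(1)] measure_ball_ubv[OF order_trans[OF r]])
    qed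
    ultimately show ?thesis by linarith
  qed
  have le: "\<bar>?m r' - ?m r\<bar> \<le> \<bar>?F r' - ?F r\<bar>" if "0 \<le> r" "0 \<le> r'" for r r'
    using le1[of r r'] le1[of r' r] that by (cases "r \<le> r'") (auto simp: abs_minus_commute)
  have "continuous_on {0..} ?F" by (intro continuous_intros)
  then show ?thesis
    unfolding continuous_on_iff
  proof (intro ballI allI impI)
    fix r e :: real
    assume F: "\<forall>r\<in>{0..}. \<forall>e>0. \<exists>d>0. \<forall>r'\<in>{0..}. dist r' r < d \<longrightarrow> dist (?F r') (?F r) < e" and r: "r \<in> {0..}" and e: "e > 0"
    then obtain d where d: "d > 0" "\<forall>r'\<in>{0..}. dist r' r < d \<longrightarrow> dist (?F r') (?F r) < e" by blast
    have "dist (?m r') (?m r) < e" if "r' \<in> {0..}" "dist r' r < d" for r'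
    proof -
      have "\<bar>?m r' - ?m r\<bar> \<le> \<bar>?F r' - ?F r\<bar>" using le[of r r'] r that by auto
      also have "\<dots> < e" using d(2) that by (auto simp: dist_real_def)
      finally show ?thesis by (simp add: dist_real_def)
    qed
    then show "\<exists>d>0. \<forall>r'\<in>{0..}. dist r' r < d \<longrightarrow> dist (?m r') (?m r) < e" using d(1) by blast
  qed
qed

text \<open>If the density were too small at some scale, extending a cut-off supported between two concentric balls bounds
  the difference of their radii by a power of the measure; summing over radii at which the measure halves gives
  a contradiction.\<close>
lemma measure_density:
  fixes \<Omega> :: "'a::euclidean_space set"
  assumes op: "open \<Omega>" and ext: "ext_prop \<Omega> C" and C: "C > 0" and c0: "c0 > 0"
    and big: "\<And>x. \<exists>R0. \<forall>R\<ge>R0. measure lebesgue (\<Omega> \<inter> ball x R) \<ge> c0 * R ^ DIM('a)"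
  shows "\<exists>\<kappa>>0. \<forall>x\<in>\<Omega>. \<forall>r>0. measure lebesgue (\<Omega> \<inter> ball x r) \<ge> \<kappa> * r ^ DIM('a)"
proof -
  let ?n = "real DIM('a)"
  have n1: "?n \<ge> 1" using DIM_positive[where 'a='a] by linarith
  have \<Omega>m: "\<Omega> \<in> sets lebesgue" using op by auto
  \<comment> \<open>The constant of \<open>gap\<close> below: sqrt 2 from m b = 2 m a, sqrt C from
    the extension, and the dimension from the gradient of the cut-off.\<close>
  define K2 where "K2 = sqrt 2 * K1 TYPE('a) * sqrt C * ?n / ker_mass TYPE('a)"
  have K2: "K2 > 0" using K1_pos[where 'a='a] C n1 ker_mass_pos[where 'a='a] by (simp add: K2_def)
  \<comment> \<open>Halving the measure multiplies its power 1/(2n) by \<theta>; the quotient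
    \<theta> / (1 - \<theta>) in \<open>K3\<close> is the sum of the resulting geometric
    series.\<close>
  define \<theta> where "\<theta> = (1/2::real) powr (1 / (2 * ?n))"
  have \<theta>: "0 < \<theta>" "\<theta> < 1"
  proof -
    show "0 < \<theta>" by (simp add: \<theta>_def)
    have "(1/2::real) powr (1 / (2 * ?n)) < (1/2) powr 0" using n1 by (intro powr_less_mono') auto
    then show "\<theta> < 1" by (simp add: \<theta>_def)
  qed
  define K3 where "K3 = K2 * \<theta> / (1 - \<theta>)"
  have K3: "K3 > 0" using K2 \<theta> by (simp add: K3_def)
  \<comment> \<open>The first entry makes all radii beyond R0 good; the second contradicts the final
    inequality, in which s^n is at most K3^(2n) m s.\<close>
  define \<kappa> where "\<kappa> = min (c0 / 2) (1 / (2 * K3 ^ (2 * DIM('a))))"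
  have \<kappa>: "\<kappa> > 0" using c0 K3 by (simp add: \<kappa>_def)
  have "measure lebesgue (\<Omega> \<inter> ball x r) \<ge> \<kappa> * r ^ DIM('a)" if x: "x \<in> \<Omega>" and r: "r > 0" for x r
  proof (rule ccontr)
    assume neg: "\<not> ?thesis"
    define m where "m r = measure lebesgue (\<Omega> \<inter> ball x r)" for r
    have lm: "\<Omega> \<inter> ball x r \<in> lmeasurable" for r using fmeasurable_Int_fmeasurable[OF lmeasurable_ball \<Omega>m, of x r] by (simp add: Int_commute)
    have cont: "continuous_on {0..} m" unfolding m_def by (rule measure_Int_ball_continuous[OF \<Omega>m])
    have mono: "m r \<le> m r'" if "r \<le> r'" for r r'
      unfolding m_def using that by (intro measure_mono_fmeasurable) (auto intro: lm fmeasurableD[OF lm])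
    obtain \<rho>0 where \<rho>0: "\<rho>0 > 0" "ball x \<rho>0 \<subseteq> \<Omega>" using op x openE by blast
    have msmall: "m r = ubv TYPE('a) * r ^ DIM('a)" if "0 \<le> r" "r \<le> \<rho>0" for r
    proof -
      have "\<Omega> \<inter> ball x r = ball x r" using \<rho>0 that by auto
      then show ?thesis unfolding m_def by (simp only: measure_ball_ubv[OF that(1)])
    qed
    have mpos: "m r > 0" if "r > 0" for r
    proof -
      have "m (min r \<rho>0) > 0" using that \<rho>0 ubv_pos[where 'a='a] by (subst msmall) auto
      then show ?thesis using mono[of "min r \<rho>0" r] by simp
    qed
    obtain R0 where R0: "\<And>R. R \<ge> R0 \<Longrightarrow> m R \<ge> c0 * R ^ DIM('a)" using big[of x] by (auto simp: m_def)
    define R1 where "R1 = max r R0"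
    \<comment> \<open>The bad radii from r on. At the largest of them, s, the measure at least
      doubles between s and 2 s, because 2 s is no longer bad; this leaves a large part of \<Omega>
      on which the cut-off vanishes.\<close>
    define S where "S = {s\<in>{r..R1}. m s \<le> \<kappa> * s ^ DIM('a)}"
    have "compact S"
    proof -
      have "continuous_on {r..R1} (\<lambda>s. m s - \<kappa> * s ^ DIM('a))"
        using r by (intro continuous_intros continuous_on_subset[OF cont]) auto
      then have "closed {s\<in>{r..R1}. m s - \<kappa> * s ^ DIM('a) \<le> 0}"
        by (intro continuous_on_closed_Collect_le continuous_on_const) auto
      moreover have "S = {r..R1} \<inter> {s\<in>{r..R1}. m s - \<kappa> * s ^ DIM('a) \<le> 0}" by (auto simp: S_def)
      ultimately show ?thesis by (metis compact_Icc compact_Int_closed)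
    qed
    moreover have "S \<noteq> {}" using neg by (auto simp: S_def R1_def m_def intro!: exI[of _ r])
    ultimately obtain s where s: "s \<in> S" and smax: "\<And>s'. s' \<in> S \<Longrightarrow> s' \<le> s"
      using compact_attains_sup[of S] by blast
    have s0: "s > 0" using s r by (auto simp: S_def)
    have ms: "m s \<le> \<kappa> * s ^ DIM('a)" using s by (simp add: S_def)
    have m2s: "m (2 * s) \<ge> 2 * m s"
    proof -
      have "m (2 * s) > \<kappa> * (2 * s) ^ DIM('a)"
      proof (cases "2 * s \<le> R1")
        case True
        then have "2 * s \<notin> S" using smax[of "2 * s"] s0 by auto
        then show ?thesis using True s s0 by (auto simp: S_def)
      next
        case False
        have "\<kappa> * (2 * s) ^ DIM('a) < c0 * (2 * s) ^ DIM('a)" using c0 s0 by (intro mult_strict_right_mono) (auto simp: \<kappa>_def)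
        also have "\<dots> \<le> m (2 * s)" using False by (intro R0) (auto simp: R1_def)
        finally show ?thesis .
      qed
      moreover have "\<kappa> * (2 * s) ^ DIM('a) \<ge> 2 * (\<kappa> * s ^ DIM('a))"
      proof -
        have "(2::real) ^ 1 \<le> 2 ^ DIM('a)" by (intro power_increasing) (auto simp: Suc_leI)
        then have "2 * (\<kappa> * s ^ DIM('a)) \<le> 2 ^ DIM('a) * (\<kappa> * s ^ DIM('a))" using \<kappa> s0 by (intro mult_right_mono) auto
        then show ?thesis by (simp add: power_mult_distrib mult.left_commute)
      qed
      ultimately show ?thesis using ms by linarith
    qed
    let ?e = "1 / (2 * ?n)"
    \<comment> \<open>The cut-off between the balls of radius a and b is extended from \<Omega>. The
      extension is 1 on \<Omega> in the small ball and 0 on \<Omega> between s and 2 s; both sets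
      have measure at least m a, so \<open>capacity_estimate\<close> bounds b - a.\<close>
    have gap: "b - a \<le> K2 * sqrt s * m a powr ?e" if ab: "0 < a" "a < b" "b \<le> s" and half: "m b = 2 * m a" for a b
    proof -
      from cutoff_gradient[OF ab(1,2), of x] obtain u g where wg: "has_weak_gradient UNIV u g"
        and gb: "AE y in lebesgue. norm (g y) \<le> ?n / (b - a)"
        and g0: "AE y in lebesgue. y \<notin> ball x b \<longrightarrow> g y = 0" and u1: "\<forall>y\<in>ball x a. u y = 1" and u0: "\<forall>y. y \<notin> ball x b \<longrightarrow> u y = 0"
        by blast
      from ext wg obtain v h where wh: "has_weak_gradient UNIV v h" and vu: "AE y in lebesgue. y \<in> \<Omega> \<longrightarrow> v y = u y"
        and le: "ennreal (sqn h) \<le> ennreal C * (\<integral>\<^sup>+y\<in>\<Omega>. ennreal ((norm (g y))\<^sup>2) \<partial>lebesgue)"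
        unfolding ext_prop_def by blast
      define SS where "SS = C * ((?n / (b - a))\<^sup>2 * m b)"
      have SS0: "SS > 0" using C ab n1 mpos[of b] by (simp add: SS_def)
      have "(\<integral>\<^sup>+y\<in>\<Omega>. ennreal ((norm (g y))\<^sup>2) \<partial>lebesgue) \<le> (\<integral>\<^sup>+y. ennreal ((?n / (b - a))\<^sup>2) * indicator (\<Omega> \<inter> ball x b) y \<partial>lebesgue)"
      proof (rule nn_integral_mono_AE)
        show "AE y in lebesgue. ennreal ((norm (g y))\<^sup>2) * indicator \<Omega> y \<le> ennreal ((?n / (b - a))\<^sup>2) * indicator (\<Omega> \<inter> ball x b) y"
          using gb g0
        proof eventually_elim
          fix y assume 1: "norm (g y) \<le> ?n / (b - a)" and 2: "y \<notin> ball x b \<longrightarrow> g y = 0"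
          have "(norm (g y))\<^sup>2 \<le> (?n / (b - a))\<^sup>2" using 1 by (intro power_mono) auto
          then show "ennreal ((norm (g y))\<^sup>2) * indicator \<Omega> y \<le> ennreal ((?n / (b - a))\<^sup>2) * indicator (\<Omega> \<inter> ball x b) y"
            using 2 by (cases "y \<in> ball x b") (auto simp: indicator_def intro: ennreal_leI)
        qed
      qed
      also have "\<dots> = ennreal ((?n / (b - a))\<^sup>2) * emeasure lebesgue (\<Omega> \<inter> ball x b)"
        by (rule nn_integral_cmult_indicator) (rule fmeasurableD[OF lm])
      also have "emeasure lebesgue (\<Omega> \<inter> ball x b) = ennreal (m b)" using lm[of b] by (simp add: m_def emeasure_eq_measure2)
      also have "ennreal ((?n / (b - a))\<^sup>2) * ennreal (m b) = ennreal ((?n / (b - a))\<^sup>2 * m b)"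
        by (rule ennreal_mult[symmetric]) (auto simp: m_def)
      finally have "ennreal C * (\<integral>\<^sup>+y\<in>\<Omega>. ennreal ((norm (g y))\<^sup>2) \<partial>lebesgue) \<le> ennreal C * ennreal ((?n / (b - a))\<^sup>2 * m b)"
        by (intro mult_left_mono) auto
      also have "\<dots> = ennreal SS" unfolding SS_def using C by (intro ennreal_mult[symmetric]) (auto simp: m_def)
      finally have "ennreal (sqn h) \<le> ennreal SS" using le by (rule order_trans[rotated])
      then have sS: "sqn h \<le> SS" using SS0 by (subst (asm) ennreal_le_iff) auto
      let ?P = "\<Omega> \<inter> ball x a" and ?Z = "\<Omega> \<inter> ball x (2 * s) - \<Omega> \<inter> ball x s"
      have Zm: "?Z \<in> lmeasurable" by (intro fmeasurable_Diff lm fmeasurableD[OF lm])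
      have "measure lebesgue ?Z = m (2 * s) - m s"
        unfolding m_def using s0 by (intro measurable_measure_Diff lm fmeasurableD[OF lm]) auto
      then have mZ: "measure lebesgue ?Z \<ge> m a" using m2s mono[of a s] ab by simp
      have "ker_mass TYPE('a) \<le> K1 TYPE('a) * sqrt SS * sqrt s * m a powr (- (1 - 1 / ?n) / 2)"
      proof (rule capacity_estimate[OF wh sS SS0 _ lm[of a] _ _ Zm mZ _ s0])
        show "m a > 0" using mpos ab by simp
        show "m a \<le> measure lebesgue ?P" by (simp add: m_def)
        show "AE y in lebesgue. y \<in> ?P \<longrightarrow> v y = 1" using vu by eventually_elim (use u1 in auto)
        show "AE y in lebesgue. y \<in> ?Z \<longrightarrow> v y = 0"
          using vu
        proof eventually_elim
          fix y assume "y \<in> \<Omega> \<longrightarrow> v y = u y"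
          then show "y \<in> ?Z \<longrightarrow> v y = 0" using u0[rule_format, of y] ab by auto
        qed
        show "norm (y - z) \<le> 3 * s" if "y \<in> ?P" "z \<in> ?Z" for y z
        proof -
          have "norm (y - z) \<le> dist x y + dist x z" by (metis dist_commute dist_norm dist_triangle)
          then show ?thesis using that ab by auto
        qed
      qed
      moreover have "sqrt SS = sqrt C * ?n / (b - a) * (sqrt 2 * m a powr (1/2))"
      proof -
        have "sqrt SS = sqrt C * (?n / (b - a)) * (sqrt 2 * sqrt (m a))"
          unfolding SS_def half using ab by (simp add: real_sqrt_mult)
        then show ?thesis using mpos[of a] ab by (simp add: powr_half_sqrt)
      qed
      ultimately have "ker_mass TYPE('a) \<le> K1 TYPE('a) * (sqrt C * ?n / (b - a) * (sqrt 2 * m a powr (1/2))) * sqrt s * m a powr (- (1 - 1 / ?n) / 2)"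
        by (simp only:)
      also have "\<dots> = (sqrt 2 * K1 TYPE('a) * sqrt C * ?n) * sqrt s * (m a powr (1/2) * m a powr (- (1 - 1 / ?n) / 2)) / (b - a)"
        by simp
      also have "m a powr (1/2) * m a powr (- (1 - 1 / ?n) / 2) = m a powr ?e"
        by (simp add: powr_add[symmetric] diff_divide_distrib mult.commute)
      finally have "ker_mass TYPE('a) * (b - a) \<le> (sqrt 2 * K1 TYPE('a) * sqrt C * ?n) * sqrt s * m a powr ?e"
        using ab by (simp add: le_divide_eq)
      then show ?thesis unfolding K2_def using ker_mass_pos[where 'a='a] by (simp add: field_simps)
    qed
    \<comment> \<open>Instead of summing over infinitely many halving radii, the supremum of this
      quotient is bounded: one halving step reproduces the supremum with the factor \<theta> < 1,
      which can be absorbed.\<close>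
    define \<psi> where "\<psi> r = r / m r powr ?e" for r
    have m\<theta>: "m a powr ?e = \<theta> * m b powr ?e" if "m b = 2 * m a" for a b
    proof -
      have "m a = (1/2) * m b" using that by simp
      then have "m a powr ?e = ((1/2) * m b) powr ?e" by (rule arg_cong)
      also have "\<dots> = (1/2) powr ?e * m b powr ?e" by (rule powr_mult)
      finally show ?thesis by (simp add: \<theta>_def)
    qed
    \<comment> \<open>Absorption requires a finite supremum. Near 0 the ball lies inside the open
      set \<Omega>, so m r is \<open>ubv\<close> times r^n and the quotient is a multiple of sqrt
      r.\<close>
    have bdd: "bdd_above (\<psi> ` {0<..s})"
    proof (rule bdd_aboveI2)
      fix b assume b: "b \<in> {0<..s}"
      show "\<psi> b \<le> max (sqrt s / ubv TYPE('a) powr ?e) (s / m \<rho>0 powr ?e)"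
      proof (cases "b \<le> \<rho>0")
        case True
        have "m b powr ?e = ubv TYPE('a) powr ?e * (b ^ DIM('a)) powr ?e"
          using True b ubv_pos[where 'a='a] by (subst msmall) (auto intro!: powr_mult)
        also have "(b ^ DIM('a)) powr ?e = sqrt b"
          using b by (simp add: powr_realpow[symmetric] powr_powr powr_half_sqrt)
        finally have "\<psi> b = b / (ubv TYPE('a) powr ?e * sqrt b)" by (simp add: \<psi>_def)
        also have "\<dots> = (sqrt b * sqrt b) / (ubv TYPE('a) powr ?e * sqrt b)" using b by simp
        also have "\<dots> = sqrt b / ubv TYPE('a) powr ?e" using b by (simp del: real_sqrt_mult_self)
        also have "\<dots> \<le> sqrt s / ubv TYPE('a) powr ?e" using b by (intro divide_right_mono) auto
        finally show ?thesis by simp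
      next
        case False
        have "\<psi> b \<le> s / m \<rho>0 powr ?e"
          unfolding \<psi>_def using b False mono[of \<rho>0 b] mpos[OF \<rho>0(1)] by (intro frac_le powr_mono2) auto
        then show ?thesis by simp
      qed
    qed
    define \<Psi> where "\<Psi> = Sup (\<psi> ` {0<..s})"
    have up: "\<psi> b \<le> \<Psi>" if "b \<in> {0<..s}" for b unfolding \<Psi>_def by (intro cSup_upper imageI that bdd)
    have step: "\<psi> b \<le> \<theta> * \<Psi> + K2 * sqrt s * \<theta>" if b: "b \<in> {0<..s}" for b
    proof -
      have mb: "m b > 0" using mpos b by simp
      have "m 0 = 0" by (simp add: m_def)
      then obtain a where a: "0 \<le> a" "a \<le> b" "m a = m b / 2"
        using IVT'[of m 0 "m b / 2" b] mb b continuous_on_subset[OF cont, of "{0..b}"] by auto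
      have "a \<noteq> 0" using a mb \<open>m 0 = 0\<close> by auto
      moreover have "a \<noteq> b" using a mb by auto
      ultimately have ab: "0 < a" "a < b" "b \<le> s" using a b by auto
      have half: "m b = 2 * m a" using a by simp
      have mbe: "m b powr ?e > 0" using mb by simp
      have "b \<le> a + K2 * sqrt s * (\<theta> * m b powr ?e)" using gap[OF ab half] m\<theta>[OF half] by simp
      then have "\<psi> b \<le> a / m b powr ?e + K2 * sqrt s * \<theta>"
        unfolding \<psi>_def using mbe by (simp add: field_simps)
      also have "a / m b powr ?e = \<theta> * \<psi> a"
        unfolding \<psi>_def m\<theta>[OF half] using \<theta> by simp
      also have "\<theta> * \<psi> a + K2 * sqrt s * \<theta> \<le> \<theta> * \<Psi> + K2 * sqrt s * \<theta>"
        using up[of a] ab \<theta> by (intro add_right_mono mult_left_mono) auto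
      finally show ?thesis .
    qed
    have "\<Psi> \<le> \<theta> * \<Psi> + K2 * sqrt s * \<theta>"
      unfolding \<Psi>_def using s0 by (intro cSup_least) (use step in \<open>auto simp: \<Psi>_def\<close>)
    then have "\<Psi> * (1 - \<theta>) \<le> K2 * sqrt s * \<theta>" by (simp add: algebra_simps)
    then have "\<Psi> \<le> K3 * sqrt s" using \<theta> by (simp add: K3_def field_simps)
    then have "\<psi> s \<le> K3 * sqrt s" using up[of s] s0 by simp
    then have "s \<le> K3 * sqrt s * m s powr ?e" unfolding \<psi>_def using mpos[OF s0] by (simp add: divide_le_eq)
    then have "sqrt s * sqrt s \<le> sqrt s * (K3 * m s powr ?e)" using s0 by (simp add: mult_ac)
    then have "sqrt s \<le> K3 * m s powr ?e" using s0 by (subst (asm) mult_le_cancel_left_pos) auto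
    then have "(sqrt s) ^ (2 * DIM('a)) \<le> (K3 * m s powr ?e) ^ (2 * DIM('a))" using s0 by (intro power_mono) auto
    also have "(sqrt s) ^ (2 * DIM('a)) = s ^ DIM('a)" using s0 by (simp add: power_mult)
    also have "(K3 * m s powr ?e) ^ (2 * DIM('a)) = K3 ^ (2 * DIM('a)) * m s"
    proof -
      have "(m s powr ?e) ^ (2 * DIM('a)) = (m s powr ?e) powr (2 * ?n)"
        using mpos[OF s0] by (subst powr_realpow[symmetric]) auto
      also have "\<dots> = m s" using mpos[OF s0] n1 by (simp add: powr_powr)
      finally show ?thesis by (simp add: power_mult_distrib)
    qed
    finally have fin: "s ^ DIM('a) \<le> K3 ^ (2 * DIM('a)) * m s" .
    have "K3 ^ (2 * DIM('a)) * m s \<le> K3 ^ (2 * DIM('a)) * (\<kappa> * s ^ DIM('a))" using K3 ms by (intro mult_left_mono) auto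
    also have "\<dots> \<le> K3 ^ (2 * DIM('a)) * (1 / (2 * K3 ^ (2 * DIM('a))) * s ^ DIM('a))"
      using K3 s0 by (intro mult_left_mono mult_right_mono) (auto simp: \<kappa>_def)
    also have "\<dots> = s ^ DIM('a) / 2" using K3 by simp
    finally show False using fin s0 zero_less_power[OF s0, of "DIM('a)"] by linarith
  qed
  with \<kappa> show ?thesis by blast
qed

section \<open>Comparison of two domains\<close>

lemma sq_sum3_le: "(a + b + c)\<^sup>2 \<le> 3 * (a\<^sup>2 + b\<^sup>2 + c\<^sup>2)" for a b c :: real
proof -
  have "0 \<le> (a - b)\<^sup>2 + (a - c)\<^sup>2 + (b - c)\<^sup>2" by simp
  then show ?thesis by (simp add: power2_eq_square algebra_simps)
qed

lemma sq_sum2_le: "(a + b)\<^sup>2 \<le> 2 * a\<^sup>2 + 2 * b\<^sup>2" for a b :: real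
proof -
  have "0 \<le> (a - b)\<^sup>2" by simp
  then show ?thesis by (simp add: power2_eq_square algebra_simps)
qed

text \<open>The squared pointwise inequality is averaged over y in A and integrated over x in the
  ball. It suffices that A has a fixed fraction of the volume; R^2 comes from the distance at most 2
  R of two points.\<close>

lemma poincare_ball:
  fixes v :: "'a::euclidean_space \<Rightarrow> real"
  assumes wg: "has_weak_gradient UNIV v h" and R: "R > 0" and c: "c > 0"
    and A: "A \<in> sets lebesgue" "A \<subseteq> ball 0 R" "measure lebesgue A \<ge> c * R ^ DIM('a)"
  shows "(\<integral>x. indicator (ball 0 R) x * (v x)\<^sup>2 \<partial>lebesgue) \<le> 3 * (ubv TYPE('a) / c) * (\<integral>x. indicator A x * (v x)\<^sup>2 \<partial>lebesgue)
     + 3 * (Clip TYPE('a))\<^sup>2 * (1 + ubv TYPE('a) / c) * Cmax TYPE('a) * R\<^sup>2 * sqn h"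
proof -
  have v: "sqi v" and h: "sqi h" using wg by (auto simp: has_weak_gradient_UNIV_iff)
  define m where "m x = enn2real (MG h x)" for x
  have m: "sqi m" "sqn m \<le> Cmax TYPE('a) * sqn h" unfolding m_def by (rule sqi_MG[OF h])+
  have Alm: "A \<in> lmeasurable" using A by (intro bounded_set_imp_lmeasurable) (auto intro: bounded_subset)
  let ?a = "measure lebesgue A" and ?b = "measure lebesgue (ball (0::'a) R)"
  have a0: "?a > 0" using A(3) c R by (smt (verit) mult_pos_pos zero_less_power)
  have iv: "integrable lebesgue (\<lambda>x. (v x)\<^sup>2)" and im: "integrable lebesgue (\<lambda>x. (m x)\<^sup>2)"
    using v m by (auto simp: sqi_def)
  have ind: "integrable lebesgue (\<lambda>x. indicator S x * f x)" if "integrable lebesgue f" "S \<in> sets lebesgue" for S and f :: "'a \<Rightarrow> real"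
    using integrable_mult_indicator[OF that(2,1)] by simp
  define I where "I = (\<integral>x. indicator A x * (v x)\<^sup>2 \<partial>lebesgue)"
  define M where "M = (\<integral>x. (m x)\<^sup>2 \<partial>lebesgue)"
  have M: "M \<le> Cmax TYPE('a) * sqn h" "M \<ge> 0" using m(2) by (auto simp: M_def sqn_def)
  let ?k = "Clip TYPE('a) * R"
  define good where "good x \<longleftrightarrow> leb_pt v x \<and> MG h x < top" for x
  have AEg: "AE x in lebesgue. good x" using AE_leb_pt_sqi[OF v] MG_finite_AE[OF h] by eventually_elim (simp add: good_def)
  have pw: "(v x)\<^sup>2 \<le> 3 * (v y)\<^sup>2 + 3 * ?k\<^sup>2 * (m x)\<^sup>2 + 3 * ?k\<^sup>2 * (m y)\<^sup>2"
    if g: "good x" "good y" and xy: "x \<in> ball 0 R" "y \<in> ball 0 R" for x y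
  proof -
    have "norm (x - y) \<le> 2 * R" using xy norm_triangle_ineq4[of x y] by auto
    then have "ker_mass TYPE('a) * \<bar>v x - v y\<bar> \<le> Cpw TYPE('a) * (m x + m y) * (2 * R)"
      using g R by (intro pw_ineq[OF wg]) (auto simp: good_def m_def ennreal_enn2real_if less_top)
    then have "\<bar>v x - v y\<bar> \<le> ?k * (m x + m y)"
      using ker_mass_pos[where 'a='a] by (simp add: Clip_def field_simps)
    then have "\<bar>v x\<bar> \<le> \<bar>v y\<bar> + ?k * m x + ?k * m y" by (simp add: distrib_left)
    then have "\<bar>v x\<bar>\<^sup>2 \<le> (\<bar>v y\<bar> + ?k * m x + ?k * m y)\<^sup>2" by (rule power_mono) simp
    also have "\<dots> \<le> 3 * (\<bar>v y\<bar>\<^sup>2 + (?k * m x)\<^sup>2 + (?k * m y)\<^sup>2)" by (rule sq_sum3_le)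
    finally show ?thesis by (simp add: power_mult_distrib)
  qed
  have stepx: "?a * (v x)\<^sup>2 \<le> 3 * I + 3 * ?k\<^sup>2 * (?a * (m x)\<^sup>2) + 3 * ?k\<^sup>2 * M" if x: "good x" "x \<in> ball 0 R" for x
  proof -
    let ?r = "\<lambda>y. 3 * (indicator A y * (v y)\<^sup>2) + (3 * ?k\<^sup>2 * (m x)\<^sup>2) * indicator A y + 3 * ?k\<^sup>2 * (m y)\<^sup>2"
    have i1: "integrable lebesgue (\<lambda>y. 3 * (indicator A y * (v y)\<^sup>2))" by (intro integrable_mult_right ind iv A(1))
    have iA: "integrable lebesgue (indicator A :: 'a \<Rightarrow> real)" using Alm by (intro integrable_real_indicator) (auto simp: fmeasurable_def)
    have i2: "integrable lebesgue (\<lambda>y. (3 * ?k\<^sup>2 * (m x)\<^sup>2) * indicator A y)" by (intro integrable_mult_right iA)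
    have i3: "integrable lebesgue (\<lambda>y. 3 * ?k\<^sup>2 * (m y)\<^sup>2)" by (intro integrable_mult_right im)
    have "?a * (v x)\<^sup>2 = (\<integral>y. (v x)\<^sup>2 * indicator A y \<partial>lebesgue)" by simp
    also have "\<dots> \<le> (\<integral>y. ?r y \<partial>lebesgue)"
    proof (rule integral_mono_AE)
      show "integrable lebesgue (\<lambda>y. (v x)\<^sup>2 * indicator A y)" by (intro integrable_mult_right iA)
      show "integrable lebesgue ?r" by (intro Bochner_Integration.integrable_add i1 i2 i3)
      show "AE y in lebesgue. (v x)\<^sup>2 * indicator A y \<le> ?r y"
        using AEg
      proof eventually_elim
        fix y assume "good y"
        then show "(v x)\<^sup>2 * indicator A y \<le> ?r y"
          using pw[OF x(1) _ x(2), of y] A(2) by (cases "y \<in> A") auto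
      qed
    qed
    also have "\<dots> = (\<integral>y. 3 * (indicator A y * (v y)\<^sup>2) \<partial>lebesgue) + (\<integral>y. (3 * ?k\<^sup>2 * (m x)\<^sup>2) * indicator A y \<partial>lebesgue) + (\<integral>y. 3 * ?k\<^sup>2 * (m y)\<^sup>2 \<partial>lebesgue)"
      by (simp only: Bochner_Integration.integral_add[OF Bochner_Integration.integrable_add[OF i1 i2] i3] Bochner_Integration.integral_add[OF i1 i2])
    also have "\<dots> = 3 * I + 3 * ?k\<^sup>2 * (?a * (m x)\<^sup>2) + 3 * ?k\<^sup>2 * M"
      by (simp add: I_def M_def)
    finally show ?thesis .
  qed
  let ?V = "\<integral>x. indicator (ball 0 R) x * (v x)\<^sup>2 \<partial>lebesgue"
  have "?a * ?V = (\<integral>x. ?a * (indicator (ball 0 R) x * (v x)\<^sup>2) \<partial>lebesgue)" by simp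
  also have "\<dots> \<le> (\<integral>x. (3 * I + 3 * ?k\<^sup>2 * M) * indicator (ball 0 R) x + 3 * ?k\<^sup>2 * ?a * (m x)\<^sup>2 \<partial>lebesgue)"
  proof (rule integral_mono_AE)
    show "integrable lebesgue (\<lambda>x. ?a * (indicator (ball 0 R) x * (v x)\<^sup>2))" by (intro integrable_mult_right ind iv) auto
    show "integrable lebesgue (\<lambda>x. (3 * I + 3 * ?k\<^sup>2 * M) * indicator (ball 0 R) x + 3 * ?k\<^sup>2 * ?a * (m x)\<^sup>2)"
      by (intro Bochner_Integration.integrable_add integrable_mult_right im integrable_real_indicator) (use emeasure_lborel_ball_finite in \<open>auto simp: less_top\<close>)
    show "AE x in lebesgue. ?a * (indicator (ball 0 R) x * (v x)\<^sup>2) \<le> (3 * I + 3 * ?k\<^sup>2 * M) * indicator (ball 0 R) x + 3 * ?k\<^sup>2 * ?a * (m x)\<^sup>2"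
      using AEg
    proof eventually_elim
      fix x assume "good x"
      then show "?a * (indicator (ball 0 R) x * (v x)\<^sup>2) \<le> (3 * I + 3 * ?k\<^sup>2 * M) * indicator (ball 0 R) x + 3 * ?k\<^sup>2 * ?a * (m x)\<^sup>2"
        using stepx[of x] by (cases "x \<in> ball 0 R") auto
    qed
  qed
  also have "\<dots> = (\<integral>x. (3 * I + 3 * ?k\<^sup>2 * M) * indicator (ball (0::'a) R) x \<partial>lebesgue) + (\<integral>x. 3 * ?k\<^sup>2 * ?a * (m x)\<^sup>2 \<partial>lebesgue)"
    by (rule Bochner_Integration.integral_add) (intro integrable_mult_right im integrable_real_indicator; use emeasure_lborel_ball_finite in \<open>auto simp: less_top\<close>)+
  also have "\<dots> = (3 * I + 3 * ?k\<^sup>2 * M) * ?b + 3 * ?k\<^sup>2 * ?a * M" by (simp add: M_def)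
  finally have main: "?a * ?V \<le> (3 * I + 3 * ?k\<^sup>2 * M) * ?b + 3 * ?k\<^sup>2 * ?a * M" .
  have I0: "I \<ge> 0" unfolding I_def by (intro Bochner_Integration.integral_nonneg) auto
  have "?b = ubv TYPE('a) * R ^ DIM('a)" using R by (intro measure_ball_ubv) auto
  also have "\<dots> = (ubv TYPE('a) / c) * (c * R ^ DIM('a))" using c by simp
  also have "\<dots> \<le> (ubv TYPE('a) / c) * ?a" using A(3) ubv_pos[where 'a='a] c by (intro mult_left_mono) auto
  finally have b: "?b \<le> (ubv TYPE('a) / c) * ?a" .
  have "?a * ?V \<le> (3 * I + 3 * ?k\<^sup>2 * M) * ((ubv TYPE('a) / c) * ?a) + 3 * ?k\<^sup>2 * ?a * M"
    using main mult_left_mono[OF b, of "3 * I + 3 * ?k\<^sup>2 * M"] I0 M by simp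
  also have "\<dots> = ?a * (3 * (ubv TYPE('a) / c) * I + 3 * ?k\<^sup>2 * (1 + ubv TYPE('a) / c) * M)"
    by (simp add: algebra_simps)
  finally have "?V \<le> 3 * (ubv TYPE('a) / c) * I + 3 * ?k\<^sup>2 * (1 + ubv TYPE('a) / c) * M"
    using a0 by (subst (asm) mult_le_cancel_left_pos) auto
  also have "\<dots> \<le> 3 * (ubv TYPE('a) / c) * I + 3 * ?k\<^sup>2 * (1 + ubv TYPE('a) / c) * (Cmax TYPE('a) * sqn h)"
    using M(1) ubv_pos[where 'a='a] c by (intro add_left_mono mult_left_mono) auto
  finally show ?thesis by (simp add: I_def power_mult_distrib mult_ac)
qed

text \<open>A point x within \<delta> of \<Omega>' has some y in \<Omega>' nearby, and the ball of
  radius \<delta> at y meets \<Omega> in measure at least \<kappa>/2 \<delta>^n, by the density of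
  \<Omega>' and the smallness of \<Omega>' - \<Omega>. There F differs from F x by at most 2 L
  \<delta>. Integrating in x, the volume of a ball of radius 2 \<delta> cancels the \<delta>^n, so
  the factor of the integral over \<Omega> does not depend on \<delta>.\<close>

lemma neighbourhood_average:
  fixes F :: "'a::euclidean_space \<Rightarrow> real"
  assumes op: "open \<Omega>" and op': "open \<Omega>'" and ne: "\<Omega>' \<noteq> {}"
    and lip: "\<And>x y. \<bar>F x - F y\<bar> \<le> L * norm (x - y)" and L: "L \<ge> 0"
    and F0: "\<And>x. norm x \<ge> r \<Longrightarrow> F x = 0" and r: "r > 0"
    and \<delta>: "0 < \<delta>" "\<delta> \<le> 1" and \<kappa>: "\<kappa> > 0"
    and dens: "\<And>y. y \<in> \<Omega>' \<Longrightarrow> measure lebesgue (\<Omega>' \<inter> ball y \<delta>) \<ge> \<kappa> * \<delta> ^ DIM('a)"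
    and small: "measure lebesgue ((\<Omega>' - \<Omega>) \<inter> ball 0 (r + 2)) \<le> \<kappa> / 2 * \<delta> ^ DIM('a)"
  shows "(\<integral>\<^sup>+x. ennreal ((F x)\<^sup>2) * indicator {x. infdist x \<Omega>' < \<delta>} x \<partial>lebesgue)
    \<le> ennreal (8 * L\<^sup>2 * \<delta>\<^sup>2 * (ubv TYPE('a) * r ^ DIM('a))) + ennreal (4 * ubv TYPE('a) * 2 ^ DIM('a) / \<kappa>) * (\<integral>\<^sup>+z\<in>\<Omega>. ennreal ((F z)\<^sup>2) \<partial>lebesgue)"
proof -
  let ?n = "DIM('a)"
  have "L-lipschitz_on UNIV F" using lip L by (intro lipschitz_onI) (auto simp: dist_real_def dist_norm)
  then have Fc: "continuous_on UNIV F" by (rule lipschitz_on_continuous_on)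
  then have [measurable]: "F \<in> borel_measurable borel" by (rule borel_measurable_continuous_onI)
  have [measurable]: "\<Omega> \<in> sets borel" using op by simp
  \<comment> \<open>Averaging over all points of \<Omega> within 2 \<delta> of x, independently of
    the choice of y, makes the kernel symmetric, so Tonelli can integrate in x first.\<close>
  define J where "J x = (\<integral>\<^sup>+z. ennreal ((F z)\<^sup>2) * indicator \<Omega> z * (if dist x z < 2 * \<delta> then 1 else 0) \<partial>lebesgue)" for x
  have pt: "ennreal ((F x)\<^sup>2) * indicator {x. infdist x \<Omega>' < \<delta>} x
     \<le> ennreal (8 * L\<^sup>2 * \<delta>\<^sup>2) * indicator (ball 0 r) x + ennreal (4 / (\<kappa> * \<delta> ^ ?n)) * J x" for x
  proof (cases "infdist x \<Omega>' < \<delta> \<and> norm x < r")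
    case False
    then show ?thesis using F0[of x] by (cases "norm x < r") auto
  next
    case True
    have "\<exists>y\<in>\<Omega>'. dist x y < \<delta>"
    proof -
      have "(INF y\<in>\<Omega>'. dist x y) < \<delta>" using True ne by (simp add: infdist_def)
      then show ?thesis using cInf_lessD[of "dist x ` \<Omega>'" \<delta>] ne by auto
    qed
    then obtain y where y: "y \<in> \<Omega>'" "dist x y < \<delta>" by blast
    define A where "A = \<Omega> \<inter> ball y \<delta>"
    have lmO: "S \<inter> ball y \<delta> \<in> lmeasurable" if "S \<in> sets lebesgue" for S
      using fmeasurable_Int_fmeasurable[OF lmeasurable_ball that, of y \<delta>] by (simp add: Int_commute)
    have Alm: "A \<in> lmeasurable" unfolding A_def using op by (intro lmO) auto
    have A2: "measure lebesgue A \<ge> \<kappa> / 2 * \<delta> ^ ?n"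
    proof -
      \<comment> \<open>The norm of x is below r, and two steps shorter than \<delta> \<le> 1 lead
        from x through y to z.\<close>
      have sub: "ball y \<delta> \<subseteq> ball 0 (r + 2)"
      proof
        fix z assume "z \<in> ball y \<delta>"
        moreover have "norm z \<le> norm x + dist x y + dist y z"
          by (smt (verit) dist_norm dist_triangle norm_minus_commute norm_triangle_sub)
        ultimately show "z \<in> ball 0 (r + 2)" using y(2) True \<delta> by auto
      qed
      have dm: "(\<Omega>' - \<Omega>) \<inter> ball y \<delta> \<in> lmeasurable" using op op' by (intro lmO) auto
      have "\<kappa> * \<delta> ^ ?n \<le> measure lebesgue (\<Omega>' \<inter> ball y \<delta>)" by (rule dens[OF y(1)])
      also have "\<dots> \<le> measure lebesgue (A \<union> ((\<Omega>' - \<Omega>) \<inter> ball y \<delta>))"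
        using op op' by (intro measure_mono_fmeasurable fmeasurable.Un Alm dm) (auto simp: A_def)
      also have "\<dots> \<le> measure lebesgue A + measure lebesgue ((\<Omega>' - \<Omega>) \<inter> ball y \<delta>)"
        by (intro measure_Un_le fmeasurableD Alm dm)
      also have "measure lebesgue ((\<Omega>' - \<Omega>) \<inter> ball y \<delta>) \<le> measure lebesgue ((\<Omega>' - \<Omega>) \<inter> ball 0 (r + 2))"
      proof (rule measure_mono_fmeasurable)
        show "(\<Omega>' - \<Omega>) \<inter> ball 0 (r + 2) \<in> lmeasurable"
          using fmeasurable_Int_fmeasurable[OF lmeasurable_ball, of "\<Omega>' - \<Omega>" 0 "r + 2"] op op' by (auto simp: Int_commute)
      qed (use sub dm in \<open>auto intro: fmeasurableD\<close>)
      also note small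
      finally show ?thesis by simp
    qed
    have kd: "\<kappa> / 2 * \<delta> ^ ?n > 0" using \<kappa> \<delta> by simp
    let ?a = "measure lebesgue A"
    have a0: "?a > 0" using A2 kd by linarith
    have zz: "(F x)\<^sup>2 \<le> 2 * (F z)\<^sup>2 + 8 * L\<^sup>2 * \<delta>\<^sup>2 \<and> dist x z < 2 * \<delta>" if z: "z \<in> A" for z
    proof -
      have d: "dist x z < 2 * \<delta>" using z y dist_triangle[of x z y] by (auto simp: A_def)
      have "\<bar>F x - F z\<bar> \<le> L * (2 * \<delta>)"
        using lip[of x z] mult_left_mono[of "norm (x - z)" "2 * \<delta>" L] d L by (simp add: dist_norm)
      then have "\<bar>F x - F z\<bar>\<^sup>2 \<le> (L * (2 * \<delta>))\<^sup>2" by (rule power_mono) simp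
      moreover have "(F z + (F x - F z))\<^sup>2 \<le> 2 * (F z)\<^sup>2 + 2 * (F x - F z)\<^sup>2" by (rule sq_sum2_le)
      ultimately show ?thesis using d by (simp add: power_mult_distrib)
    qed
    have [measurable]: "A \<in> sets lebesgue" using Alm by (rule fmeasurableD)
    have Fml: "(\<lambda>z. ennreal ((F z)\<^sup>2) * indicator A z) \<in> borel_measurable lebesgue"
    proof -
      have [measurable]: "F \<in> borel_measurable lebesgue" by (rule borel_measurable_continuous_lebesgue[OF Fc])
      show ?thesis by measurable
    qed
    have "ennreal (?a * (F x)\<^sup>2) = (\<integral>\<^sup>+z. ennreal ((F x)\<^sup>2) * indicator A z \<partial>lebesgue)"
      using Alm by (subst nn_integral_cmult_indicator) (auto simp: emeasure_eq_measure2 ennreal_mult mult.commute)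
    also have "\<dots> \<le> (\<integral>\<^sup>+z. ennreal 2 * (ennreal ((F z)\<^sup>2) * indicator A z) + ennreal (8 * L\<^sup>2 * \<delta>\<^sup>2) * indicator A z \<partial>lebesgue)"
    proof (rule nn_integral_mono)
      fix z
      show "ennreal ((F x)\<^sup>2) * indicator A z \<le> ennreal 2 * (ennreal ((F z)\<^sup>2) * indicator A z) + ennreal (8 * L\<^sup>2 * \<delta>\<^sup>2) * indicator A z"
      proof (cases "z \<in> A")
        case True
        have "ennreal ((F x)\<^sup>2) \<le> ennreal (2 * (F z)\<^sup>2 + 8 * L\<^sup>2 * \<delta>\<^sup>2)" using zz[OF True] by (intro ennreal_leI) simp
        also have "\<dots> = ennreal (2 * (F z)\<^sup>2) + ennreal (8 * L\<^sup>2 * \<delta>\<^sup>2)" by (rule ennreal_plus) auto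
        also have "ennreal (2 * (F z)\<^sup>2) = ennreal 2 * ennreal ((F z)\<^sup>2)" by (rule ennreal_mult) auto
        finally show ?thesis using True by simp
      qed simp
    qed
    also have "\<dots> = ennreal 2 * (\<integral>\<^sup>+z. ennreal ((F z)\<^sup>2) * indicator A z \<partial>lebesgue) + ennreal (8 * L\<^sup>2 * \<delta>\<^sup>2) * emeasure lebesgue A"
      using Fml by (subst nn_integral_add) (auto simp: nn_integral_cmult nn_integral_cmult_indicator simp del: ennreal_numeral)
    also have "\<dots> \<le> ennreal 2 * J x + ennreal (8 * L\<^sup>2 * \<delta>\<^sup>2) * ennreal ?a"
    proof (intro add_mono mult_left_mono)
      show "(\<integral>\<^sup>+z. ennreal ((F z)\<^sup>2) * indicator A z \<partial>lebesgue) \<le> J x"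
        unfolding J_def
      proof (rule nn_integral_mono)
        fix z
        show "ennreal ((F z)\<^sup>2) * indicator A z \<le> ennreal ((F z)\<^sup>2) * indicator \<Omega> z * (if dist x z < 2 * \<delta> then 1 else 0)"
          using zz[of z] by (cases "z \<in> A") (auto simp: A_def)
      qed
      show "emeasure lebesgue A \<le> ennreal ?a" using Alm by (simp add: emeasure_eq_measure2)
    qed auto
    finally have "ennreal (?a * (F x)\<^sup>2) \<le> ennreal 2 * J x + ennreal (8 * L\<^sup>2 * \<delta>\<^sup>2) * ennreal ?a" .
    then have "ennreal (1 / ?a) * ennreal (?a * (F x)\<^sup>2) \<le> ennreal (1 / ?a) * (ennreal 2 * J x + ennreal (8 * L\<^sup>2 * \<delta>\<^sup>2) * ennreal ?a)"
      by (rule mult_left_mono) simp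
    also have "ennreal (1 / ?a) * ennreal (?a * (F x)\<^sup>2) = ennreal ((F x)\<^sup>2)"
      using a0 by (subst ennreal_mult[symmetric]) auto
    also have "ennreal (1 / ?a) * (ennreal 2 * J x + ennreal (8 * L\<^sup>2 * \<delta>\<^sup>2) * ennreal ?a)
        = ennreal (2 / ?a) * J x + ennreal (8 * L\<^sup>2 * \<delta>\<^sup>2)"
    proof -
      have "ennreal (1 / ?a) * ennreal 2 = ennreal (2 / ?a)" using a0 by (subst ennreal_mult[symmetric]) auto
      moreover have "ennreal (1 / ?a) * (ennreal (8 * L\<^sup>2 * \<delta>\<^sup>2) * ennreal ?a) = ennreal (8 * L\<^sup>2 * \<delta>\<^sup>2)"
      proof -
        have 1: "ennreal (1 / ?a) * ennreal ?a = 1" using a0 by (subst ennreal_mult[symmetric]) auto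
        show ?thesis unfolding mult.left_commute[of "ennreal (1 / ?a)"] 1 by simp
      qed
      ultimately show ?thesis by (simp only: distrib_left mult.assoc[symmetric])
    qed
    also have "\<dots> \<le> ennreal (4 / (\<kappa> * \<delta> ^ ?n)) * J x + ennreal (8 * L\<^sup>2 * \<delta>\<^sup>2)"
    proof -
      have "2 / ?a \<le> 2 / (\<kappa> / 2 * \<delta> ^ ?n)" using A2 kd by (intro divide_left_mono) auto
      also have "\<dots> = 4 / (\<kappa> * \<delta> ^ ?n)" by simp
      finally show ?thesis by (intro add_right_mono mult_right_mono ennreal_leI) auto
    qed
    finally show ?thesis using True by (simp add: add.commute)
  qed
  have JI: "(\<integral>\<^sup>+x. J x \<partial>lebesgue) = ennreal (ubv TYPE('a) * (2 * \<delta>) ^ ?n) * (\<integral>\<^sup>+z\<in>\<Omega>. ennreal ((F z)\<^sup>2) \<partial>lebesgue)"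
    and Jm: "J \<in> borel_measurable lebesgue"
  proof -
    define H where "H x z = ennreal ((F z)\<^sup>2) * indicator \<Omega> z * (if dist x z < 2 * \<delta> then 1 else 0)" for x z :: 'a
    have Hm[measurable]: "case_prod H \<in> borel_measurable (lborel \<Otimes>\<^sub>M lborel)" unfolding H_def by measurable
    have J: "J x = (\<integral>\<^sup>+z. H x z \<partial>lborel)" for x unfolding J_def H_def by (rule nn_integral_completion)
    have Jb: "J \<in> borel_measurable lborel" unfolding J[abs_def] by measurable
    then show "J \<in> borel_measurable lebesgue" by (rule measurable_completion)
    have "(\<integral>\<^sup>+x. J x \<partial>lebesgue) = (\<integral>\<^sup>+x. J x \<partial>lborel)" by (rule nn_integral_completion)
    also have "\<dots> = (\<integral>\<^sup>+x. (\<integral>\<^sup>+z. H x z \<partial>lborel) \<partial>lborel)" by (simp only: J)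
    also have "\<dots> = (\<integral>\<^sup>+z. (\<integral>\<^sup>+x. H x z \<partial>lborel) \<partial>lborel)" by (rule lborel_pair.Fubini'[symmetric, OF Hm])
    also have "\<dots> = (\<integral>\<^sup>+z. ennreal (ubv TYPE('a) * (2 * \<delta>) ^ ?n) * (ennreal ((F z)\<^sup>2) * indicator \<Omega> z) \<partial>lborel)"
    proof (rule nn_integral_cong)
      fix z
      have "(\<integral>\<^sup>+x. H x z \<partial>lborel) = (\<integral>\<^sup>+x. (ennreal ((F z)\<^sup>2) * indicator \<Omega> z) * indicator (ball z (2 * \<delta>)) x \<partial>lborel)"
        by (intro nn_integral_cong) (auto simp: H_def indicator_def dist_commute)
      also have "\<dots> = (ennreal ((F z)\<^sup>2) * indicator \<Omega> z) * emeasure lborel (ball z (2 * \<delta>))" by (rule nn_integral_cmult_indicator) simp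
      also have "emeasure lborel (ball z (2 * \<delta>)) = ennreal (ubv TYPE('a) * (2 * \<delta>) ^ ?n)"
        using \<delta> emeasure_ball[of "2 * \<delta>" z] by (simp add: ubv_def)
      finally show "(\<integral>\<^sup>+x. H x z \<partial>lborel) = ennreal (ubv TYPE('a) * (2 * \<delta>) ^ ?n) * (ennreal ((F z)\<^sup>2) * indicator \<Omega> z)" by (simp only: mult.commute)
    qed
    also have "\<dots> = ennreal (ubv TYPE('a) * (2 * \<delta>) ^ ?n) * (\<integral>\<^sup>+z. ennreal ((F z)\<^sup>2) * indicator \<Omega> z \<partial>lborel)"
      by (rule nn_integral_cmult) measurable
    also have "(\<integral>\<^sup>+z. ennreal ((F z)\<^sup>2) * indicator \<Omega> z \<partial>lborel) = (\<integral>\<^sup>+z\<in>\<Omega>. ennreal ((F z)\<^sup>2) \<partial>lebesgue)"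
      by (rule nn_integral_completion[symmetric])
    finally show "(\<integral>\<^sup>+x. J x \<partial>lebesgue) = ennreal (ubv TYPE('a) * (2 * \<delta>) ^ ?n) * (\<integral>\<^sup>+z\<in>\<Omega>. ennreal ((F z)\<^sup>2) \<partial>lebesgue)" .
  qed
  have "(\<integral>\<^sup>+x. ennreal ((F x)\<^sup>2) * indicator {x. infdist x \<Omega>' < \<delta>} x \<partial>lebesgue)
     \<le> (\<integral>\<^sup>+x. ennreal (8 * L\<^sup>2 * \<delta>\<^sup>2) * indicator (ball 0 r) x + ennreal (4 / (\<kappa> * \<delta> ^ ?n)) * J x \<partial>lebesgue)"
    by (rule nn_integral_mono) (rule pt)
  also have "\<dots> = ennreal (8 * L\<^sup>2 * \<delta>\<^sup>2) * emeasure lebesgue (ball (0::'a) r) + ennreal (4 / (\<kappa> * \<delta> ^ ?n)) * (\<integral>\<^sup>+x. J x \<partial>lebesgue)"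
  proof -
    have bm: "ball (0::'a) r \<in> sets lebesgue" by simp
    have m1: "(\<lambda>x. ennreal (8 * L\<^sup>2 * \<delta>\<^sup>2) * indicator (ball (0::'a) r) x) \<in> borel_measurable lebesgue" using bm by measurable
    have m2: "(\<lambda>x. ennreal (4 / (\<kappa> * \<delta> ^ ?n)) * J x) \<in> borel_measurable lebesgue" using Jm by measurable
    show ?thesis unfolding nn_integral_add[OF m1 m2] nn_integral_cmult_indicator[OF bm] nn_integral_cmult[OF Jm] ..
  qed
  also have "ennreal (8 * L\<^sup>2 * \<delta>\<^sup>2) * emeasure lebesgue (ball (0::'a) r) = ennreal (8 * L\<^sup>2 * \<delta>\<^sup>2 * (ubv TYPE('a) * r ^ ?n))"
  proof -
    have "emeasure lebesgue (ball (0::'a) r) = ennreal (ubv TYPE('a) * r ^ ?n)" using r by (intro emeasure_ball_ubv) auto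
    then show ?thesis using r ubv_pos[where 'a='a] by (simp only:) (subst ennreal_mult, auto)
  qed
  also have "ennreal (4 / (\<kappa> * \<delta> ^ ?n)) * (\<integral>\<^sup>+x. J x \<partial>lebesgue) = ennreal (4 * ubv TYPE('a) * 2 ^ ?n / \<kappa>) * (\<integral>\<^sup>+z\<in>\<Omega>. ennreal ((F z)\<^sup>2) \<partial>lebesgue)"
  proof -
    have "4 / (\<kappa> * \<delta> ^ ?n) * (ubv TYPE('a) * (2 * \<delta>) ^ ?n) = 4 * ubv TYPE('a) * 2 ^ ?n / \<kappa>"
      using \<delta> by (simp add: power_mult_distrib)
    moreover have "ennreal (4 / (\<kappa> * \<delta> ^ ?n)) * ennreal (ubv TYPE('a) * (2 * \<delta>) ^ ?n) = ennreal (4 / (\<kappa> * \<delta> ^ ?n) * (ubv TYPE('a) * (2 * \<delta>) ^ ?n))"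
      using \<delta> \<kappa> ubv_pos[where 'a='a] by (intro ennreal_mult[symmetric]) auto
    ultimately show ?thesis unfolding JI by (simp only: mult.assoc[symmetric])
  qed
  finally show ?thesis .
qed

text \<open>The weighted form keeps the coefficient of the main term as close to 1 as desired; the
  terms created by the cut-off carry 1 + 1/\<eta>.\<close>

lemma ennreal_Young:
  fixes a b :: "'a::euclidean_space" and \<eta> p q :: real
  assumes "\<eta> > 0"
  shows "(norm (a + b))\<^sup>2 \<le> (1 + \<eta>) * (norm a)\<^sup>2 + (1 + 1 / \<eta>) * (norm b)\<^sup>2"
proof -
  let ?p = "norm a" and ?q = "norm b"
  have "(norm (a + b))\<^sup>2 \<le> (?p + ?q)\<^sup>2" by (intro power_mono norm_triangle_ineq) auto
  also have "\<dots> = ?p\<^sup>2 + 2 * ?p * ?q + ?q\<^sup>2" by (simp add: power2_sum)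
  also have "2 * ?p * ?q \<le> \<eta> * ?p\<^sup>2 + (1 / \<eta>) * ?q\<^sup>2"
  proof -
    have "2 * (sqrt \<eta> * ?p) * (?q / sqrt \<eta>) \<le> (sqrt \<eta> * ?p)\<^sup>2 + (?q / sqrt \<eta>)\<^sup>2" by (rule sum_squares_bound)
    moreover have "2 * (sqrt \<eta> * ?p) * (?q / sqrt \<eta>) = 2 * ?p * ?q" using assms by simp
    moreover have "(sqrt \<eta> * ?p)\<^sup>2 + (?q / sqrt \<eta>)\<^sup>2 = \<eta> * ?p\<^sup>2 + (1 / \<eta>) * ?q\<^sup>2"
      using assms by (simp add: power_mult_distrib power_divide)
    ultimately show ?thesis by simp
  qed
  finally show ?thesis by (simp add: algebra_simps)
qed

lemma ennreal_triple:
  assumes "a \<ge> 0" "b \<ge> 0" "c \<ge> 0"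
  shows "ennreal (3 * (a + (b + c))) = ennreal 3 * (ennreal a + (ennreal b + ennreal c))"
proof -
  have "ennreal (3 * (a + (b + c))) = ennreal 3 * ennreal (a + (b + c))" using assms by (intro ennreal_mult) auto
  also have "ennreal (a + (b + c)) = ennreal a + (ennreal b + ennreal c)" using assms by simp
  finally show ?thesis .
qed

lemma lipschitz_bounded:
  fixes F :: "'a::euclidean_space \<Rightarrow> real"
  assumes lip: "\<And>x y. \<bar>F x - F y\<bar> \<le> L * norm (x - y)" and L: "L \<ge> 0"
    and F0: "\<And>x. norm x \<ge> r \<Longrightarrow> F x = 0" and r: "r > 0"
  shows "\<bar>F x\<bar> \<le> L * (2 * r)"
proof (cases "norm x < r")
  case True
  obtain b :: 'a where b: "b \<in> Basis" using nonempty_Basis by blast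
  have "\<bar>F x - F (r *\<^sub>R b)\<bar> \<le> L * norm (x - r *\<^sub>R b)" by (rule lip)
  also have "\<dots> \<le> L * (2 * r)"
    using True r b norm_triangle_ineq4[of x "r *\<^sub>R b"] L by (intro mult_left_mono) auto
  finally show ?thesis using F0[of "r *\<^sub>R b"] r b by simp
next
  case False
  then show ?thesis using F0 L r by simp
qed

text \<open>The construction for one index with all parameters free. The energy has four sources: g
  on the good part of \<Omega>, the gradient of the cut-off (W), the bad set (1/N), and \<Omega>' -
  \<Omega> (b), where only the Lipschitz constant is available. In the L2 error, T stands for one
  truncation and Y for the distance of w to u; \<open>neighbourhood_average\<close> carries these
  from \<Omega> to the \<delta>-neighbourhood of \<Omega>'.\<close>

lemma modification_step:
  fixes w u e :: "'a::euclidean_space \<Rightarrow> real"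
  assumes op: "open \<Omega>" and op': "open \<Omega>'" and ne: "\<Omega>' \<noteq> {}"
    and wg: "has_weak_gradient UNIV w g" and wu: "has_weak_gradient UNIV u gu"
    and we: "has_weak_gradient UNIV e h" and ew: "AE x in lebesgue. x \<in> \<Omega> \<longrightarrow> e x = w x"
    and \<psi>: "test_fun UNIV \<psi>" "\<And>x. 0 \<le> \<psi> x \<and> \<psi> x \<le> 1" "\<And>x. norm x \<ge> R \<Longrightarrow> \<psi> x = 0"
    and td: "\<And>x. norm (tgrad \<psi> x) \<le> d" "\<And>x. norm x > R \<Longrightarrow> tgrad \<psi> x = 0" and R: "R > 0"
    and G3: "sqn (\<lambda>x. \<psi> x *\<^sub>R h x + e x *\<^sub>R tgrad \<psi> x) \<le> C3"
    and G4: "sqn (\<lambda>x. \<psi> x *\<^sub>R gu x + u x *\<^sub>R tgrad \<psi> x) \<le> C3"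
    and N: "N \<ge> 1" "ubv TYPE('a) * C3 \<le> 4 ^ N"
    and \<rho>: "\<rho> > 0" "Cmax TYPE('a) * C3 / N < ubv TYPE('a) * \<rho> ^ DIM('a)"
    and \<kappa>: "\<kappa> > 0" and \<delta>: "0 < \<delta>" "\<delta> \<le> 1"
    and dens: "\<And>y. y \<in> \<Omega>' \<Longrightarrow> measure lebesgue (\<Omega>' \<inter> ball y \<delta>) \<ge> \<kappa> * \<delta> ^ DIM('a)"
    and small: "measure lebesgue ((\<Omega>' - \<Omega>) \<inter> ball 0 (R + 4)) \<le> b" "b \<le> \<kappa> / 2 * \<delta> ^ DIM('a)"
    and \<eta>: "\<eta> > 0"
    and W: "(\<integral>x. indicator (ball 0 (2 * R)) x * (w x)\<^sup>2 \<partial>lebesgue) \<le> W"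
    and Y: "(\<integral>\<^sup>+x\<in>ball 0 (2 * R). ennreal ((w x - u x)\<^sup>2) \<partial>lebesgue) \<le> ennreal Y" "Y \<ge> 0"
  defines "T \<equiv> (2 * Clip TYPE('a) * \<rho>)\<^sup>2 * (Cmax TYPE('a) * C3)"
    and "L \<equiv> 2 * Clip TYPE('a) * 4 ^ N"
  shows "\<exists>v hv. has_weak_gradient UNIV v hv \<and>
     (\<integral>\<^sup>+x\<in>\<Omega>'. ennreal ((norm (hv x))\<^sup>2) \<partial>lebesgue) \<le> ennreal (1 + \<eta>) * (\<integral>\<^sup>+x\<in>\<Omega>. ennreal ((norm (g x))\<^sup>2) \<partial>lebesgue)
        + ennreal ((1 + 1 / \<eta>) * d\<^sup>2 * W + (real DIM('a) * Clip TYPE('a))\<^sup>2 * (Cmax TYPE('a) * C3 / N + 16 ^ N * b)) \<and>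
     (\<integral>\<^sup>+x. ennreal ((v x - \<psi> x * u x)\<^sup>2) \<partial>lebesgue)
        \<le> ennreal (2 * T + 2 * (8 * L\<^sup>2 * \<delta>\<^sup>2 * (ubv TYPE('a) * (R + 2) ^ DIM('a)) + 4 * ubv TYPE('a) * 2 ^ DIM('a) / \<kappa> * (6 * T + 3 * Y)))"
proof -
  let ?n = "real DIM('a)"
  let ?G = "\<lambda>x. \<psi> x *\<^sub>R h x + e x *\<^sub>R tgrad \<psi> x" and ?G4 = "\<lambda>x. \<psi> x *\<^sub>R gu x + u x *\<^sub>R tgrad \<psi> x"
  let ?f = "\<lambda>x. \<psi> x * e x" and ?p = "\<lambda>x. \<psi> x * u x"
  have Cl: "Clip TYPE('a) > 0" and Cm: "Cmax TYPE('a) > 0" and ub: "ubv TYPE('a) > 0"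
    by (rule Clip_pos Cmax_pos ubv_pos)+
  have C30: "C3 \<ge> 0" using G3 sqn_nonneg order_trans by blast
  have wf: "has_weak_gradient UNIV ?f ?G" by (rule weak_gradient_mult_test[OF we \<psi>(1)])
  have wp: "has_weak_gradient UNIV ?p ?G4" by (rule weak_gradient_mult_test[OF wu \<psi>(1)])
  have sq: "sqi w" "sqi g" "sqi u" "sqi gu" "sqi e" "sqi h" "sqi ?f" "sqi ?G" "sqi ?p" "sqi ?G4"
    using wg wu we wf wp by (auto simp: has_weak_gradient_UNIV_iff)
  have le4: "Cmax TYPE('a) * s / N \<le> Cmax TYPE('a) * C3 / N" "ubv TYPE('a) * s \<le> 4 ^ N" if "s \<le> C3" for s
  proof -
    show "Cmax TYPE('a) * s / N \<le> Cmax TYPE('a) * C3 / N" using that Cm by (intro divide_right_mono mult_left_mono) auto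
    have "ubv TYPE('a) * s \<le> ubv TYPE('a) * C3" using that ub by (intro mult_left_mono) auto
    then show "ubv TYPE('a) * s \<le> 4 ^ N" using N(2) by linarith
  qed
  \<comment> \<open>Both truncations are stated with the common bound C3 instead of their own
    energies, so that one N and one \<rho> serve for both. Their levels may differ.\<close>
  have trunc: "\<exists>j F B. j < 2 * N \<and> B \<in> sets lebesgue
     \<and> ennreal (4 ^ j) * emeasure lebesgue B \<le> ennreal (Cmax TYPE('a) * C3 / N)
     \<and> (\<forall>x y. \<bar>F x - F y\<bar> \<le> (Clip TYPE('a) * 2 ^ j) * norm (x - y))
     \<and> (\<forall>x. norm x \<ge> R + 2 \<longrightarrow> F x = 0)
     \<and> (AE x in lebesgue. x \<notin> B \<longrightarrow> F x = q x)
     \<and> sqi (\<lambda>x. F x - q x) \<and> sqn (\<lambda>x. F x - q x) \<le> T"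
    if wq: "has_weak_gradient UNIV q gq" and q0: "\<And>x. norm x \<ge> R \<Longrightarrow> q x = 0" and qC: "sqn gq \<le> C3" for q :: "'a \<Rightarrow> real" and gq
  proof -
    from lipschitz_truncation[OF wq N(1) q0 le4(2)[OF qC]]
    obtain j F B where 1: "j < 2 * N" "B \<in> sets lebesgue" and 2: "ennreal (4 ^ j) * emeasure lebesgue B \<le> ennreal (Cmax TYPE('a) * sqn gq / N)"
      and 3: "\<forall>x y. \<bar>F x - F y\<bar> \<le> (Clip TYPE('a) * 2 ^ j) * norm (x - y)" "\<forall>x. norm x \<ge> R + 2 \<longrightarrow> F x = 0"
        "AE x in lebesgue. x \<notin> B \<longrightarrow> F x = q x"
      and 4: "\<forall>\<rho>>0. Cmax TYPE('a) * sqn gq / N < ubv TYPE('a) * \<rho> ^ DIM('a) \<longrightarrow>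
          sqi (\<lambda>x. F x - q x) \<and> sqn (\<lambda>x. F x - q x) \<le> (2 * Clip TYPE('a) * \<rho>)\<^sup>2 * (Cmax TYPE('a) * sqn gq)" by blast
    have "Cmax TYPE('a) * sqn gq / N < ubv TYPE('a) * \<rho> ^ DIM('a)" using le4(1)[OF qC] \<rho>(2) by linarith
    then have 5: "sqi (\<lambda>x. F x - q x)" "sqn (\<lambda>x. F x - q x) \<le> (2 * Clip TYPE('a) * \<rho>)\<^sup>2 * (Cmax TYPE('a) * sqn gq)"
      using 4 \<rho>(1) by blast+
    have "(2 * Clip TYPE('a) * \<rho>)\<^sup>2 * (Cmax TYPE('a) * sqn gq) \<le> T"
      unfolding T_def using qC Cm by (intro mult_left_mono) auto
    then have 6: "sqn (\<lambda>x. F x - q x) \<le> T" using 5(2) by linarith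
    have 7: "ennreal (4 ^ j) * emeasure lebesgue B \<le> ennreal (Cmax TYPE('a) * C3 / N)"
      using 2 ennreal_leI[OF le4(1)[OF qC]] by (rule order_trans)
    from 1 3 5(1) 6 7 show ?thesis by blast
  qed
  have f0: "?f x = 0" "?p x = 0" if "norm x \<ge> R" for x using \<psi>(3)[OF that] by auto
  obtain j F1 B where j: "j < 2 * N" and Bm[measurable]: "B \<in> sets lebesgue"
    and Bs: "ennreal (4 ^ j) * emeasure lebesgue B \<le> ennreal (Cmax TYPE('a) * C3 / N)"
    and F1lip: "\<forall>x y. \<bar>F1 x - F1 y\<bar> \<le> (Clip TYPE('a) * 2 ^ j) * norm (x - y)"
    and F10: "\<forall>x. norm x \<ge> R + 2 \<longrightarrow> F1 x = 0" and F1eq: "AE x in lebesgue. x \<notin> B \<longrightarrow> F1 x = ?f x"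
    and F1s: "sqi (\<lambda>x. F1 x - ?f x)" "sqn (\<lambda>x. F1 x - ?f x) \<le> T"
    using trunc[OF wf f0(1) G3] by blast
  obtain j2 F2 B2 where j2: "j2 < 2 * N"
    and F2lip: "\<forall>x y. \<bar>F2 x - F2 y\<bar> \<le> (Clip TYPE('a) * 2 ^ j2) * norm (x - y)"
    and F20: "\<forall>x. norm x \<ge> R + 2 \<longrightarrow> F2 x = 0"
    and F2s: "sqi (\<lambda>x. F2 x - ?p x)" "sqn (\<lambda>x. F2 x - ?p x) \<le> T"
    using trunc[OF wp f0(2) G4] by blast
  \<comment> \<open>The chosen levels lie below 2 N; this makes 4^N a common bound for both
    Lipschitz constants.\<close>
  have pow: "(2::real) ^ i \<le> 4 ^ N" if "i < 2 * N" for i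
  proof -
    have "(2::real) ^ i \<le> 2 ^ (2 * N)" using that by (intro power_increasing) auto
    then show ?thesis by (simp add: power_mult)
  qed
  have lipN: "(Clip TYPE('a) * 2 ^ i) * norm z \<le> (Clip TYPE('a) * 4 ^ N) * norm z" if "i < 2 * N" for i and z :: 'a
    using pow[OF that] Cl by (intro mult_right_mono mult_left_mono) auto
  define F where "F x = F1 x - F2 x" for x
  have L0: "L \<ge> 0" using Cl by (simp add: L_def)
  have Flip: "\<bar>F x - F y\<bar> \<le> L * norm (x - y)" for x y
  proof -
    have "\<bar>F1 x - F1 y\<bar> \<le> (Clip TYPE('a) * 4 ^ N) * norm (x - y)" using F1lip lipN[OF j] by (meson order_trans)
    moreover have "\<bar>F2 x - F2 y\<bar> \<le> (Clip TYPE('a) * 4 ^ N) * norm (x - y)" using F2lip lipN[OF j2] by (meson order_trans)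
    moreover have "L * norm (x - y) = (Clip TYPE('a) * 4 ^ N) * norm (x - y) + (Clip TYPE('a) * 4 ^ N) * norm (x - y)" by (simp add: L_def)
    ultimately show ?thesis unfolding F_def by linarith
  qed
  have F0: "F x = 0" if "norm x \<ge> R + 2" for x using F10 F20 that by (simp add: F_def)
  have R2: "R + 2 > 0" using R by simp
  define \<phi> where "\<phi> x = max 0 (1 - infdist x \<Omega>' / \<delta>)" for x
  have \<phi>01: "0 \<le> \<phi> x" "\<phi> x \<le> 1" for x using \<delta> infdist_nonneg[of x \<Omega>'] by (auto simp: \<phi>_def)
  have \<phi>1: "\<phi> x = 1" if "x \<in> \<Omega>'" for x using that by (simp add: \<phi>_def)
  have \<phi>0: "\<phi> x = 0" if "\<not> infdist x \<Omega>' < \<delta>" for x using that \<delta> by (simp add: \<phi>_def)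
  have \<phi>lip: "\<bar>\<phi> x - \<phi> y\<bar> \<le> (1 / \<delta>) * norm (x - y)" for x y
  proof -
    have "\<bar>infdist x \<Omega>' - infdist y \<Omega>'\<bar> \<le> dist x y" by (rule infdist_triangle_abs)
    then have "\<bar>infdist x \<Omega>' - infdist y \<Omega>'\<bar> / \<delta> \<le> norm (x - y) / \<delta>" using \<delta> by (intro divide_right_mono) (auto simp: dist_norm)
    moreover have "\<bar>\<phi> x - \<phi> y\<bar> \<le> \<bar>infdist x \<Omega>' / \<delta> - infdist y \<Omega>' / \<delta>\<bar>" unfolding \<phi>_def by (auto simp: max_def)
    moreover have "\<bar>infdist x \<Omega>' / \<delta> - infdist y \<Omega>' / \<delta>\<bar> = \<bar>infdist x \<Omega>' - infdist y \<Omega>'\<bar> / \<delta>"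
      using \<delta> by (simp add: diff_divide_distrib[symmetric])
    ultimately show ?thesis by simp
  qed
  define v where "v x = F2 x + \<phi> x * F x" for x
  \<comment> \<open>This constant contains 1/\<delta>; it guarantees that v has a weak gradient. The
    energy on \<Omega>' is estimated through F1, with which v agrees there.\<close>
  define Lv where "Lv = Clip TYPE('a) * 4 ^ N + (L + L * (2 * (R + 2)) * (1 / \<delta>))"
  have vlip: "\<bar>v x - v y\<bar> \<le> Lv * norm (x - y)" for x y
  proof -
    have 1: "\<bar>F2 x - F2 y\<bar> \<le> (Clip TYPE('a) * 4 ^ N) * norm (x - y)" using F2lip lipN[OF j2] by (meson order_trans)
    have "\<bar>\<phi> x * F x - \<phi> y * F y\<bar> = \<bar>\<phi> x * (F x - F y) + F y * (\<phi> x - \<phi> y)\<bar>" by (simp add: algebra_simps)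
    also have "\<dots> \<le> \<bar>\<phi> x * (F x - F y)\<bar> + \<bar>F y * (\<phi> x - \<phi> y)\<bar>" by (rule abs_triangle_ineq)
    also have "\<dots> = \<phi> x * \<bar>F x - F y\<bar> + \<bar>F y\<bar> * \<bar>\<phi> x - \<phi> y\<bar>" using \<phi>01 by (simp add: abs_mult)
    also have "\<dots> \<le> 1 * (L * norm (x - y)) + (L * (2 * (R + 2))) * ((1 / \<delta>) * norm (x - y))"
      using \<phi>01 Flip \<phi>lip lipschitz_bounded[OF Flip L0 F0 R2, of y] L0 R2 \<delta>
      by (intro add_mono mult_mono) auto
    finally have "\<bar>\<phi> x * F x - \<phi> y * F y\<bar> \<le> (L + L * (2 * (R + 2)) * (1 / \<delta>)) * norm (x - y)" by (simp add: distrib_right)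
    with 1 show ?thesis unfolding v_def Lv_def distrib_right by linarith
  qed
  have v0: "v x = 0" if "norm x \<ge> R + 2" for x using F0[OF that] F20 that by (simp add: v_def)
  obtain hv where wv: "has_weak_gradient UNIV v hv" using lipschitz_has_weak_gradient[OF vlip R2 v0] by blast
  obtain h1 where w1: "has_weak_gradient UNIV F1 h1" and h1b: "AE x in lebesgue. norm (h1 x) \<le> ?n * (Clip TYPE('a) * 2 ^ j)"
    using lipschitz_has_weak_gradient[of F1 "Clip TYPE('a) * 2 ^ j" "R + 2"] F1lip R2 F10 by blast
  have \<Omega>m[measurable]: "\<Omega> \<in> sets lebesgue" "\<Omega>' \<in> sets lebesgue" using op op' by auto
  have hv1: "AE x in lebesgue. x \<in> \<Omega>' \<longrightarrow> hv x = h1 x"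
    by (rule weak_gradient_eq_on[OF wv w1 \<Omega>m(2)]) (auto intro!: always_eventually simp: v_def \<phi>1 F_def)
  have h10: "AE x in lebesgue. x \<in> - ball 0 (R + 2) \<longrightarrow> h1 x = 0"
    using F10 by (intro weak_gradient_zero_on[OF w1]) (auto intro!: always_eventually simp: not_less)
  have mB: "- B \<in> sets lebesgue" using sets.compl_sets[OF Bm] by (simp add: Compl_eq_Diff_UNIV)
  have h1G: "AE x in lebesgue. x \<in> - B \<longrightarrow> h1 x = ?G x"
    using F1eq by (intro weak_gradient_eq_on[OF w1 wf mB]) auto
  have hg: "AE x in lebesgue. x \<in> \<Omega> \<longrightarrow> h x = g x" by (rule weak_gradient_eq_on[OF we wg \<Omega>m(1) ew])
  \<comment> \<open>F1 and F2 vanish from radius R + 2 on, and \<open>neighbourhood_average\<close>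
    looks another 2 further.\<close>
  define A where "A = (\<Omega>' - \<Omega>) \<inter> ball 0 (R + 4)"
  have Alm: "A \<in> lmeasurable"
    using fmeasurable_Int_fmeasurable[OF lmeasurable_ball, of "\<Omega>' - \<Omega>" 0 "R + 4"] by (simp add: A_def Int_commute)
  let ?k = "(?n * (Clip TYPE('a) * 2 ^ j))\<^sup>2"
  have wm[measurable]: "w \<in> borel_measurable lebesgue" "g \<in> borel_measurable lebesgue" using sq by (auto intro: sqi_measurable)
  have ball2: "ball (0::'a) (2 * R) \<in> sets lebesgue" by simp
  let ?t1 = "\<lambda>x. ennreal (1 + \<eta>) * (ennreal ((norm (g x))\<^sup>2) * indicator \<Omega> x)"
  let ?t2 = "\<lambda>x. ennreal ((1 + 1 / \<eta>) * d\<^sup>2) * ennreal (indicator (ball 0 (2 * R)) x * (w x)\<^sup>2)"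
  let ?t3 = "\<lambda>x. ennreal ?k * indicator B x" and ?t4 = "\<lambda>x. ennreal ?k * indicator A x"
  have d0: "d \<ge> 0" using td(1)[of 0] norm_ge_zero order_trans by blast
  have "AE x in lebesgue. ennreal ((norm (hv x))\<^sup>2) * indicator \<Omega>' x \<le> (?t1 x + ?t2 x) + (?t3 x + ?t4 x)"
    using hv1 h1b h10 h1G hg ew
  proof eventually_elim
    fix x
    assume a1: "x \<in> \<Omega>' \<longrightarrow> hv x = h1 x" and a2: "norm (h1 x) \<le> ?n * (Clip TYPE('a) * 2 ^ j)"
      and a3: "x \<in> - ball 0 (R + 2) \<longrightarrow> h1 x = 0" and a4: "x \<in> - B \<longrightarrow> h1 x = ?G x"
      and a5: "x \<in> \<Omega> \<longrightarrow> h x = g x" and a6: "x \<in> \<Omega> \<longrightarrow> e x = w x"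
    have k: "ennreal ((norm (h1 x))\<^sup>2) \<le> ennreal ?k" using a2 by (intro ennreal_leI power_mono) auto
    show "ennreal ((norm (hv x))\<^sup>2) * indicator \<Omega>' x \<le> (?t1 x + ?t2 x) + (?t3 x + ?t4 x)"
    proof (cases "x \<in> \<Omega>'")
      case False
      then show ?thesis by simp
    next
      case True
      then have hv: "hv x = h1 x" using a1 by simp
      \<comment> \<open>Bad points and points of A see only the Lipschitz constant of F1. At good
        points of \<Omega> the gradient is that of \<psi> w, to which the weighted Young inequality
        applies. Beyond radius R + 2 nothing remains.\<close>
      consider "x \<in> B" | "x \<notin> B" "x \<in> \<Omega>" | "x \<notin> \<Omega>" "x \<in> ball 0 (R + 2)" | "x \<notin> ball 0 (R + 2)" by blast
      then show ?thesis
      proof cases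
        case 1
        have "ennreal ((norm (h1 x))\<^sup>2) \<le> ?t3 x" using 1 k by simp
        also have "\<dots> \<le> (?t1 x + ?t2 x) + (?t3 x + ?t4 x)" by (simp add: add_increasing add_increasing2)
        finally show ?thesis using True hv by simp
      next
        case 2
        have G: "h1 x = \<psi> x *\<^sub>R g x + w x *\<^sub>R tgrad \<psi> x" using 2 a4 a5 a6 by simp
        have "(norm (h1 x))\<^sup>2 \<le> (1 + \<eta>) * (norm (\<psi> x *\<^sub>R g x))\<^sup>2 + (1 + 1 / \<eta>) * (norm (w x *\<^sub>R tgrad \<psi> x))\<^sup>2"
          unfolding G by (rule ennreal_Young[OF \<eta>])
        also have "\<dots> \<le> (1 + \<eta>) * (norm (g x))\<^sup>2 + (1 + 1 / \<eta>) * (d\<^sup>2 * (indicator (ball 0 (2 * R)) x * (w x)\<^sup>2))"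
        proof (intro add_mono mult_left_mono)
          have "norm (\<psi> x *\<^sub>R g x) \<le> 1 * norm (g x)" unfolding norm_scaleR using \<psi>(2)[of x] by (intro mult_right_mono) auto
          then show "(norm (\<psi> x *\<^sub>R g x))\<^sup>2 \<le> (norm (g x))\<^sup>2" by (intro power_mono) auto
          show "(norm (w x *\<^sub>R tgrad \<psi> x))\<^sup>2 \<le> d\<^sup>2 * (indicator (ball 0 (2 * R)) x * (w x)\<^sup>2)"
          proof (cases "norm x > R")
            case True
            then show ?thesis using td(2)[OF True] by simp
          next
            case False
            then have "x \<in> ball 0 (2 * R)" using R by simp
            moreover have "(norm (tgrad \<psi> x))\<^sup>2 * (w x)\<^sup>2 \<le> d\<^sup>2 * (w x)\<^sup>2" using td(1)[of x] by (intro mult_right_mono power_mono) auto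
            ultimately show ?thesis by (simp add: power_mult_distrib mult.commute)
          qed
        qed (use \<eta> in auto)
        finally have "ennreal ((norm (h1 x))\<^sup>2) \<le> ennreal ((1 + \<eta>) * (norm (g x))\<^sup>2 + ((1 + 1 / \<eta>) * d\<^sup>2) * (indicator (ball 0 (2 * R)) x * (w x)\<^sup>2))"
          by (intro ennreal_leI) (simp add: mult.assoc)
        also have "\<dots> = ennreal ((1 + \<eta>) * (norm (g x))\<^sup>2) + ennreal (((1 + 1 / \<eta>) * d\<^sup>2) * (indicator (ball 0 (2 * R)) x * (w x)\<^sup>2))"
          using \<eta> by (intro ennreal_plus) auto
        also have "\<dots> = ?t1 x + ?t2 x"
          using 2 \<eta> by (subst (1 2) ennreal_mult) auto
        also have "\<dots> \<le> (?t1 x + ?t2 x) + (?t3 x + ?t4 x)" by (simp add: add_increasing2)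
        finally show ?thesis using True hv by simp
      next
        case 3
        then have "x \<in> A" using True by (simp add: A_def)
        then have "ennreal ((norm (h1 x))\<^sup>2) \<le> ?t4 x" using k by simp
        also have "\<dots> \<le> (?t1 x + ?t2 x) + (?t3 x + ?t4 x)" by (simp add: add_increasing add_increasing2)
        finally show ?thesis using True hv by simp
      next
        case 4
        then show ?thesis using a3 hv by simp
      qed
    qed
  qed
  then have "(\<integral>\<^sup>+x\<in>\<Omega>'. ennreal ((norm (hv x))\<^sup>2) \<partial>lebesgue) \<le> (\<integral>\<^sup>+x. (?t1 x + ?t2 x) + (?t3 x + ?t4 x) \<partial>lebesgue)"
    by (rule nn_integral_mono_AE)
  also have "\<dots> = ((\<integral>\<^sup>+x. ?t1 x \<partial>lebesgue) + (\<integral>\<^sup>+x. ?t2 x \<partial>lebesgue)) + ((\<integral>\<^sup>+x. ?t3 x \<partial>lebesgue) + (\<integral>\<^sup>+x. ?t4 x \<partial>lebesgue))"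
  proof -
    have m1: "?t1 \<in> borel_measurable lebesgue" by measurable
    have m2: "?t2 \<in> borel_measurable lebesgue" using ball2 by measurable
    have m3: "?t3 \<in> borel_measurable lebesgue" by measurable
    have m4: "?t4 \<in> borel_measurable lebesgue" using fmeasurableD[OF Alm] by measurable
    have m12: "(\<lambda>x. ?t1 x + ?t2 x) \<in> borel_measurable lebesgue" using m1 m2 by (rule borel_measurable_add)
    have m34: "(\<lambda>x. ?t3 x + ?t4 x) \<in> borel_measurable lebesgue" using m3 m4 by (rule borel_measurable_add)
    show ?thesis unfolding nn_integral_add[OF m12 m34] nn_integral_add[OF m1 m2] nn_integral_add[OF m3 m4] ..
  qed
  also have "(\<integral>\<^sup>+x. ?t1 x \<partial>lebesgue) = ennreal (1 + \<eta>) * (\<integral>\<^sup>+x\<in>\<Omega>. ennreal ((norm (g x))\<^sup>2) \<partial>lebesgue)"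
    by (rule nn_integral_cmult) measurable
  also have "(\<integral>\<^sup>+x. ?t2 x \<partial>lebesgue) \<le> ennreal ((1 + 1 / \<eta>) * d\<^sup>2 * W)"
  proof -
    have iw: "integrable lebesgue (\<lambda>x. indicator (ball 0 (2 * R)) x * (w x)\<^sup>2)"
      using integrable_mult_indicator[OF ball2, of "\<lambda>x. (w x)\<^sup>2"] sq(1) by (simp add: sqi_def)
    have m: "(\<lambda>x. ennreal (indicator (ball 0 (2 * R)) x * (w x)\<^sup>2)) \<in> borel_measurable lebesgue" using ball2 by measurable
    have "(\<integral>\<^sup>+x. ?t2 x \<partial>lebesgue) = ennreal ((1 + 1 / \<eta>) * d\<^sup>2) * (\<integral>\<^sup>+x. ennreal (indicator (ball 0 (2 * R)) x * (w x)\<^sup>2) \<partial>lebesgue)"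
      by (rule nn_integral_cmult[OF m])
    also have "(\<integral>\<^sup>+x. ennreal (indicator (ball 0 (2 * R)) x * (w x)\<^sup>2) \<partial>lebesgue) = ennreal (\<integral>x. indicator (ball 0 (2 * R)) x * (w x)\<^sup>2 \<partial>lebesgue)"
      by (rule nn_integral_eq_integral[OF iw]) auto
    also have "ennreal ((1 + 1 / \<eta>) * d\<^sup>2) * \<dots> \<le> ennreal ((1 + 1 / \<eta>) * d\<^sup>2) * ennreal W"
      by (intro mult_left_mono ennreal_leI W) simp
    also have "\<dots> = ennreal ((1 + 1 / \<eta>) * d\<^sup>2 * W)" using \<eta> by (intro ennreal_mult'[symmetric]) auto
    finally show ?thesis .
  qed
  also have "(\<integral>\<^sup>+x. ?t3 x \<partial>lebesgue) \<le> ennreal ((?n * Clip TYPE('a))\<^sup>2 * (Cmax TYPE('a) * C3 / N))"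
  proof -
    have k4: "?k = (?n * Clip TYPE('a))\<^sup>2 * 4 ^ j"
    proof -
      have "((2::real) ^ j)\<^sup>2 = 4 ^ j" by (simp add: power2_eq_square power_mult_distrib[symmetric])
      then show ?thesis by (simp add: power_mult_distrib)
    qed
    have "(\<integral>\<^sup>+x. ?t3 x \<partial>lebesgue) = ennreal ?k * emeasure lebesgue B" by (rule nn_integral_cmult_indicator) measurable
    also have "\<dots> = ennreal ((?n * Clip TYPE('a))\<^sup>2) * (ennreal (4 ^ j) * emeasure lebesgue B)"
      unfolding k4 by (subst ennreal_mult) (auto simp: mult.assoc)
    also have "\<dots> \<le> ennreal ((?n * Clip TYPE('a))\<^sup>2) * ennreal (Cmax TYPE('a) * C3 / N)" by (intro mult_left_mono Bs) simp
    also have "\<dots> = ennreal ((?n * Clip TYPE('a))\<^sup>2 * (Cmax TYPE('a) * C3 / N))" using Cm C30 by (intro ennreal_mult[symmetric]) auto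
    finally show ?thesis .
  qed
  also have "(\<integral>\<^sup>+x. ?t4 x \<partial>lebesgue) \<le> ennreal ((?n * Clip TYPE('a))\<^sup>2 * (16 ^ N * b))"
  proof -
    have "(\<integral>\<^sup>+x. ?t4 x \<partial>lebesgue) = ennreal ?k * emeasure lebesgue A" by (rule nn_integral_cmult_indicator[OF fmeasurableD[OF Alm]])
    also have "emeasure lebesgue A = ennreal (measure lebesgue A)" using Alm by (simp add: emeasure_eq_measure2)
    also have "ennreal ?k * ennreal (measure lebesgue A) = ennreal (?k * measure lebesgue A)" by (rule ennreal_mult[symmetric]) auto
    also have "\<dots> \<le> ennreal ((?n * Clip TYPE('a))\<^sup>2 * 16 ^ N * b)"
    proof (intro ennreal_leI mult_mono)
      have "((2::real) ^ j)\<^sup>2 \<le> (4 ^ N)\<^sup>2" using pow[OF j] by (intro power_mono) auto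
      also have "((4::real) ^ N)\<^sup>2 = 16 ^ N" by (simp add: power2_eq_square power_mult_distrib[symmetric])
      finally show "?k \<le> (?n * Clip TYPE('a))\<^sup>2 * 16 ^ N" by (simp add: power_mult_distrib mult.assoc[symmetric] mult_left_mono)
      show "measure lebesgue A \<le> b" using small(1) by (simp add: A_def)
    qed auto
    finally show ?thesis by (simp add: mult.assoc)
  qed
  finally have "(\<integral>\<^sup>+x\<in>\<Omega>'. ennreal ((norm (hv x))\<^sup>2) \<partial>lebesgue) \<le> (ennreal (1 + \<eta>) * (\<integral>\<^sup>+x\<in>\<Omega>. ennreal ((norm (g x))\<^sup>2) \<partial>lebesgue) + ennreal ((1 + 1 / \<eta>) * d\<^sup>2 * W))
     + (ennreal ((?n * Clip TYPE('a))\<^sup>2 * (Cmax TYPE('a) * C3 / N)) + ennreal ((?n * Clip TYPE('a))\<^sup>2 * (16 ^ N * b)))"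
    by (simp add: add_mono)
  also have "\<dots> = ennreal (1 + \<eta>) * (\<integral>\<^sup>+x\<in>\<Omega>. ennreal ((norm (g x))\<^sup>2) \<partial>lebesgue)
        + ennreal ((1 + 1 / \<eta>) * d\<^sup>2 * W + (?n * Clip TYPE('a))\<^sup>2 * (Cmax TYPE('a) * C3 / N + 16 ^ N * b))"
  proof -
    have W0: "W \<ge> 0"
    proof -
      have "(\<integral>x. indicator (ball 0 (2 * R)) x * (w x)\<^sup>2 \<partial>lebesgue) \<ge> 0" by (intro Bochner_Integration.integral_nonneg) auto
      then show ?thesis using W by linarith
    qed
    have b0: "b \<ge> 0" using small(1) measure_nonneg order_trans by blast
    have p1: "(1 + 1 / \<eta>) * d\<^sup>2 * W \<ge> 0" using \<eta> W0 by simp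
    have p2: "(?n * Clip TYPE('a))\<^sup>2 * (Cmax TYPE('a) * C3 / N) \<ge> 0" using Cm C30 by simp
    have p3: "(?n * Clip TYPE('a))\<^sup>2 * (16 ^ N * b) \<ge> 0" using b0 by simp
    show ?thesis
      unfolding distrib_left[of "(?n * Clip TYPE('a))\<^sup>2"] add.assoc ennreal_plus[OF p2 p3, symmetric]
        ennreal_plus[OF p1 add_nonneg_nonneg[OF p2 p3], symmetric] ..
  qed
  finally have energy: "(\<integral>\<^sup>+x\<in>\<Omega>'. ennreal ((norm (hv x))\<^sup>2) \<partial>lebesgue) \<le> ennreal (1 + \<eta>) * (\<integral>\<^sup>+x\<in>\<Omega>. ennreal ((norm (g x))\<^sup>2) \<partial>lebesgue)
        + ennreal ((1 + 1 / \<eta>) * d\<^sup>2 * W + (?n * Clip TYPE('a))\<^sup>2 * (Cmax TYPE('a) * C3 / N + 16 ^ N * b))" .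
  have T0: "T \<ge> 0" using Cm C30 by (simp add: T_def)
  have FO: "(\<integral>\<^sup>+z\<in>\<Omega>. ennreal ((F z)\<^sup>2) \<partial>lebesgue) \<le> ennreal (6 * T + 3 * Y)"
  proof -
    let ?s1 = "\<lambda>z. ennreal ((norm (F1 z - ?f z))\<^sup>2)" and ?s3 = "\<lambda>z. ennreal ((norm (F2 z - ?p z))\<^sup>2)"
    let ?s2 = "\<lambda>z. ennreal ((w z - u z)\<^sup>2) * indicator (ball 0 (2 * R)) z"
    have um[measurable]: "u \<in> borel_measurable lebesgue" using sq(3) by (rule sqi_measurable)
    have m1: "?s1 \<in> borel_measurable lebesgue" using sqi_measurable[OF F1s(1)] by measurable
    have m3: "?s3 \<in> borel_measurable lebesgue" using sqi_measurable[OF F2s(1)] by measurable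
    have m2: "?s2 \<in> borel_measurable lebesgue" using ball2 by measurable
    have "(\<integral>\<^sup>+z\<in>\<Omega>. ennreal ((F z)\<^sup>2) \<partial>lebesgue) \<le> (\<integral>\<^sup>+z. ennreal 3 * (?s1 z + (?s2 z + ?s3 z)) \<partial>lebesgue)"
    proof (rule nn_integral_mono_AE)
      show "AE z in lebesgue. ennreal ((F z)\<^sup>2) * indicator \<Omega> z \<le> ennreal 3 * (?s1 z + (?s2 z + ?s3 z))"
        using ew
      proof eventually_elim
        fix z assume ez: "z \<in> \<Omega> \<longrightarrow> e z = w z"
        show "ennreal ((F z)\<^sup>2) * indicator \<Omega> z \<le> ennreal 3 * (?s1 z + (?s2 z + ?s3 z))"
        proof (cases "z \<in> \<Omega>")
          case True
          have mid: "(\<psi> z * (w z - u z))\<^sup>2 \<le> indicator (ball 0 (2 * R)) z * (w z - u z)\<^sup>2"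
          proof (cases "norm z < R")
            case True
            have "(\<psi> z)\<^sup>2 \<le> 1" using \<psi>(2)[of z] by (intro power_le_one) auto
            then have "(\<psi> z)\<^sup>2 * (w z - u z)\<^sup>2 \<le> 1 * (w z - u z)\<^sup>2" by (intro mult_right_mono) auto
            then show ?thesis using True R by (simp add: power_mult_distrib)
          next
            case False
            then show ?thesis using \<psi>(3)[of z] by simp
          qed
          \<comment> \<open>On \<Omega>, where e = w, the difference of the truncations splits into
            two truncation errors and the difference of the cut-off functions \<psi> w and \<psi>
            u.\<close>
          have "F z = (F1 z - ?f z) + \<psi> z * (w z - u z) + (- (F2 z - ?p z))"
            using True ez by (simp add: F_def algebra_simps)
          then have "(F z)\<^sup>2 \<le> 3 * ((F1 z - ?f z)\<^sup>2 + (\<psi> z * (w z - u z))\<^sup>2 + (- (F2 z - ?p z))\<^sup>2)"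
            by (simp only: sq_sum3_le)
          also have "\<dots> \<le> 3 * ((norm (F1 z - ?f z))\<^sup>2 + (indicator (ball 0 (2 * R)) z * (w z - u z)\<^sup>2 + (norm (F2 z - ?p z))\<^sup>2))"
            using mid by (simp add: power2_commute)
          finally have "ennreal ((F z)\<^sup>2) \<le> ennreal (3 * ((norm (F1 z - ?f z))\<^sup>2 + (indicator (ball 0 (2 * R)) z * (w z - u z)\<^sup>2 + (norm (F2 z - ?p z))\<^sup>2)))"
            by (rule ennreal_leI)
          also have "\<dots> = ennreal 3 * (ennreal ((norm (F1 z - ?f z))\<^sup>2) + (ennreal (indicator (ball 0 (2 * R)) z * (w z - u z)\<^sup>2) + ennreal ((norm (F2 z - ?p z))\<^sup>2)))"
            by (rule ennreal_triple) auto
          also have "ennreal (indicator (ball 0 (2 * R)) z * (w z - u z)\<^sup>2) = ?s2 z" by (auto simp: indicator_def)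
          finally show ?thesis using True by simp
        qed simp
      qed
    qed
    also have "\<dots> = ennreal 3 * ((\<integral>\<^sup>+z. ?s1 z \<partial>lebesgue) + ((\<integral>\<^sup>+z. ?s2 z \<partial>lebesgue) + (\<integral>\<^sup>+z. ?s3 z \<partial>lebesgue)))"
    proof -
      have m23: "(\<lambda>z. ?s2 z + ?s3 z) \<in> borel_measurable lebesgue" using m2 m3 by (rule borel_measurable_add)
      have m123: "(\<lambda>z. ?s1 z + (?s2 z + ?s3 z)) \<in> borel_measurable lebesgue" using m1 m23 by (rule borel_measurable_add)
      show ?thesis unfolding nn_integral_cmult[OF m123] nn_integral_add[OF m1 m23] nn_integral_add[OF m2 m3] ..
    qed
    also have "\<dots> \<le> ennreal 3 * (ennreal T + (ennreal Y + ennreal T))"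
      unfolding nn_integral_sqn[OF F1s(1)] nn_integral_sqn[OF F2s(1)]
      using F1s(2) F2s(2) Y(1) by (intro mult_left_mono add_mono ennreal_leI) auto
    also have "\<dots> = ennreal (6 * T + 3 * Y)"
    proof -
      have "ennreal T + (ennreal Y + ennreal T) = ennreal (T + (Y + T))"
        by (simp only: ennreal_plus[OF Y(2) T0, symmetric] ennreal_plus[OF T0 add_nonneg_nonneg[OF Y(2) T0], symmetric])
      moreover have "ennreal 3 * ennreal (T + (Y + T)) = ennreal (3 * (T + (Y + T)))" using T0 Y(2) by (intro ennreal_mult[symmetric]) auto
      moreover have "3 * (T + (Y + T)) = 6 * T + 3 * Y" by simp
      ultimately show ?thesis by (simp only:)
    qed
    finally show ?thesis .
  qed
  let ?X = "8 * L\<^sup>2 * \<delta>\<^sup>2 * (ubv TYPE('a) * (R + 2) ^ DIM('a))" and ?Q = "4 * ubv TYPE('a) * 2 ^ DIM('a) / \<kappa>"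
  have NF: "(\<integral>\<^sup>+x. ennreal ((F x)\<^sup>2) * indicator {x. infdist x \<Omega>' < \<delta>} x \<partial>lebesgue) \<le> ennreal (?X + ?Q * (6 * T + 3 * Y))"
  proof -
    have "R + 2 + 2 = R + 4" by simp
    then have sm: "measure lebesgue ((\<Omega>' - \<Omega>) \<inter> ball 0 (R + 2 + 2)) \<le> \<kappa> / 2 * \<delta> ^ DIM('a)" using small by (simp only:)
    have "(\<integral>\<^sup>+x. ennreal ((F x)\<^sup>2) * indicator {x. infdist x \<Omega>' < \<delta>} x \<partial>lebesgue) \<le> ennreal ?X + ennreal ?Q * (\<integral>\<^sup>+z\<in>\<Omega>. ennreal ((F z)\<^sup>2) \<partial>lebesgue)"
      by (rule neighbourhood_average[OF op op' ne Flip L0 F0 R2 \<delta> \<kappa> dens sm])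
    also have "\<dots> \<le> ennreal ?X + ennreal ?Q * ennreal (6 * T + 3 * Y)" by (intro add_left_mono mult_left_mono FO) simp
    also have "\<dots> = ennreal (?X + ?Q * (6 * T + 3 * Y))"
    proof -
      have q: "?Q \<ge> 0" "6 * T + 3 * Y \<ge> 0" using ub \<kappa> T0 Y(2) by auto
      have x: "?X \<ge> 0" using ub R2 by simp
      show ?thesis unfolding ennreal_mult[OF q, symmetric] by (rule ennreal_plus[OF x mult_nonneg_nonneg[OF q], symmetric])
    qed
    finally show ?thesis .
  qed
  have L2: "(\<integral>\<^sup>+x. ennreal ((v x - ?p x)\<^sup>2) \<partial>lebesgue) \<le> ennreal (2 * T + 2 * (?X + ?Q * (6 * T + 3 * Y)))"
  proof -
    let ?s1 = "\<lambda>x. ennreal ((norm (F2 x - ?p x))\<^sup>2)" and ?s2 = "\<lambda>x. ennreal ((F x)\<^sup>2) * indicator {x. infdist x \<Omega>' < \<delta>} x"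
    have m1: "?s1 \<in> borel_measurable lebesgue" using sqi_measurable[OF F2s(1)] by measurable
    have m2: "?s2 \<in> borel_measurable lebesgue"
    proof -
      have "L-lipschitz_on UNIV F" using Flip L0 by (intro lipschitz_onI) (auto simp: dist_real_def dist_norm)
      then have [measurable]: "F \<in> borel_measurable lebesgue" by (intro borel_measurable_continuous_lebesgue lipschitz_on_continuous_on)
      have "open {x. infdist x \<Omega>' < \<delta>}" by (intro open_Collect_less continuous_intros)
      then have [measurable]: "{x. infdist x \<Omega>' < \<delta>} \<in> sets lebesgue" by auto
      show ?thesis by measurable
    qed
    have "(\<integral>\<^sup>+x. ennreal ((v x - ?p x)\<^sup>2) \<partial>lebesgue) \<le> (\<integral>\<^sup>+x. ennreal 2 * (?s1 x + ?s2 x) \<partial>lebesgue)"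
    proof (rule nn_integral_mono)
      fix x
      have "(\<phi> x * F x)\<^sup>2 \<le> (F x)\<^sup>2 * indicator {x. infdist x \<Omega>' < \<delta>} x"
      proof (cases "infdist x \<Omega>' < \<delta>")
        case True
        have "(\<phi> x)\<^sup>2 \<le> 1" using \<phi>01[of x] by (intro power_le_one) auto
        then have "(\<phi> x)\<^sup>2 * (F x)\<^sup>2 \<le> 1 * (F x)\<^sup>2" by (intro mult_right_mono) auto
        then show ?thesis using True by (simp add: power_mult_distrib)
      next
        case False
        then show ?thesis using \<phi>0[of x] by simp
      qed
      moreover have "(v x - ?p x)\<^sup>2 \<le> 2 * (F2 x - ?p x)\<^sup>2 + 2 * (\<phi> x * F x)\<^sup>2"
      proof -
        have "v x - ?p x = (F2 x - ?p x) + \<phi> x * F x" by (simp add: v_def)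
        then show ?thesis by (simp only: sq_sum2_le)
      qed
      ultimately have "(v x - ?p x)\<^sup>2 \<le> 2 * ((norm (F2 x - ?p x))\<^sup>2 + (F x)\<^sup>2 * indicator {x. infdist x \<Omega>' < \<delta>} x)" by simp
      then have "ennreal ((v x - ?p x)\<^sup>2) \<le> ennreal (2 * ((norm (F2 x - ?p x))\<^sup>2 + (F x)\<^sup>2 * indicator {x. infdist x \<Omega>' < \<delta>} x))" by (rule ennreal_leI)
      also have "\<dots> = ennreal 2 * (ennreal ((norm (F2 x - ?p x))\<^sup>2) + ennreal ((F x)\<^sup>2 * indicator {x. infdist x \<Omega>' < \<delta>} x))"
        by (subst ennreal_mult, simp, simp, subst ennreal_plus, auto)
      also have "ennreal ((F x)\<^sup>2 * indicator {x. infdist x \<Omega>' < \<delta>} x) = ?s2 x" by (auto simp: indicator_def)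
      finally show "ennreal ((v x - ?p x)\<^sup>2) \<le> ennreal 2 * (?s1 x + ?s2 x)" .
    qed
    also have "\<dots> = ennreal 2 * ((\<integral>\<^sup>+x. ?s1 x \<partial>lebesgue) + (\<integral>\<^sup>+x. ?s2 x \<partial>lebesgue))"
      unfolding nn_integral_cmult[OF borel_measurable_add[OF m1 m2]] nn_integral_add[OF m1 m2] ..
    also have "\<dots> \<le> ennreal 2 * (ennreal T + ennreal (?X + ?Q * (6 * T + 3 * Y)))"
      unfolding nn_integral_sqn[OF F2s(1)] using F2s(2) by (intro mult_left_mono add_mono ennreal_leI NF) auto
    also have "\<dots> = ennreal (2 * T + 2 * (?X + ?Q * (6 * T + 3 * Y)))"
    proof -
      have z: "?X + ?Q * (6 * T + 3 * Y) \<ge> 0" using ub R2 \<kappa> T0 Y(2) by (intro add_nonneg_nonneg mult_nonneg_nonneg) auto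
      have "ennreal T + ennreal (?X + ?Q * (6 * T + 3 * Y)) = ennreal (T + (?X + ?Q * (6 * T + 3 * Y)))" by (rule ennreal_plus[OF T0 z, symmetric])
      moreover have "ennreal 2 * ennreal (T + (?X + ?Q * (6 * T + 3 * Y))) = ennreal (2 * (T + (?X + ?Q * (6 * T + 3 * Y))))"
        using T0 z by (intro ennreal_mult[symmetric]) auto
      ultimately show ?thesis by (simp only: distrib_left)
    qed
    finally show ?thesis .
  qed
  show ?thesis using wv energy L2 by blast
qed

text \<open>The factor exp 1 normalises the value at the origin to 1. The summand 0 retains the
  affine form c x + b of the composition lemmas.\<close>

definition cutoff :: "real \<Rightarrow> 'a::euclidean_space \<Rightarrow> real" where
  "cutoff R x = exp 1 * bump ((1/R) *\<^sub>R x + 0)"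

lemma cutoff_props:
  fixes x :: "'a::euclidean_space"
  assumes R: "R > 0"
  shows "test_fun UNIV (cutoff R :: 'a \<Rightarrow> real)" "0 \<le> cutoff R x \<and> cutoff R x \<le> 1"
    "norm x \<ge> R \<Longrightarrow> cutoff R x = 0" "norm x > R \<Longrightarrow> tgrad (cutoff R) x = 0"
proof -
  show t: "test_fun UNIV (cutoff R :: 'a \<Rightarrow> real)"
    unfolding cutoff_def[abs_def] using R by (intro test_fun_cmult test_fun_affine test_fun_bump) auto
  have "exp 1 * bump y \<le> 1" for y :: 'a
  proof (cases "1 - y \<bullet> y > 0")
    case True
    have "inverse (1 - y \<bullet> y) \<ge> 1" using True by (intro one_le_inverse) auto
    then have "exp 1 * bump y \<le> exp 1 * exp (- 1 :: real)" using True by (simp add: bump_def flat_exp_def)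
    also have "\<dots> = 1" by (simp add: exp_minus)
    finally show ?thesis .
  next
    case False
    then show ?thesis by (simp add: bump_def flat_exp_def)
  qed
  then show "0 \<le> cutoff R x \<and> cutoff R x \<le> 1" using bump_nonneg[of "(1/R) *\<^sub>R x + 0"] unfolding cutoff_def by (intro conjI mult_nonneg_nonneg) auto
  have z: "cutoff R y = 0" if "norm y \<ge> R" for y :: 'a
  proof -
    have "norm ((1/R) *\<^sub>R y + 0) \<ge> 1" using that R by simp
    from bump_eq_0[OF this] show ?thesis by (simp add: cutoff_def)
  qed
  then show "norm x \<ge> R \<Longrightarrow> cutoff R x = 0" .
  assume x: "norm x > R"
  have "frechet_derivative (cutoff R) (at x) i = 0" for i
  proof (rule frechet_derivative_eqI)
    have "((\<lambda>x. 0) has_derivative (\<lambda>v. 0)) (at x)" by simp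
    then show "(cutoff R has_derivative (\<lambda>v. 0)) (at x)"
    proof (rule has_derivative_transform_within_open[where s="- cball (0::'a) R"])
      show "0 = cutoff R y" if "y \<in> - cball 0 R" for y :: 'a using z[of y] that by simp
    qed (use x in auto)
  qed
  then show "tgrad (cutoff R) x = 0" by (simp add: tgrad_def)
qed

text \<open>All cut-offs are dilations of one bump, so a single D serves for every radius and the
  cut-off becomes free of charge as R grows.\<close>

lemma tgrad_cutoff_le: "\<exists>D>0. \<forall>R>0. \<forall>x::'a::euclidean_space. norm (tgrad (cutoff R) x) \<le> D / R"
proof -
  have "\<forall>i. \<exists>c. \<forall>x. \<bar>frechet_derivative bump (at (x::'a)) i\<bar> \<le> c"
    using test_fun_bounded[OF test_fun_deriv[OF test_fun_bump]] by blast
  from choice[OF this] obtain c where c: "\<And>i x. \<bar>frechet_derivative bump (at (x::'a)) i\<bar> \<le> c i" by blast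
  define D where "D = exp 1 * (\<Sum>i\<in>(Basis::'a set). c i) + 1"
  have c0: "c i \<ge> 0" for i using c[of 0 i] by linarith
  have D: "D > 0" unfolding D_def using c0 by (intro add_nonneg_pos mult_nonneg_nonneg sum_nonneg) auto
  have "norm (tgrad (cutoff R) x) \<le> D / R" if R: "R > 0" for R and x :: 'a
  proof -
    have d: "frechet_derivative (cutoff R) (at x) i = exp 1 * ((1/R) * frechet_derivative bump (at ((1/R) *\<^sub>R x + 0)) i)" for i
      unfolding cutoff_def[abs_def]
      by (simp only: frechet_derivative_cmult_smooth[OF smooth_fun_affine[OF smooth_fun_bump]] frechet_derivative_affine[OF smooth_fun_bump])
    have "norm (tgrad (cutoff R) x) \<le> (\<Sum>i\<in>Basis. \<bar>tgrad (cutoff R) x \<bullet> i\<bar>)" by (rule norm_le_l1)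
    also have "\<dots> = (\<Sum>i\<in>Basis. exp 1 * ((1/R) * \<bar>frechet_derivative bump (at ((1/R) *\<^sub>R x + 0)) i\<bar>))"
    proof (rule sum.cong[OF refl])
      fix i :: 'a assume "i \<in> Basis"
      then have "tgrad (cutoff R) x \<bullet> i = frechet_derivative (cutoff R) (at x) i" by (simp add: tgrad_def inner_sum_left_Basis)
      then show "\<bar>tgrad (cutoff R) x \<bullet> i\<bar> = exp 1 * ((1/R) * \<bar>frechet_derivative bump (at ((1/R) *\<^sub>R x + 0)) i\<bar>)"
        using R by (simp only: d abs_mult) simp
    qed
    also have "\<dots> \<le> (\<Sum>i\<in>(Basis::'a set). exp 1 * ((1/R) * c i))"
      using R c by (intro sum_mono mult_left_mono) auto
    also have "\<dots> = exp 1 * (\<Sum>i\<in>(Basis::'a set). c i) / R" by (simp add: sum_distrib_left sum_divide_distrib)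
    also have "\<dots> \<le> D / R" using R by (intro divide_right_mono) (auto simp: D_def)
    finally show ?thesis .
  qed
  with D show ?thesis by blast
qed

lemma cutoff_L2:
  fixes u :: "'a::euclidean_space \<Rightarrow> real"
  assumes u: "sqi u"
  shows "((\<lambda>R. sqn (\<lambda>x. cutoff R x * u x - u x)) \<longlongrightarrow> 0) at_top"
proof -
  have [measurable]: "u \<in> borel_measurable lebesgue" using u by (rule sqi_measurable)
  have cm[measurable]: "(cutoff R :: 'a \<Rightarrow> real) \<in> borel_measurable lebesgue" for R
  proof (rule borel_measurable_continuous_lebesgue)
    have "continuous_on UNIV (bump :: 'a \<Rightarrow> real)" by (rule smooth_fun_continuous_on[OF smooth_fun_bump])
    then have "continuous_on UNIV (\<lambda>x::'a. bump ((1/R) *\<^sub>R x + 0))"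
      by (rule continuous_on_compose2) (auto intro!: continuous_intros)
    then show "continuous_on UNIV (cutoff R :: 'a \<Rightarrow> real)" unfolding cutoff_def[abs_def] by (intro continuous_intros)
  qed
  have "((\<lambda>R. \<integral>x. (cutoff R x * u x - u x)\<^sup>2 \<partial>lebesgue) \<longlongrightarrow> (\<integral>x. 0 \<partial>(lebesgue :: 'a measure))) at_top"
  proof (rule integral_dominated_convergence_at_top[where w="\<lambda>x. (u x)\<^sup>2"])
    show "integrable lebesgue (\<lambda>x. (u x)\<^sup>2)" using u by (simp add: sqi_def)
    show "(\<lambda>x. (cutoff R x * u x - u x)\<^sup>2) \<in> borel_measurable lebesgue" for R by measurable
    show "\<forall>\<^sub>F R in at_top. AE x in lebesgue. norm ((cutoff R x * u x - u x)\<^sup>2) \<le> (u x)\<^sup>2"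
      using eventually_gt_at_top[of 0]
    proof eventually_elim
      fix R :: real assume R: "R > 0"
      show "AE x in lebesgue. norm ((cutoff R x * u x - u x)\<^sup>2) \<le> (u x)\<^sup>2"
      proof (rule AE_I2)
        fix x :: 'a
        have "\<bar>cutoff R x - 1\<bar> \<le> 1" using cutoff_props(2)[OF R, of x] by auto
        then have "\<bar>cutoff R x - 1\<bar> * \<bar>u x\<bar> \<le> 1 * \<bar>u x\<bar>" by (intro mult_right_mono) auto
        then have "\<bar>cutoff R x * u x - u x\<bar> \<le> \<bar>u x\<bar>" by (simp add: abs_mult[symmetric] left_diff_distrib)
        then have "\<bar>cutoff R x * u x - u x\<bar>\<^sup>2 \<le> \<bar>u x\<bar>\<^sup>2" by (rule power_mono) simp
        then show "norm ((cutoff R x * u x - u x)\<^sup>2) \<le> (u x)\<^sup>2" by simp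
      qed
    qed
    show "AE x in lebesgue. ((\<lambda>R. (cutoff R x * u x - u x)\<^sup>2) \<longlongrightarrow> 0) at_top"
    proof (rule AE_I2)
      fix x :: 'a
      have "((\<lambda>R. (1/R) *\<^sub>R x + 0) \<longlongrightarrow> 0 *\<^sub>R x + 0) at_top"
        by (intro tendsto_add tendsto_scaleR tendsto_const tendsto_divide_0[OF tendsto_const] filterlim_at_top_imp_at_infinity filterlim_ident)
      then have "((\<lambda>R. (1/R) *\<^sub>R x + 0) \<longlongrightarrow> 0) at_top" by simp
      note lim = this
      have "continuous_on UNIV (bump :: 'a \<Rightarrow> real)" by (rule smooth_fun_continuous_on[OF smooth_fun_bump])
      then have "isCont bump (0::'a)" using continuous_on_eq_continuous_at[OF open_UNIV, of "bump :: 'a \<Rightarrow> real"] by blast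
      from isCont_tendsto_compose[OF this lim] have "((\<lambda>R. bump ((1/R) *\<^sub>R x + 0)) \<longlongrightarrow> bump (0::'a)) at_top" .
      then have "((\<lambda>R. cutoff R x) \<longlongrightarrow> exp 1 * bump (0::'a)) at_top" unfolding cutoff_def by (intro tendsto_intros)
      moreover have "exp 1 * bump (0::'a) = 1" by (simp add: bump_def flat_exp_def exp_minus)
      ultimately have "((\<lambda>R. (cutoff R x * u x - u x)\<^sup>2) \<longlongrightarrow> (1 * u x - u x)\<^sup>2) at_top" by (intro tendsto_intros) simp
      then show "((\<lambda>R. (cutoff R x * u x - u x)\<^sup>2) \<longlongrightarrow> 0) at_top" by simp
    qed
  qed simp
  then show ?thesis by (simp add: sqn_def)
qed

lemma product_gradient_le:
  fixes f :: "'a::euclidean_space \<Rightarrow> real" and g :: "'a \<Rightarrow> 'a"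
  assumes f: "sqi f" and g: "sqi g" and \<psi>: "test_fun UNIV \<psi>" "\<And>x. 0 \<le> \<psi> x \<and> \<psi> x \<le> 1"
    and td: "\<And>x. norm (tgrad \<psi> x) \<le> d" "\<And>x. norm x > R \<Longrightarrow> tgrad \<psi> x = 0" and R: "R > 0"
  shows "sqn (\<lambda>x. \<psi> x *\<^sub>R g x + f x *\<^sub>R tgrad \<psi> x) \<le> 2 * sqn g + 2 * (d\<^sup>2 * (\<integral>x. indicator (ball 0 (2 * R)) x * (f x)\<^sup>2 \<partial>lebesgue))"
proof -
  have [measurable]: "f \<in> borel_measurable lebesgue" "g \<in> borel_measurable lebesgue" "\<psi> \<in> borel_measurable lebesgue"
    using f g sqi_test_fun(1)[OF \<psi>(1)] by (auto intro: sqi_measurable)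
  have [measurable]: "tgrad \<psi> \<in> borel_measurable lebesgue"
    unfolding tgrad_def[abs_def] using sqi_measurable[OF sqi_test_fun(2)[OF \<psi>(1)]] by measurable
  have d0: "d \<ge> 0" using td(1)[of 0] norm_ge_zero order_trans by blast
  have l1: "norm (\<psi> x *\<^sub>R g x) \<le> norm (g x)" for x
    using mult_right_mono[of "\<psi> x" 1 "norm (g x)"] \<psi>(2)[of x] by simp
  have s1: "sqi (\<lambda>x. \<psi> x *\<^sub>R g x)" "sqn (\<lambda>x. \<psi> x *\<^sub>R g x) \<le> sqn g"
    by (rule sqi_bound[OF _ g]; use l1 in auto)+
  let ?e = "\<lambda>x. d *\<^sub>R (indicator (ball 0 (2 * R)) x *\<^sub>R f x)"
  have e: "sqi ?e" by (intro sqi_cmult sqi_indicator_mult f) simp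
  have l2: "norm (f x *\<^sub>R tgrad \<psi> x) \<le> norm (?e x)" for x
  proof (cases "norm x > R")
    case True
    then show ?thesis using td(2) by simp
  next
    case False
    then have "x \<in> ball 0 (2 * R)" using R by simp
    moreover have "\<bar>f x\<bar> * norm (tgrad \<psi> x) \<le> \<bar>f x\<bar> * d" using td(1)[of x] by (intro mult_left_mono) auto
    ultimately show ?thesis using d0 by (simp add: abs_mult mult.commute)
  qed
  have s2: "sqi (\<lambda>x. f x *\<^sub>R tgrad \<psi> x)" "sqn (\<lambda>x. f x *\<^sub>R tgrad \<psi> x) \<le> sqn ?e"
    by (rule sqi_bound[OF _ e]; use l2 in auto)+
  have "sqn ?e = (\<integral>x. d\<^sup>2 * (indicator (ball 0 (2 * R)) x * (f x)\<^sup>2) \<partial>lebesgue)"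
    unfolding sqn_def by (rule Bochner_Integration.integral_cong) (auto simp: power_mult_distrib indicator_def)
  then have "sqn ?e = d\<^sup>2 * (\<integral>x. indicator (ball 0 (2 * R)) x * (f x)\<^sup>2 \<partial>lebesgue)" by simp
  with sqi_add(2)[OF s1(1) s2(1)] s1(2) s2(2) show ?thesis by linarith
qed

lemma integral_indicator_sq_mono:
  fixes f :: "'a::euclidean_space \<Rightarrow> real"
  assumes "sqi f" "S \<in> sets lebesgue"
  shows "(\<integral>x. indicator S x * (f x)\<^sup>2 \<partial>lebesgue) \<le> sqn f" "integrable lebesgue (\<lambda>x. indicator S x * (f x)\<^sup>2)"
proof -
  have i: "integrable lebesgue (\<lambda>x. (f x)\<^sup>2)" using assms by (simp add: sqi_def)
  show j: "integrable lebesgue (\<lambda>x. indicator S x * (f x)\<^sup>2)" using integrable_mult_indicator[OF assms(2) i] by simp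
  have "(\<integral>x. indicator S x * (f x)\<^sup>2 \<partial>lebesgue) \<le> (\<integral>x. (f x)\<^sup>2 \<partial>lebesgue)"
    by (rule integral_mono[OF j i]) (auto simp: indicator_def)
  then show "(\<integral>x. indicator S x * (f x)\<^sup>2 \<partial>lebesgue) \<le> sqn f" by (simp add: sqn_def)
qed

text \<open>The parameters are fixed in the order R, \<rho>, N, \<delta>, b, each against the
  earlier ones, and only then is k taken large. This order works because C3, which bounds the
  gradients after the cut-off, does not depend on R: the factor R^2 of the Poincare inequality meets
  1/R^2 from the cut-off.\<close>

lemma modification:
  fixes \<Omega> \<Omega>' :: "nat \<Rightarrow> 'a::euclidean_space set" and w :: "nat \<Rightarrow> 'a \<Rightarrow> real" and u :: "'a \<Rightarrow> real"
  assumes op: "\<And>k. open (\<Omega> k)" and op': "\<And>k. open (\<Omega>' k)" and ne: "\<And>k. \<Omega>' k \<noteq> {}"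
    and ext: "\<And>k. ext_prop (\<Omega> k) C" and C: "C > 0"
    and \<kappa>: "\<kappa> > 0" and dens: "\<And>k y r. y \<in> \<Omega>' k \<Longrightarrow> r > 0 \<Longrightarrow> measure lebesgue (\<Omega>' k \<inter> ball y r) \<ge> \<kappa> * r ^ DIM('a)"
    and c: "c > 0" and big: "\<And>r. r > 0 \<Longrightarrow> \<forall>\<^sub>F k in sequentially. measure lebesgue (\<Omega> k \<inter> ball 0 r) \<ge> c * r ^ DIM('a)"
    and sym: "\<And>r. r > 0 \<Longrightarrow> (\<lambda>k. measure lebesgue ((\<Omega>' k - \<Omega> k) \<inter> ball 0 r)) \<longlonglongrightarrow> 0"
    and wg: "\<And>k. has_weak_gradient UNIV (w k) (g k)" and wu: "has_weak_gradient UNIV u gu"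
    and conv: "L2loc_tendsto w u"
    and bnd: "\<And>k. (\<integral>\<^sup>+x\<in>\<Omega> k. ennreal ((norm (g k x))\<^sup>2) \<partial>lebesgue) \<le> ennreal M0" and M0: "M0 \<ge> 0"
    and \<tau>: "\<tau> > 0"
  shows "\<forall>\<^sub>F k in sequentially. \<exists>v hv. has_weak_gradient UNIV v hv \<and>
     (\<integral>\<^sup>+x\<in>\<Omega>' k. ennreal ((norm (hv x))\<^sup>2) \<partial>lebesgue) \<le> (\<integral>\<^sup>+x\<in>\<Omega> k. ennreal ((norm (g k x))\<^sup>2) \<partial>lebesgue) + ennreal \<tau> \<and>
     (\<integral>\<^sup>+x. ennreal ((v x - u x)\<^sup>2) \<partial>lebesgue) \<le> ennreal \<tau>"
proof -
  let ?n = "real DIM('a)" and ?w = "ubv TYPE('a)"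
  have Cl: "Clip TYPE('a) > 0" and Cm: "Cmax TYPE('a) > 0" and ub: "?w > 0"
    by (rule Clip_pos Cmax_pos ubv_pos)+
  have u: "sqi u" and gu: "sqi gu" using wu by (auto simp: has_weak_gradient_UNIV_iff)
  obtain D where D: "D > 0" and tD: "\<And>R x. R > 0 \<Longrightarrow> norm (tgrad (cutoff R) (x::'a)) \<le> D / R" using tgrad_cutoff_le by blast
  define U where "U = sqn u"
  have U0: "U \<ge> 0" by (simp add: U_def sqn_nonneg)
  define Kp where "Kp = 3 * (Clip TYPE('a))\<^sup>2 * (1 + ?w / c) * Cmax TYPE('a)"
  have Kp0: "Kp \<ge> 0" using ub c Cm by (simp add: Kp_def)
  \<comment> \<open>The first entry serves e, the second u. The 4 is (2 R)^2 / R^2, from the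
    Poincare inequality on radius 2 R against (D / R)^2; 2 U + 2 bounds the integral of w^2 over
    that ball once w is within squared distance 1 of u there.\<close>
  define C3 where "C3 = max (2 * (C * M0) + 2 * (D\<^sup>2 * (3 * (?w / c) * (2 * U + 2) + 4 * Kp * (C * M0)))) (2 * sqn gu + 2 * (D\<^sup>2 * U))"
  have C30: "C3 \<ge> 0"
  proof -
    have "0 \<le> 2 * sqn gu + 2 * (D\<^sup>2 * U)" using sqn_nonneg[of gu] U0 by (intro add_nonneg_nonneg mult_nonneg_nonneg) auto
    then show ?thesis unfolding C3_def by (rule order_trans) (rule max.cobounded2)
  qed
  \<comment> \<open>This makes \<eta> M0 at most \<tau>/4. The other quarters of the energy budget
    go to the cut-off, the bad set and \<Omega>' - \<Omega>.\<close>
  define \<eta> where "\<eta> = \<tau> / (4 * (M0 + 1))"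
  have \<eta>: "\<eta> > 0" using \<tau> M0 by (simp add: \<eta>_def)
  have \<eta>M: "\<eta> * M0 \<le> \<tau> / 4"
  proof -
    have "\<eta> * M0 \<le> \<eta> * (M0 + 1)" using \<eta> by (intro mult_left_mono) auto
    also have "\<dots> = \<tau> / 4"
    proof -
      have "M0 + 1 \<noteq> 0" using M0 by linarith
      then show ?thesis unfolding \<eta>_def by (simp only: times_divide_eq_left) (metis mult_divide_mult_cancel_right)
    qed
    finally show ?thesis .
  qed
  define Q where "Q = 4 * ?w * 2 ^ DIM('a) / \<kappa>"
  have Q0: "Q \<ge> 0" using ub \<kappa> by (simp add: Q_def)
  \<comment> \<open>The L2 budget: with each of T, Y and the \<delta>-term at most s, the distance
    of v to \<psi> u is at most (4 + 18 Q) s. The triangle inequality doubles this and adds 2 s for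
    the distance of \<psi> u to u.\<close>
  define s where "s = \<tau> / (10 + 36 * Q)"
  have s0: "s > 0" using \<tau> Q0 by (simp add: s_def add_pos_nonneg)
  have sQ: "(10 + 36 * Q) * s = \<tau>" using Q0 by (simp add: s_def)
  have "\<forall>\<^sub>F R in at_top. R \<ge> 1 \<and> (1 + 1 / \<eta>) * (D / R)\<^sup>2 * (2 * U + 2) < \<tau> / 4 \<and> sqn (\<lambda>x. cutoff R x * u x - u x) < s"
  proof (intro eventually_conj)
    show "\<forall>\<^sub>F R in at_top. R \<ge> (1::real)" by (rule eventually_ge_at_top)
    have "((\<lambda>R. (1 + 1 / \<eta>) * (D / R)\<^sup>2 * (2 * U + 2)) \<longlongrightarrow> (1 + 1 / \<eta>) * 0\<^sup>2 * (2 * U + 2)) at_top"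
      by (intro tendsto_mult tendsto_const tendsto_power tendsto_divide_0[OF tendsto_const] filterlim_at_top_imp_at_infinity filterlim_ident)
    then show "\<forall>\<^sub>F R in at_top. (1 + 1 / \<eta>) * (D / R)\<^sup>2 * (2 * U + 2) < \<tau> / 4"
      using \<tau> by (intro order_tendstoD(2)[where y="(1 + 1 / \<eta>) * 0\<^sup>2 * (2 * U + 2)"]) auto
    show "\<forall>\<^sub>F R in at_top. sqn (\<lambda>x. cutoff R x * u x - u x) < s" using cutoff_L2[OF u] s0 by (rule order_tendstoD(2))
  qed
  then obtain R where R1: "R \<ge> 1" and RW: "(1 + 1 / \<eta>) * (D / R)\<^sup>2 * (2 * U + 2) < \<tau> / 4"
    and RZ: "sqn (\<lambda>x. cutoff R x * u x - u x) < s"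
    using eventually_happens'[OF trivial_limit_at_top_linorder] by blast
  have R: "R > 0" using R1 by simp
  have "\<forall>\<^sub>F \<rho> in at_right 0. \<rho> > 0 \<and> (2 * Clip TYPE('a) * \<rho>)\<^sup>2 * (Cmax TYPE('a) * C3) < s"
  proof (intro eventually_conj)
    show "\<forall>\<^sub>F \<rho> in at_right 0. (0::real) < \<rho>" by (auto simp: eventually_at_right_field intro!: exI[of _ 1])
    have "((\<lambda>\<rho>. (2 * Clip TYPE('a) * \<rho>)\<^sup>2 * (Cmax TYPE('a) * C3)) \<longlongrightarrow> (2 * Clip TYPE('a) * 0)\<^sup>2 * (Cmax TYPE('a) * C3)) (at_right 0)"
      by (intro tendsto_mult tendsto_const tendsto_power tendsto_ident_at)
    then show "\<forall>\<^sub>F \<rho> in at_right 0. (2 * Clip TYPE('a) * \<rho>)\<^sup>2 * (Cmax TYPE('a) * C3) < s"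
      using s0 by (intro order_tendstoD(2)[where y="(2 * Clip TYPE('a) * 0)\<^sup>2 * (Cmax TYPE('a) * C3)"]) auto
  qed
  then obtain \<rho> where \<rho>: "\<rho> > 0" and \<rho>T: "(2 * Clip TYPE('a) * \<rho>)\<^sup>2 * (Cmax TYPE('a) * C3) < s"
    using eventually_happens'[of "at_right (0::real)"] by auto
  have "\<forall>\<^sub>F N in sequentially. N \<ge> 1 \<and> ?w * C3 \<le> 4 ^ N \<and> Cmax TYPE('a) * C3 / real N < ?w * \<rho> ^ DIM('a)
     \<and> (?n * Clip TYPE('a))\<^sup>2 * (Cmax TYPE('a) * C3 / real N) < \<tau> / 4"
  proof (intro eventually_conj)
    show "\<forall>\<^sub>F N in sequentially. N \<ge> (1::nat)" by (rule eventually_ge_at_top)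
    obtain N0 where "?w * C3 < 4 ^ N0" using real_arch_pow[of 4 "?w * C3"] by auto
    then have "?w * C3 \<le> 4 ^ N" if "N \<ge> N0" for N
    proof -
      have "(4::real) ^ N0 \<le> 4 ^ N" by (rule power_increasing[OF that]) simp
      with \<open>?w * C3 < 4 ^ N0\<close> show ?thesis by linarith
    qed
    then show "\<forall>\<^sub>F N in sequentially. ?w * C3 \<le> 4 ^ N" unfolding eventually_sequentially by blast
    have lim: "(\<lambda>N. Cmax TYPE('a) * C3 / real N) \<longlonglongrightarrow> 0" by (rule lim_const_over_n)
    have "0 < ?w * \<rho> ^ DIM('a)" using ub \<rho> by simp
    then show "\<forall>\<^sub>F N in sequentially. Cmax TYPE('a) * C3 / real N < ?w * \<rho> ^ DIM('a)" by (rule order_tendstoD(2)[OF lim])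
    have "(\<lambda>N. (?n * Clip TYPE('a))\<^sup>2 * (Cmax TYPE('a) * C3 / real N)) \<longlonglongrightarrow> 0" by (rule tendsto_mult_right_zero[OF lim])
    then show "\<forall>\<^sub>F N in sequentially. (?n * Clip TYPE('a))\<^sup>2 * (Cmax TYPE('a) * C3 / real N) < \<tau> / 4" using \<tau> by (intro order_tendstoD(2)) auto
  qed
  \<comment> \<open>N follows \<rho>, since the bad set must be too small to contain a ball of
    radius \<rho>. It also has to make 4^N dominate \<open>ubv\<close> times C3, which gives the
    truncations bounded support.\<close>
  then obtain N where N: "N \<ge> 1" "?w * C3 \<le> 4 ^ N" and N\<rho>: "Cmax TYPE('a) * C3 / real N < ?w * \<rho> ^ DIM('a)"
    and NB: "(?n * Clip TYPE('a))\<^sup>2 * (Cmax TYPE('a) * C3 / real N) < \<tau> / 4"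
    using eventually_happens'[OF trivial_limit_sequentially] by blast
  \<comment> \<open>The Lipschitz constant is now fixed through N, and \<delta> is chosen small
    against it.\<close>
  define L where "L = 2 * Clip TYPE('a) * 4 ^ N"
  have "\<forall>\<^sub>F \<delta> in at_right 0. \<delta> > 0 \<and> \<delta> < 1 \<and> 8 * L\<^sup>2 * \<delta>\<^sup>2 * (?w * (R + 2) ^ DIM('a)) < s"
  proof (intro eventually_conj)
    show "\<forall>\<^sub>F \<delta> in at_right 0. (0::real) < \<delta>" by (auto simp: eventually_at_right_field intro!: exI[of _ 1])
    show "\<forall>\<^sub>F \<delta> in at_right 0. \<delta> < (1::real)" by (auto simp: eventually_at_right_field intro!: exI[of _ 1])
    have "((\<lambda>\<delta>. 8 * L\<^sup>2 * \<delta>\<^sup>2 * (?w * (R + 2) ^ DIM('a))) \<longlongrightarrow> 8 * L\<^sup>2 * 0\<^sup>2 * (?w * (R + 2) ^ DIM('a))) (at_right 0)"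
      by (intro tendsto_mult tendsto_const tendsto_power tendsto_ident_at)
    then show "\<forall>\<^sub>F \<delta> in at_right 0. 8 * L\<^sup>2 * \<delta>\<^sup>2 * (?w * (R + 2) ^ DIM('a)) < s"
      using s0 by (intro order_tendstoD(2)[where y="8 * L\<^sup>2 * 0\<^sup>2 * (?w * (R + 2) ^ DIM('a))"]) auto
  qed
  then obtain \<delta> where \<delta>: "\<delta> > 0" "\<delta> < 1" and \<delta>X: "8 * L\<^sup>2 * \<delta>\<^sup>2 * (?w * (R + 2) ^ DIM('a)) < s"
    using eventually_happens'[of "at_right (0::real)"] by auto
  define kk where "kk = (?n * Clip TYPE('a))\<^sup>2"
  have kk0: "kk \<ge> 0" by (simp add: kk_def)
  \<comment> \<open>The first entry keeps half of the density of \<Omega>' inside \<Omega> at scale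
    \<delta>. The second makes the energy on \<Omega>' - \<Omega>, with squared gradient at most
    \<open>kk\<close> times 16^N, fit into a quarter of \<tau>.\<close>
  define b where "b = min (\<kappa> / 2 * \<delta> ^ DIM('a)) (\<tau> / (4 * (kk * 16 ^ N + 1)))"
  have kN: "kk * 16 ^ N + 1 > 0" using kk0 by (simp add: add_nonneg_pos)
  have b0: "b > 0" using \<kappa> \<delta> \<tau> kN by (simp add: b_def)
  have bk: "kk * (16 ^ N * b) \<le> \<tau> / 4"
  proof -
    have "kk * (16 ^ N * b) \<le> (kk * 16 ^ N + 1) * b" using b0 by (simp add: algebra_simps)
    also have "\<dots> \<le> (kk * 16 ^ N + 1) * (\<tau> / (4 * (kk * 16 ^ N + 1)))" using kN by (intro mult_left_mono) (auto simp: b_def)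
    also have "\<dots> = \<tau> / 4" using kN by (simp add: field_simps)
    finally show ?thesis .
  qed
  define Y where "Y = min s 1"
  have Y: "Y > 0" "Y \<le> s" "Y \<le> 1" using s0 by (auto simp: Y_def)
  have e1: "\<forall>\<^sub>F k in sequentially. measure lebesgue (\<Omega> k \<inter> ball 0 (2 * R)) \<ge> c * (2 * R) ^ DIM('a)" using R by (intro big) simp
  have e2: "\<forall>\<^sub>F k in sequentially. measure lebesgue ((\<Omega>' k - \<Omega> k) \<inter> ball 0 (R + 4)) < b"
    using sym[of "R + 4"] b0 R by (intro order_tendstoD(2)) auto
  have e3: "\<forall>\<^sub>F k in sequentially. (\<integral>\<^sup>+x\<in>ball 0 (2 * R). ennreal ((w k x - u x)\<^sup>2) \<partial>lebesgue) < ennreal Y"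

  proof (rule order_tendstoD(2))
    show "(\<lambda>k. \<integral>\<^sup>+x\<in>ball 0 (2 * R). ennreal ((w k x - u x)\<^sup>2) \<partial>lebesgue) \<longlonglongrightarrow> 0"
      using conv R unfolding L2loc_tendsto_def by (meson mult_pos_pos zero_less_numeral)
    show "0 < ennreal Y" using Y(1) by simp
  qed
  from e1 e2 e3 show ?thesis
  proof eventually_elim
    case (elim k)
    let ?B = "ball (0::'a) (2 * R)"
    have Bm: "?B \<in> sets lebesgue" by simp
    have wk: "sqi (w k)" and gk: "sqi (g k)" using wg[of k] by (auto simp: has_weak_gradient_UNIV_iff)
    obtain e h where we: "has_weak_gradient UNIV e h" and ew: "AE x in lebesgue. x \<in> \<Omega> k \<longrightarrow> e x = w k x"
      and hle: "ennreal (sqn h) \<le> ennreal C * (\<integral>\<^sup>+x\<in>\<Omega> k. ennreal ((norm (g k x))\<^sup>2) \<partial>lebesgue)"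
      using ext[of k] wg[of k] unfolding ext_prop_def by blast
    have esq: "sqi e" and hsq: "sqi h" using we by (auto simp: has_weak_gradient_UNIV_iff)
    have hC: "sqn h \<le> C * M0"
    proof -
      have "ennreal (sqn h) \<le> ennreal C * ennreal M0" using hle mult_left_mono[OF bnd[of k], of "ennreal C"] by (simp add: order_trans)
      also have "\<dots> = ennreal (C * M0)" using C M0 by (simp add: ennreal_mult)
      finally show ?thesis using C M0 by (subst (asm) ennreal_le_iff) auto
    qed
    have W: "(\<integral>x. indicator ?B x * (w k x)\<^sup>2 \<partial>lebesgue) \<le> 2 * U + 2"
    proof -
      have dsq: "sqi (\<lambda>x. w k x - u x)" by (rule sqi_diff(1)[OF wk u])
      note I1 = integral_indicator_sq_mono(2)[OF dsq Bm] and I2 = integral_indicator_sq_mono(2)[OF u Bm]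
      have "ennreal (\<integral>x. indicator ?B x * (w k x - u x)\<^sup>2 \<partial>lebesgue) = (\<integral>\<^sup>+x. ennreal (indicator ?B x * (w k x - u x)\<^sup>2) \<partial>lebesgue)"
        by (rule nn_integral_eq_integral[symmetric, OF I1]) auto
      also have "\<dots> = (\<integral>\<^sup>+x\<in>?B. ennreal ((w k x - u x)\<^sup>2) \<partial>lebesgue)" by (intro nn_integral_cong) (auto simp: indicator_def)
      also have "\<dots> \<le> ennreal 1" using elim(3) Y(3) by (meson ennreal_leI order_less_imp_le order_trans)
      finally have d1: "(\<integral>x. indicator ?B x * (w k x - u x)\<^sup>2 \<partial>lebesgue) \<le> 1" by (subst (asm) ennreal_le_iff) auto
      have "(\<integral>x. indicator ?B x * (w k x)\<^sup>2 \<partial>lebesgue) \<le> (\<integral>x. 2 * (indicator ?B x * (w k x - u x)\<^sup>2) + 2 * (indicator ?B x * (u x)\<^sup>2) \<partial>lebesgue)"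
      proof (rule integral_mono)
        show "integrable lebesgue (\<lambda>x. indicator ?B x * (w k x)\<^sup>2)" by (rule integral_indicator_sq_mono(2)[OF wk Bm])
        show "integrable lebesgue (\<lambda>x. 2 * (indicator ?B x * (w k x - u x)\<^sup>2) + 2 * (indicator ?B x * (u x)\<^sup>2))"
          by (intro Bochner_Integration.integrable_add integrable_mult_right I1 I2)
        show "indicator ?B x * (w k x)\<^sup>2 \<le> 2 * (indicator ?B x * (w k x - u x)\<^sup>2) + 2 * (indicator ?B x * (u x)\<^sup>2)" for x
          using sq_sum2_le[of "w k x - u x" "u x"] by (cases "x \<in> ?B") auto
      qed
      also have "\<dots> = 2 * (\<integral>x. indicator ?B x * (w k x - u x)\<^sup>2 \<partial>lebesgue) + 2 * (\<integral>x. indicator ?B x * (u x)\<^sup>2 \<partial>lebesgue)"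
        by (subst Bochner_Integration.integral_add[OF integrable_mult_right[OF I1] integrable_mult_right[OF I2]]) simp
      also have "\<dots> \<le> 2 * 1 + 2 * U"
        using d1 integral_indicator_sq_mono(1)[OF u Bm] by (intro add_mono mult_left_mono) (auto simp: U_def)
      finally show ?thesis by simp
    qed
    let ?A = "\<Omega> k \<inter> ?B"
    have Am: "?A \<in> sets lebesgue" using op[of k] by auto
    have Ae: "(\<integral>x. indicator ?A x * (e x)\<^sup>2 \<partial>lebesgue) \<le> 2 * U + 2"
    proof -
      have "(\<integral>x. indicator ?A x * (e x)\<^sup>2 \<partial>lebesgue) \<le> (\<integral>x. indicator ?B x * (w k x)\<^sup>2 \<partial>lebesgue)"
      proof (rule integral_mono_AE)
        show "integrable lebesgue (\<lambda>x. indicator ?A x * (e x)\<^sup>2)" by (rule integral_indicator_sq_mono(2)[OF esq Am])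
        show "integrable lebesgue (\<lambda>x. indicator ?B x * (w k x)\<^sup>2)" by (rule integral_indicator_sq_mono(2)[OF wk Bm])
        show "AE x in lebesgue. indicator ?A x * (e x)\<^sup>2 \<le> indicator ?B x * (w k x)\<^sup>2"
          using ew by eventually_elim (auto simp: indicator_def)
      qed
      then show ?thesis using W by linarith
    qed
    have PB: "(\<integral>x. indicator ?B x * (e x)\<^sup>2 \<partial>lebesgue) \<le> 3 * (?w / c) * (2 * U + 2) + Kp * (2 * R)\<^sup>2 * (C * M0)"
    proof -
      have "(\<integral>x. indicator ?B x * (e x)\<^sup>2 \<partial>lebesgue) \<le> 3 * (?w / c) * (\<integral>x. indicator ?A x * (e x)\<^sup>2 \<partial>lebesgue) + Kp * (2 * R)\<^sup>2 * sqn h"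
        unfolding Kp_def using R elim(1) by (intro poincare_ball[OF we _ c Am]) auto
      also have "\<dots> \<le> 3 * (?w / c) * (2 * U + 2) + Kp * (2 * R)\<^sup>2 * (C * M0)"
        using ub c Ae hC Kp0 by (intro add_mono mult_left_mono) auto
      finally show ?thesis .
    qed
    let ?\<psi> = "cutoff R :: 'a \<Rightarrow> real"
    note cp = cutoff_props[OF R]
    have G3: "sqn (\<lambda>x. ?\<psi> x *\<^sub>R h x + e x *\<^sub>R tgrad ?\<psi> x) \<le> C3"
    proof -
      have "sqn (\<lambda>x. ?\<psi> x *\<^sub>R h x + e x *\<^sub>R tgrad ?\<psi> x) \<le> 2 * sqn h + 2 * ((D / R)\<^sup>2 * (\<integral>x. indicator ?B x * (e x)\<^sup>2 \<partial>lebesgue))"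
        by (rule product_gradient_le[OF esq hsq cp(1,2) tD[OF R] cp(4) R])
      also have "\<dots> \<le> 2 * (C * M0) + 2 * ((D / R)\<^sup>2 * (3 * (?w / c) * (2 * U + 2) + Kp * (2 * R)\<^sup>2 * (C * M0)))"
        using hC PB by (intro add_mono mult_left_mono) auto
      also have "(D / R)\<^sup>2 * (3 * (?w / c) * (2 * U + 2) + Kp * (2 * R)\<^sup>2 * (C * M0))
         = (D / R)\<^sup>2 * (3 * (?w / c) * (2 * U + 2)) + D\<^sup>2 * (4 * Kp * (C * M0))"
        using R by (simp add: power_mult_distrib power_divide distrib_left)
      also have "\<dots> \<le> D\<^sup>2 * (3 * (?w / c) * (2 * U + 2)) + D\<^sup>2 * (4 * Kp * (C * M0))"
      proof (intro add_right_mono mult_right_mono)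
        have "D / R \<le> D" using D R1 by (simp add: divide_le_eq)
        then show "(D / R)\<^sup>2 \<le> D\<^sup>2" using D R by (intro power_mono) auto
      qed (use ub c U0 in auto)
      also have "2 * (C * M0) + 2 * \<dots> \<le> C3" unfolding C3_def distrib_left by simp
      finally show ?thesis by simp
    qed
    have G4: "sqn (\<lambda>x. ?\<psi> x *\<^sub>R gu x + u x *\<^sub>R tgrad ?\<psi> x) \<le> C3"
    proof -
      have "sqn (\<lambda>x. ?\<psi> x *\<^sub>R gu x + u x *\<^sub>R tgrad ?\<psi> x) \<le> 2 * sqn gu + 2 * ((D / R)\<^sup>2 * (\<integral>x. indicator ?B x * (u x)\<^sup>2 \<partial>lebesgue))"
        by (rule product_gradient_le[OF u gu cp(1,2) tD[OF R] cp(4) R])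
      also have "\<dots> \<le> 2 * sqn gu + 2 * (D\<^sup>2 * U)"
      proof (intro add_left_mono mult_left_mono mult_mono)
        have "D / R \<le> D" using D R1 by (simp add: divide_le_eq)
        then show "(D / R)\<^sup>2 \<le> D\<^sup>2" using D R by (intro power_mono) auto
        show "(\<integral>x. indicator ?B x * (u x)\<^sup>2 \<partial>lebesgue) \<le> U" unfolding U_def by (rule integral_indicator_sq_mono(1)[OF u Bm])
      qed (auto intro!: Bochner_Integration.integral_nonneg)
      also have "\<dots> \<le> C3" by (simp add: C3_def)
      finally show ?thesis .
    qed
    define T where "T = (2 * Clip TYPE('a) * \<rho>)\<^sup>2 * (Cmax TYPE('a) * C3)"
    have dns: "measure lebesgue (\<Omega>' k \<inter> ball y \<delta>) \<ge> \<kappa> * \<delta> ^ DIM('a)" if "y \<in> \<Omega>' k" for y by (rule dens[OF that \<delta>(1)])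
    have bb: "b \<le> \<kappa> / 2 * \<delta> ^ DIM('a)" unfolding b_def by (rule min.cobounded1)
    obtain v hv where wv: "has_weak_gradient UNIV v hv"
      and en: "(\<integral>\<^sup>+x\<in>\<Omega>' k. ennreal ((norm (hv x))\<^sup>2) \<partial>lebesgue) \<le> ennreal (1 + \<eta>) * (\<integral>\<^sup>+x\<in>\<Omega> k. ennreal ((norm (g k x))\<^sup>2) \<partial>lebesgue)
        + ennreal ((1 + 1 / \<eta>) * (D / R)\<^sup>2 * (2 * U + 2) + (?n * Clip TYPE('a))\<^sup>2 * (Cmax TYPE('a) * C3 / N + 16 ^ N * b))"
      and l2: "(\<integral>\<^sup>+x. ennreal ((v x - ?\<psi> x * u x)\<^sup>2) \<partial>lebesgue)
        \<le> ennreal (2 * T + 2 * (8 * L\<^sup>2 * \<delta>\<^sup>2 * (?w * (R + 2) ^ DIM('a)) + 4 * ?w * 2 ^ DIM('a) / \<kappa> * (6 * T + 3 * Y)))"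
      using modification_step[OF op[of k] op'[of k] ne[of k] wg[of k] wu we ew cp(1,2,3) tD[OF R] cp(4) R G3 G4 N \<rho> N\<rho> \<kappa> \<delta>(1) less_imp_le[OF \<delta>(2)] dns less_imp_le[OF elim(2)] bb \<eta> W less_imp_le[OF elim(3)] less_imp_le[OF Y(1)]]
      unfolding T_def L_def by blast
    have E: "(\<integral>\<^sup>+x\<in>\<Omega>' k. ennreal ((norm (hv x))\<^sup>2) \<partial>lebesgue) \<le> (\<integral>\<^sup>+x\<in>\<Omega> k. ennreal ((norm (g k x))\<^sup>2) \<partial>lebesgue) + ennreal \<tau>"
    proof -
      let ?I = "\<integral>\<^sup>+x\<in>\<Omega> k. ennreal ((norm (g k x))\<^sup>2) \<partial>lebesgue"
      have "?I \<noteq> \<infinity>" using bnd[of k] by (auto simp: top_unique)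
      then obtain i where i: "?I = ennreal i" "i \<ge> 0" using ennreal_finite_ex by blast
      have iM: "i \<le> M0" using bnd[of k] M0 unfolding i(1) by simp
      let ?z = "(1 + 1 / \<eta>) * (D / R)\<^sup>2 * (2 * U + 2) + (?n * Clip TYPE('a))\<^sup>2 * (Cmax TYPE('a) * C3 / N + 16 ^ N * b)"
      have z0: "?z \<ge> 0" using \<eta> U0 Cm C30 b0 by (intro add_nonneg_nonneg mult_nonneg_nonneg) auto
      have "(?n * Clip TYPE('a))\<^sup>2 * (Cmax TYPE('a) * C3 / N + 16 ^ N * b) \<le> \<tau> / 4 + \<tau> / 4"

        using NB bk unfolding distrib_left kk_def by linarith
      then have z: "?z \<le> 3 * \<tau> / 4" using RW by linarith
      have "\<eta> * i \<le> \<eta> * M0" using iM \<eta> by (intro mult_left_mono) auto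
      moreover have "(1 + \<eta>) * i = i + \<eta> * i" by (simp add: distrib_right)
      ultimately have fin: "(1 + \<eta>) * i + ?z \<le> i + \<tau>" using \<eta>M z \<tau> by linarith
      have "ennreal (1 + \<eta>) * ?I + ennreal ?z = ennreal ((1 + \<eta>) * i + ?z)"
        unfolding i(1) using \<eta> i(2) z0 by (subst ennreal_plus) (auto simp: ennreal_mult)
      also have "\<dots> \<le> ennreal (i + \<tau>)" by (rule ennreal_leI[OF fin])
      also have "\<dots> = ?I + ennreal \<tau>" unfolding i(1) using i(2) \<tau> by (intro ennreal_plus) auto
      finally show ?thesis using en by (rule order_trans[rotated])
    qed
    have F: "(\<integral>\<^sup>+x. ennreal ((v x - u x)\<^sup>2) \<partial>lebesgue) \<le> ennreal \<tau>"
    proof -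
      have v: "sqi v" using wv by (simp add: has_weak_gradient_UNIV_iff)
      have wp: "sqi (\<lambda>x. ?\<psi> x * u x)" using weak_gradient_mult_test[OF wu cp(1)] by (simp add: has_weak_gradient_UNIV_iff)
      have s1: "sqi (\<lambda>x. v x - ?\<psi> x * u x)" by (rule sqi_diff(1)[OF v wp])
      have s2: "sqi (\<lambda>x. ?\<psi> x * u x - u x)" by (rule sqi_diff(1)[OF wp u])
      have s3: "sqi (\<lambda>x. v x - u x)" by (rule sqi_diff(1)[OF v u])
      let ?x = "2 * T + 2 * (8 * L\<^sup>2 * \<delta>\<^sup>2 * (?w * (R + 2) ^ DIM('a)) + Q * (6 * T + 3 * Y))"
      have T: "T < s" "T \<ge> 0" using \<rho>T Cm C30 by (auto simp: T_def)
      have "Q * (6 * T + 3 * Y) \<le> Q * (9 * s)" using T Y Q0 by (intro mult_left_mono) auto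
      then have xs: "?x \<le> (4 + 18 * Q) * s" using T \<delta>X by (simp add: distrib_right)
      have "(\<integral>\<^sup>+x. ennreal ((norm (v x - ?\<psi> x * u x))\<^sup>2) \<partial>lebesgue) \<le> ennreal ?x" using l2 by (simp add: Q_def)
      then have "ennreal (sqn (\<lambda>x. v x - ?\<psi> x * u x)) \<le> ennreal ?x" unfolding nn_integral_sqn[OF s1] .
      moreover have "?x \<ge> 0" using T Q0 Y ub R by (intro add_nonneg_nonneg mult_nonneg_nonneg) auto
      ultimately have a: "sqn (\<lambda>x. v x - ?\<psi> x * u x) \<le> (4 + 18 * Q) * s" using xs by (subst (asm) ennreal_le_iff) auto
      have "sqn (\<lambda>x. v x - u x) \<le> 2 * sqn (\<lambda>x. v x - ?\<psi> x * u x) + 2 * sqn (\<lambda>x. ?\<psi> x * u x - u x)"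
        using sqi_add(2)[OF s1 s2] by simp
      also have "\<dots> \<le> 2 * ((4 + 18 * Q) * s) + 2 * s" using a RZ by linarith
      also have "\<dots> = \<tau>" unfolding sQ[symmetric] by (simp add: algebra_simps)
      finally have "ennreal (sqn (\<lambda>x. v x - u x)) \<le> ennreal \<tau>" by (rule ennreal_leI)
      then show ?thesis using nn_integral_sqn[OF s3] by simp
    qed
    show ?case using wv E F by blast
  qed
qed

section \<open>Gamma-convergence\<close>

lemma mem_scale_image:
  fixes x :: "'a::real_vector"
  assumes "a > 0"
  shows "x \<in> (\<lambda>y. a *\<^sub>R y) ` A \<longleftrightarrow> (1/a) *\<^sub>R x \<in> A"
proof
  assume "(1/a) *\<^sub>R x \<in> A"
  moreover have "x = a *\<^sub>R ((1/a) *\<^sub>R x)" using assms by simp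
  ultimately show "x \<in> (\<lambda>y. a *\<^sub>R y) ` A" by blast
qed (use assms in auto)

lemma measure_scale_inter_ball:
  fixes A :: "'a::euclidean_space set"
  assumes a: "a > 0"
  shows "measure lebesgue ((\<lambda>y. a *\<^sub>R y) ` A \<inter> ball x r) = a ^ DIM('a) * measure lebesgue (A \<inter> ball ((1/a) *\<^sub>R x) (r/a))"
proof -
  have "(\<lambda>y. a *\<^sub>R y) ` A \<inter> ball x r = (\<lambda>y. a *\<^sub>R y + 0) ` (A \<inter> ball ((1/a) *\<^sub>R x) (r/a))"
  proof (rule set_eqI)
    fix z
    have "dist x z = a * dist ((1/a) *\<^sub>R x) ((1/a) *\<^sub>R z)"
      unfolding dist_norm scaleR_diff_right[symmetric] norm_scaleR using a by simp
    then have "z \<in> ball x r \<longleftrightarrow> (1/a) *\<^sub>R z \<in> ball ((1/a) *\<^sub>R x) (r/a)"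
      using a by (simp add: pos_less_divide_eq mult.commute)
    then show "z \<in> (\<lambda>y. a *\<^sub>R y) ` A \<inter> ball x r \<longleftrightarrow> z \<in> (\<lambda>y. a *\<^sub>R y + 0) ` (A \<inter> ball ((1/a) *\<^sub>R x) (r/a))"
      unfolding add_0_right using mem_scale_image[OF a, of z] by (simp del: image_Int)
  qed
  then show ?thesis using measure_lebesgue_affine[of a 0 "A \<inter> ball ((1/a) *\<^sub>R x) (r/a)"] a by simp
qed

text \<open>The energy is defined with a chosen weak gradient; uniqueness almost everywhere lets any
  other one compute it.\<close>

lemma FE_eq:
  fixes u :: "'a::euclidean_space \<Rightarrow> real"
  assumes g: "has_weak_gradient UNIV u g"
  shows "FE E \<epsilon> u = (\<integral>\<^sup>+x\<in>- ((\<lambda>y. \<epsilon> *\<^sub>R y) ` E). ennreal ((norm (g x))\<^sup>2) \<partial>lebesgue)"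
proof -
  have "has_weak_gradient UNIV u (wgrad UNIV u)" using g by (intro has_weak_gradient_wgrad) (auto simp: H1_def)
  from weak_gradient_unique[OF open_UNIV this g] show ?thesis
    unfolding FE_def by (intro nn_integral_cong_AE) auto
qed

lemma FE_le_sqn:
  fixes u :: "'a::euclidean_space \<Rightarrow> real"
  assumes g: "has_weak_gradient UNIV u g"
  shows "FE E \<epsilon> u \<le> ennreal (sqn g)"
proof -
  have "sqi g" using g by (simp add: has_weak_gradient_UNIV_iff)
  from nn_integral_sqn[OF this] show ?thesis
    unfolding FE_eq[OF g] by (intro order_trans[OF nn_integral_mono eq_refl]) (auto simp: indicator_def)
qed

text \<open>For R \<ge> 2 |x| the ball of radius R at x contains the ball of radius R/2 at the
  origin, which costs the factor 2^n. \<open>measure_density\<close> requires the volume bound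
  around every point.\<close>

lemma density_recentre:
  fixes A :: "'a::euclidean_space set"
  assumes A: "A \<in> sets lebesgue" and c: "c \<ge> 0" and big: "\<And>R. R \<ge> R0 \<Longrightarrow> measure lebesgue (A \<inter> ball 0 R) \<ge> c * R ^ DIM('a)"
  shows "\<exists>R1. \<forall>R\<ge>R1. measure lebesgue (A \<inter> ball x R) \<ge> c / 2 ^ DIM('a) * R ^ DIM('a)"
proof (intro exI allI impI)
  fix R assume R: "R \<ge> max (2 * norm x) (2 * R0)"
  have "c / 2 ^ DIM('a) * R ^ DIM('a) = c * (R/2) ^ DIM('a)" by (simp add: power_divide)
  also have "\<dots> \<le> measure lebesgue (A \<inter> ball 0 (R/2))" using R by (intro big) auto
  also have "\<dots> \<le> measure lebesgue (A \<inter> ball x R)"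
  proof (rule measure_mono_fmeasurable)
    show "A \<inter> ball 0 (R/2) \<subseteq> A \<inter> ball x R"
    proof
      fix y assume y: "y \<in> A \<inter> ball 0 (R/2)"
      have "dist x y \<le> norm x + norm y" by (simp add: dist_norm norm_triangle_ineq4)
      also have "\<dots> < R" using y R by auto
      finally show "y \<in> A \<inter> ball x R" using y by simp
    qed
    show "A \<inter> ball x R \<in> fmeasurable lebesgue"
      using A fmeasurable_Int_fmeasurable[of "ball x R" lebesgue A] by (simp add: Int_commute)
  qed (use A in auto)
  finally show "measure lebesgue (A \<inter> ball x R) \<ge> c / 2 ^ DIM('a) * R ^ DIM('a)" .
qed

text \<open>The sequence \<open>t\<close> is the infimum of the admissible tolerances plus a vanishing sequence.\<close>
lemma eventually_diagonal:
  fixes P :: "real \<Rightarrow> nat \<Rightarrow> bool"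
  assumes mono: "\<And>s t k. P s k \<Longrightarrow> s \<le> t \<Longrightarrow> P t k" and ev: "\<And>\<tau>. \<tau> > 0 \<Longrightarrow> \<forall>\<^sub>F k in sequentially. P \<tau> k"
  shows "\<exists>t. t \<longlonglongrightarrow> 0 \<and> (\<forall>\<^sub>F k in sequentially. P (t k) k)"
proof -
  define S where "S k = {\<tau>. \<tau> > 0 \<and> P \<tau> k}" for k
  define t where "t k = Inf (S k) + inverse (real (Suc k))" for k
  have bdd: "bdd_below (S k)" for k unfolding S_def by (rule bdd_belowI[of _ 0]) auto
  have ne: "\<forall>\<^sub>F k in sequentially. S k \<noteq> {}"
    using ev[of 1] by (auto simp: S_def elim!: eventually_mono intro!: exI[of _ 1])
  have "t \<longlonglongrightarrow> 0"
  proof (rule order_tendstoI)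
    fix e :: real assume e: "e < 0"
    show "\<forall>\<^sub>F k in sequentially. e < t k" using ne
    proof eventually_elim
      case (elim k)
      then have "0 \<le> Inf (S k)" by (rule cInf_greatest) (auto simp: S_def)
      then show ?case using e by (simp add: t_def add_nonneg_pos less_trans[of _ 0])
    qed
  next
    fix e :: real assume e: "0 < e"
    have "\<forall>\<^sub>F k in sequentially. inverse (real (Suc k)) < e / 2"
      using LIMSEQ_inverse_real_of_nat e by (intro order_tendstoD(2)) auto
    moreover have "\<forall>\<^sub>F k in sequentially. P (e / 2) k" using e by (intro ev) simp
    ultimately show "\<forall>\<^sub>F k in sequentially. t k < e"
    proof eventually_elim
      case (elim k)
      have "Inf (S k) \<le> e / 2" using e elim by (intro cInf_lower[OF _ bdd]) (simp add: S_def)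
      with elim show ?case by (simp add: t_def)
    qed
  qed
  moreover have "\<forall>\<^sub>F k in sequentially. P (t k) k" using ne
  proof eventually_elim
    case (elim k)
    have "Inf (S k) < t k" by (simp add: t_def)
    then obtain s where "s \<in> S k" "s < t k" using cInf_less_iff[OF elim bdd] by blast
    then show ?case using mono[of s k "t k"] by (simp add: S_def)
  qed
  ultimately show ?thesis by blast
qed

text \<open>Dilations preserve the constant of the extension property and the density constant, so
  both hold uniformly in k for the rescaled domains. The volume of \<Omega>' - \<Omega> in a fixed
  ball of radius r is r^n times the density of E - E' at scale r / \<epsilon> k, hence tends to 0. A
  diagonal choice then lets the tolerance of \<open>modification\<close> vanish along the
  sequence.\<close>

lemma energy_transfer:
  fixes E E' :: "'a::euclidean_space set" and w :: "nat \<Rightarrow> 'a \<Rightarrow> real"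
  assumes E: "closed E" "admits_extension E" and E': "closed E'" "admits_extension E'"
    and c: "c > 0" and bigE: "\<forall>R\<ge>R0. measure lebesgue (- E \<inter> ball 0 R) \<ge> c * R ^ DIM('a)"
    and bigE': "\<forall>R\<ge>R0. measure lebesgue (- E' \<inter> ball 0 R) \<ge> c * R ^ DIM('a)"
    and sym: "((\<lambda>R. measure lebesgue ((E - E') \<inter> ball 0 R) / R ^ DIM('a)) \<longlongrightarrow> 0) at_top"
    and \<epsilon>: "\<And>k. \<epsilon> k > 0" "\<epsilon> \<longlonglongrightarrow> 0"
    and w: "\<And>k. H1 UNIV (w k)" and u: "H1 UNIV u" and conv: "L2loc_tendsto w u"
    and bnd: "\<And>k. FE E (\<epsilon> k) (w k) \<le> ennreal M0" and M0: "M0 \<ge> 0"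
  shows "\<exists>v t. (\<forall>k. H1 UNIV (v k)) \<and> L2loc_tendsto v u \<and> t \<longlonglongrightarrow> 0 \<and>
     (\<forall>\<^sub>F k in sequentially. FE E' (\<epsilon> k) (v k) \<le> FE E (\<epsilon> k) (w k) + ennreal (t k))"
proof -
  let ?n = "DIM('a)"
  note big = bigE[rule_format] and big' = bigE'[rule_format]
  define \<Omega> where "\<Omega> k = (\<lambda>y. \<epsilon> k *\<^sub>R y) ` (- E)" for k
  define \<Omega>' where "\<Omega>' k = (\<lambda>y. \<epsilon> k *\<^sub>R y) ` (- E')" for k
  have cpl: "- ((\<lambda>y. \<epsilon> k *\<^sub>R y) ` A) = (\<lambda>y. \<epsilon> k *\<^sub>R y) ` (- A)" for k and A :: "'a set"
    by (rule set_eqI) (simp only: Compl_iff mem_scale_image[OF \<epsilon>(1)])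
  have \<Omega>e: "- ((\<lambda>y. \<epsilon> k *\<^sub>R y) ` E) = \<Omega> k" "- ((\<lambda>y. \<epsilon> k *\<^sub>R y) ` E') = \<Omega>' k" for k
    unfolding \<Omega>_def \<Omega>'_def by (rule cpl)+
  have op: "open (\<Omega> k)" "open (\<Omega>' k)" for k
    unfolding \<Omega>e[symmetric] using E E' by (auto intro!: open_Compl closed_scaling)
  have oE: "open (- E)" "open (- E')" using E E' by (auto simp: open_Compl)
  then have mE: "- E \<in> sets lebesgue" "- E' \<in> sets lebesgue" by auto
  obtain C where C: "C > 0" "ext_prop (- E) C" using admits_extension_ext_prop[OF E] by blast
  obtain C' where C': "C' > 0" "ext_prop (- E') C'" using admits_extension_ext_prop[OF E'] by blast
  have ext: "ext_prop (\<Omega> k) C" for k unfolding \<Omega>_def by (rule ext_prop_scale[OF C(2) mE(1) \<epsilon>(1)])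
  \<comment> \<open>The volume bound at large radii is turned into a density bound at all radii for
    the unscaled set; rescaling then carries it over to every \<Omega>' k.\<close>
  obtain \<kappa> where \<kappa>: "\<kappa> > 0" and d': "\<And>x r. x \<in> - E' \<Longrightarrow> r > 0 \<Longrightarrow> measure lebesgue (- E' \<inter> ball x r) \<ge> \<kappa> * r ^ ?n"
    using measure_density[OF oE(2) C'(2,1), of "c / 2 ^ ?n"] density_recentre[OF mE(2) less_imp_le[OF c] big'] c by auto
  have dens: "measure lebesgue (\<Omega>' k \<inter> ball y r) \<ge> \<kappa> * r ^ ?n" if y: "y \<in> \<Omega>' k" and r: "r > 0" for k y r
  proof -
    have "(1 / \<epsilon> k) *\<^sub>R y \<in> - E'" using y unfolding \<Omega>'_def mem_scale_image[OF \<epsilon>(1)] .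
    from d'[OF this, of "r / \<epsilon> k"] have "\<kappa> * (r / \<epsilon> k) ^ ?n \<le> measure lebesgue (- E' \<inter> ball ((1 / \<epsilon> k) *\<^sub>R y) (r / \<epsilon> k))"
      using r \<epsilon>(1)[of k] by simp
    then have "\<epsilon> k ^ ?n * (\<kappa> * (r / \<epsilon> k) ^ ?n) \<le> measure lebesgue (\<Omega>' k \<inter> ball y r)"
      unfolding \<Omega>'_def measure_scale_inter_ball[OF \<epsilon>(1)] using \<epsilon>(1)[of k] by (intro mult_left_mono) auto
    then show ?thesis using \<epsilon>(1)[of k] by (simp add: power_divide)
  qed
  have ne: "\<Omega>' k \<noteq> {}" for k
  proof
    assume "\<Omega>' k = {}"
    then have "- E' = {}" by (simp add: \<Omega>'_def)
    moreover have "0 < c * (max R0 1) ^ ?n" using c by simp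
    ultimately show False using big'[of "max R0 1"] by simp
  qed
  have lim: "filterlim (\<lambda>k. r / \<epsilon> k) at_top sequentially" if r: "r > 0" for r
    unfolding filterlim_at_top
  proof
    fix Z
    have "\<forall>\<^sub>F k in sequentially. \<epsilon> k < r / (\<bar>Z\<bar> + 1)" using \<epsilon>(2) r by (intro order_tendstoD(2)) auto
    then show "\<forall>\<^sub>F k in sequentially. Z \<le> r / \<epsilon> k"
    proof eventually_elim
      case (elim k)
      have "\<epsilon> k * (\<bar>Z\<bar> + 1) < r" using elim by (simp add: pos_less_divide_eq add_nonneg_pos)
      moreover have "\<epsilon> k * Z \<le> \<epsilon> k * (\<bar>Z\<bar> + 1)" using \<epsilon>(1)[of k] by (intro mult_left_mono) auto
      ultimately have "Z * \<epsilon> k \<le> r" by (metis less_imp_le mult.commute order.strict_trans1)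
      then show ?case using \<epsilon>(1)[of k] by (simp add: pos_le_divide_eq)
    qed
  qed
  have bigs: "\<forall>\<^sub>F k in sequentially. measure lebesgue (\<Omega> k \<inter> ball 0 r) \<ge> c * r ^ ?n" if r: "r > 0" for r
    using lim[OF r, unfolded filterlim_at_top, rule_format, of R0]
  proof eventually_elim
    case (elim k)
    have "\<epsilon> k ^ ?n * (c * (r / \<epsilon> k) ^ ?n) \<le> \<epsilon> k ^ ?n * measure lebesgue (- E \<inter> ball 0 (r / \<epsilon> k))"
      using big[OF elim] \<epsilon>(1)[of k] by (intro mult_left_mono) auto
    also have "\<dots> = measure lebesgue (\<Omega> k \<inter> ball 0 r)" unfolding \<Omega>_def measure_scale_inter_ball[OF \<epsilon>(1)] by simp
    finally show ?case using \<epsilon>(1)[of k] by (simp add: power_divide)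
  qed
  have syms: "(\<lambda>k. measure lebesgue ((\<Omega>' k - \<Omega> k) \<inter> ball 0 r)) \<longlonglongrightarrow> 0" if r: "r > 0" for r
  proof -
    have "(\<lambda>k. r ^ ?n * (measure lebesgue ((E - E') \<inter> ball 0 (r / \<epsilon> k)) / (r / \<epsilon> k) ^ ?n)) \<longlonglongrightarrow> 0"
      by (rule tendsto_mult_right_zero[OF filterlim_compose[OF sym lim[OF r]]])
    moreover have "r ^ ?n * (measure lebesgue ((E - E') \<inter> ball 0 (r / \<epsilon> k)) / (r / \<epsilon> k) ^ ?n)
        = measure lebesgue ((\<Omega>' k - \<Omega> k) \<inter> ball 0 r)" for k
    proof -
      have "\<Omega>' k - \<Omega> k = (\<lambda>y. \<epsilon> k *\<^sub>R y) ` (E - E')"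
        unfolding \<Omega>_def \<Omega>'_def by (rule set_eqI) (auto simp only: Diff_iff Compl_iff mem_scale_image[OF \<epsilon>(1)])
      then show ?thesis using r \<epsilon>(1)[of k] by (simp add: measure_scale_inter_ball power_divide)
    qed
    ultimately show ?thesis by simp
  qed
  \<comment> \<open>One tolerance governs both the excess of energy and the L2 distance, so the
    property is monotone in \<tau> as the diagonal argument requires.\<close>
  define P where "P \<tau> k \<longleftrightarrow> (\<exists>v. H1 UNIV v \<and> FE E' (\<epsilon> k) v \<le> FE E (\<epsilon> k) (w k) + ennreal \<tau> \<and>
     (\<integral>\<^sup>+x. ennreal ((v x - u x)\<^sup>2) \<partial>lebesgue) \<le> ennreal \<tau>)" for \<tau> k
  have FEw: "FE E (\<epsilon> k) (w k) = (\<integral>\<^sup>+x\<in>\<Omega> k. ennreal ((norm (wgrad UNIV (w k) x))\<^sup>2) \<partial>lebesgue)" for k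
    unfolding FE_def \<Omega>e ..
  have "\<exists>t. t \<longlonglongrightarrow> 0 \<and> (\<forall>\<^sub>F k in sequentially. P (t k) k)"
  proof (rule eventually_diagonal)
    fix s t k assume "P s k" "s \<le> t"
    then show "P t k" unfolding P_def
      by (meson add_left_mono ennreal_leI order_trans)
  next
    fix \<tau> :: real assume \<tau>: "\<tau> > 0"
    have "\<forall>\<^sub>F k in sequentially. \<exists>v hv. has_weak_gradient UNIV v hv \<and>
     (\<integral>\<^sup>+x\<in>\<Omega>' k. ennreal ((norm (hv x))\<^sup>2) \<partial>lebesgue) \<le> (\<integral>\<^sup>+x\<in>\<Omega> k. ennreal ((norm (wgrad UNIV (w k) x))\<^sup>2) \<partial>lebesgue) + ennreal \<tau> \<and>
     (\<integral>\<^sup>+x. ennreal ((v x - u x)\<^sup>2) \<partial>lebesgue) \<le> ennreal \<tau>"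
      by (rule modification[OF op ne ext C(1) \<kappa> dens c bigs syms has_weak_gradient_wgrad[OF w] has_weak_gradient_wgrad[OF u] conv bnd[unfolded FEw] M0 \<tau>])
    then show "\<forall>\<^sub>F k in sequentially. P \<tau> k"
    proof eventually_elim
      case (elim k)
      then obtain v hv where v: "has_weak_gradient UNIV v hv"
        "(\<integral>\<^sup>+x\<in>\<Omega>' k. ennreal ((norm (hv x))\<^sup>2) \<partial>lebesgue) \<le> FE E (\<epsilon> k) (w k) + ennreal \<tau>"
        "(\<integral>\<^sup>+x. ennreal ((v x - u x)\<^sup>2) \<partial>lebesgue) \<le> ennreal \<tau>" unfolding FEw by blast
      have "FE E' (\<epsilon> k) v \<le> FE E (\<epsilon> k) (w k) + ennreal \<tau>" unfolding FE_eq[OF v(1)] \<Omega>e by (rule v(2))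
      then show ?case unfolding P_def H1_def using v by blast
    qed
  qed
  then obtain t where t: "t \<longlonglongrightarrow> 0" and tP: "\<forall>\<^sub>F k in sequentially. P (t k) k" by blast
  \<comment> \<open>At indices without an admissible modification, the function u serves as default,
    so that v k lies in H1 for every k.\<close>
  have "\<exists>v. H1 UNIV v \<and> (P (t k) k \<longrightarrow> FE E' (\<epsilon> k) v \<le> FE E (\<epsilon> k) (w k) + ennreal (t k) \<and>
     (\<integral>\<^sup>+x. ennreal ((v x - u x)\<^sup>2) \<partial>lebesgue) \<le> ennreal (t k))" for k
    using u unfolding P_def by blast
  then obtain v where v: "\<And>k. H1 UNIV (v k)" and vP: "\<And>k. P (t k) k \<Longrightarrow> FE E' (\<epsilon> k) (v k) \<le> FE E (\<epsilon> k) (w k) + ennreal (t k) \<and>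
     (\<integral>\<^sup>+x. ennreal ((v k x - u x)\<^sup>2) \<partial>lebesgue) \<le> ennreal (t k)"
    by metis
  have "L2loc_tendsto v u" unfolding L2loc_tendsto_def
  proof (intro allI impI)
    fix R :: real
    show "(\<lambda>k. \<integral>\<^sup>+x\<in>ball 0 R. ennreal ((v k x - u x)\<^sup>2) \<partial>lebesgue) \<longlonglongrightarrow> 0"
    proof (rule tendsto_sandwich[where f="\<lambda>_. 0" and h="\<lambda>k. ennreal (t k)"])
      show "\<forall>\<^sub>F k in sequentially. (\<integral>\<^sup>+x\<in>ball 0 R. ennreal ((v k x - u x)\<^sup>2) \<partial>lebesgue) \<le> ennreal (t k)" using tP
      proof eventually_elim
        case (elim k)
        have "(\<integral>\<^sup>+x\<in>ball 0 R. ennreal ((v k x - u x)\<^sup>2) \<partial>lebesgue) \<le> (\<integral>\<^sup>+x. ennreal ((v k x - u x)\<^sup>2) \<partial>lebesgue)"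
          by (intro nn_integral_mono) (auto simp: indicator_def)
        then show ?case using vP[OF elim] order_trans by blast
      qed
      show "(\<lambda>k. ennreal (t k)) \<longlonglongrightarrow> 0" using tendsto_ennrealI[OF t] by simp
    qed simp_all
  qed
  moreover have "\<forall>\<^sub>F k in sequentially. FE E' (\<epsilon> k) (v k) \<le> FE E (\<epsilon> k) (w k) + ennreal (t k)"
    using tP by eventually_elim (use vP in blast)
  ultimately show ?thesis using v t by blast
qed

text \<open>Inserting the limit itself at some indices preserves convergence. This discards indices
  of uncontrolled energy while keeping a full sequence, so that no subsequence of \<epsilon> has to
  be taken.\<close>

lemma L2loc_tendsto_if:
  assumes "L2loc_tendsto us u"
  shows "L2loc_tendsto (\<lambda>k. if k \<in> I then us k else u) u"
  unfolding L2loc_tendsto_def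
proof (intro allI impI)
  fix R :: real assume "R > 0"
  then have "(\<lambda>k. \<integral>\<^sup>+x\<in>ball 0 R. ennreal ((us k x - u x)\<^sup>2) \<partial>lebesgue) \<longlonglongrightarrow> 0"
    using assms unfolding L2loc_tendsto_def by blast
  then show "(\<lambda>k. \<integral>\<^sup>+x\<in>ball 0 R. ennreal (((if k \<in> I then us k else u) x - u x)\<^sup>2) \<partial>lebesgue) \<longlonglongrightarrow> 0"
    by (rule tendsto_sandwich[OF _ _ tendsto_const, rotated 2]) (auto intro!: always_eventually)
qed

theorem theorem9p1:
  fixes E E' :: "'a::euclidean_space set" and \<epsilon> :: "nat \<Rightarrow> real"
    and G :: "('a \<Rightarrow> real) \<Rightarrow> ennreal"
  assumes "closed E" and "closed E'"
    and "admits_extension E" and "admits_extension E'"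
    and "((\<lambda>R. measure lebesgue (((E - E') \<union> (E' - E)) \<inter> ball 0 R) / R ^ DIM('a))
           \<longlongrightarrow> 0) at_top"
    and "Liminf at_top (\<lambda>R. ereal (measure lebesgue (ball 0 R - E) / R ^ DIM('a))) > 0"
    and "\<forall>k. \<epsilon> k > 0" and "\<epsilon> \<longlonglongrightarrow> 0"
    and "gamma_converges (\<lambda>k. FE E (\<epsilon> k)) G"
  shows "gamma_converges (\<lambda>k. FE E' (\<epsilon> k)) G"
proof -
  let ?n = "DIM('a)" and ?D = "(E - E') \<union> (E' - E)"
  note E = assms(1,3) and E' = assms(2,4) and sd = assms(5)
  have \<epsilon>: "\<And>k. \<epsilon> k > 0" using assms(7) by blast
  have m: "A \<inter> ball 0 R \<in> fmeasurable lebesgue" if "A \<in> sets lebesgue" for A :: "'a set" and R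
    using that fmeasurable_Int_fmeasurable[of "ball 0 R" lebesgue A] by (simp add: Int_commute)
  have Em: "E \<in> sets lebesgue" "E' \<in> sets lebesgue" "- E \<in> sets lebesgue" "- E' \<in> sets lebesgue"
    using assms(1,2) by (auto simp: open_Compl)
  have half: "((\<lambda>R. measure lebesgue (A \<inter> ball 0 R) / R ^ ?n) \<longlongrightarrow> 0) at_top" if A: "A \<subseteq> ?D" "A \<in> sets lebesgue" for A
  proof (rule tendsto_sandwich[OF _ _ tendsto_const sd])
    show "\<forall>\<^sub>F R in at_top. 0 \<le> measure lebesgue (A \<inter> ball 0 R) / R ^ ?n"
      using eventually_gt_at_top[of 0] by eventually_elim simp
    show "\<forall>\<^sub>F R in at_top. measure lebesgue (A \<inter> ball 0 R) / R ^ ?n \<le> measure lebesgue (?D \<inter> ball 0 R) / R ^ ?n"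
      using eventually_gt_at_top[of 0]
    proof eventually_elim
      case (elim R)
      have "measure lebesgue (A \<inter> ball 0 R) \<le> measure lebesgue (?D \<inter> ball 0 R)"
        using A Em by (intro measure_mono_fmeasurable m fmeasurableD[OF m]) auto
      then show ?case using elim by (intro divide_right_mono) auto
    qed
  qed
  \<comment> \<open>With c below the liminf, the complement of E' keeps the volume bound with c / 2,
    since the symmetric difference eventually occupies less than c / 2 times R^n.\<close>
  obtain c where c: "c > 0" and cL: "ereal c < Liminf at_top (\<lambda>R. ereal (measure lebesgue (ball 0 R - E) / R ^ ?n))"
    using ereal_dense2[OF assms(6)] by auto
  have "\<forall>\<^sub>F R in at_top. c * R ^ ?n \<le> measure lebesgue (- E \<inter> ball 0 R) \<and> c / 2 * R ^ ?n \<le> measure lebesgue (- E' \<inter> ball 0 R)"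
    using less_LiminfD[OF cL] order_tendstoD(2)[OF sd half_gt_zero[OF c]] eventually_gt_at_top[of 0]
  proof eventually_elim
    case (elim R)
    have "ball 0 R - E = - E \<inter> ball 0 R" by auto
    then have 1: "c * R ^ ?n < measure lebesgue (- E \<inter> ball 0 R)" using elim by (simp add: pos_less_divide_eq)
    have 2: "measure lebesgue (?D \<inter> ball 0 R) < c / 2 * R ^ ?n" using elim c by (simp add: pos_divide_less_eq)
    have s: "- E \<inter> ball 0 R \<in> sets lebesgue" "- E' \<inter> ball 0 R \<in> sets lebesgue" "?D \<inter> ball 0 R \<in> sets lebesgue"
      using Em by auto
    have "measure lebesgue (- E \<inter> ball 0 R) \<le> measure lebesgue (- E' \<inter> ball 0 R \<union> ?D \<inter> ball 0 R)"
      using Em s by (intro measure_mono_fmeasurable fmeasurable.Un m) auto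
    also have "\<dots> \<le> measure lebesgue (- E' \<inter> ball 0 R) + measure lebesgue (?D \<inter> ball 0 R)" by (rule measure_Un_le[OF s(2,3)])
    finally have "c / 2 * R ^ ?n \<le> measure lebesgue (- E' \<inter> ball 0 R)" using 1 2 by (simp add: field_simps)
    with 1 show ?case by simp
  qed
  then obtain R0 where R0: "\<And>R. R \<ge> R0 \<Longrightarrow> c * R ^ ?n \<le> measure lebesgue (- E \<inter> ball 0 R) \<and> c / 2 * R ^ ?n \<le> measure lebesgue (- E' \<inter> ball 0 R)"
    unfolding eventually_at_top_linorder by blast
  have c2: "c / 2 > 0" using c by simp
  have b: "\<forall>R\<ge>max R0 0. c / 2 * R ^ ?n \<le> measure lebesgue (- E \<inter> ball 0 R)"
    "\<forall>R\<ge>max R0 0. c / 2 * R ^ ?n \<le> measure lebesgue (- E' \<inter> ball 0 R)"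
  proof (intro allI impI)
    fix R assume R: "R \<ge> max R0 0"
    have "c / 2 * R ^ ?n \<le> c * R ^ ?n" using c R by (intro mult_right_mono) auto
    then show "c / 2 * R ^ ?n \<le> measure lebesgue (- E \<inter> ball 0 R)" using R0[of R] R by linarith
  qed (use R0 in simp)
  have sy: "((\<lambda>R. measure lebesgue ((E - E') \<inter> ball 0 R) / R ^ ?n) \<longlongrightarrow> 0) at_top"
    "((\<lambda>R. measure lebesgue ((E' - E) \<inter> ball 0 R) / R ^ ?n) \<longlongrightarrow> 0) at_top"
    using Em by (intro half; auto)+
  note transfer = energy_transfer[OF E E' c2 b(1) b(2) sy(1) \<epsilon> assms(8)]
    and transfer' = energy_transfer[OF E' E c2 b(2) b(1) sy(2) \<epsilon> assms(8)]
  have lower: "G u \<le> liminf (\<lambda>k. FE E (\<epsilon> k) (us k))"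
    if "H1 UNIV u" "\<And>k. H1 UNIV (us k)" "L2loc_tendsto us u" for u us
    using assms(9) that unfolding gamma_converges_def by blast
  have upper: "\<exists>us. (\<forall>k. H1 UNIV (us k)) \<and> L2loc_tendsto us u \<and> limsup (\<lambda>k. FE E (\<epsilon> k) (us k)) \<le> G u"
    if "H1 UNIV u" for u
    using assms(9) that unfolding gamma_converges_def by blast
  show ?thesis
    unfolding gamma_converges_def
  proof (intro conjI allI impI)
    fix u :: "'a \<Rightarrow> real" and us assume H: "H1 UNIV u \<and> (\<forall>k. H1 UNIV (us k)) \<and> L2loc_tendsto us u"
    let ?f = "\<lambda>k. FE E' (\<epsilon> k) (us k)"
    note gu = has_weak_gradient_wgrad[OF conjunct1[OF H]]
    show "G u \<le> liminf ?f"
    proof (rule ennreal_le_epsilon)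
      fix e :: real assume fin: "liminf ?f < top" and e: "e > 0"
      obtain l where l: "liminf ?f = ennreal l" "l \<ge> 0" using ennreal_finite_ex[of "liminf ?f"] fin[THEN less_imp_neq] by (metis infinity_ennreal_def)
      \<comment> \<open>The indices with energy close to the liminf: infinitely many, perhaps not
        all large ones. At the others \<open>us k\<close> is replaced by u, whose energy is at most
        \<open>sqn (wgrad UNIV u)\<close> for every k; this yields the uniform bound that
        \<open>energy_transfer\<close> requires.\<close>
      define I where "I = {k. ?f k < ennreal (l + e / 2)}"
      define M0 where "M0 = max (l + e / 2) (sqn (wgrad UNIV u))"
      let ?w = "\<lambda>k. if k \<in> I then us k else u"
      have bnd: "FE E' (\<epsilon> k) (?w k) \<le> ennreal M0" for k
      proof (cases "k \<in> I")
        case True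
        then have "?f k \<le> ennreal (l + e / 2)" by (simp add: I_def)
        also have "\<dots> \<le> ennreal M0" by (rule ennreal_leI) (simp add: M0_def)
        finally show ?thesis using True by simp
      next
        case False
        have "FE E' (\<epsilon> k) u \<le> ennreal (sqn (wgrad UNIV u))" by (rule FE_le_sqn[OF gu])
        also have "\<dots> \<le> ennreal M0" by (rule ennreal_leI) (simp add: M0_def)
        finally show ?thesis using False by simp
      qed
      have wH: "H1 UNIV (?w k)" for k using H by simp
      have M00: "M0 \<ge> 0" using l e by (simp add: M0_def le_max_iff_disj)
      obtain v t where v: "\<And>k. H1 UNIV (v k)" "L2loc_tendsto v u" and t: "t \<longlonglongrightarrow> 0"
        and vt: "\<forall>\<^sub>F k in sequentially. FE E (\<epsilon> k) (v k) \<le> FE E' (\<epsilon> k) (?w k) + ennreal (t k)"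
        using transfer'[OF wH conjunct1[OF H] L2loc_tendsto_if[OF conjunct2[OF conjunct2[OF H]]] bnd M00] by blast
      have GG: "G u \<le> liminf (\<lambda>k. FE E (\<epsilon> k) (v k))" by (rule lower[OF conjunct1[OF H] v])
      show "G u \<le> liminf ?f + ennreal e"
      proof (rule ccontr)
        \<comment> \<open>If G u exceeded the liminf by more than e, no large k could lie in I: the
          energies of v k on E would be above l + e, while the transfer from an index in I leaves at
          most l + e/2 + e/2. But then the original energies are eventually at least l + e/2,
          against their liminf l.\<close>
        assume "\<not> ?thesis"
        then have "liminf ?f + ennreal e < liminf (\<lambda>k. FE E (\<epsilon> k) (v k))" using GG by simp
        then have "\<forall>\<^sub>F k in sequentially. liminf ?f + ennreal e < FE E (\<epsilon> k) (v k)" by (rule less_LiminfD)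
        moreover have "\<forall>\<^sub>F k in sequentially. t k < e / 2" using t e by (intro order_tendstoD(2)) auto
        ultimately have "\<forall>\<^sub>F k in sequentially. ennreal (l + e / 2) \<le> ?f k" using vt
        proof eventually_elim
          case (elim k)
          show ?case
          proof (rule ccontr)
            assume "\<not> ?thesis"
            then have k: "k \<in> I" "?f k \<le> ennreal (l + e / 2)" by (auto simp: I_def)
            have "FE E (\<epsilon> k) (v k) \<le> ?f k + ennreal (t k)" using elim(3) k(1) by simp
            also have "\<dots> \<le> ennreal (l + e / 2) + ennreal (e / 2)" using k(2) elim(2) by (intro add_mono ennreal_leI) auto
            also have "\<dots> = liminf ?f + ennreal e" unfolding l(1) using l(2) e by (simp add: ennreal_plus[symmetric] del: ennreal_plus)
            finally show False using elim(1) by simp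
          qed
        qed
        then have "ennreal (l + e / 2) \<le> liminf ?f" by (rule Liminf_bounded)
        then show False unfolding l(1) using l(2) e by simp
      qed
    qed
  next
    fix u :: "'a \<Rightarrow> real" assume u: "H1 UNIV u"
    note gu = has_weak_gradient_wgrad[OF u]
    show "\<exists>us. (\<forall>k. H1 UNIV (us k)) \<and> L2loc_tendsto us u \<and> limsup (\<lambda>k. FE E' (\<epsilon> k) (us k)) \<le> G u"
    proof (cases "G u = \<infinity>")
      case True
      have "L2loc_tendsto (\<lambda>k. u) u" by (simp add: L2loc_tendsto_def)
      with u True show ?thesis by (intro exI[of _ "\<lambda>k. u"]) simp
    next
      case False
      then obtain a where a: "G u = ennreal a" "a \<ge> 0" using ennreal_finite_ex by blast
      obtain us where us: "\<And>k. H1 UNIV (us k)" "L2loc_tendsto us u" and ls: "limsup (\<lambda>k. FE E (\<epsilon> k) (us k)) \<le> G u"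
        using upper[OF u] by blast
      let ?f = "\<lambda>k. FE E (\<epsilon> k) (us k)"
      \<comment> \<open>By the limsup bound all large k belong to I; inserting u at the remaining
        indices makes the energy bound hold for every k.\<close>
      define I where "I = {k. ?f k < ennreal (a + 1)}"
      define M0 where "M0 = max (a + 1) (sqn (wgrad UNIV u))"
      let ?w = "\<lambda>k. if k \<in> I then us k else u"
      have bnd: "FE E (\<epsilon> k) (?w k) \<le> ennreal M0" for k
      proof (cases "k \<in> I")
        case True
        then have "?f k \<le> ennreal (a + 1)" by (simp add: I_def)
        also have "\<dots> \<le> ennreal M0" by (rule ennreal_leI) (simp add: M0_def)
        finally show ?thesis using True by simp
      next
        case False
        have "FE E (\<epsilon> k) u \<le> ennreal (sqn (wgrad UNIV u))" by (rule FE_le_sqn[OF gu])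
        also have "\<dots> \<le> ennreal M0" by (rule ennreal_leI) (simp add: M0_def)
        finally show ?thesis using False by simp
      qed
      have wH: "H1 UNIV (?w k)" for k using u us by simp
      have M00: "M0 \<ge> 0" using a by (simp add: M0_def le_max_iff_disj)
      obtain v t where v: "\<And>k. H1 UNIV (v k)" "L2loc_tendsto v u" and t: "t \<longlonglongrightarrow> 0"
        and vt: "\<forall>\<^sub>F k in sequentially. FE E' (\<epsilon> k) (v k) \<le> FE E (\<epsilon> k) (?w k) + ennreal (t k)"
        using transfer[OF wH u L2loc_tendsto_if[OF us(2)] bnd M00] by blast
      have small: "\<forall>\<^sub>F k in sequentially. ?f k < ennreal (a + e)" if "e > 0" for e
      proof (rule Limsup_lessD)
        have "limsup ?f \<le> ennreal a" using ls a by simp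
        also have "\<dots> < ennreal (a + e)" using a that by (simp add: ennreal_less_iff)
        finally show "limsup ?f < ennreal (a + e)" .
      qed
      have "limsup (\<lambda>k. FE E' (\<epsilon> k) (v k)) \<le> G u"
      proof (rule ennreal_le_epsilon)
        fix e :: real assume e: "e > 0"
        have "\<forall>\<^sub>F k in sequentially. t k < e / 2" using t e by (intro order_tendstoD(2)) auto
        moreover have "\<forall>\<^sub>F k in sequentially. ?f k < ennreal (a + e / 2)" using e by (intro small) simp
        moreover have "\<forall>\<^sub>F k in sequentially. ?f k < ennreal (a + 1)" by (intro small) simp
        ultimately have "\<forall>\<^sub>F k in sequentially. FE E' (\<epsilon> k) (v k) \<le> G u + ennreal e" using vt
        proof eventually_elim
          case (elim k)
          have "FE E' (\<epsilon> k) (v k) \<le> ?f k + ennreal (t k)" using elim(3,4) by (simp add: I_def)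
          also have "\<dots> \<le> ennreal (a + e / 2) + ennreal (e / 2)" using elim(1,2) by (intro add_mono ennreal_leI) auto
          also have "\<dots> = G u + ennreal e" unfolding a(1) using a(2) e by (simp add: ennreal_plus[symmetric] del: ennreal_plus)
          finally show ?case .
        qed
        then show "limsup (\<lambda>k. FE E' (\<epsilon> k) (v k)) \<le> G u + ennreal e" by (rule Limsup_bounded)
      qed
      with v show ?thesis by blast
    qed
  qed
qed

end
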